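(* Let $i\ge 1$, let $W^{h,i}\in\tilde V_h$ be the streamline diffusion solution of the Maxwell equations at iteration step $i$, let $W^i$ be the exact solution of the approximated Maxwell equations at iteration step $i$, and let $\tilde e^i=W^i-W^{h,i}$. There exists a constant $C$ (independent of the mesh parameter $h$, of $i$, and of the exact and discrete solutions; it may depend on $T$) such that $$\|\tilde e^i\|_{H^{-1}(\tilde Q_T)}\le C\left(\|h\tilde R_1^i\|_{L_2(\tilde Q_T)}+\|h\tilde R_2^i\|_{L_2(\tilde Q_T)}\right).$$
   Context: **Continuous problem.** Let $T>0$, let $\Omega_x\subset\mathbb R$ and $\Omega_v\subset\mathbb R^2$ be bounded space and velocity domains, $\tilde Q_T=[0,T]\times\Omega_x$, $\hat v=v/\sqrt{1+|v|^2}$ for $v\in\mathbb R^2$. The one and one-half dimensional relativistic Vlasov-Maxwell system, with unknowns $f(t,x,v)$, $E_1,E_2,B$ (functions of $(t,x)$) and given background density $\rho_b$, is $$\partial_t f+\hat v_1\partial_x f+(E_1+\hat v_2B)\partial_{v_1}f+(E_2-\hat v_1B)\partial_{v_2}f=0,$$ $$\partial_xE_1=\int f\,dv-\rho_b,\quad \partial_tE_1=-\int\hat v_1f\,dv,\quad \partial_tE_2+\partial_xB=-\int\hat v_2f\,dv,\quad \partial_tB+\partial_xE_2=0,$$ with initial data $f^0\ge0$, $E_2^0$, $B^0$ and $E_1^0(x)=\int_{-\infty}^x(\int f^0(y,v)\,dv-\rho_b(y))\,dy$. The background density is smooth, compactly supported and neutralizing: $\int(\int f^0\,dv-\rho_b)\,dx=0$.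 All functions of $x$ involved in the Maxwell problem are assumed to have compact support in $\Omega_x$, and $f$ has compact support in $\Omega_v$ as a function of $v$. **Matrix form.** Put $W=(E_1,E_2,B)^T$, $W^0=(E_1^0,E_2^0,B^0)^T$ and $$M_1=\begin{pmatrix}0&0&0\\1&0&0\\0&1&0\\0&0&1\end{pmatrix},\qquad M_2=\begin{pmatrix}1&0&0\\0&0&0\\0&0&1\\0&1&0\end{pmatrix}.$$ The Maxwell equations are $M_1W_t+M_2W_x=b$, $W(0,\cdot)=W^0$, with $b=(\int f\,dv-\rho_b,\,-\int\hat v_1f\,dv,\,-\int\hat v_2f\,dv,\,0)^T$. **Discretization.** Let $0=t_0<\dots<t_M=T$, $I_m=(t_{m-1},t_m]$, $S_m=I_m\times\Omega_x$. Let $\{\tau_x\}$ be a finite element subdivision of $\Omega_x$ and let $h$ be the mesh parameter (diameter of the elements; time steps have length $h$). For a fixed $k\in\{0,1,2,\dots\}$ let $P_k$ denote polynomials of degree at most $k$ and $$\tilde V_h=\{g\in[\tilde{\mathcal H}_0]^3:\ g_l|_{I_m\times\tau_x}\in P_k(I_m)\times P_k(\tau_x)\ \forall m,\tau_x,\ l=1,2,3\},$$ where $\tilde{\mathcal H}_0=\prod_{m=1}^M\{w\in H^1(I_m\times\Omega_x): w=0\text{ on }\partial\Omega_x\}$; functions may jump in time across the $t_m$. Write $g_\pm(t,x)=\lim_{s\to0^\pm}g(t+s,x)$, $[g]=g_+-g_-$, $(\cdot,\cdot)_m$ for the $L_2(S_m)$ inner product, $\langle f,g\rangle_m=(f(t_m,\cdot),g(t_m,\cdot))_{L_2(\Omega_x)}$,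 and $\hat g=(g_1,g_1,g_2,g_3)^T$ for $g=(g_1,g_2,g_3)^T$. **Iteration and streamline diffusion scheme.** Given a numerical approximation $f^{h,i-1}$ of $f$ from the previous iteration step, let $b^{h,i-1}$ be $b$ with $f$ replaced by $f^{h,i-1}$. The streamline diffusion solution $W^{h,i}\in\tilde V_h$ satisfies, for $m=1,\dots,M$ and all $g\in\tilde V_h$, $$(M_1W^{h,i}_t+M_2W^{h,i}_x,\ \hat g+\delta(M_1g_t+M_2g_x))_m+\langle W^{h,i}_+,g_+\rangle_{m-1}=(b^{h,i-1},\ \hat g+\delta(M_1g_t+M_2g_x))_m+\langle W^{h,i}_-,g_+\rangle_{m-1},$$ with $W^{h,i}_-(0,\cdot)=W^0$ and $\delta$ a fixed multiple of $h$. The function $W^i$ is the exact solution of $M_1W^i_t+M_2W^i_x=b^{h,i-1}$, $W^i(0,\cdot)=W^0$. **Residuals.** $\tilde R_1^i=b^{h,i-1}-M_1W^{h,i}_t-M_2W^{h,i}_x$ (computed slab-wise) and $\tilde R_2^i|_{S_m}=\big(W^{h,i}_+(t_{m-1},x)-W^{h,i}_-(t_{m-1},x)\big)/h$, constant in time on each slab. **Negative norm.** For a domain $G$, $\|u\|_{H^{-1}(G)}=\sup_{\psi}\,(u,\psi)_{L_2(G)}/\|\psi\|_{H^1(G)}$, the supremum being over nonzero (vector-valued, if $u$ is) $\psi\in C_0^\infty(G)$.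
   Formalization: The polynomial degree k is at least 1 (for k=0 the discrete space is zero and the bound fails), and the supports in x lie in a fixed compact subset of Ω_x on which C may depend (the bound fails uniformly if supports approach the boundary as h tends to 0). *)

theory Defs
  imports "HOL-Analysis.Analysis"
begin

section \<open>Function spaces\<close>

primrec Ck :: "nat \<Rightarrow> ('a::real_normed_vector \<Rightarrow> 'b::real_normed_vector) \<Rightarrow> bool" where
  "Ck 0 f \<longleftrightarrow> continuous_on UNIV f"
| "Ck (Suc n) f \<longleftrightarrow>
     (\<forall>p. f differentiable (at p)) \<and> (\<forall>v. Ck n (\<lambda>p. frechet_derivative f (at p) v))"

definition smooth :: "('a::real_normed_vector \<Rightarrow> 'b::real_normed_vector) \<Rightarrow> bool" where
  "smooth f \<longleftrightarrow> (\<forall>n. Ck n f)"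

definition test_functions :: "'a::euclidean_space set \<Rightarrow> ('a \<Rightarrow> 'b::euclidean_space) set" where
  "test_functions G =
     {\<psi>. smooth \<psi> \<and> compact (closure {p. \<psi> p \<noteq> 0}) \<and> closure {p. \<psi> p \<noteq> 0} \<subseteq> G}"

definition L2 :: "'a::euclidean_space set \<Rightarrow> ('a \<Rightarrow> 'b::euclidean_space) set" where
  "L2 G = {u. u \<in> borel_measurable (lebesgue_on G) \<and> integrable (lebesgue_on G) (\<lambda>p. (norm (u p))\<^sup>2)}"

definition L2_ip ::
    "'a::euclidean_space set \<Rightarrow> ('a \<Rightarrow> 'b::euclidean_space) \<Rightarrow> ('a \<Rightarrow> 'b) \<Rightarrow> real" where
  "L2_ip G u w = (LINT p|lebesgue_on G. u p \<bullet> w p)"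

definition L2_norm :: "'a::euclidean_space set \<Rightarrow> ('a \<Rightarrow> 'b::euclidean_space) \<Rightarrow> real" where
  "L2_norm G u = sqrt (LINT p|lebesgue_on G. (norm (u p))\<^sup>2)"

text \<open>\<open>w\<close> is the distributional derivative of \<open>u\<close> on \<open>G\<close> in direction \<open>d\<close>.\<close>

definition weak_derivative ::
    "'a::euclidean_space set \<Rightarrow> 'a \<Rightarrow> ('a \<Rightarrow> 'b::euclidean_space) \<Rightarrow> ('a \<Rightarrow> 'b) \<Rightarrow> bool" where
  "weak_derivative G d u w \<longleftrightarrow>
     (\<forall>\<phi> \<in> (test_functions G :: ('a \<Rightarrow> real) set).
        (LINT p|lebesgue_on G. frechet_derivative \<phi> (at p) d *\<^sub>R u p)
          = - (LINT p|lebesgue_on G. \<phi> p *\<^sub>R w p))"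

definition H1 :: "'a::euclidean_space set \<Rightarrow> ('a \<Rightarrow> 'b::euclidean_space) set" where
  "H1 G = {u \<in> L2 G. \<forall>d\<in>Basis. \<exists>w \<in> L2 G. weak_derivative G d u w}"

text \<open>A representative of the weak derivative; it is determined only almost everywhere on \<open>G\<close>, and
  it is used only under integrals over \<open>G\<close> and in almost-everywhere statements on \<open>G\<close>.\<close>

definition wderiv ::
    "'a::euclidean_space set \<Rightarrow> 'a \<Rightarrow> ('a \<Rightarrow> 'b::euclidean_space) \<Rightarrow> 'a \<Rightarrow> 'b" where
  "wderiv G d u = (SOME w. w \<in> L2 G \<and> weak_derivative G d u w)"

definition H1_norm :: "'a::euclidean_space set \<Rightarrow> ('a \<Rightarrow> 'b::euclidean_space) \<Rightarrow> real" where
  "H1_norm G \<psi> = sqrt ((L2_norm G \<psi>)\<^sup>2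
      + (\<Sum>d\<in>Basis. (L2_norm G (\<lambda>p. frechet_derivative \<psi> (at p) d))\<^sup>2))"

text \<open>The norm \<open>H1_norm\<close> uses classical derivatives: here it is applied to test functions only.
  The supremum is taken in the extended reals, so no boundedness is presupposed.\<close>

definition Hneg1_norm :: "'a::euclidean_space set \<Rightarrow> ('a \<Rightarrow> 'b::euclidean_space) \<Rightarrow> ereal" where
  "Hneg1_norm G u =
     (SUP \<psi> \<in> test_functions G - {\<lambda>_. 0}. ereal (L2_ip G u \<psi> / H1_norm G \<psi>))"

section \<open>The Maxwell system in matrix form\<close>

text \<open>Points of space-time are pairs \<open>(t, x)\<close>; phase-space points are triples \<open>(t, x, v)\<close>.\<close>

definition M1 :: "real^3^4" where
  "M1 = vector [vector [0, 0, 0], vector [1, 0, 0], vector [0, 1, 0], vector [0, 0, 1]]"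

definition M2 :: "real^3^4" where
  "M2 = vector [vector [1, 0, 0], vector [0, 0, 0], vector [0, 0, 1], vector [0, 1, 0]]"

definition hat :: "real^3 \<Rightarrow> real^4" where
  "hat g = vector [g $ 1, g $ 1, g $ 2, g $ 3]"

definition vhat :: "real^2 \<Rightarrow> real^2" where
  "vhat v = v /\<^sub>R sqrt (1 + (norm v)\<^sup>2)"

definition source ::
    "(real \<times> real \<times> (real^2) \<Rightarrow> real) \<Rightarrow> (real \<Rightarrow> real) \<Rightarrow> real \<times> real \<Rightarrow> real^4" where
  "source f \<rho> = (\<lambda>(t, x). vector
     [(LINT v|lebesgue. f (t, x, v)) - \<rho> x,
      - (LINT v|lebesgue. vhat v $ 1 * f (t, x, v)),
      - (LINT v|lebesgue. vhat v $ 2 * f (t, x, v)),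
      0])"

definition E10 :: "(real \<times> (real^2) \<Rightarrow> real) \<Rightarrow> (real \<Rightarrow> real) \<Rightarrow> real \<Rightarrow> real" where
  "E10 f0 \<rho> x = (LINT y|lebesgue_on {..x}. (LINT v|lebesgue. f0 (y, v)) - \<rho> y)"

definition W0 ::
    "(real \<times> (real^2) \<Rightarrow> real) \<Rightarrow> (real \<Rightarrow> real) \<Rightarrow> (real \<Rightarrow> real) \<Rightarrow> (real \<Rightarrow> real) \<Rightarrow> real \<Rightarrow> real^3" where
  "W0 f0 \<rho> E20 B0 x = vector [E10 f0 \<rho> x, E20 x, B0 x]"

text \<open>The compact set \<open>K\<close> carries the supports in \<open>x\<close>.\<close>

definition maxwell_data ::
    "real set \<Rightarrow> (real^2) set \<Rightarrow> (real \<times> (real^2) \<Rightarrow> real) \<Rightarrow> (real \<Rightarrow> real)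
      \<Rightarrow> (real \<Rightarrow> real) \<Rightarrow> (real \<Rightarrow> real) \<Rightarrow> bool" where
  "maxwell_data K \<Omega>v f0 \<rho> E20 B0 \<longleftrightarrow>
     (\<forall>x v. 0 \<le> f0 (x, v)) \<and> integrable lebesgue f0 \<and>
     (\<exists>Kv. compact Kv \<and> Kv \<subseteq> \<Omega>v \<and> (\<forall>x v. v \<notin> Kv \<longrightarrow> f0 (x, v) = 0)) \<and>
     smooth \<rho> \<and> E20 \<in> L2 UNIV \<and> B0 \<in> L2 UNIV \<and>
     (\<forall>x. x \<notin> K \<longrightarrow> (\<forall>v. f0 (x, v) = 0) \<and> \<rho> x = 0 \<and> W0 f0 \<rho> E20 B0 x = 0) \<and>
     (LINT x|lebesgue. (LINT v|lebesgue. f0 (x, v)) - \<rho> x) = 0"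

text \<open>Initial values are attained in the \<open>L\<^sub>2\<close> sense; averaging over short times makes the
  condition independent of the representative of \<open>W\<close>, and for \<open>W\<close> in \<open>H1\<close> it says that the
  trace of \<open>W\<close> at \<open>t = 0\<close> is \<open>g\<close>.\<close>

definition initial_trace :: "real set \<Rightarrow> (real \<times> real \<Rightarrow> real^3) \<Rightarrow> (real \<Rightarrow> real^3) \<Rightarrow> bool" where
  "initial_trace \<Omega>x W g \<longleftrightarrow>
     g \<in> L2 \<Omega>x \<and>
     ((\<lambda>\<epsilon>. (LINT p|lebesgue_on ({0<..<\<epsilon>} \<times> \<Omega>x). (norm (W p - g (snd p)))\<^sup>2) / \<epsilon>)
        \<longlongrightarrow> 0) (at_right 0)"

definition maxwell_solution ::
    "real \<Rightarrow> real set \<Rightarrow> real set \<Rightarrow> (real \<times> real \<Rightarrow> real^4) \<Rightarrow> (real \<Rightarrow> real^3)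
      \<Rightarrow> (real \<times> real \<Rightarrow> real^3) \<Rightarrow> bool" where
  "maxwell_solution T \<Omega>x K b g W \<longleftrightarrow>
     (let Q = {0<..<T} \<times> \<Omega>x in
        W \<in> H1 Q \<and>
        (AE p in lebesgue_on Q. M1 *v wderiv Q (1, 0) W p + M2 *v wderiv Q (0, 1) W p = b p) \<and>
        initial_trace \<Omega>x W g \<and>
        (\<forall>t\<in>{0..T}. \<forall>x. x \<notin> K \<longrightarrow> W (t, x) = 0))"

section \<open>The streamline diffusion scheme\<close>

definition mesh ::
    "real \<Rightarrow> real set \<Rightarrow> real \<Rightarrow> nat \<Rightarrow> (nat \<Rightarrow> real) \<Rightarrow> nat \<Rightarrow> (nat \<Rightarrow> real) \<Rightarrow> bool" where
  "mesh T \<Omega>x h M t N x \<longleftrightarrow>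
     0 < h \<and> t 0 = 0 \<and> t M = T \<and> (\<forall>m\<in>{1..M}. t m - t (m - 1) = h) \<and>
     {x 0<..<x N} = \<Omega>x \<and> (\<forall>j\<in>{1..N}. x (j - 1) < x j \<and> x j - x (j - 1) \<le> h)"

text \<open>The interior of the slab \<open>S\<^sub>m\<close>, which differs from \<open>S\<^sub>m\<close> by a null set.\<close>

definition slab :: "real set \<Rightarrow> (nat \<Rightarrow> real) \<Rightarrow> nat \<Rightarrow> (real \<times> real) set" where
  "slab \<Omega>x t m = {t (m - 1)<..<t m} \<times> \<Omega>x"

definition tensor_poly_on :: "nat \<Rightarrow> (real \<times> real) set \<Rightarrow> (real \<times> real \<Rightarrow> real) \<Rightarrow> bool" where
  "tensor_poly_on k A g \<longleftrightarrow>
     (\<exists>c. \<forall>(s, y)\<in>A. g (s, y) = (\<Sum>a\<le>k. \<Sum>b\<le>k. c a b * s ^ a * y ^ b))"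

text \<open>The elements are closed intervals, so a member is given on each slab by its continuous
  representative up to \<open>\<partial>\<Omega>\<^sub>x\<close>, and the boundary condition can be read pointwise.\<close>

definition Vh ::
    "nat \<Rightarrow> real set \<Rightarrow> nat \<Rightarrow> (nat \<Rightarrow> real) \<Rightarrow> nat \<Rightarrow> (nat \<Rightarrow> real) \<Rightarrow> (real \<times> real \<Rightarrow> real^3) set" where
  "Vh k \<Omega>x M t N x = {g. \<forall>m\<in>{1..M}.
     g \<in> H1 (slab \<Omega>x t m) \<and>
     (\<forall>s\<in>{t (m - 1)<..t m}. \<forall>y\<in>frontier \<Omega>x. g (s, y) = 0) \<and>
     (\<forall>j\<in>{1..N}. \<forall>l. tensor_poly_on k ({t (m - 1)<..t m} \<times> {x (j - 1)..x j}) (\<lambda>p. g p $ l))}"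

definition limit_plus :: "(real \<times> real \<Rightarrow> real^3) \<Rightarrow> real \<Rightarrow> real \<Rightarrow> real^3" where
  "limit_plus g s y = Lim (at_right s) (\<lambda>r. g (r, y))"

text \<open>The left limit, where the value at time \<open>0\<close> is prescribed to be the initial datum \<open>g0\<close>.\<close>

definition limit_minus ::
    "(real \<Rightarrow> real^3) \<Rightarrow> (real \<times> real \<Rightarrow> real^3) \<Rightarrow> real \<Rightarrow> real \<Rightarrow> real^3" where
  "limit_minus g0 g s y = (if s = 0 then g0 y else Lim (at_left s) (\<lambda>r. g (r, y)))"

definition maxwell_op ::
    "(real \<times> real) set \<Rightarrow> (real \<times> real \<Rightarrow> real^3) \<Rightarrow> real \<times> real \<Rightarrow> real^4" where
  "maxwell_op G W p = M1 *v wderiv G (1, 0) W p + M2 *v wderiv G (0, 1) W p"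

definition sd_solution ::
    "nat \<Rightarrow> real \<Rightarrow> real set \<Rightarrow> nat \<Rightarrow> (nat \<Rightarrow> real) \<Rightarrow> nat \<Rightarrow> (nat \<Rightarrow> real)
      \<Rightarrow> (real \<times> real \<Rightarrow> real^4) \<Rightarrow> (real \<Rightarrow> real^3) \<Rightarrow> (real \<times> real \<Rightarrow> real^3) \<Rightarrow> bool" where
  "sd_solution k \<delta> \<Omega>x M t N x b g0 Wh \<longleftrightarrow>
     Wh \<in> Vh k \<Omega>x M t N x \<and>
     (\<forall>m\<in>{1..M}. \<forall>g\<in>Vh k \<Omega>x M t N x.
        (let S = slab \<Omega>x t m; \<theta> = (\<lambda>p. hat (g p) + \<delta> *\<^sub>R maxwell_op S g p) in
          L2_ip S (maxwell_op S Wh) \<theta>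
            + L2_ip \<Omega>x (limit_plus Wh (t (m - 1))) (limit_plus g (t (m - 1)))
          = L2_ip S b \<theta>
            + L2_ip \<Omega>x (limit_minus g0 Wh (t (m - 1))) (limit_plus g (t (m - 1)))))"

text \<open>The \<open>m\<close> with \<open>s \<in> I\<^sub>m\<close>, for \<open>0 < s \<le> T\<close>.\<close>

definition slab_index :: "(nat \<Rightarrow> real) \<Rightarrow> real \<Rightarrow> nat" where
  "slab_index t s = (LEAST m. s \<le> t m)"

definition residual1 ::
    "real set \<Rightarrow> (nat \<Rightarrow> real) \<Rightarrow> (real \<times> real \<Rightarrow> real^4) \<Rightarrow> (real \<times> real \<Rightarrow> real^3)
      \<Rightarrow> real \<times> real \<Rightarrow> real^4" where
  "residual1 \<Omega>x t b Wh p = b p - maxwell_op (slab \<Omega>x t (slab_index t (fst p))) Wh p"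

definition residual2 ::
    "real \<Rightarrow> (nat \<Rightarrow> real) \<Rightarrow> (real \<Rightarrow> real^3) \<Rightarrow> (real \<times> real \<Rightarrow> real^3) \<Rightarrow> real \<times> real \<Rightarrow> real^3" where
  "residual2 h t g0 Wh = (\<lambda>(s, y).
     let r = t (slab_index t s - 1) in (limit_plus Wh r y - limit_minus g0 Wh r y) /\<^sub>R h)"

end

theory Submission imports Defs begin

text \<open>The Maxwell system has the characteristic speeds 1, 1 and -1. Contracting the scheme and the exact
  equation with the vectors \<open>(1, 0, 0)\<close>, \<open>(0, 1, 1)\<close> and \<open>(0, 1, -1)\<close> of \<open>characteristic\<close> gives three scalar
  transport problems \<open>V\<^sub>t + \<sigma> V\<^sub>x = \<beta>\<close> (\<open>characteristic_equation\<close>), and the error functional splits accordingly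
  (\<open>characteristic_sum\<close>). So it suffices to bound \<open>\<integral> (V - U) \<omega>\<close> for a scalar test function \<open>\<omega>\<close>, where \<open>U\<close> is
  the contracted discrete solution.

  For this the dual problem \<open>\<phi>\<^sub>t + \<sigma> \<phi>\<^sub>x = - \<omega>\<close> with final value 0 is solved along characteristics (\<open>dual\<close>); \<open>\<phi>\<close>
  and \<open>\<phi>\<^sub>x\<close> are controlled by \<open>\<omega>\<close> and \<open>\<omega>\<^sub>x\<close>, hence by the \<open>H\<^sup>1\<close> norm of the test function. Integration by
  parts turns the error into residuals tested with \<open>\<phi>\<close>, and the orthogonality of the scheme allows an
  interpolant of \<open>\<phi>\<close> to be subtracted, which gains the factor \<open>h\<close>.

  The obstacle is the boundary. The exact solution is supported away from it, but \<open>\<phi>\<close> does not vanish at the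
  inflow end, so its interpolant is not an admissible test function. Therefore \<open>\<phi>\<close> is replaced by
  \<open>\<theta> = (1 - \<mu> \<psi>) \<phi>\<close>, where \<open>\<psi>\<close> is affine on a strip of elements next to the inflow end, vanishes elsewhere and
  satisfies \<open>\<mu> \<psi> = 1\<close> at the inflow end (\<open>inflow_weight\<close>). The commutator of \<open>\<psi>\<close> with the transport operator
  leaves a term with \<open>U\<close> on the strip (\<open>error_representation\<close>). Since all data vanish on the strip, \<open>U\<close> is small
  there: an energy estimate with the weight \<open>\<psi>\<close>, whose slope \<open>- \<sigma>\<close> makes the transport term coercive, bounds it
  by the residuals (\<open>inflow_stability\<close>). The function \<open>\<psi> U\<close> has degree \<open>k + 1\<close> and is not in the discrete space;
  on each element it is corrected by a multiple of the element width, which the inverse estimate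
  \<open>tensor_inverse_estimate\<close> controls. In the stabilization term the sign is right for each contraction by
  \<open>characteristic_dissipative\<close>. On coarse meshes, where no strip fits between the boundary and the data, \<open>h\<close> is bounded
  below and the representation with \<open>\<psi> = 0\<close> is enough (\<open>coarse_mesh_estimate\<close>).\<close>

section \<open>Calculus of continuously differentiable functions\<close>

declare Ck.simps(2) [simp del]

lemma Ck_SucI:
  assumes "\<And>p. (f has_derivative f' p) (at p)" and "\<And>v. Ck n (\<lambda>p. f' p v)"
  shows "Ck (Suc n) f"
proof -
  have "frechet_derivative f (at p) = f' p" for p
    using frechet_derivative_at[OF assms(1)] by simp
  then show ?thesis using assms by (auto simp: differentiable_def Ck.simps)
qed

lemma Ck_Suc_has_derivative:
  "Ck (Suc n) f \<Longrightarrow> (f has_derivative frechet_derivative f (at p)) (at p)"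
  by (auto simp: frechet_derivative_works Ck.simps)

lemma Ck_SucD: "Ck (Suc n) f \<Longrightarrow> Ck n (\<lambda>p. frechet_derivative f (at p) v)"
  by (simp add: Ck.simps)

lemma Ck_Suc_imp_Ck: "Ck (Suc n) f \<Longrightarrow> Ck n f"
proof (induction n arbitrary: f)
  case 0
  then show ?case
    by (auto simp: Ck.simps intro!: continuous_at_imp_continuous_on differentiable_imp_continuous_within)
next
  case (Suc n)
  have "Ck (Suc n) (\<lambda>p. frechet_derivative f (at p) v)" for v
    using Suc.prems by (metis Ck.simps(2))
  then have "Ck n (\<lambda>p. frechet_derivative f (at p) v)" for v
    using Suc.IH by blast
  moreover have "\<forall>p. f differentiable (at p)"
    using Suc.prems by (metis Ck.simps(2))
  ultimately show ?case by (simp add: Ck.simps)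
qed

lemma Ck_mono: "m \<le> n \<Longrightarrow> Ck n f \<Longrightarrow> Ck m f"
  by (induction n rule: dec_induct) (auto dest: Ck_Suc_imp_Ck)

lemma Ck_continuous: "Ck n f \<Longrightarrow> continuous_on S f"
  using Ck_mono[of 0 n f] continuous_on_subset by auto

lemma Ck_const [simp]: "Ck n (\<lambda>_. c)"
  by (induction n arbitrary: c) (auto intro!: Ck_SucI[where f'="\<lambda>_ _. 0"])

lemma Ck_bounded_linear_compose:
  assumes "bounded_linear L"
  shows "Ck n f \<Longrightarrow> Ck n (\<lambda>p. L (f p))"
proof (induction n arbitrary: f)
  case 0
  then show ?case using assms
    by (auto intro: linear_continuous_on_compose bounded_linear.continuous_on)
next
  case (Suc n)
  show ?case
  proof (rule Ck_SucI)
    show "((\<lambda>p. L (f p)) has_derivative (\<lambda>v. L (frechet_derivative f (at p) v))) (at p)" for p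
      by (rule bounded_linear.has_derivative[OF assms Ck_Suc_has_derivative[OF Suc.prems]])
    show "Ck n (\<lambda>p. L (frechet_derivative f (at p) v))" for v
      using Suc.IH Ck_SucD[OF Suc.prems] by blast
  qed
qed

lemma Ck_compose_affine:
  assumes "bounded_linear L"
  shows "Ck n f \<Longrightarrow> Ck n (\<lambda>p. f (c + L p))"
proof (induction n arbitrary: f)
  case 0
  have "continuous_on UNIV (\<lambda>p. c + L p)"
    using assms by (intro continuous_intros linear_continuous_on)
  then show ?case using 0 continuous_on_compose2[of UNIV f UNIV "\<lambda>p. c + L p"] by auto
next
  case (Suc n)
  show ?case
  proof (rule Ck_SucI)
    show "((\<lambda>p. f (c + L p)) has_derivative (\<lambda>v. frechet_derivative f (at (c + L p)) (L v))) (at p)" for p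
    proof (rule has_derivative_compose[where g=f, rotated])
      show "(f has_derivative frechet_derivative f (at (c + L p))) (at (c + L p))"
        by (rule Ck_Suc_has_derivative[OF Suc.prems])
      show "((\<lambda>p. c + L p) has_derivative L) (at p)"
        by (rule derivative_eq_intros bounded_linear_imp_has_derivative assms refl | simp)+
    qed
    show "Ck n (\<lambda>p. frechet_derivative f (at (c + L p)) (L v))" for v
      using Suc.IH Ck_SucD[OF Suc.prems] by blast
  qed
qed

lemma Ck_add: "Ck n f \<Longrightarrow> Ck n g \<Longrightarrow> Ck n (\<lambda>p. f p + g p)"
proof (induction n arbitrary: f g)
  case 0
  then show ?case by (auto intro!: continuous_intros)
next
  case (Suc n)
  show ?case
  proof (rule Ck_SucI)
    show "((\<lambda>p. f p + g p) has_derivative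
      (\<lambda>v. frechet_derivative f (at p) v + frechet_derivative g (at p) v)) (at p)" for p
      by (intro has_derivative_add Ck_Suc_has_derivative[OF Suc.prems(1)] Ck_Suc_has_derivative[OF Suc.prems(2)])
    show "Ck n (\<lambda>p. frechet_derivative f (at p) v + frechet_derivative g (at p) v)" for v
      by (intro Suc.IH Ck_SucD[OF Suc.prems(1)] Ck_SucD[OF Suc.prems(2)])
  qed
qed

lemma Ck_scaleR:
  fixes f :: "'a::real_normed_vector \<Rightarrow> real" and g :: "'a \<Rightarrow> 'b::real_normed_vector"
  shows "Ck n f \<Longrightarrow> Ck n g \<Longrightarrow> Ck n (\<lambda>p. f p *\<^sub>R g p)"
proof (induction n arbitrary: f g)
  case 0
  then show ?case by (auto intro!: continuous_intros)
next
  case (Suc n)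
  show ?case
  proof (rule Ck_SucI)
    show "((\<lambda>p. f p *\<^sub>R g p) has_derivative
      (\<lambda>v. f p *\<^sub>R frechet_derivative g (at p) v + frechet_derivative f (at p) v *\<^sub>R g p)) (at p)" for p
      by (intro has_derivative_scaleR Ck_Suc_has_derivative[OF Suc.prems(1)] Ck_Suc_has_derivative[OF Suc.prems(2)])
    show "Ck n (\<lambda>p. f p *\<^sub>R frechet_derivative g (at p) v + frechet_derivative f (at p) v *\<^sub>R g p)" for v
      by (intro Ck_add Suc.IH Ck_SucD Suc.prems Ck_Suc_imp_Ck[OF Suc.prems(1)] Ck_Suc_imp_Ck[OF Suc.prems(2)])
  qed
qed

lemma Ck_mult:
  fixes f g :: "'a::real_normed_vector \<Rightarrow> real"
  shows "Ck n f \<Longrightarrow> Ck n g \<Longrightarrow> Ck n (\<lambda>p. f p * g p)"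
  using Ck_scaleR[of n f g] by simp

lemma Ck_bounded_linear: "bounded_linear L \<Longrightarrow> Ck n L"
proof (cases n)
  case 0
  then show "bounded_linear L \<Longrightarrow> ?thesis" by (auto intro: linear_continuous_on)
next
  case (Suc m)
  assume "bounded_linear L"
  then show ?thesis unfolding Suc
    by (intro Ck_SucI[where f'="\<lambda>_. L"]) (auto intro: bounded_linear_imp_has_derivative)
qed

lemma Ck_fst [simp]: "Ck n (fst :: 'a::real_normed_vector \<times> 'b::real_normed_vector \<Rightarrow> 'a)"
  by (rule Ck_bounded_linear) (rule bounded_linear_fst)

lemma Ck_snd [simp]: "Ck n (snd :: 'a::real_normed_vector \<times> 'b::real_normed_vector \<Rightarrow> 'b)"
  by (rule Ck_bounded_linear) (rule bounded_linear_snd)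

lemma Ck_minus: "Ck n f \<Longrightarrow> Ck n (\<lambda>p. - f p)"
  by (rule Ck_bounded_linear_compose[OF bounded_linear_minus[OF bounded_linear_ident]])

lemma Ck_diff: "Ck n f \<Longrightarrow> Ck n g \<Longrightarrow> Ck n (\<lambda>p. f p - g p)"
  using Ck_add[of n f "\<lambda>p. - g p"] Ck_minus[of n g] by simp

lemma Ck_sum: "(\<And>i. i \<in> I \<Longrightarrow> Ck n (f i)) \<Longrightarrow> Ck n (\<lambda>p. \<Sum>i\<in>I. f i p)"
  by (induction I rule: infinite_finite_induct) (auto intro: Ck_add)

lemma Ck_power:
  fixes f :: "'a::real_normed_vector \<Rightarrow> real"
  shows "Ck n f \<Longrightarrow> Ck n (\<lambda>p. f p ^ m)"
  by (induction m) (auto intro: Ck_mult)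

lemma Ck_fst_compose:
  fixes f :: "real \<Rightarrow> real"
  shows "Ck n f \<Longrightarrow> Ck n (\<lambda>p::real \<times> real. f (c + a * fst p))"
  using Ck_compose_affine[of "\<lambda>p. a * fst p" n f c]
  by (simp add: bounded_linear_mult_const bounded_linear_const_mult bounded_linear_fst)

lemma Ck_snd_compose:
  fixes f :: "real \<Rightarrow> real"
  shows "Ck n f \<Longrightarrow> Ck n (\<lambda>p::real \<times> real. f (c + a * snd p))"
  using Ck_compose_affine[of "\<lambda>p. a * snd p" n f c]
  by (simp add: bounded_linear_mult_const bounded_linear_const_mult bounded_linear_snd)

lemma Ck_Suc_real:
  fixes f :: "real \<Rightarrow> real"
  assumes "\<And>x. (f has_field_derivative f' x) (at x)" "Ck n f'"
  shows "Ck (Suc n) f"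
proof (rule Ck_SucI)
  show "(f has_derivative (\<lambda>v. f' p * v)) (at p)" for p
    using assms(1) by (simp add: has_field_derivative_def)
  show "Ck n (\<lambda>p. f' p * v)" for v
    by (intro Ck_mult assms Ck_const)
qed

text \<open>Differentiation under the integral sign; it makes the solution of the dual problem as smooth as its
  right-hand side.\<close>

lemma Ck_average_along_line:
  fixes f :: "'a::euclidean_space \<Rightarrow> 'b::euclidean_space"
  shows "Ck n f \<Longrightarrow> Ck n (\<lambda>p. integral {0..T::real} (\<lambda>r. f (p + r *\<^sub>R d)))"
    and "Ck (Suc n) f \<Longrightarrow> ((\<lambda>p. integral {0..T::real} (\<lambda>r. f (p + r *\<^sub>R d))) has_derivative
      (\<lambda>v. integral {0..T} (\<lambda>r. frechet_derivative f (at (p + r *\<^sub>R d)) v))) (at p)"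
proof -
  have cont: "continuous_on S (\<lambda>(p, r). f (p + r *\<^sub>R d))" if "Ck m f" for m S and f :: "'a \<Rightarrow> 'b"
    unfolding case_prod_unfold
    by (rule continuous_on_compose2[OF Ck_continuous[OF that, of UNIV]]) (auto intro!: continuous_intros)
  have der: "((\<lambda>p. integral {0..T} (\<lambda>r. f (p + r *\<^sub>R d))) has_derivative
      (\<lambda>v. integral {0..T} (\<lambda>r. frechet_derivative f (at (p + r *\<^sub>R d)) v))) (at p)"
    if "Ck (Suc n) f" for f :: "'a \<Rightarrow> 'b" and p n
  proof -
    define D where "D q = Blinfun (frechet_derivative f (at q))" for q
    have D: "blinfun_apply (D q) = frechet_derivative f (at q)" for q
      unfolding D_def using Ck_Suc_has_derivative[OF that] has_derivative_bounded_linear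
      by (intro bounded_linear_Blinfun_apply) blast
    have Dcont: "continuous_on UNIV D"
      by (rule continuous_on_blinfun_componentwise) (simp add: D Ck_continuous[OF Ck_SucD[OF that]])
    have D2: "continuous_on S (\<lambda>(p, r). D (p + r *\<^sub>R d))" for S
      unfolding case_prod_unfold
      by (rule continuous_on_compose2[OF Dcont]) (auto intro!: continuous_intros)
    have "((\<lambda>p. integral (cbox 0 T) (\<lambda>r. f (p + r *\<^sub>R d))) has_derivative
      integral (cbox 0 T) (\<lambda>r. D (p + r *\<^sub>R d))) (at p within UNIV)"
    proof (rule leibniz_rule)
      show "((\<lambda>p. f (p + r *\<^sub>R d)) has_derivative blinfun_apply (D (p + r *\<^sub>R d))) (at p within UNIV)" for p r
        unfolding D
        apply (rule has_derivative_eq_rhs)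
        apply (rule has_derivative_compose[where g=f])
        apply (rule derivative_intros)+
        apply (rule Ck_Suc_has_derivative[OF that])
        apply simp
        done
      show "(\<lambda>r. f (p + r *\<^sub>R d)) integrable_on cbox 0 T" for p
        by (intro integrable_continuous continuous_on_compose2[OF Ck_continuous[OF that, of UNIV]])
          (auto intro!: continuous_intros)
    qed (use D2 in auto)
    moreover have "blinfun_apply (integral (cbox 0 T) (\<lambda>r. D (p + r *\<^sub>R d))) =
       (\<lambda>v. integral {0..T} (\<lambda>r. frechet_derivative f (at (p + r *\<^sub>R d)) v))"
    proof
      fix v
      have int: "(\<lambda>r. D (p + r *\<^sub>R d)) integrable_on cbox 0 T"
        by (intro integrable_continuous continuous_on_compose2[OF Dcont]) (auto intro!: continuous_intros)
      show "blinfun_apply (integral (cbox 0 T) (\<lambda>r. D (p + r *\<^sub>R d))) v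
        = integral {0..T} (\<lambda>r. frechet_derivative f (at (p + r *\<^sub>R d)) v)"
        using integral_linear[OF int bounded_linear_blinfun_apply[OF bounded_linear_ident], of]
          integral_linear[OF int blinfun.bounded_linear_left, of v]
        by (simp add: o_def D)
    qed
    ultimately show ?thesis by simp
  qed
  show "Ck n f \<Longrightarrow> Ck n (\<lambda>p. integral {0..T::real} (\<lambda>r. f (p + r *\<^sub>R d)))"
  proof (induction n arbitrary: f)
    case 0
    have "continuous_on UNIV (\<lambda>p. integral (cbox 0 T) (\<lambda>r. f (p + r *\<^sub>R d)))"
      by (rule integral_continuous_on_param) (rule cont[OF 0])
    then show ?case by simp
  next
    case (Suc n)
    show ?case
      by (rule Ck_SucI[OF der[OF Suc.prems]]) (intro Suc.IH Ck_SucD Suc.prems)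
  qed
  show "Ck (Suc n) f \<Longrightarrow> ((\<lambda>p. integral {0..T::real} (\<lambda>r. f (p + r *\<^sub>R d))) has_derivative
      (\<lambda>v. integral {0..T} (\<lambda>r. frechet_derivative f (at (p + r *\<^sub>R d)) v))) (at p)"
    by (rule der)
qed

section \<open>Smooth cutoff functions\<close>

definition flat :: "nat \<Rightarrow> real \<Rightarrow> real" where
  "flat n x = (if 0 < x then exp (- 1 / x) / x ^ n else 0)"

lemma flat_tendsto_0: "((flat n) \<longlongrightarrow> 0) (at_right 0)"
proof -
  have "((\<lambda>x::real. (inverse x) ^ n / exp (inverse x)) \<longlongrightarrow> 0) (at_right 0)"
    by (rule filterlim_compose[OF tendsto_power_div_exp_0 filterlim_inverse_at_top_right])
  then show ?thesis
    by (rule tendsto_cong[THEN iffD1, rotated])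
      (auto simp: eventually_at_right_field flat_def exp_minus field_simps intro!: exI[of _ 1])
qed

text \<open>The family of functions \<open>exp (- 1 / x) / x ^ n\<close> is closed under differentiation up to linear
  combinations, so smoothness follows by induction.\<close>

lemma flat_has_derivative:
  "(flat n has_field_derivative flat (n + 2) x - real n * flat (n + 1) x) (at x)"
proof -
  consider "x < 0" | "x = 0" | "0 < x" by linarith
  then show ?thesis
  proof cases
    case 1
    have "(flat n has_field_derivative 0) (at x)"
      by (rule has_field_derivative_transform_within_open[of "\<lambda>_. 0" _ _ "{..<0}"])
        (use 1 in \<open>auto simp: flat_def\<close>)
    then show ?thesis using 1 by (simp add: flat_def)
  next
    case 2
    have "((\<lambda>y. (flat n y - flat n 0) / (y - 0)) \<longlongrightarrow> 0) (at_right 0)"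
      by (rule tendsto_cong[THEN iffD1, OF _ flat_tendsto_0[of "Suc n"]])
        (auto simp: eventually_at_right_field flat_def field_simps intro!: exI[of _ 1])
    moreover have "((\<lambda>y. (flat n y - flat n 0) / (y - 0)) \<longlongrightarrow> 0) (at_left 0)"
      by (rule tendsto_cong[THEN iffD1, OF _ tendsto_const[of 0]])
        (auto simp: eventually_at_left_field flat_def field_simps intro!: exI[of _ "-1"])
    ultimately have "((\<lambda>y. (flat n y - flat n 0) / (y - 0)) \<longlongrightarrow> 0) (at 0)"
      using filterlim_split_at by blast
    then have "(flat n has_field_derivative 0) (at 0)"
      by (simp add: has_field_derivative_iff)
    then show ?thesis using 2 by (simp add: flat_def)
  next
    case 3
    have "((\<lambda>x. exp (- 1 / x) / x ^ n) has_field_derivative flat (n + 2) x - real n * flat (n + 1) x) (at x)"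
      using 3 by (auto simp: flat_def divide_simps power2_eq_square algebra_simps simp flip: power_Suc
        intro!: derivative_eq_intros split: nat.split) (cases n; simp add: algebra_simps)+
    then show ?thesis
      by (rule has_field_derivative_transform_within_open[of _ _ _ "{0<..}"])
        (use 3 in \<open>auto simp: flat_def\<close>)
  qed
qed

lemma Ck_flat: "Ck k (flat n)"
proof (induction k arbitrary: n)
  case 0
  then show ?case
    by (auto intro!: continuous_at_imp_continuous_on DERIV_isCont[OF flat_has_derivative])
next
  case (Suc k)
  show ?case
    by (rule Ck_Suc_real[OF flat_has_derivative]) (intro Ck_diff Ck_mult Ck_const Suc.IH)
qed

lemma flat_nonneg: "0 \<le> flat n x"
  by (simp add: flat_def)

definition bump :: "real \<Rightarrow> real" where
  "bump x = flat 0 x * flat 0 (1 - x) / integral {0..1} (\<lambda>x. flat 0 x * flat 0 (1 - x))"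

lemma Ck_bump: "Ck k bump"
proof -
  have "Ck k (\<lambda>x. flat 0 (1 - x))"
    using Ck_compose_affine[of "\<lambda>x. - x" k "flat 0" 1] Ck_flat
    by (simp add: bounded_linear_minus bounded_linear_ident)
  then have "Ck k (\<lambda>x. flat 0 x * flat 0 (1 - x) * (1 / integral {0..1} (\<lambda>x. flat 0 x * flat 0 (1 - x))))"
    by (intro Ck_mult Ck_flat Ck_const)
  then show ?thesis by (simp add: bump_def[abs_def])
qed

lemma bump_outside: "x \<le> 0 \<or> 1 \<le> x \<Longrightarrow> bump x = 0"
  by (auto simp: bump_def flat_def)

lemma continuous_bump: "continuous_on S bump"
  using Ck_continuous[OF Ck_bump] by blast

lemma bump_nonneg: "0 \<le> bump x"
  unfolding bump_def
  by (intro divide_nonneg_nonneg mult_nonneg_nonneg flat_nonneg integral_nonneg)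
    (auto intro!: flat_nonneg integrable_continuous_real continuous_intros
      continuous_on_compose2[OF Ck_continuous[OF Ck_flat, of UNIV]] mult_nonneg_nonneg)

lemma integral_bump: "integral {0..1} bump = 1"
proof -
  let ?g = "\<lambda>x::real. flat 0 x * flat 0 (1 - x)"
  have "continuous_on {0..1} ?g"
    by (auto intro!: continuous_intros continuous_on_compose2[OF Ck_continuous[OF Ck_flat, of UNIV]])
  then have "integral {0..1} ?g \<noteq> 0"
    using integral_eq_0_iff[of 0 1 ?g] flat_nonneg
    by (auto simp: intro!: bexI[of _ "1/2"] simp: flat_def)
  then show ?thesis
    unfolding bump_def by simp
qed

definition step :: "real \<Rightarrow> real" where
  "step x = integral {-1..x} bump"

lemma step_0: "x \<le> 0 \<Longrightarrow> step x = 0"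
  unfolding step_def
  by (intro integral_unique has_integral_eq[OF _ has_integral_0])
    (auto simp: bump_outside)

lemma step_has_derivative: "(step has_field_derivative bump x) (at x)"
proof (cases "x < 0")
  case True
  have "(step has_field_derivative 0) (at x)"
    by (rule has_field_derivative_transform_within_open[of "\<lambda>_. 0" _ _ "{..<0}"])
      (use True in \<open>auto simp: step_0\<close>)
  then show ?thesis using True by (simp add: bump_outside)
next
  case False
  have "(step has_field_derivative bump x) (at x within {-1..x+1})"
    unfolding step_def[abs_def]
    by (rule integral_has_real_derivative) (use False in \<open>auto simp: continuous_bump\<close>)
  moreover have "at x within {-1..x+1} = at x"
    by (rule at_within_interior) (use False in auto)
  ultimately show ?thesis by simp
qed

lemma Ck_step: "Ck k step"
  by (rule Ck_Suc_imp_Ck[OF Ck_Suc_real[OF step_has_derivative Ck_bump]])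

lemma step_mono: "x \<le> y \<Longrightarrow> step x \<le> step y"
  using DERIV_nonneg_imp_nondecreasing[of x y step] step_has_derivative bump_nonneg by blast

lemma step_1: "1 \<le> x \<Longrightarrow> step x = 1"
proof -
  assume x: "1 \<le> x"
  have i: "bump integrable_on {a..b}" for a b
    by (intro integrable_continuous_real continuous_bump)
  have "integral {-1..x} bump = integral {-1..0} bump + integral {0..1} bump + integral {1..x} bump"
    using x Henstock_Kurzweil_Integration.integral_combine[of "-1" 0 x bump] Henstock_Kurzweil_Integration.integral_combine[of 0 1 x bump] i by simp
  moreover have "integral {-1..0} bump = 0" "integral {1..x} bump = 0"
    by (intro integral_unique has_integral_eq[OF _ has_integral_0]; auto simp: bump_outside)+
  ultimately show ?thesis by (simp add: step_def integral_bump)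
qed

lemma step_bounds: "0 \<le> step x" "step x \<le> 1"
  using step_mono[of "min x 0" x] step_mono[of x "max x 1"] step_0[of "min x 0"] step_1[of "max x 1"] by auto

section \<open>Square integrable functions\<close>

lemma integral_pieces:
  fixes f :: "'a::euclidean_space \<Rightarrow> 'b::euclidean_space"
  assumes "finite I" and A: "\<And>i. i \<in> I \<Longrightarrow> A i \<in> sets lebesgue" "\<And>i. i \<in> I \<Longrightarrow> A i \<subseteq> G"
    and disj: "disjoint_family_on A I" and G: "G \<in> sets lebesgue" and null: "negligible (G - (\<Union>i\<in>I. A i))"
    and int: "\<And>i. i \<in> I \<Longrightarrow> integrable (lebesgue_on (A i)) f"
  shows "integrable (lebesgue_on G) f"
    and "integral\<^sup>L (lebesgue_on G) f = (\<Sum>i\<in>I. integral\<^sup>L (lebesgue_on (A i)) f)"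
proof -
  let ?s = "\<lambda>x. \<Sum>i\<in>I. indicator (A i) x *\<^sub>R f x"
  have int': "integrable lebesgue (\<lambda>x. indicator (A i) x *\<^sub>R f x)" if "i \<in> I" for i
    using int[OF that] A(1)[OF that] by (simp add: integrable_restrict_space)
  then have s: "integrable lebesgue ?s" by auto
  have ae: "AE x in lebesgue. ?s x = indicator G x *\<^sub>R f x"
  proof (rule AE_I'[of "G - (\<Union>i\<in>I. A i)"])
    show "G - (\<Union>i\<in>I. A i) \<in> null_sets lebesgue"
      using null by (simp add: negligible_iff_null_sets)
    have "?s x = indicator G x *\<^sub>R f x" if nx: "x \<notin> G - (\<Union>i\<in>I. A i)" for x
    proof (cases "x \<in> G")
      case True
      then obtain i where i: "i \<in> I" "x \<in> A i" using nx by blast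
      have "(\<Sum>i\<in>I. indicator (A i) x *\<^sub>R f x) = (\<Sum>j\<in>I. if j = i then f x else 0)"
        using disj i by (intro sum.cong) (auto simp: disjoint_family_on_def indicator_def)
      then show ?thesis using True i \<open>finite I\<close> by simp
    next
      case False
      then have "indicator (A i) x *\<^sub>R f x = 0" if "i \<in> I" for i
        using A(2)[OF that] by (auto simp: indicator_def)
      then have "?s x = 0" by (intro sum.neutral) blast
      then show ?thesis using False by simp
    qed
    then show "{x \<in> space lebesgue. ?s x \<noteq> indicator G x *\<^sub>R f x} \<subseteq> G - (\<Union>i\<in>I. A i)" by blast
  qed
  have m: "(\<lambda>x. indicator G x *\<^sub>R f x) \<in> borel_measurable lebesgue"
    by (rule borel_measurable_AE[OF _ ae]) (use s in auto)
  have "integrable lebesgue (\<lambda>x. indicator G x *\<^sub>R f x)"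
    using integrable_cong_AE[OF _ m ae] s by auto
  then show "integrable (lebesgue_on G) f" using G by (simp add: integrable_restrict_space)
  have "integral\<^sup>L (lebesgue_on G) f = integral\<^sup>L lebesgue ?s"
    using G integral_cong_AE[OF _ m ae] s by (auto simp: integral_restrict_space)
  also have "\<dots> = (\<Sum>i\<in>I. integral\<^sup>L lebesgue (\<lambda>x. indicator (A i) x *\<^sub>R f x))"
    by (rule Bochner_Integration.integral_sum) (use int' in auto)
  also have "\<dots> = (\<Sum>i\<in>I. integral\<^sup>L (lebesgue_on (A i)) f)"
    using A(1) by (intro sum.cong) (auto simp: integral_restrict_space)
  finally show "integral\<^sup>L (lebesgue_on G) f = (\<Sum>i\<in>I. integral\<^sup>L (lebesgue_on (A i)) f)" .
qed

lemma integrable_subset: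
  fixes f :: "'a::euclidean_space \<Rightarrow> 'b::euclidean_space"
  assumes "integrable (lebesgue_on G) f" "A \<subseteq> G" "A \<in> sets lebesgue" "G \<in> sets lebesgue"
  shows "integrable (lebesgue_on A) f"
  using assms set_integrable_subset[of lebesgue G f A]
  by (simp add: integrable_restrict_space set_integrable_def)

lemma L2_measurable: "u \<in> L2 G \<Longrightarrow> u \<in> borel_measurable (lebesgue_on G)"
  and L2_integrable_square: "u \<in> L2 G \<Longrightarrow> integrable (lebesgue_on G) (\<lambda>p. (norm (u p))\<^sup>2)"
  by (auto simp: L2_def)

lemma L2_norm_square: "(L2_norm G u)\<^sup>2 = (LINT p|lebesgue_on G. (norm (u p))\<^sup>2)"
  by (simp add: L2_norm_def)

lemma L2_norm_nonneg: "0 \<le> L2_norm G u"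
  by (simp add: L2_norm_def)

lemma L2_inner_integrable:
  assumes "u \<in> L2 G" "w \<in> L2 G"
  shows "integrable (lebesgue_on G) (\<lambda>p. u p \<bullet> w p)"
proof (rule Bochner_Integration.integrable_bound)
  show "integrable (lebesgue_on G) (\<lambda>p. (norm (u p))\<^sup>2 + (norm (w p))\<^sup>2)"
    using assms by (auto dest: L2_integrable_square)
  have "\<bar>u p \<bullet> w p\<bar> \<le> (norm (u p))\<^sup>2 + (norm (w p))\<^sup>2" for p
  proof -
    have "2 * (norm (u p) * norm (w p)) \<le> (norm (u p))\<^sup>2 + (norm (w p))\<^sup>2"
      using sum_squares_bound[of "norm (u p)" "norm (w p)"] by simp
    moreover have "0 \<le> norm (u p) * norm (w p)" by simp
    ultimately show ?thesis using Cauchy_Schwarz_ineq2[of "u p" "w p"] by linarith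
  qed
  then show "AE p in lebesgue_on G. norm (u p \<bullet> w p) \<le> norm ((norm (u p))\<^sup>2 + (norm (w p))\<^sup>2)" by simp
qed (use assms[THEN L2_measurable] in measurable)

lemma L2_mult_integrable:
  fixes u w :: "'a::euclidean_space \<Rightarrow> real"
  assumes "u \<in> L2 G" "w \<in> L2 G"
  shows "integrable (lebesgue_on G) (\<lambda>p. u p * w p)"
  using L2_inner_integrable[OF assms] by simp

lemma L2_Cauchy_Schwarz:
  assumes "u \<in> L2 G" "w \<in> L2 G"
  shows "\<bar>LINT p|lebesgue_on G. u p \<bullet> w p\<bar> \<le> L2_norm G u * L2_norm G w"
proof -
  let ?M = "lebesgue_on G"
  let ?a = "L2_norm G u" and ?b = "L2_norm G w"
  have au: "(LINT p|?M. (norm (u p))\<^sup>2) = ?a\<^sup>2" "(LINT p|?M. (norm (w p))\<^sup>2) = ?b\<^sup>2"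
    by (simp_all add: L2_norm_square)
  note int = L2_inner_integrable[OF assms] L2_integrable_square[OF assms(1)] L2_integrable_square[OF assms(2)]
  have key: "\<bar>LINT p|?M. u p \<bullet> w p\<bar> * (2 * (s * t)) \<le> t\<^sup>2 * ?a\<^sup>2 + s\<^sup>2 * ?b\<^sup>2" if "0 \<le> s" "0 \<le> t" for s t
  proof -
    have "\<bar>LINT p|?M. u p \<bullet> w p\<bar> * (2 * (s * t)) \<le> (LINT p|?M. \<bar>u p \<bullet> w p\<bar>) * (2 * (s * t))"
      using that by (intro mult_right_mono integral_abs_bound) auto
    also have "\<dots> = (LINT p|?M. \<bar>u p \<bullet> w p\<bar> * (2 * (s * t)))" by simp
    also have "\<dots> \<le> (LINT p|?M. t\<^sup>2 * (norm (u p))\<^sup>2 + s\<^sup>2 * (norm (w p))\<^sup>2)"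
    proof (rule integral_mono)
      fix p
      have "\<bar>u p \<bullet> w p\<bar> * (2 * (s * t)) \<le> norm (u p) * norm (w p) * (2 * (s * t))"
        using that by (intro mult_right_mono Cauchy_Schwarz_ineq2) auto
      also have "\<dots> \<le> t\<^sup>2 * (norm (u p))\<^sup>2 + s\<^sup>2 * (norm (w p))\<^sup>2"
        using sum_squares_bound[of "t * norm (u p)" "s * norm (w p)"] by (simp add: power_mult_distrib algebra_simps)
      finally show "\<bar>u p \<bullet> w p\<bar> * (2 * (s * t)) \<le> t\<^sup>2 * (norm (u p))\<^sup>2 + s\<^sup>2 * (norm (w p))\<^sup>2" .
    qed (use int in auto)
    also have "\<dots> = t\<^sup>2 * ?a\<^sup>2 + s\<^sup>2 * ?b\<^sup>2" using int by (simp add: au)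
    finally show ?thesis .
  qed
  have ab: "0 \<le> ?a" "0 \<le> ?b" by (simp_all add: L2_norm_nonneg)
  show ?thesis
  proof (cases "?a = 0 \<or> ?b = 0")
    case False
    then have "0 < ?a * ?b" using ab by auto
    have "\<bar>LINT p|?M. u p \<bullet> w p\<bar> * (2 * (?a * ?b)) \<le> (?a * ?b) * (2 * (?a * ?b))"
      using key[OF ab] by (simp add: power2_eq_square algebra_simps)
    then show ?thesis using \<open>0 < ?a * ?b\<close> by (simp add: mult_le_cancel_right)
  next
    case True
    let ?I = "\<bar>LINT p|?M. u p \<bullet> w p\<bar>"
    have "?I \<le> 0"
    proof (rule ccontr)
      assume "\<not> ?I \<le> 0"
      then have I: "?I > 0" by simp
      consider "?a = 0" | "?b = 0" using True by blast
      then show False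
      proof cases
        case 1
        have "?I * (2 * (?I * t)) \<le> ?I\<^sup>2 * ?b\<^sup>2" if "0 \<le> t" for t using key[of ?I t] that 1 by simp
        from this[of "?b\<^sup>2 + 1"] have "?I\<^sup>2 * (2 * (?b\<^sup>2 + 1)) \<le> ?I\<^sup>2 * ?b\<^sup>2" by (simp add: power2_eq_square algebra_simps)
        then have "2 * (?b\<^sup>2 + 1) \<le> ?b\<^sup>2" using I by (simp add: mult_le_cancel_left)
        then show False by (smt (verit) zero_le_power2)
      next
        case 2
        have "?I * (2 * (s * ?I)) \<le> ?I\<^sup>2 * ?a\<^sup>2" if "0 \<le> s" for s using key[of s ?I] that 2 by simp
        from this[of "?a\<^sup>2 + 1"] have "?I\<^sup>2 * (2 * (?a\<^sup>2 + 1)) \<le> ?I\<^sup>2 * ?a\<^sup>2" by (simp add: power2_eq_square algebra_simps)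
        then have "2 * (?a\<^sup>2 + 1) \<le> ?a\<^sup>2" using I by (simp add: mult_le_cancel_left)
        then show False by (smt (verit) zero_le_power2)
      qed
    qed
    then show ?thesis using True by auto
  qed
qed

lemma L2_Cauchy_Schwarz_real:
  fixes u w :: "'a::euclidean_space \<Rightarrow> real"
  assumes "u \<in> L2 G" "w \<in> L2 G"
  shows "\<bar>LINT p|lebesgue_on G. u p * w p\<bar> \<le> L2_norm G u * L2_norm G w"
  using L2_Cauchy_Schwarz[OF assms] by simp

lemma L2_bound:
  fixes u :: "'a::euclidean_space \<Rightarrow> 'b::euclidean_space" and w :: "'a \<Rightarrow> 'c::euclidean_space"
  assumes "w \<in> L2 G" "u \<in> borel_measurable (lebesgue_on G)" "AE p in lebesgue_on G. norm (u p) \<le> c * norm (w p)"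
  shows "u \<in> L2 G"
proof -
  have "integrable (lebesgue_on G) (\<lambda>p. (norm (u p))\<^sup>2)"
  proof (rule Bochner_Integration.integrable_bound)
    show "integrable (lebesgue_on G) (\<lambda>p. c\<^sup>2 * (norm (w p))\<^sup>2)"
      using assms by (auto dest: L2_integrable_square)
    show "AE p in lebesgue_on G. norm ((norm (u p))\<^sup>2) \<le> norm (c\<^sup>2 * (norm (w p))\<^sup>2)"
      using assms(3)
    proof eventually_elim
      case (elim p)
      then have "(norm (u p))\<^sup>2 \<le> (c * norm (w p))\<^sup>2" by (intro power_mono) auto
      then show ?case by (simp add: power_mult_distrib)
    qed
  qed (use assms in auto)
  then show ?thesis using assms(2) by (simp add: L2_def)
qed

lemma L2_norm_bound:
  fixes u :: "'a::euclidean_space \<Rightarrow> 'b::euclidean_space" and w :: "'a \<Rightarrow> 'c::euclidean_space"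
  assumes "w \<in> L2 G" "AE p in lebesgue_on G. norm (u p) \<le> c * norm (w p)" "0 \<le> c"
  shows "L2_norm G u \<le> c * L2_norm G w"
proof -
  have "(LINT p|lebesgue_on G. (norm (u p))\<^sup>2) \<le> (LINT p|lebesgue_on G. c\<^sup>2 * (norm (w p))\<^sup>2)"
  proof (rule integral_mono_AE')
    show "integrable (lebesgue_on G) (\<lambda>p. c\<^sup>2 * (norm (w p))\<^sup>2)"
      using assms by (auto dest: L2_integrable_square)
    show "AE p in lebesgue_on G. (norm (u p))\<^sup>2 \<le> c\<^sup>2 * (norm (w p))\<^sup>2"
      using assms(2)
    proof eventually_elim
      case (elim p)
      then have "(norm (u p))\<^sup>2 \<le> (c * norm (w p))\<^sup>2" by (intro power_mono) auto
      then show ?case by (simp add: power_mult_distrib)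
    qed
  qed auto
  then have "(L2_norm G u)\<^sup>2 \<le> (c * L2_norm G w)\<^sup>2"
    by (simp add: L2_norm_square power_mult_distrib)
  then show ?thesis
    by (rule power2_le_imp_le) (simp add: assms L2_norm_nonneg)
qed

lemma L2_add:
  assumes "u \<in> L2 G" "w \<in> L2 G"
  shows "(\<lambda>p. u p + w p) \<in> L2 G"
proof -
  have "integrable (lebesgue_on G) (\<lambda>p. (norm (u p + w p))\<^sup>2)"
  proof (rule Bochner_Integration.integrable_bound)
    show "integrable (lebesgue_on G) (\<lambda>p. 2 * (norm (u p))\<^sup>2 + 2 * (norm (w p))\<^sup>2)"
      using assms[THEN L2_integrable_square] by auto
    have "(norm (u p + w p))\<^sup>2 \<le> 2 * (norm (u p))\<^sup>2 + 2 * (norm (w p))\<^sup>2" for p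
    proof -
      have "(norm (u p + w p))\<^sup>2 \<le> (norm (u p) + norm (w p))\<^sup>2"
        by (intro power_mono norm_triangle_ineq) auto
      also have "\<dots> \<le> 2 * (norm (u p))\<^sup>2 + 2 * (norm (w p))\<^sup>2"
        using sum_squares_bound[of "norm (u p)" "norm (w p)"] by (simp add: power2_sum)
      finally show ?thesis .
    qed
    then show "AE p in lebesgue_on G. norm ((norm (u p + w p))\<^sup>2) \<le> norm (2 * (norm (u p))\<^sup>2 + 2 * (norm (w p))\<^sup>2)"
      by simp
  qed (use assms[THEN L2_measurable] in measurable)
  then show ?thesis using assms by (auto simp: L2_def)
qed

lemma L2_bounded_linear:
  fixes u :: "'a::euclidean_space \<Rightarrow> 'b::euclidean_space" and L :: "'b \<Rightarrow> 'c::euclidean_space"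
  assumes "u \<in> L2 G" "bounded_linear L"
  shows "(\<lambda>p. L (u p)) \<in> L2 G"
proof -
  obtain K where K: "\<And>x. norm (L x) \<le> norm x * K" using bounded_linear.bounded[OF assms(2)] by blast
  have "L \<in> borel_measurable borel"
    by (intro borel_measurable_continuous_onI linear_continuous_on assms)
  then have "(\<lambda>p. L (u p)) \<in> borel_measurable (lebesgue_on G)"
    using measurable_compose[OF L2_measurable[OF assms(1)]] by blast
  then show ?thesis using K by (intro L2_bound[OF assms(1), of _ K]) (auto simp: mult.commute)
qed

lemma L2_minus: "u \<in> L2 G \<Longrightarrow> (\<lambda>p. - u p) \<in> L2 G"
  using L2_bounded_linear[of u G uminus] by (simp add: bounded_linear_minus bounded_linear_ident)

lemma L2_diff: "u \<in> L2 G \<Longrightarrow> w \<in> L2 G \<Longrightarrow> (\<lambda>p. u p - w p) \<in> L2 G"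
  using L2_add[of u G "\<lambda>p. - w p"] L2_minus[of w G] by simp

lemma L2_scaleR: "u \<in> L2 G \<Longrightarrow> (\<lambda>p. c *\<^sub>R u p) \<in> L2 G"
  using L2_bounded_linear[of u G "\<lambda>x. c *\<^sub>R x"] by (simp add: bounded_linear_scaleR_right)

lemma L2_cmult: "u \<in> L2 G \<Longrightarrow> (\<lambda>p. c * u p) \<in> L2 G" for c :: real
  using L2_scaleR[of u G c] by simp

lemma L2_inner_const: "u \<in> L2 G \<Longrightarrow> (\<lambda>p. v \<bullet> u p) \<in> L2 G"
  by (erule L2_bounded_linear) (rule bounded_linear_inner_right)

lemma L2_norm_scaleR: "L2_norm G (\<lambda>p. c *\<^sub>R u p) = \<bar>c\<bar> * L2_norm G u"
  by (simp add: L2_norm_def power_mult_distrib real_sqrt_mult)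

lemma L2_norm_cmult: "L2_norm G (\<lambda>p. c * u p) = \<bar>c\<bar> * L2_norm G u" for c :: real
  using L2_norm_scaleR[of G c u] by simp

lemma L2_subset:
  fixes u :: "'a::euclidean_space \<Rightarrow> 'b::euclidean_space"
  assumes "u \<in> L2 G" "A \<subseteq> G" "A \<in> sets lebesgue" "G \<in> sets lebesgue"
  shows "u \<in> L2 A"
proof -
  have "restrict_space (lebesgue_on G) A = lebesgue_on A"
    using assms by (simp add: restrict_restrict_space Int_absorb1)
  then have "u \<in> borel_measurable (lebesgue_on A)"
    using measurable_restrict_space1[OF L2_measurable[OF assms(1)], of A] by metis
  then show ?thesis
    using integrable_subset[OF L2_integrable_square[OF assms(1)] assms(2-)] by (simp add: L2_def)
qed

lemma L2_bounded:
  fixes u :: "'a::euclidean_space \<Rightarrow> 'b::euclidean_space"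
  assumes "u \<in> borel_measurable (lebesgue_on G)" "\<And>p. p \<in> G \<Longrightarrow> norm (u p) \<le> c"
    and "emeasure lebesgue G < \<infinity>" "G \<in> sets lebesgue"
  shows "u \<in> L2 G"
proof -
  have "(\<lambda>_::'a. 1::real) \<in> L2 G"
    using assms by (simp add: L2_def integrable_restrict_space set_integrable_def)
  then show ?thesis
    by (rule L2_bound[of _ _ _ c]) (use assms in auto)
qed

section \<open>Uniqueness of weak derivatives\<close>

text \<open>The sets on which the integral vanishes contain the boxes, which are stable under intersection, and form a
  Dynkin system; hence they contain all Borel sets.\<close>

lemma AE_zero_of_box_integrals:
  fixes u :: "'a::euclidean_space \<Rightarrow> real"
  assumes int: "integrable (lebesgue_on (box a b)) u"
    and zero: "\<And>c d. box c d \<subseteq> box a b \<Longrightarrow> (LINT p|lebesgue_on (box c d). u p) = 0"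
  shows "AE p in lebesgue_on (box a b). u p = 0"
proof -
  define v where "v p = indicator (box a b) p * u p" for p
  have v: "integrable lebesgue v"
    using int unfolding v_def by (simp add: integrable_restrict_space)
  have P: "set_lebesgue_integral lebesgue A v = 0" if "A \<in> sets borel" for A
  proof -
    have box_case: "set_lebesgue_integral lebesgue (box c d) v = 0" for c d
    proof -
      obtain e f where ef: "box a b \<inter> box c d = box e f" using box_Int_box by blast
      have "set_lebesgue_integral lebesgue (box c d) v = (LINT p|lebesgue_on (box e f). u p)"
        unfolding set_lebesgue_integral_def v_def ef[symmetric]
        by (subst integral_restrict_space) (simp_all add: indicator_inter_arith mult_ac del: box_Int_box)
      then show ?thesis using zero ef by (metis inf_le1)
    qed
    have si: "set_integrable lebesgue A v" if "A \<in> sets borel" for A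
      using v that unfolding set_integrable_def by (intro integrable_mult_indicator) auto
    have UN: "set_lebesgue_integral lebesgue UNIV v = 0"
    proof -
      have "set_lebesgue_integral lebesgue UNIV v = set_lebesgue_integral lebesgue (box a b) v"
        unfolding set_lebesgue_integral_def v_def by (auto intro!: Bochner_Integration.integral_cong simp: indicator_def)
      then show ?thesis using box_case by simp
    qed
    have sig: "A \<in> sigma_sets UNIV (range (\<lambda>(a, b). box a b::'a set))"
      using that unfolding borel_eq_box by (simp add: sets_measure_of)
    have "Int_stable (range (\<lambda>(a, b). box a b::'a set))"
      by (auto simp: Int_stable_def box_Int_box)
    moreover have "range (\<lambda>(a, b). box a b::'a set) \<subseteq> Pow UNIV" by simp
    moreover note sig
    ultimately show ?thesis
    proof (induction rule: sigma_sets_induct_disjoint)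
      case (compl A)
      then have A: "A \<in> sets borel" unfolding borel_eq_box by (simp add: sets_measure_of)
      have "set_lebesgue_integral lebesgue (A \<union> (UNIV - A)) v
          = set_lebesgue_integral lebesgue A v + set_lebesgue_integral lebesgue (UNIV - A) v"
      proof (rule set_integral_Un)
        show "set_integrable lebesgue A v" "set_integrable lebesgue (UNIV - A) v"
          using A by (intro si; simp)+
      qed blast
      then show ?case using UN compl by simp
    next
      case (union A)
      then have A: "A i \<in> sets borel" for i unfolding borel_eq_box by (auto simp add: sets_measure_of)
      have "set_lebesgue_integral lebesgue (\<Union>i. A i) v = (\<Sum>i. set_lebesgue_integral lebesgue (A i) v)"
      proof (rule lebesgue_integral_countable_add)
        show "A i \<in> sets lebesgue" for i using A[of i] by simp
        show "i \<noteq> j \<Longrightarrow> A i \<inter> A j = {}" for i j using union(1) by (simp add: disjoint_family_on_def)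
        show "set_integrable lebesgue (\<Union>i. A i) v" using A by (intro si) blast
      qed
      then show ?case using union by simp
    next
      case empty
      then show ?case by (simp add: set_lebesgue_integral_def)
    next
      case (basic A)
      then show ?case using box_case by auto
    qed
  qed
  obtain w where w: "w \<in> borel_measurable borel" "AE x in lborel. v x = w x"
    using completion_ex_borel_measurable_real[of v lborel] v by auto
  have ae: "AE x in lebesgue. v x = w x" using w(2) by (rule AE_completion)
  have w_int: "integrable lebesgue w"
    using v w ae by (subst integrable_cong_AE[of w lebesgue v]) (auto intro: measurable_completion)
  have Pw: "set_lebesgue_integral lebesgue A w = 0" if "A \<in> sets borel" for A
  proof -
    have "set_lebesgue_integral lebesgue A w = set_lebesgue_integral lebesgue A v"
      unfolding set_lebesgue_integral_def
      proof (rule integral_cong_AE)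
        show "(\<lambda>x. indicator A x *\<^sub>R w x) \<in> borel_measurable lebesgue"
          "(\<lambda>x. indicator A x *\<^sub>R v x) \<in> borel_measurable lebesgue"
          using that v w_int by (intro borel_measurable_scaleR borel_measurable_indicator; auto)+
      qed (use ae in auto)
    then show ?thesis using P that by simp
  qed
  have half: "AE x in lebesgue. indicator A x * w x = 0" if "A = {x. 0 < s * w x}" for A and s :: real
  proof (cases "s = 0")
    case True then show ?thesis using that by simp
  next
    case False
    have A: "A \<in> sets borel" unfolding that using w(1) by measurable
    have i: "integrable lebesgue (\<lambda>x. indicator A x * w x)"
      using integrable_mult_indicator[of A lebesgue w] w_int A by auto
    have "(LINT x|lebesgue. s * (indicator A x * w x)) = 0"
      using Pw[OF A] by (simp add: set_lebesgue_integral_def)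
    then have "AE x in lebesgue. s * (indicator A x * w x) = 0"
      by (subst (asm) integral_nonneg_eq_0_iff_AE)
        (use i that in \<open>auto simp: indicator_def\<close>)
    then show ?thesis using False by simp
  qed
  have "AE x in lebesgue. w x = 0"
    using half[OF refl, of 1] half[OF refl, of "-1"]
    by eventually_elim (auto simp: indicator_def not_less split: if_splits)
  then have "AE x in lebesgue. v x = 0" using ae by eventually_elim auto
  then have "AE p in lebesgue. p \<in> box a b \<longrightarrow> u p = 0"
    by eventually_elim (auto simp: v_def)
  then show ?thesis by (subst AE_restrict_space_iff) auto
qed

lemma L2_scaleR_integrable:
  fixes f :: "'a::euclidean_space \<Rightarrow> real" and w :: "'a \<Rightarrow> 'b::euclidean_space"
  assumes "f \<in> L2 G" "w \<in> L2 G"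
  shows "integrable (lebesgue_on G) (\<lambda>p. f p *\<^sub>R w p)"
proof (rule Bochner_Integration.integrable_bound)
  show "integrable (lebesgue_on G) (\<lambda>p. (norm (f p))\<^sup>2 + (norm (w p))\<^sup>2)"
    using assms[THEN L2_integrable_square] by auto
  have "norm (f p *\<^sub>R w p) \<le> (norm (f p))\<^sup>2 + (norm (w p))\<^sup>2" for p
  proof -
    have "2 * (norm (f p) * norm (w p)) \<le> (norm (f p))\<^sup>2 + (norm (w p))\<^sup>2"
      using sum_squares_bound[of "norm (f p)" "norm (w p)"] by simp
    moreover have "0 \<le> norm (f p) * norm (w p)" by simp
    ultimately show ?thesis unfolding norm_scaleR real_norm_def[symmetric] by linarith
  qed
  then show "AE p in lebesgue_on G. norm (f p *\<^sub>R w p) \<le> norm ((norm (f p))\<^sup>2 + (norm (w p))\<^sup>2)" by simp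
qed (use assms[THEN L2_measurable] in measurable)

lemma test_function_Ck: "\<phi> \<in> test_functions G \<Longrightarrow> Ck n \<phi>"
  by (simp add: test_functions_def smooth_def)

lemma test_function_zero: "\<phi> \<in> test_functions G \<Longrightarrow> p \<notin> G \<Longrightarrow> \<phi> p = 0"
  using closure_subset[of "{p. \<phi> p \<noteq> 0}"] by (auto simp: test_functions_def)

lemma continuous_L2:
  fixes f :: "'a::euclidean_space \<Rightarrow> 'b::euclidean_space"
  assumes "continuous_on UNIV f" "bounded G" "G \<in> sets lebesgue"
  shows "f \<in> L2 G"
proof -
  have "bounded (f ` closure G)"
    using assms by (intro compact_imp_bounded compact_continuous_image) (auto intro: continuous_on_subset)
  then obtain c where c: "\<forall>x\<in>f ` closure G. norm x \<le> c" using bounded_iff by blast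
  show ?thesis
  proof (rule L2_bounded)
    show "f \<in> borel_measurable (lebesgue_on G)"
      using assms by (intro continuous_imp_measurable_on_sets_lebesgue) (auto intro: continuous_on_subset)
    show "p \<in> G \<Longrightarrow> norm (f p) \<le> c" for p using c closure_subset[of G] by auto
    have "G \<in> lmeasurable" using bounded_set_imp_lmeasurable[OF assms(2,3)] .
    then show "emeasure lebesgue G < \<infinity>" unfolding fmeasurable_def by auto
  qed fact
qed

lemma test_function_L2:
  "\<phi> \<in> test_functions G \<Longrightarrow> bounded A \<Longrightarrow> A \<in> sets lebesgue \<Longrightarrow> \<phi> \<in> L2 A"
  by (intro continuous_L2 Ck_continuous[OF test_function_Ck])

lemma test_function_derivative:
  assumes "\<phi> \<in> test_functions G"
  shows "(\<lambda>p. frechet_derivative \<phi> (at p) d) \<in> test_functions G"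
proof -
  let ?K = "closure {p. \<phi> p \<noteq> 0}"
  have z: "frechet_derivative \<phi> (at p) d = 0" if "p \<notin> ?K" for p
  proof -
    have "(\<phi> has_derivative (\<lambda>_. 0)) (at p)"
    proof (rule has_derivative_transform_within_open[of "\<lambda>_. 0" _ _ UNIV "- ?K"])
      show "q \<in> - ?K \<Longrightarrow> 0 = \<phi> q" for q using closure_subset[of "{p. \<phi> p \<noteq> 0}"] by auto
    qed (use that in auto)
    from frechet_derivative_at[OF this] show ?thesis by metis
  qed
  then have sub: "closure {p. frechet_derivative \<phi> (at p) d \<noteq> 0} \<subseteq> ?K"
    by (intro closure_minimal) auto
  moreover have "smooth (\<lambda>p. frechet_derivative \<phi> (at p) d)"
    unfolding smooth_def using Ck_SucD[OF test_function_Ck[OF assms]] by blast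
  ultimately show ?thesis
    using assms bounded_subset[OF _ sub] unfolding test_functions_def compact_eq_bounded_closed
    by blast
qed

lemma test_functionI:
  assumes "\<And>n. Ck n \<phi>" "compact C" "C \<subseteq> G" "\<And>p. p \<notin> C \<Longrightarrow> \<phi> p = 0"
  shows "\<phi> \<in> test_functions G"
proof -
  have "closure {p. \<phi> p \<noteq> 0} \<subseteq> C"
    using assms by (intro closure_minimal compact_imp_closed) auto
  then show ?thesis
    using assms bounded_subset[of C] unfolding test_functions_def smooth_def compact_eq_bounded_closed
    by blast
qed

lemma box_Pair: "box (a, b) (c, d) = {a<..<c} \<times> {b<..<d}" for a b c d :: real
  by (auto simp: box_def Basis_prod_def)

lemma box_cutoffs:
  fixes a b c d :: real
  obtains \<phi> :: "nat \<Rightarrow> real \<times> real \<Rightarrow> real" where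
    "\<And>n. \<phi> n \<in> test_functions (box (a, b) (c, d))" "\<And>n p. 0 \<le> \<phi> n p" "\<And>n p. \<phi> n p \<le> 1"
    "\<And>p. p \<in> box (a, b) (c, d) \<Longrightarrow> (\<lambda>n. \<phi> n p) \<longlonglongrightarrow> 1"
proof
  define st where "st n z = step (real (Suc n) * z - 1)" for n z
  define \<phi> where "\<phi> n p = st n (fst p - a) * st n (c - fst p) * st n (snd p - b) * st n (d - snd p)" for n and p :: "real \<times> real"
  have st: "0 \<le> st n z" "st n z \<le> 1" "z \<le> 1 / Suc n \<Longrightarrow> st n z = 0" for n z
    by (auto simp: st_def step_bounds field_simps intro!: step_0)
  have st1: "(\<lambda>n. st n z) \<longlonglongrightarrow> 1" if "0 < z" for z
  proof (rule tendsto_eventually)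
    obtain n0 where n0: "2 / z < real n0" using reals_Archimedean2 by blast
    have "st n z = 1" if "n \<ge> n0" for n
    proof -
      have "2 / z \<le> real (Suc n)" using n0 that by simp
      then have "2 \<le> real (Suc n) * z" using \<open>0 < z\<close> by (simp add: field_simps)
      then show ?thesis unfolding st_def by (intro step_1) simp
    qed
    then show "\<forall>\<^sub>F n in sequentially. st n z = 1" by (auto simp: eventually_sequentially)
  qed
  have Ck_st: "Ck k (\<lambda>p::real\<times>real. st n (e + s * fst p))" "Ck k (\<lambda>p::real\<times>real. st n (e + s * snd p))" for k n e s
    using Ck_fst_compose[OF Ck_step, of k "real (Suc n) * e - 1" "real (Suc n) * s"]
      Ck_snd_compose[OF Ck_step, of k "real (Suc n) * e - 1" "real (Suc n) * s"]
    by (simp_all add: st_def algebra_simps)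
  show "\<phi> n \<in> test_functions (box (a, b) (c, d))" for n
  proof (rule test_functionI[where C="cbox (a + 1 / Suc n, b + 1 / Suc n) (c - 1 / Suc n, d - 1 / Suc n)"])
    show "Ck k (\<phi> n)" for k
      unfolding \<phi>_def[abs_def]
      using Ck_st[of k n "-a" 1] Ck_st[of k n c "-1"] Ck_st[of k n "-b" 1] Ck_st[of k n d "-1"]
      by (auto intro!: Ck_mult)
    define e where "e = 1 / real (Suc n)"
    have e: "0 < e" by (simp add: e_def)
    then show "cbox (a + 1 / Suc n, b + 1 / Suc n) (c - 1 / Suc n, d - 1 / Suc n) \<subseteq> box (a, b) (c, d)"
      unfolding box_Pair cbox_Pair_eq e_def[symmetric] by (auto simp del: of_nat_Suc)
    show "\<phi> n p = 0" if "p \<notin> cbox (a + 1 / Suc n, b + 1 / Suc n) (c - 1 / Suc n, d - 1 / Suc n)" for p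
      using that unfolding \<phi>_def cbox_Pair_eq
      by (cases p) (auto simp: not_le algebra_simps intro!: st(3))
  qed simp
  show "0 \<le> \<phi> n p" "\<phi> n p \<le> 1" for n p
    unfolding \<phi>_def by (auto intro!: mult_nonneg_nonneg mult_le_one st)
  show "(\<lambda>n. \<phi> n p) \<longlonglongrightarrow> 1" if "p \<in> box (a, b) (c, d)" for p
  proof -
    have "(\<lambda>n. st n (fst p - a) * st n (c - fst p) * st n (snd p - b) * st n (d - snd p)) \<longlonglongrightarrow> 1 * 1 * 1 * 1"
      using that unfolding box_Pair by (intro tendsto_mult st1) auto
    then show ?thesis by (simp add: \<phi>_def)
  qed
qed

lemma test_functions_mono: "A \<subseteq> B \<Longrightarrow> test_functions A \<subseteq> test_functions B"
  unfolding test_functions_def by auto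

text \<open>Smooth cutoffs converge boundedly to the indicator of a box, which reduces the claim to integrals over
  boxes.\<close>

lemma AE_zero_of_test_integrals:
  fixes u :: "real \<times> real \<Rightarrow> real"
  assumes int: "integrable (lebesgue_on (box a b)) u"
    and zero: "\<And>\<phi>. \<phi> \<in> test_functions (box a b) \<Longrightarrow> (LINT p|lebesgue_on (box a b). \<phi> p * u p) = 0"
  shows "AE p in lebesgue_on (box a b). u p = 0"
proof (rule AE_zero_of_box_integrals[OF int])
  fix c d :: "real \<times> real" assume sub: "box c d \<subseteq> box a b"
  obtain \<phi> :: "nat \<Rightarrow> real \<times> real \<Rightarrow> real" where \<phi>: "\<And>n. \<phi> n \<in> test_functions (box c d)"
    "\<And>n p. 0 \<le> \<phi> n p" "\<And>n p. \<phi> n p \<le> 1" "\<And>p. p \<in> box c d \<Longrightarrow> (\<lambda>n. \<phi> n p) \<longlonglongrightarrow> 1"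
    using box_cutoffs[of "fst c" "snd c" "fst d" "snd d"] by (metis prod.collapse)
  have int': "integrable (lebesgue_on (box c d)) u"
    by (rule integrable_subset[OF int sub]) auto
  have "(\<lambda>n. LINT p|lebesgue_on (box c d). \<phi> n p * u p) \<longlonglongrightarrow> (LINT p|lebesgue_on (box c d). 1 * u p)"
  proof (rule integral_dominated_convergence[where w="\<lambda>p. \<bar>u p\<bar>"])
    have m: "\<phi> n \<in> borel_measurable (lebesgue_on (box c d))" for n
      by (intro continuous_imp_measurable_on_sets_lebesgue Ck_continuous[OF test_function_Ck[OF \<phi>(1)]]) auto
    then show "(\<lambda>p. \<phi> n p * u p) \<in> borel_measurable (lebesgue_on (box c d))" for n
      using int' by auto
    show "AE p in lebesgue_on (box c d). (\<lambda>n. \<phi> n p * u p) \<longlonglongrightarrow> 1 * u p"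
      by (intro AE_I2 tendsto_mult tendsto_const \<phi>(4)) simp
    show "AE p in lebesgue_on (box c d). norm (\<phi> n p * u p) \<le> \<bar>u p\<bar>" for n
      using \<phi>(2,3) by (intro AE_I2) (auto simp: abs_mult intro: mult_left_le_one_le)
  qed (use int' in auto)
  moreover have "(LINT p|lebesgue_on (box c d). \<phi> n p * u p) = 0" for n
  proof -
    have "(LINT p|lebesgue_on (box c d). \<phi> n p * u p) = (LINT p|lebesgue_on (box a b). (if p \<in> box c d then \<phi> n p * u p else 0))"
      by (rule integral_restrict[OF sub, symmetric]) auto
    also have "\<dots> = (LINT p|lebesgue_on (box a b). \<phi> n p * u p)"
      using test_function_zero[OF \<phi>(1)] by (intro Bochner_Integration.integral_cong) auto
    finally show ?thesis using zero[of "\<phi> n"] \<phi>(1) test_functions_mono[OF sub] by auto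
  qed
  ultimately show "(LINT p|lebesgue_on (box c d). u p) = 0"
    by (simp add: LIMSEQ_const_iff)
qed

lemma weak_derivative_unique:
  fixes u w w' :: "real \<times> real \<Rightarrow> 'b::euclidean_space"
  assumes "weak_derivative (box a b) d u w" "w \<in> L2 (box a b)"
    and "weak_derivative (box a b) d u w'" "w' \<in> L2 (box a b)"
  shows "AE p in lebesgue_on (box a b). w p = w' p"
proof -
  let ?G = "box a b"
  have one: "(\<lambda>_. 1::real) \<in> L2 ?G" by (rule continuous_L2) auto
  have "AE p in lebesgue_on ?G. (w p - w' p) \<bullet> e = 0" for e
  proof (rule AE_zero_of_test_integrals)
    have L2: "(\<lambda>p. (w p - w' p) \<bullet> e) \<in> L2 ?G"
      using L2_inner_const[OF L2_diff[OF assms(2,4)], of e] by (simp add: inner_commute)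
    show "integrable (lebesgue_on ?G) (\<lambda>p. (w p - w' p) \<bullet> e)"
      using L2_mult_integrable[OF one L2] by simp
    fix \<phi> :: "real \<times> real \<Rightarrow> real" assume \<phi>: "\<phi> \<in> test_functions ?G"
    have \<phi>2: "\<phi> \<in> L2 ?G" by (rule test_function_L2[OF \<phi>]) auto
    note int = L2_scaleR_integrable[OF \<phi>2 assms(2)] L2_scaleR_integrable[OF \<phi>2 assms(4)]
    have "- (LINT p|lebesgue_on ?G. \<phi> p *\<^sub>R w p) = - (LINT p|lebesgue_on ?G. \<phi> p *\<^sub>R w' p)"
      using assms(1,3) \<phi> unfolding weak_derivative_def by auto
    then have "(LINT p|lebesgue_on ?G. \<phi> p *\<^sub>R w p - \<phi> p *\<^sub>R w' p) = 0" using int by simp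
    then have "(LINT p|lebesgue_on ?G. (\<phi> p *\<^sub>R w p - \<phi> p *\<^sub>R w' p) \<bullet> e) = 0"
      using int by (cases "e = 0") auto
    then show "(LINT p|lebesgue_on ?G. \<phi> p * ((w p - w' p) \<bullet> e)) = 0"
      by (simp add: inner_diff_left algebra_simps)
  qed
  then have "AE p in lebesgue_on ?G. \<forall>e\<in>Basis. (w p - w' p) \<bullet> e = 0"
    by (intro AE_ball_countable[THEN iffD2]) (auto intro: countable_finite)
  then show ?thesis
  proof eventually_elim
    case (elim p)
    then have "w p - w' p = 0" using euclidean_all_zero_iff by blast
    then show ?case by simp
  qed
qed

text \<open>Identifies the choice in \<open>wderiv\<close> almost everywhere, so that an explicitly known weak
  derivative may be used in its place.\<close>

lemma wderiv_AE:
  fixes u :: "real \<times> real \<Rightarrow> 'b::euclidean_space"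
  assumes "weak_derivative (box a b) d u w" "w \<in> L2 (box a b)"
  shows "wderiv (box a b) d u \<in> L2 (box a b)" "weak_derivative (box a b) d u (wderiv (box a b) d u)"
    "AE p in lebesgue_on (box a b). wderiv (box a b) d u p = w p"
proof -
  show *: "wderiv (box a b) d u \<in> L2 (box a b)" "weak_derivative (box a b) d u (wderiv (box a b) d u)"
    using someI[of "\<lambda>w. w \<in> L2 (box a b) \<and> weak_derivative (box a b) d u w" w] assms
    unfolding wderiv_def by auto
  show "AE p in lebesgue_on (box a b). wderiv (box a b) d u p = w p"
    by (rule weak_derivative_unique[OF *(2,1) assms])
qed

declare One_nat_def [simp del]

lemma Ck_1_has_derivative: "Ck 1 f \<Longrightarrow> (f has_derivative frechet_derivative f (at p)) (at p)"
  using Ck_Suc_has_derivative[of 0 f p] by (simp add: One_nat_def)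

section \<open>Integration over rectangles and slabs\<close>

abbreviation pd :: "'a::real_normed_vector \<Rightarrow> ('a \<Rightarrow> 'b::real_normed_vector) \<Rightarrow> 'a \<Rightarrow> 'b" where
  "pd d F p \<equiv> frechet_derivative F (at p) d"

lemma pd_eqI: "(F has_derivative F') (at p) \<Longrightarrow> pd d F p = F' d"
  using frechet_derivative_at by metis

lemma pd_scaleR:
  fixes f :: "'a::real_normed_vector \<Rightarrow> real" and g :: "'a \<Rightarrow> 'b::real_normed_vector"
  assumes "Ck 1 f" "Ck 1 g"
  shows "pd d (\<lambda>p. f p *\<^sub>R g p) p = f p *\<^sub>R pd d g p + pd d f p *\<^sub>R g p"
  using assms by (intro pd_eqI has_derivative_scaleR Ck_1_has_derivative)

lemma pd_mult:
  fixes f g :: "'a::real_normed_vector \<Rightarrow> real"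
  assumes "Ck 1 f" "Ck 1 g"
  shows "pd d (\<lambda>p. f p * g p) p = f p * pd d g p + pd d f p * g p"
  using pd_scaleR[OF assms] by simp

lemma pd_diff:
  assumes "Ck 1 f" "Ck 1 g"
  shows "pd d (\<lambda>p. f p - g p) p = pd d f p - pd d g p"
  using assms by (intro pd_eqI has_derivative_diff Ck_1_has_derivative)

lemma pd_bounded_linear:
  assumes "bounded_linear L" "Ck 1 f"
  shows "pd d (\<lambda>p. L (f p)) p = L (pd d f p)"
  using assms by (intro pd_eqI bounded_linear.has_derivative[OF assms(1)] Ck_1_has_derivative)

lemma pd_linear_direction:
  assumes "Ck 1 f"
  shows "pd (r *\<^sub>R d + e) f p = r *\<^sub>R pd d f p + pd e f p"
proof -
  have "linear (frechet_derivative f (at p))"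
    using Ck_1_has_derivative[OF assms] by (rule has_derivative_linear)
  then show ?thesis by (simp add: linear_add linear_scale)
qed

lemma Ck_pd: "Ck 1 f \<Longrightarrow> continuous_on S (pd d f)"
  using Ck_SucD[of 0 f d] by (auto simp: One_nat_def intro: continuous_on_subset)

lemma pd_fst: "pd d (\<lambda>p::real\<times>real. f (fst p)) p = fst d *\<^sub>R f'" if "(f has_vector_derivative f') (at (fst p))"
proof -
  have "((\<lambda>p. f (fst p)) has_derivative (\<lambda>d. fst d *\<^sub>R f')) (at p)"
    using that unfolding has_vector_derivative_def
    by (rule has_derivative_compose[OF has_derivative_fst[OF has_derivative_ident]])
  then show ?thesis by (rule pd_eqI)
qed

lemma pd_snd: "pd d (\<lambda>p::real\<times>real. f (snd p)) p = snd d *\<^sub>R f'" if "(f has_vector_derivative f') (at (snd p))"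
proof -
  have "((\<lambda>p. f (snd p)) has_derivative (\<lambda>d. snd d *\<^sub>R f')) (at p)"
    using that unfolding has_vector_derivative_def
    by (rule has_derivative_compose[OF has_derivative_snd[OF has_derivative_ident]])
  then show ?thesis by (rule pd_eqI)
qed

lemma has_vector_derivative_along:
  assumes "Ck 1 F"
  shows "((\<lambda>r. F (p + r *\<^sub>R d)) has_vector_derivative pd d F (p + r *\<^sub>R d)) (at r within S)"
proof -
  have F: "(F has_derivative frechet_derivative F (at (p + r *\<^sub>R d))) (at (p + r *\<^sub>R d))"
    by (rule Ck_1_has_derivative[OF assms])
  have "((\<lambda>r. F (p + r *\<^sub>R d)) has_derivative (\<lambda>s. frechet_derivative F (at (p + r *\<^sub>R d)) (s *\<^sub>R d))) (at r within S)"
    by (rule has_derivative_compose[where g=F and f="\<lambda>r. p + r *\<^sub>R d", OF _ F]) (auto intro!: derivative_eq_intros)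
  moreover have "frechet_derivative F (at (p + r *\<^sub>R d)) (s *\<^sub>R d) = s *\<^sub>R pd d F (p + r *\<^sub>R d)" for s
    using has_derivative_linear[OF F] by (simp add: linear_scale)
  ultimately show ?thesis by (simp add: has_vector_derivative_def)
qed

lemma integral_pd_t:
  fixes F :: "real \<times> real \<Rightarrow> 'b::euclidean_space"
  assumes "Ck 1 F" "a \<le> c"
  shows "integral {a..c} (\<lambda>s. pd (1, 0) F (s, y)) = F (c, y) - F (a, y)"
  using fundamental_theorem_of_calculus[OF assms(2), of "\<lambda>s. F (s, y)" "\<lambda>s. pd (1, 0) F (s, y)"]
    has_vector_derivative_along[OF assms(1), of "(0, y)" "(1, 0)"]
  by (auto intro!: integral_unique simp: add.commute)

lemma integral_pd_x:
  fixes F :: "real \<times> real \<Rightarrow> 'b::euclidean_space"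
  assumes "Ck 1 F" "b \<le> d"
  shows "integral {b..d} (\<lambda>y. pd (0, 1) F (s, y)) = F (s, d) - F (s, b)"
  using fundamental_theorem_of_calculus[OF assms(2), of "\<lambda>y. F (s, y)" "\<lambda>y. pd (0, 1) F (s, y)"]
    has_vector_derivative_along[OF assms(1), of "(s, 0)" "(0, 1)"]
  by (auto intro!: integral_unique simp: add.commute)

lemma rectangle_Fubini:
  fixes F :: "real \<times> real \<Rightarrow> 'b::euclidean_space"
  assumes "continuous_on (cbox (a, b) (c, d)) F"
  shows "integral (cbox (a, b) (c, d)) F = integral {a..c} (\<lambda>s. integral {b..d} (\<lambda>y. F (s, y)))"
    "integral (cbox (a, b) (c, d)) F = integral {b..d} (\<lambda>y. integral {a..c} (\<lambda>s. F (s, y)))"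
  using integral_prod_continuous[OF assms] integral_swap_continuous[of a b c d "\<lambda>s y. F (s, y)"] assms
  by simp_all

lemma rectangle_integral:
  fixes F :: "'a::euclidean_space \<Rightarrow> 'b::euclidean_space"
  assumes "continuous_on (cbox a b) F" "\<And>p. p \<in> box a b \<Longrightarrow> f p = F p"
  shows "integrable (lebesgue_on (box a b)) f" "(LINT p|lebesgue_on (box a b). f p) = integral (cbox a b) F"
proof -
  have "F absolutely_integrable_on box a b"
    using absolutely_integrable_continuous[OF assms(1)] absolutely_integrable_on_open_interval by blast
  then have F: "integrable (lebesgue_on (box a b)) F"
    by (rule absolutely_integrable_imp_integrable) auto
  then show "integrable (lebesgue_on (box a b)) f"
    using assms(2) by (subst Bochner_Integration.integrable_cong[OF refl, of _ _ F]) auto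
  have "(LINT p|lebesgue_on (box a b). f p) = (LINT p|lebesgue_on (box a b). F p)"
    using assms(2) by (intro Bochner_Integration.integral_cong) auto
  also have "\<dots> = integral (box a b) F"
    by (rule lebesgue_integral_eq_integral[OF F]) auto
  also have "\<dots> = integral (cbox a b) F" by (rule integral_open_interval)
  finally show "(LINT p|lebesgue_on (box a b). f p) = integral (cbox a b) F" .
qed

lemma negligible_snd: "negligible {p::real \<times> real. snd p = c}"
proof -
  have "{p::real \<times> real. snd p = c} = {p. p \<bullet> (0, 1) = c}" by (auto simp: inner_Pair_0)
  then show ?thesis using negligible_standard_hyperplane[of "(0, 1) :: real \<times> real" c] by (simp add: Basis_prod_def)
qed

lemma negligible_fst: "negligible {p::real \<times> real. fst p = c}"
proof -
  have "{p::real \<times> real. fst p = c} = {p. p \<bullet> (1, 0) = c}" by (auto simp: inner_Pair_0)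
  then show ?thesis using negligible_standard_hyperplane[of "(1, 0) :: real \<times> real" c] by (simp add: Basis_prod_def)
qed

locale partition =
  fixes x :: "nat \<Rightarrow> real" and N :: nat
  assumes N_pos: "1 \<le> N" and x_inc: "j \<in> {1..N} \<Longrightarrow> x (j - 1) < x j"
begin

lemma x_less: "i < j \<Longrightarrow> j \<le> N \<Longrightarrow> x i < x j"
proof (induction j)
  case (Suc j)
  have "x j < x (Suc j)" using x_inc[of "Suc j"] Suc by simp
  then show ?case using Suc by (cases "i = j") auto
qed simp

lemma x_le: "i \<le> j \<Longrightarrow> j \<le> N \<Longrightarrow> x i \<le> x j"
  using x_less[of i j] by (cases "i = j") auto

text \<open>Every point between the end nodes is assigned to one half-open element, as in the indexing of time
  slabs.\<close>

definition elem :: "real \<Rightarrow> nat" where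
  "elem y = (LEAST j. y \<le> x j)"

lemma elem_eq:
  assumes "j \<in> {1..N}" "x (j - 1) < y" "y \<le> x j"
  shows "elem y = j"
  unfolding elem_def
proof (rule Least_equality)
  fix i assume i: "y \<le> x i"
  show "j \<le> i"
  proof (rule ccontr)
    assume "\<not> j \<le> i"
    then have "x i \<le> x (j - 1)" using assms(1) by (intro x_le) auto
    then show False using i assms by simp
  qed
qed fact

lemma elem_props:
  assumes "x 0 < y" "y \<le> x N"
  shows "elem y \<in> {1..N}" "x (elem y - 1) < y" "y \<le> x (elem y)"
proof -
  show le: "y \<le> x (elem y)" unfolding elem_def using assms(2) by (rule LeastI)
  have "elem y \<le> N" unfolding elem_def using assms(2) by (rule Least_le)
  moreover have "elem y \<noteq> 0" using le assms(1) by (cases "elem y = 0") auto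
  ultimately show "elem y \<in> {1..N}" by simp
  then have "elem y - 1 < elem y" by simp
  then have "\<not> y \<le> x (elem y - 1)" unfolding elem_def by (rule not_less_Least)
  then show "x (elem y - 1) < y" by simp
qed

lemma node_or_inside: "x 0 < y \<Longrightarrow> y < x N \<Longrightarrow> (\<exists>j\<in>{1..N}. x (j - 1) < y \<and> y < x j) \<or> y \<in> x ` {1..N}"
  using elem_props[of y] by force

lemma cells_disjoint: "i \<in> {1..N} \<Longrightarrow> j \<in> {1..N} \<Longrightarrow> x (i - 1) < y \<Longrightarrow> y < x i \<Longrightarrow> x (j - 1) < y \<Longrightarrow> y < x j \<Longrightarrow> i = j"
  using elem_eq[of i y] elem_eq[of j y] by simp

lemma cell_subset: "j \<in> {1..N} \<Longrightarrow> x 0 \<le> x (j - 1)" "j \<in> {1..N} \<Longrightarrow> x j \<le> x N"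
  by (auto intro!: x_le)

lemma integral_over_rows:
  fixes f :: "real \<times> real \<Rightarrow> 'b::euclidean_space"
  assumes "\<And>j. j \<in> {1..N} \<Longrightarrow> integrable (lebesgue_on (box (a, x (j - 1)) (c, x j))) f"
  shows "integrable (lebesgue_on (box (a, x 0) (c, x N))) f"
    "(LINT p|lebesgue_on (box (a, x 0) (c, x N)). f p) = (\<Sum>j=1..N. LINT p|lebesgue_on (box (a, x (j - 1)) (c, x j)). f p)"
proof -
  let ?A = "\<lambda>j. box (a, x (j - 1)) (c, x j)"
  have sub: "?A j \<subseteq> box (a, x 0) (c, x N)" if "j \<in> {1..N}" for j
    using cell_subset[OF that] by (auto simp: box_Pair)
  have disj: "disjoint_family_on ?A {1..N}"
    unfolding disjoint_family_on_def box_Pair using cells_disjoint by (auto simp: disjoint_iff)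
  have null: "negligible (box (a, x 0) (c, x N) - (\<Union>j\<in>{1..N}. ?A j))"
  proof (rule negligible_subset)
    show "negligible (\<Union>j\<in>{1..N}. {p::real \<times> real. snd p = x j})"
      by (intro negligible_Union) (auto intro: negligible_snd)
    show "box (a, x 0) (c, x N) - (\<Union>j\<in>{1..N}. ?A j) \<subseteq> (\<Union>j\<in>{1..N}. {p. snd p = x j})"
      using node_or_inside by (fastforce simp: box_Pair)
  qed
  note pc = integral_pieces[of "{1..N}" ?A, OF _ _ sub disj _ null assms]
  show "integrable (lebesgue_on (box (a, x 0) (c, x N))) f"
    by (rule pc(1)) auto
  show "(LINT p|lebesgue_on (box (a, x 0) (c, x N)). f p) = (\<Sum>j=1..N. LINT p|lebesgue_on (?A j). f p)"
    by (rule pc(2)) auto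
qed

lemma integral_over_columns:
  fixes f :: "real \<times> real \<Rightarrow> 'b::euclidean_space"
  assumes "\<And>j. j \<in> {1..N} \<Longrightarrow> integrable (lebesgue_on (box (x (j - 1), a) (x j, c))) f"
  shows "integrable (lebesgue_on (box (x 0, a) (x N, c))) f"
    "(LINT p|lebesgue_on (box (x 0, a) (x N, c)). f p) = (\<Sum>j=1..N. LINT p|lebesgue_on (box (x (j - 1), a) (x j, c)). f p)"
proof -
  let ?A = "\<lambda>j. box (x (j - 1), a) (x j, c)"
  have sub: "?A j \<subseteq> box (x 0, a) (x N, c)" if "j \<in> {1..N}" for j
    using cell_subset[OF that] by (auto simp: box_Pair)
  have disj: "disjoint_family_on ?A {1..N}"
    unfolding disjoint_family_on_def box_Pair using cells_disjoint by (auto simp: disjoint_iff)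
  have null: "negligible (box (x 0, a) (x N, c) - (\<Union>j\<in>{1..N}. ?A j))"
  proof (rule negligible_subset)
    show "negligible (\<Union>j\<in>{1..N}. {p::real \<times> real. fst p = x j})"
      by (intro negligible_Union) (auto intro: negligible_fst)
    show "box (x 0, a) (x N, c) - (\<Union>j\<in>{1..N}. ?A j) \<subseteq> (\<Union>j\<in>{1..N}. {p. fst p = x j})"
      using node_or_inside by (fastforce simp: box_Pair)
  qed
  note pc = integral_pieces[of "{1..N}" ?A, OF _ _ sub disj _ null assms]
  show "integrable (lebesgue_on (box (x 0, a) (x N, c))) f"
    by (rule pc(1)) auto
  show "(LINT p|lebesgue_on (box (x 0, a) (x N, c)). f p) = (\<Sum>j=1..N. LINT p|lebesgue_on (?A j). f p)"
    by (rule pc(2)) auto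
qed

lemma integral_over_cells:
  fixes f :: "real \<Rightarrow> 'b::euclidean_space"
  assumes "\<And>j. j \<in> {1..N} \<Longrightarrow> integrable (lebesgue_on {x (j - 1)<..<x j}) f"
  shows "integrable (lebesgue_on {x 0<..<x N}) f"
    "(LINT p|lebesgue_on {x 0<..<x N}. f p) = (\<Sum>j=1..N. LINT p|lebesgue_on {x (j - 1)<..<x j}. f p)"
proof -
  let ?A = "\<lambda>j. {x (j - 1)<..<x j}"
  have sub: "?A j \<subseteq> {x 0<..<x N}" if "j \<in> {1..N}" for j
    using cell_subset[OF that] by auto
  have disj: "disjoint_family_on ?A {1..N}"
    unfolding disjoint_family_on_def using cells_disjoint by (auto simp: disjoint_iff simp del: Int_greaterThanLessThan)
  have null: "negligible ({x 0<..<x N} - (\<Union>j\<in>{1..N}. ?A j))"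
  proof (rule negligible_subset)
    show "negligible (x ` {1..N})" by (intro negligible_finite) auto
    show "{x 0<..<x N} - (\<Union>j\<in>{1..N}. ?A j) \<subseteq> x ` {1..N}"
      using node_or_inside by fastforce
  qed
  note pc = integral_pieces[of "{1..N}" ?A, OF _ _ sub disj _ null assms]
  show "integrable (lebesgue_on {x 0<..<x N}) f"
    by (rule pc(1)) auto
  show "(LINT p|lebesgue_on {x 0<..<x N}. f p) = (\<Sum>j=1..N. LINT p|lebesgue_on (?A j). f p)"
    by (rule pc(2)) auto
qed

lemma slab_integral:
  fixes f :: "real \<times> real \<Rightarrow> 'b::euclidean_space"
  assumes "\<And>j. j \<in> {1..N} \<Longrightarrow> continuous_on UNIV (F j)"
    and "\<And>j p. j \<in> {1..N} \<Longrightarrow> p \<in> box (a, x (j - 1)) (c, x j) \<Longrightarrow> f p = F j p"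
  shows "integrable (lebesgue_on (box (a, x 0) (c, x N))) f"
    "(LINT p|lebesgue_on (box (a, x 0) (c, x N)). f p) = (\<Sum>j=1..N. integral (cbox (a, x (j - 1)) (c, x j)) (F j))"
proof -
  have *: "integrable (lebesgue_on (box (a, x (j - 1)) (c, x j))) f"
    "(LINT p|lebesgue_on (box (a, x (j - 1)) (c, x j)). f p) = integral (cbox (a, x (j - 1)) (c, x j)) (F j)" if "j \<in> {1..N}" for j
    using rectangle_integral[OF continuous_on_subset[OF assms(1)[OF that]] assms(2)[OF that], of "(a, x (j - 1))" "(c, x j)"] by auto
  show "integrable (lebesgue_on (box (a, x 0) (c, x N))) f"
    using integral_over_rows(1) *(1) by blast
  show "(LINT p|lebesgue_on (box (a, x 0) (c, x N)). f p) = (\<Sum>j=1..N. integral (cbox (a, x (j - 1)) (c, x j)) (F j))"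
    by (subst integral_over_rows(2)[OF *(1)]) (auto intro!: sum.cong *(2))
qed

lemma cells_integral:
  fixes f :: "real \<Rightarrow> 'b::euclidean_space"
  assumes "\<And>j. j \<in> {1..N} \<Longrightarrow> continuous_on UNIV (F j)"
    and "\<And>j y. j \<in> {1..N} \<Longrightarrow> y \<in> {x (j - 1)<..<x j} \<Longrightarrow> f y = F j y"
  shows "integrable (lebesgue_on {x 0<..<x N}) f"
    "(LINT y|lebesgue_on {x 0<..<x N}. f y) = (\<Sum>j=1..N. integral {x (j - 1)..x j} (F j))"
proof -
  have *: "integrable (lebesgue_on {x (j - 1)<..<x j}) f"
    "(LINT p|lebesgue_on {x (j - 1)<..<x j}. f p) = integral {x (j - 1)..x j} (F j)" if "j \<in> {1..N}" for j
    using rectangle_integral[OF continuous_on_subset[OF assms(1)[OF that]], of "x (j - 1)" "x j" f] assms(2)[OF that] by auto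
  show "integrable (lebesgue_on {x 0<..<x N}) f"
    using integral_over_cells(1) *(1) by blast
  show "(LINT p|lebesgue_on {x 0<..<x N}. f p) = (\<Sum>j=1..N. integral {x (j - 1)..x j} (F j))"
    by (subst integral_over_cells(2)[OF *(1)]) (auto intro!: sum.cong *(2))
qed

lemma slab_L2:
  fixes f :: "real \<times> real \<Rightarrow> 'b::euclidean_space"
  assumes "\<And>j. j \<in> {1..N} \<Longrightarrow> continuous_on UNIV (F j)"
    and "\<And>j p. j \<in> {1..N} \<Longrightarrow> p \<in> box (a, x (j - 1)) (c, x j) \<Longrightarrow> f p = F j p"
  shows "f \<in> L2 (box (a, x 0) (c, x N))"
proof -
  have "integrable (lebesgue_on (box (a, x 0) (c, x N))) (\<lambda>p. (norm (f p))\<^sup>2)"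
    by (rule slab_integral(1)[where F="\<lambda>j p. (norm (F j p))\<^sup>2"]) (use assms in \<open>auto intro!: continuous_intros\<close>)
  then show ?thesis
    using slab_integral(1)[OF assms] by (auto simp: L2_def)
qed

lemma cells_L2:
  fixes f :: "real \<Rightarrow> 'b::euclidean_space"
  assumes "\<And>j. j \<in> {1..N} \<Longrightarrow> continuous_on UNIV (F j)"
    and "\<And>j y. j \<in> {1..N} \<Longrightarrow> y \<in> {x (j - 1)<..<x j} \<Longrightarrow> f y = F j y"
  shows "f \<in> L2 {x 0<..<x N}"
proof -
  have "integrable (lebesgue_on {x 0<..<x N}) (\<lambda>p. (norm (f p))\<^sup>2)"
    by (rule cells_integral(1)[where F="\<lambda>j p. (norm (F j p))\<^sup>2"]) (use assms in \<open>auto intro!: continuous_intros\<close>)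
  then show ?thesis
    using cells_integral(1)[OF assms] by (auto simp: L2_def)
qed

definition glue :: "(nat \<Rightarrow> real \<times> real \<Rightarrow> 'b) \<Rightarrow> real \<times> real \<Rightarrow> 'b" where
  "glue F p = F (elem (snd p)) p"

lemma glue_eq: "j \<in> {1..N} \<Longrightarrow> p \<in> box (a, x (j - 1)) (c, x j) \<Longrightarrow> glue F p = F j p"
  unfolding glue_def using elem_eq[of j "snd p"] by (auto simp: box_Pair)

text \<open>Pieces are defined on the whole plane. This allows classical derivatives up to the boundary of each
  element, and continuity across nodes is forced because neighbouring closed elements share the values of
  \<open>u\<close>.\<close>

definition piecewise :: "real \<Rightarrow> real \<Rightarrow> (real \<times> real \<Rightarrow> 'b::euclidean_space) \<Rightarrow> (nat \<Rightarrow> real \<times> real \<Rightarrow> 'b) \<Rightarrow> bool" where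
  "piecewise a c u F \<longleftrightarrow> (\<forall>j\<in>{1..N}. Ck 1 (F j) \<and> (\<forall>s\<in>{a<..c}. \<forall>y\<in>{x (j - 1)..x j}. u (s, y) = F j (s, y)))"

lemma piecewise_Ck: "piecewise a c u F \<Longrightarrow> j \<in> {1..N} \<Longrightarrow> Ck 1 (F j)"
  by (simp add: piecewise_def)

lemma piecewise_box: "piecewise a c u F \<Longrightarrow> j \<in> {1..N} \<Longrightarrow> p \<in> box (a, x (j - 1)) (c, x j) \<Longrightarrow> u p = F j p"
  unfolding piecewise_def box_Pair by (cases p) auto

lemma piecewise_nodes:
  assumes "piecewise a c u F" "a < c" "j \<in> {1..N}" "s \<in> {a..c}" "Suc j \<le> N"
  shows "F j (s, x j) = F (Suc j) (s, x j)"
proof -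
  have j: "j \<in> {1..N}" "Suc j \<in> {1..N}" using assms by auto
  have xl: "x (j - 1) < x j" "x j < x (Suc j)" using x_inc[OF j(1)] x_inc[OF j(2)] by auto
  have C: "continuous_on {a..c} (\<lambda>s. F i (s, x j))" if "i \<in> {1..N}" for i
    by (rule continuous_on_compose2[OF Ck_continuous[OF piecewise_Ck[OF assms(1) that], of UNIV]])
      (auto intro!: continuous_intros)
  have eq: "F j (s, x j) = F (Suc j) (s, x j)" if "s \<in> {a<..c}" for s
  proof -
    have "u (s, x j) = F j (s, x j)" using assms(1) j(1) that xl unfolding piecewise_def by auto
    moreover have "u (s, x j) = F (Suc j) (s, x j)" using assms(1) j(2) that xl unfolding piecewise_def by force
    ultimately show ?thesis by simp
  qed
  have Wh_coeff: "closure {a<..<c} = {a..c}" using assms(2) by simp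
  have "continuous_on (closure {a<..<c}) (\<lambda>s. F j (s, x j) - F (Suc j) (s, x j))"
    unfolding Wh_coeff using C j by (intro continuous_on_diff) auto
  then have "F j (s, x j) - F (Suc j) (s, x j) = 0"
    by (rule continuous_constant_on_closure) (use eq assms(4) Wh_coeff in auto)
  then show ?thesis by simp
qed

lemma piecewise_Green_t:
  assumes "piecewise a c u F" "a \<le> c"
  shows "(LINT p|lebesgue_on (box (a, x 0) (c, x N)). glue (\<lambda>j. pd (1, 0) (F j)) p)
    = (\<Sum>j=1..N. integral {x (j - 1)..x j} (\<lambda>y. F j (c, y))) - (\<Sum>j=1..N. integral {x (j - 1)..x j} (\<lambda>y. F j (a, y)))"
proof -
  note Ck = piecewise_Ck[OF assms(1)]
  have "(LINT p|lebesgue_on (box (a, x 0) (c, x N)). glue (\<lambda>j. pd (1, 0) (F j)) p)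
     = (\<Sum>j=1..N. integral (cbox (a, x (j - 1)) (c, x j)) (pd (1, 0) (F j)))"
    by (rule slab_integral(2)[OF Ck_pd[OF Ck]]) (assumption, rule glue_eq)
  also have "\<dots> = (\<Sum>j=1..N. integral {x (j - 1)..x j} (\<lambda>y. F j (c, y)) - integral {x (j - 1)..x j} (\<lambda>y. F j (a, y)))"
  proof (rule sum.cong[OF refl])
    fix j assume j: "j \<in> {1..N}"
    have "integral (cbox (a, x (j - 1)) (c, x j)) (pd (1, 0) (F j)) = integral {x (j - 1)..x j} (\<lambda>y. F j (c, y) - F j (a, y))"
      by (subst rectangle_Fubini(2)[OF Ck_pd[OF Ck[OF j]]]) (simp add: integral_pd_t[OF Ck[OF j] assms(2)])
    also have "\<dots> = integral {x (j - 1)..x j} (\<lambda>y. F j (c, y)) - integral {x (j - 1)..x j} (\<lambda>y. F j (a, y))"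
      by (intro Henstock_Kurzweil_Integration.integral_diff integrable_continuous_real continuous_on_compose2[OF Ck_continuous[OF Ck[OF j], of UNIV]])
        (auto intro!: continuous_intros)
    finally show "integral (cbox (a, x (j - 1)) (c, x j)) (pd (1, 0) (F j))
      = integral {x (j - 1)..x j} (\<lambda>y. F j (c, y)) - integral {x (j - 1)..x j} (\<lambda>y. F j (a, y))" .
  qed
  finally show ?thesis by (simp add: sum_subtractf)
qed

lemma piecewise_Green_x:
  assumes "piecewise a c u F" "a < c"
  shows "(LINT p|lebesgue_on (box (a, x 0) (c, x N)). glue (\<lambda>j. pd (0, 1) (F j)) p)
    = integral {a..c} (\<lambda>s. F N (s, x N)) - integral {a..c} (\<lambda>s. F 1 (s, x 0))"
proof -
  note Ck = piecewise_Ck[OF assms(1)]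
  let ?I = "\<lambda>j i. integral {a..c} (\<lambda>s. F j (s, x i))"
  have "(LINT p|lebesgue_on (box (a, x 0) (c, x N)). glue (\<lambda>j. pd (0, 1) (F j)) p)
     = (\<Sum>j=1..N. integral (cbox (a, x (j - 1)) (c, x j)) (pd (0, 1) (F j)))"
    by (rule slab_integral(2)[OF Ck_pd[OF Ck]]) (assumption, rule glue_eq)
  also have "\<dots> = (\<Sum>j=1..N. ?I j j - ?I j (j - 1))"
  proof (rule sum.cong[OF refl])
    fix j assume j: "j \<in> {1..N}"
    have "integral (cbox (a, x (j - 1)) (c, x j)) (pd (0, 1) (F j)) = integral {a..c} (\<lambda>s. F j (s, x j) - F j (s, x (j - 1)))"
      using x_inc[OF j] by (subst rectangle_Fubini(1)[OF Ck_pd[OF Ck[OF j]]]) (simp add: integral_pd_x[OF Ck[OF j]])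
    also have "\<dots> = ?I j j - ?I j (j - 1)"
      by (intro Henstock_Kurzweil_Integration.integral_diff integrable_continuous_real continuous_on_compose2[OF Ck_continuous[OF Ck[OF j], of UNIV]])
        (auto intro!: continuous_intros)
    finally show "integral (cbox (a, x (j - 1)) (c, x j)) (pd (0, 1) (F j)) = ?I j j - ?I j (j - 1)" .
  qed
  also have "(\<Sum>j=1..n. ?I j j - ?I j (j - 1)) = ?I n n - ?I 1 0" if "1 \<le> n" "n \<le> N" for n
    using that
  proof (induction n rule: dec_induct)
    case (step n)
    have "?I n n = ?I (Suc n) n"
      using step piecewise_nodes[OF assms, of n] by (intro Henstock_Kurzweil_Integration.integral_cong) auto
    then show ?case using step by simp
  qed simp
  from this[OF N_pos] have "(\<Sum>j=1..N. ?I j j - ?I j (j - 1)) = ?I N N - ?I 1 0" by simp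
  finally show ?thesis .
qed

lemma piecewise_scaleR:
  assumes "Ck 1 \<phi>" "piecewise a c u F"
  shows "piecewise a c (\<lambda>p. \<phi> p *\<^sub>R u p) (\<lambda>j p. \<phi> p *\<^sub>R F j p)"
  using assms unfolding piecewise_def by (simp add: Ck_scaleR)

lemma piecewise_mult:
  fixes u w :: "real \<times> real \<Rightarrow> real"
  assumes "piecewise a c u F" "piecewise a c w G"
  shows "piecewise a c (\<lambda>p. u p * w p) (\<lambda>j p. F j p * G j p)"
  using assms unfolding piecewise_def by (simp add: Ck_mult)

lemma piecewise_L2:
  assumes "piecewise a c u F"
  shows "u \<in> L2 (box (a, x 0) (c, x N))" "glue (\<lambda>j. pd d (F j)) \<in> L2 (box (a, x 0) (c, x N))"
proof -
  show "u \<in> L2 (box (a, x 0) (c, x N))"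
    by (rule slab_L2[OF Ck_continuous[OF piecewise_Ck[OF assms]] piecewise_box[OF assms]])
  show "glue (\<lambda>j. pd d (F j)) \<in> L2 (box (a, x 0) (c, x N))"
    by (rule slab_L2[where F="\<lambda>j. pd d (F j)"]) (erule Ck_pd[OF piecewise_Ck[OF assms]], rule glue_eq)
qed

text \<open>The jump terms at interior nodes cancel because the pieces agree there, and the terms on the outer
  boundary vanish because the test function does.\<close>

lemma piecewise_weak_derivative:
  fixes u :: "real \<times> real \<Rightarrow> 'b::euclidean_space"
  assumes pw: "piecewise a c u F" and ac: "a < c" and d: "d = (1, 0) \<or> d = (0, 1)"
  shows "weak_derivative (box (a, x 0) (c, x N)) d u (glue (\<lambda>j. pd d (F j)))"
  unfolding weak_derivative_def
proof
  let ?G = "box (a, x 0) (c, x N)"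
  fix \<phi> :: "real \<times> real \<Rightarrow> real" assume \<phi>: "\<phi> \<in> test_functions ?G"
  have C\<phi>: "Ck 1 \<phi>" by (rule test_function_Ck[OF \<phi>])
  have out: "\<phi> p = 0" if "p \<notin> ?G" for p by (rule test_function_zero[OF \<phi> that])
  note pw' = piecewise_scaleR[OF C\<phi> pw]
  have zero: "(LINT p|lebesgue_on ?G. glue (\<lambda>j. pd d (\<lambda>p. \<phi> p *\<^sub>R F j p)) p) = 0"
    using d piecewise_Green_t[OF pw'] piecewise_Green_x[OF pw' ac] ac
    by (auto simp: out box_Pair)
  have L: "\<phi> \<in> L2 ?G" "pd d \<phi> \<in> L2 ?G"
    using test_function_L2[OF \<phi>] test_function_L2[OF test_function_derivative[OF \<phi>]] by auto
  note int = L2_scaleR_integrable[OF L(1) piecewise_L2(2)[OF pw, of d]] L2_scaleR_integrable[OF L(2) piecewise_L2(1)[OF pw]]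
  have "(LINT p|lebesgue_on ?G. \<phi> p *\<^sub>R glue (\<lambda>j. pd d (F j)) p) + (LINT p|lebesgue_on ?G. pd d \<phi> p *\<^sub>R u p)
     = (LINT p|lebesgue_on ?G. \<phi> p *\<^sub>R glue (\<lambda>j. pd d (F j)) p + pd d \<phi> p *\<^sub>R u p)"
    using int by simp
  also have "\<dots> = (\<Sum>j=1..N. integral (cbox (a, x (j - 1)) (c, x j)) (\<lambda>p. \<phi> p *\<^sub>R pd d (F j) p + pd d \<phi> p *\<^sub>R F j p))"
  proof (rule slab_integral(2))
    show "continuous_on UNIV (\<lambda>p. \<phi> p *\<^sub>R pd d (F j) p + pd d \<phi> p *\<^sub>R F j p)" if "j \<in> {1..N}" for j
      by (intro continuous_intros Ck_pd C\<phi> Ck_continuous[OF C\<phi>] Ck_continuous[OF piecewise_Ck[OF pw that]] piecewise_Ck[OF pw that])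
    show "\<phi> p *\<^sub>R glue (\<lambda>j. pd d (F j)) p + pd d \<phi> p *\<^sub>R u p = \<phi> p *\<^sub>R pd d (F j) p + pd d \<phi> p *\<^sub>R F j p"
      if "j \<in> {1..N}" "p \<in> box (a, x (j - 1)) (c, x j)" for j p
      by (simp only: glue_eq[OF that] piecewise_box[OF pw that])
  qed
  also have "\<dots> = (LINT p|lebesgue_on ?G. glue (\<lambda>j. pd d (\<lambda>p. \<phi> p *\<^sub>R F j p)) p)"
  proof (rule slab_integral(2)[symmetric])
    show "continuous_on UNIV (\<lambda>p. \<phi> p *\<^sub>R pd d (F j) p + pd d \<phi> p *\<^sub>R F j p)" if "j \<in> {1..N}" for j
      by (intro continuous_intros Ck_pd C\<phi> Ck_continuous[OF C\<phi>] Ck_continuous[OF piecewise_Ck[OF pw that]] piecewise_Ck[OF pw that])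
    show "glue (\<lambda>j. pd d (\<lambda>p. \<phi> p *\<^sub>R F j p)) p = \<phi> p *\<^sub>R pd d (F j) p + pd d \<phi> p *\<^sub>R F j p"
      if "j \<in> {1..N}" "p \<in> box (a, x (j - 1)) (c, x j)" for j p
      by (simp only: glue_eq[OF that] pd_scaleR[OF C\<phi> piecewise_Ck[OF pw that(1)]])
  qed
  finally show "(LINT p|lebesgue_on ?G. pd d \<phi> p *\<^sub>R u p) = - (LINT p|lebesgue_on ?G. \<phi> p *\<^sub>R glue (\<lambda>j. pd d (F j)) p)"
    using zero by (simp add: add_eq_0_iff add.commute)
qed

lemma piecewise_wderiv:
  assumes "piecewise a c u F" "a < c" "d = (1, 0) \<or> d = (0, 1)"
  shows "AE p in lebesgue_on (box (a, x 0) (c, x N)). wderiv (box (a, x 0) (c, x N)) d u p = glue (\<lambda>j. pd d (F j)) p"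
    "wderiv (box (a, x 0) (c, x N)) d u \<in> L2 (box (a, x 0) (c, x N))"
  using wderiv_AE[OF piecewise_weak_derivative[OF assms] piecewise_L2(2)[OF assms(1)]] by auto

lemma piecewise_H1:
  assumes "piecewise a c u F" "a < c"
  shows "u \<in> H1 (box (a, x 0) (c, x N))"
proof -
  have "\<exists>w \<in> L2 (box (a, x 0) (c, x N)). weak_derivative (box (a, x 0) (c, x N)) d u w" if "d \<in> Basis" for d
  proof -
    have "d = (1, 0) \<or> d = (0, 1)" using that by (auto simp: Basis_prod_def)
    then show ?thesis using piecewise_weak_derivative[OF assms] piecewise_L2(2)[OF assms(1)] by blast
  qed
  then show ?thesis unfolding H1_def using piecewise_L2(1)[OF assms(1)] by blast
qed

end

section \<open>Inverse estimates for polynomials\<close>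

lemma integral_affine:
  fixes f :: "real \<Rightarrow> real"
  assumes f: "continuous_on UNIV f" and h: "0 < h"
  shows "integral {\<alpha>..\<alpha> + h} (\<lambda>s. f ((s - \<alpha>) / h)) = h * integral {0..1} f"
proof -
  have "(f has_integral integral {0..1} f) (cbox 0 1)"
    using f by (auto intro!: integrable_integral integrable_continuous_real continuous_on_subset[OF f])
  from has_integral_affinity'[OF this, of "1 / h" "- \<alpha> / h"] h
  have "((\<lambda>s. f (s / h + - \<alpha> / h)) has_integral h * integral {0..1} f) {\<alpha>..(1 + \<alpha> / h) * h}"
    by (simp add: mult.commute)
  moreover have "(1 + \<alpha> / h) * h = \<alpha> + h" using h by (simp add: field_simps)
  moreover have "s / h + - \<alpha> / h = (s - \<alpha>) / h" for s by (simp add: diff_divide_distrib)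
  ultimately show ?thesis by (simp only: integral_unique)
qed

lemma continuous_square_integrable: "continuous_on UNIV f \<Longrightarrow> (\<lambda>s. (f s)\<^sup>2) integrable_on {a..b}" for f :: "real \<Rightarrow> real"
  by (intro integrable_continuous_real continuous_intros) (auto intro: continuous_on_subset)

lemma integral_square_add_le:
  fixes f g :: "real \<Rightarrow> real"
  assumes "continuous_on UNIV f" "continuous_on UNIV g"
  shows "integral {a..b} (\<lambda>s. (f s + g s)\<^sup>2) \<le> 2 * integral {a..b} (\<lambda>s. (f s)\<^sup>2) + 2 * integral {a..b} (\<lambda>s. (g s)\<^sup>2)"
proof -
  note int = continuous_square_integrable[OF assms(1), of a b] continuous_square_integrable[OF assms(2), of a b]
  have "integral {a..b} (\<lambda>s. (f s + g s)\<^sup>2) \<le> integral {a..b} (\<lambda>s. 2 * (f s)\<^sup>2 + 2 * (g s)\<^sup>2)"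
  proof (rule integral_le)
    show "(\<lambda>s. (f s + g s)\<^sup>2) integrable_on {a..b}"
      using assms by (intro continuous_square_integrable continuous_intros)
    show "(f s + g s)\<^sup>2 \<le> 2 * (f s)\<^sup>2 + 2 * (g s)\<^sup>2" for s
      using sum_squares_bound[of "f s" "g s"] by (simp add: power2_sum)
  qed (use int in \<open>auto intro!: integrable_add integrable_on_cmult_left\<close>)
  also have "\<dots> = 2 * integral {a..b} (\<lambda>s. (f s)\<^sup>2) + 2 * integral {a..b} (\<lambda>s. (g s)\<^sup>2)"
    using int by (simp add: Henstock_Kurzweil_Integration.integral_add integrable_on_cmult_left)
  finally show ?thesis .
qed

text \<open>An induction that lowers the degree by a difference: \<open>P ((z + 1) / 2) - P (z / 2)\<close> has degree
  one less, its leading coefficient is a fixed multiple of that of \<open>P\<close>, and its square integral over the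
  unit interval is bounded by that of \<open>P\<close>.\<close>

lemma leading_coefficient_bound:
  "\<exists>C>0. \<forall>c::nat \<Rightarrow> real. (c k)\<^sup>2 \<le> C * integral {0..1} (\<lambda>z. (\<Sum>a\<le>k. c a * z ^ a)\<^sup>2)"
proof (induction k)
  case 0
  show ?case by (auto intro!: exI[of _ 1])
next
  case (Suc k)
  then obtain C where C: "0 < C" "\<And>c::nat \<Rightarrow> real. (c k)\<^sup>2 \<le> C * integral {0..1} (\<lambda>z. (\<Sum>a\<le>k. c a * z ^ a)\<^sup>2)" by blast
  define B where "B = (2 ^ Suc k / real (Suc k))\<^sup>2 * C * 4"
  have "0 < B" using C(1) by (simp add: B_def)
  moreover have "(c (Suc k))\<^sup>2 \<le> B * integral {0..1} (\<lambda>z. (\<Sum>a\<le>Suc k. c a * z ^ a)\<^sup>2)" for c :: "nat \<Rightarrow> real"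
  proof -
  (* The difference has leading coefficient (k + 1) c (k + 1) / 2 ^ (k + 1), whence the constant B. *)
    define P where "P z = (\<Sum>a\<le>Suc k. c a * z ^ a)" for z
    define d where "d i = (\<Sum>a\<le>Suc k. if i < a then c a / 2 ^ a * real (a choose i) else 0)" for i
    have P: "continuous_on UNIV P" unfolding P_def by (intro continuous_intros)
    have diff: "P ((z + 1) / 2) - P (z / 2) = (\<Sum>i\<le>k. d i * z ^ i)" for z
    proof -
      have one: "c a * ((z + 1) / 2) ^ a - c a * (z / 2) ^ a
          = (\<Sum>i\<le>k. if i < a then c a / 2 ^ a * real (a choose i) * z ^ i else 0)" if "a \<le> Suc k" for a
      proof -
        have "(z + 1) ^ a = (\<Sum>i\<le>a. real (a choose i) * z ^ i)"
          using binomial_ring[of z 1 a] by simp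
        also have "\<dots> = (\<Sum>i<a. real (a choose i) * z ^ i) + z ^ a"
          by (simp flip: lessThan_Suc_atMost)
        finally have "c a * ((z + 1) / 2) ^ a - c a * (z / 2) ^ a = c a / 2 ^ a * (\<Sum>i<a. real (a choose i) * z ^ i)"
          by (simp add: power_divide field_simps)
        also have "\<dots> = (\<Sum>i\<in>{i. i \<le> k \<and> i < a}. c a / 2 ^ a * real (a choose i) * z ^ i)"
          using that by (auto simp: sum_distrib_left mult_ac intro!: sum.cong)
        also have "\<dots> = (\<Sum>i\<le>k. if i < a then c a / 2 ^ a * real (a choose i) * z ^ i else 0)"
          by (intro sum.mono_neutral_cong_left) auto
        finally show ?thesis .
      qed
      have "P ((z + 1) / 2) - P (z / 2) = (\<Sum>a\<le>Suc k. c a * ((z + 1) / 2) ^ a - c a * (z / 2) ^ a)"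
        by (simp add: P_def sum_subtractf del: sum.atMost_Suc)
      also have "\<dots> = (\<Sum>a\<le>Suc k. \<Sum>i\<le>k. if i < a then c a / 2 ^ a * real (a choose i) * z ^ i else 0)"
        by (intro sum.cong one) auto
      also have "\<dots> = (\<Sum>i\<le>k. \<Sum>a\<le>Suc k. if i < a then c a / 2 ^ a * real (a choose i) * z ^ i else 0)"
        by (rule sum.swap)
      also have "\<dots> = (\<Sum>i\<le>k. d i * z ^ i)"
        unfolding d_def sum_distrib_right by (intro sum.cong refl) auto
      finally show ?thesis .
    qed
    have dk: "d k = c (Suc k) * real (Suc k) / 2 ^ Suc k"
    proof -
      have "d k = (\<Sum>a\<le>Suc k. if a = Suc k then c a / 2 ^ a * real (a choose k) else 0)"
        unfolding d_def by (intro sum.cong) auto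
      then show ?thesis by (simp del: sum.atMost_Suc)
    qed
    have h1: "integral {0..1/2} (\<lambda>s. (P s)\<^sup>2) = 1/2 * integral {0..1} (\<lambda>z. (P (z / 2))\<^sup>2)"
    proof -
      have "continuous_on UNIV (\<lambda>z. (P (z / 2))\<^sup>2)"
        by (intro continuous_intros continuous_on_compose2[OF P]) auto
      from integral_affine[OF this, of "1/2" 0] show ?thesis by simp
    qed
    have h2: "integral {1/2..1} (\<lambda>s. (P s)\<^sup>2) = 1/2 * integral {0..1} (\<lambda>z. (P ((z + 1) / 2))\<^sup>2)"
    proof -
      have "((s - 1/2) / (1/2) + 1) / 2 = s" for s :: real by (simp add: field_simps)
      moreover have "continuous_on UNIV (\<lambda>z. (P ((z + 1) / 2))\<^sup>2)"
        by (intro continuous_intros continuous_on_compose2[OF P]) auto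
      from integral_affine[OF this, of "1/2" "1/2"]
      have "integral {1/2..1} (\<lambda>s. (P (((s - 1/2) / (1/2) + 1) / 2))\<^sup>2) = 1/2 * integral {0..1} (\<lambda>z. (P ((z + 1) / 2))\<^sup>2)"
        by simp
      ultimately show ?thesis by (simp only:)
    qed
    have h3: "integral {0..1/2} (\<lambda>s. (P s)\<^sup>2) + integral {1/2..1} (\<lambda>s. (P s)\<^sup>2) = integral {0..1} (\<lambda>s. (P s)\<^sup>2)"
      by (intro Henstock_Kurzweil_Integration.integral_combine continuous_square_integrable P) auto
    have "integral {0..1} (\<lambda>z. (P ((z + 1) / 2) + - P (z / 2))\<^sup>2)
       \<le> 2 * integral {0..1} (\<lambda>z. (P ((z + 1) / 2))\<^sup>2) + 2 * integral {0..1} (\<lambda>z. (- P (z / 2))\<^sup>2)"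
      by (intro integral_square_add_le) (auto intro!: continuous_intros continuous_on_compose2[OF P])
    also have "\<dots> = 4 * integral {0..1} (\<lambda>s. (P s)\<^sup>2)" using h1 h2 h3 by simp
    finally have q: "integral {0..1} (\<lambda>z. (\<Sum>i\<le>k. d i * z ^ i)\<^sup>2) \<le> 4 * integral {0..1} (\<lambda>s. (P s)\<^sup>2)"
      by (simp add: diff)
    have "(c (Suc k))\<^sup>2 = (2 ^ Suc k / real (Suc k))\<^sup>2 * (d k)\<^sup>2"
    proof -
      have "(2 ^ Suc k / real (Suc k)) * d k = c (Suc k)" unfolding dk by (simp del: power_Suc of_nat_Suc)
      then show ?thesis by (simp only: power_mult_distrib[symmetric])
    qed
    also have "\<dots> \<le> (2 ^ Suc k / real (Suc k))\<^sup>2 * (C * (4 * integral {0..1} (\<lambda>s. (P s)\<^sup>2)))"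
      using order_trans[OF C(2)[of d] mult_left_mono[OF q]] C(1) by (intro mult_left_mono) auto
    finally show ?thesis by (simp add: B_def P_def mult_ac)
  qed
  ultimately show ?case by blast
qed

text \<open>Subtracting the leading term, which is already controlled, reduces the degree.\<close>

lemma coefficient_bound:
  "\<exists>C>0. \<forall>c::nat \<Rightarrow> real. \<forall>i\<le>k. (c i)\<^sup>2 \<le> C * integral {0..1} (\<lambda>z. (\<Sum>a\<le>k. c a * z ^ a)\<^sup>2)"
proof (induction k)
  case 0
  show ?case by (auto intro!: exI[of _ 1])
next
  case (Suc k)
  then obtain C where C: "0 < C" "\<And>c::nat \<Rightarrow> real. \<And>i. i \<le> k \<Longrightarrow> (c i)\<^sup>2 \<le> C * integral {0..1} (\<lambda>z. (\<Sum>a\<le>k. c a * z ^ a)\<^sup>2)" by blast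
  obtain D where D: "0 < D" "\<And>c::nat \<Rightarrow> real. (c (Suc k))\<^sup>2 \<le> D * integral {0..1} (\<lambda>z. (\<Sum>a\<le>Suc k. c a * z ^ a)\<^sup>2)"
    using leading_coefficient_bound[of "Suc k"] by blast
  define B where "B = D + C * (2 + 2 * D)"
  have "0 < B" using C(1) D(1) by (simp add: B_def add_pos_pos)
  moreover have "(c i)\<^sup>2 \<le> B * integral {0..1} (\<lambda>z. (\<Sum>a\<le>Suc k. c a * z ^ a)\<^sup>2)" if i: "i \<le> Suc k" for c :: "nat \<Rightarrow> real" and i
  proof -
    let ?I = "integral {0..1} (\<lambda>z. (\<Sum>a\<le>Suc k. c a * z ^ a)\<^sup>2)"
    have I0: "0 \<le> ?I" by (intro integral_nonneg continuous_square_integrable continuous_intros) auto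
    have top: "(c (Suc k))\<^sup>2 \<le> D * ?I" by (rule D(2))
    show ?thesis
    proof (cases "i = Suc k")
      case True
      have "0 \<le> C * (2 + 2 * D) * ?I" using C(1) D(1) I0 by simp
      then show ?thesis using top True by (simp add: B_def algebra_simps)
    next
      case False
      have le1: "integral {0..1} (\<lambda>z. (c (Suc k) * z ^ Suc k)\<^sup>2) \<le> (c (Suc k))\<^sup>2"
      proof -
        have "integral {0..1} (\<lambda>z. (c (Suc k) * z ^ Suc k)\<^sup>2) \<le> integral {0..1} (\<lambda>z::real. (c (Suc k))\<^sup>2)"
        proof (rule integral_le)
          fix z :: real assume "z \<in> {0..1}"
          then have "(z ^ Suc k)\<^sup>2 \<le> 1" by (intro power_le_one) (auto intro: power_le_one mult_le_one)
          then show "(c (Suc k) * z ^ Suc k)\<^sup>2 \<le> (c (Suc k))\<^sup>2"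
            by (simp add: power_mult_distrib mult_left_le)
        qed (auto intro!: continuous_square_integrable continuous_intros)
        then show ?thesis by simp
      qed
      have "integral {0..1} (\<lambda>z. (\<Sum>a\<le>k. c a * z ^ a)\<^sup>2) = integral {0..1} (\<lambda>z. ((\<Sum>a\<le>Suc k. c a * z ^ a) + - (c (Suc k) * z ^ Suc k))\<^sup>2)"
        by simp
      also have "\<dots> \<le> 2 * ?I + 2 * integral {0..1} (\<lambda>z. (- (c (Suc k) * z ^ Suc k))\<^sup>2)"
        by (intro integral_square_add_le continuous_intros)
      also have "\<dots> \<le> 2 * ?I + 2 * (D * ?I)"
        using le1 top by simp
      finally have q: "integral {0..1} (\<lambda>z. (\<Sum>a\<le>k. c a * z ^ a)\<^sup>2) \<le> (2 + 2 * D) * ?I" by (simp add: algebra_simps)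
      have "(c i)\<^sup>2 \<le> C * integral {0..1} (\<lambda>z. (\<Sum>a\<le>k. c a * z ^ a)\<^sup>2)"
        using C(2)[of i c] i False by simp
      also have "\<dots> \<le> C * ((2 + 2 * D) * ?I)" using q C(1) by (intro mult_left_mono) auto
      also have "\<dots> \<le> B * ?I" using D(1) I0 by (simp add: B_def algebra_simps)
      finally show ?thesis .
    qed
  qed
  ultimately show ?case by blast
qed

definition tensor :: "nat \<Rightarrow> (nat \<Rightarrow> nat \<Rightarrow> real) \<Rightarrow> real \<Rightarrow> real \<Rightarrow> real" where
  "tensor k c z w = (\<Sum>a\<le>k. \<Sum>b\<le>k. c a b * z ^ a * w ^ b)"

lemma tensor_affine: "\<exists>c'. \<forall>z w. tensor k c (p + q * z) (p' + q' * w) = tensor k c' z w"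
proof -
  define e where "e p q a i = (if i \<le> a then real (a choose i) * q ^ i * p ^ (a - i) else 0)" for p q :: real and a i :: nat
  have e: "(p + q * z) ^ a = (\<Sum>i\<le>k. e p q a i * z ^ i)" if "a \<le> k" for p q z a
  proof -
    have "(p + q * z) ^ a = (\<Sum>i\<le>a. real (a choose i) * (q * z) ^ i * p ^ (a - i))"
      using binomial_ring[of "q * z" p a] by (simp add: add.commute)
    also have "\<dots> = (\<Sum>i\<in>{i. i \<le> k \<and> i \<le> a}. real (a choose i) * q ^ i * p ^ (a - i) * z ^ i)"
      using that by (intro sum.cong) (auto simp: power_mult_distrib)
    also have "\<dots> = (\<Sum>i\<le>k. e p q a i * z ^ i)"
      unfolding e_def by (intro sum.mono_neutral_cong_left) auto
    finally show ?thesis .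
  qed
  define c' where "c' i j = (\<Sum>a\<le>k. \<Sum>b\<le>k. c a b * e p q a i * e p' q' b j)" for i j
  have "tensor k c (p + q * z) (p' + q' * w) = tensor k c' z w" for z w
  proof -
    have "tensor k c (p + q * z) (p' + q' * w)
      = (\<Sum>a\<le>k. \<Sum>b\<le>k. c a b * (\<Sum>i\<le>k. e p q a i * z ^ i) * (\<Sum>j\<le>k. e p' q' b j * w ^ j))"
      unfolding tensor_def by (intro sum.cong) (simp_all add: e)
    also have "\<dots> = (\<Sum>a\<le>k. \<Sum>b\<le>k. \<Sum>i\<le>k. \<Sum>j\<le>k. c a b * e p q a i * e p' q' b j * z ^ i * w ^ j)"
    proof (intro sum.cong refl)
      fix a b
      have "c a b * (\<Sum>i\<le>k. e p q a i * z ^ i) * (\<Sum>j\<le>k. e p' q' b j * w ^ j)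
        = (\<Sum>i\<le>k. \<Sum>j\<le>k. c a b * ((e p q a i * z ^ i) * (e p' q' b j * w ^ j)))"
        by (subst mult.assoc, subst sum_product) (simp only: sum_distrib_left)
      also have "\<dots> = (\<Sum>i\<le>k. \<Sum>j\<le>k. c a b * e p q a i * e p' q' b j * z ^ i * w ^ j)"
        by (simp add: mult_ac)
      finally show "c a b * (\<Sum>i\<le>k. e p q a i * z ^ i) * (\<Sum>j\<le>k. e p' q' b j * w ^ j)
        = (\<Sum>i\<le>k. \<Sum>j\<le>k. c a b * e p q a i * e p' q' b j * z ^ i * w ^ j)" .
    qed
    also have "\<dots> = (\<Sum>a\<le>k. \<Sum>i\<le>k. \<Sum>b\<le>k. \<Sum>j\<le>k. c a b * e p q a i * e p' q' b j * z ^ i * w ^ j)"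
      by (rule sum.cong[OF refl], rule sum.swap)
    also have "\<dots> = (\<Sum>i\<le>k. \<Sum>a\<le>k. \<Sum>b\<le>k. \<Sum>j\<le>k. c a b * e p q a i * e p' q' b j * z ^ i * w ^ j)"
      by (rule sum.swap)
    also have "\<dots> = (\<Sum>i\<le>k. \<Sum>a\<le>k. \<Sum>j\<le>k. \<Sum>b\<le>k. c a b * e p q a i * e p' q' b j * z ^ i * w ^ j)"
      by (rule sum.cong[OF refl], rule sum.cong[OF refl], rule sum.swap)
    also have "\<dots> = (\<Sum>i\<le>k. \<Sum>j\<le>k. \<Sum>a\<le>k. \<Sum>b\<le>k. c a b * e p q a i * e p' q' b j * z ^ i * w ^ j)"
      by (rule sum.cong[OF refl], rule sum.swap)
    also have "\<dots> = tensor k c' z w"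
      unfolding tensor_def c'_def by (simp add: sum_distrib_left sum_distrib_right)
    finally show ?thesis .
  qed
  then show ?thesis by blast
qed

lemma continuous_on_tensor:
  "continuous_on S f \<Longrightarrow> continuous_on S g \<Longrightarrow> continuous_on S (\<lambda>p. tensor k c (f p) (g p))"
  unfolding tensor_def by (intro continuous_intros)

lemma Ck_tensor: "Ck n (\<lambda>p::real\<times>real. tensor k c ((fst p - \<alpha>) / h) ((snd p - \<beta>) / l))"
proof -
  have "Ck n (\<lambda>p::real\<times>real. (fst p - \<alpha>) / h)" "Ck n (\<lambda>p::real\<times>real. (snd p - \<beta>) / l)"
    using Ck_mult[OF Ck_diff[OF Ck_fst Ck_const[of _ \<alpha>]] Ck_const[of _ "1 / h"], of n]
      Ck_mult[OF Ck_diff[OF Ck_snd Ck_const[of _ \<beta>]] Ck_const[of _ "1 / l"], of n] by simp_all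
  then show ?thesis unfolding tensor_def by (intro Ck_sum Ck_mult Ck_const Ck_power)
qed

text \<open>The one-dimensional coefficient bound is applied in each variable on the unit square and transported by
  the affine map; the factor \<open>h * l\<close> is its Jacobian.\<close>

lemma tensor_inverse_estimate:
  "\<exists>C>0. \<forall>c \<alpha> \<beta> h l. 0 < h \<longrightarrow> 0 < l \<longrightarrow> (\<forall>i\<le>k. \<forall>j\<le>k. (c i j)\<^sup>2 * (h * l)
     \<le> C * integral (cbox (\<alpha>, \<beta>) (\<alpha> + h, \<beta> + l)) (\<lambda>p. (tensor k c ((fst p - \<alpha>) / h) ((snd p - \<beta>) / l))\<^sup>2))"
proof -
  obtain C where C: "0 < C" "\<And>c::nat \<Rightarrow> real. \<And>i. i \<le> k \<Longrightarrow> (c i)\<^sup>2 \<le> C * integral {0..1} (\<lambda>z. (\<Sum>a\<le>k. c a * z ^ a)\<^sup>2)"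
    using coefficient_bound by blast
  have scaled: "(c i)\<^sup>2 * h \<le> C * integral {\<alpha>..\<alpha> + h} (\<lambda>s. (\<Sum>a\<le>k. c a * ((s - \<alpha>) / h) ^ a)\<^sup>2)"
    if "i \<le> k" "0 < h" for c :: "nat \<Rightarrow> real" and i h \<alpha>
  proof -
    have "h * integral {0..1} (\<lambda>z. (\<Sum>a\<le>k. c a * z ^ a)\<^sup>2) = integral {\<alpha>..\<alpha> + h} (\<lambda>s. (\<Sum>a\<le>k. c a * ((s - \<alpha>) / h) ^ a)\<^sup>2)"
      by (rule integral_affine[symmetric]) (use that in \<open>auto intro!: continuous_intros\<close>)
    then show ?thesis using mult_left_mono[OF C(2)[OF that(1), of c], of h] that by (simp add: mult_ac)
  qed
  have "(c i j)\<^sup>2 * (h * l) \<le> C\<^sup>2 * integral (cbox (\<alpha>, \<beta>) (\<alpha> + h, \<beta> + l)) (\<lambda>p. (tensor k c ((fst p - \<alpha>) / h) ((snd p - \<beta>) / l))\<^sup>2)"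
    if hl: "0 < h" "0 < l" and ij: "i \<le> k" "j \<le> k" for c \<alpha> \<beta> h l i j
  proof -
    let ?U = "\<lambda>p. tensor k c ((fst p - \<alpha>) / h) ((snd p - \<beta>) / l)"
    let ?g = "\<lambda>j s. \<Sum>a\<le>k. c a j * ((s - \<alpha>) / h) ^ a"
    have contU: "continuous_on S (\<lambda>p. (?U p)\<^sup>2)" for S
      by (intro continuous_intros Ck_continuous[OF Ck_tensor])
    have inner: "(?g j s)\<^sup>2 * l \<le> C * integral {\<beta>..\<beta> + l} (\<lambda>y. (?U (s, y))\<^sup>2)" for s
    proof -
      have "(\<Sum>b\<le>k. ?g b s * ((y - \<beta>) / l) ^ b) = ?U (s, y)" for y
        unfolding tensor_def sum_distrib_right by (subst sum.swap) simp
      then show ?thesis using scaled[OF ij(2) hl(2), of "\<lambda>b. ?g b s" \<beta>] by simp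
    qed
    have "(c i j)\<^sup>2 * (h * l) = (c i j)\<^sup>2 * h * l" by simp
    also have "\<dots> \<le> C * integral {\<alpha>..\<alpha> + h} (\<lambda>s. (?g j s)\<^sup>2) * l"
      using scaled[OF ij(1) hl(1), of "\<lambda>a. c a j" \<alpha>] hl by (intro mult_right_mono) auto
    also have "\<dots> = C * integral {\<alpha>..\<alpha> + h} (\<lambda>s. (?g j s)\<^sup>2 * l)"
      by simp
    also have "\<dots> \<le> C * integral {\<alpha>..\<alpha> + h} (\<lambda>s. C * integral {\<beta>..\<beta> + l} (\<lambda>y. (?U (s, y))\<^sup>2))"
    proof (intro mult_left_mono integral_le inner)
      show "(\<lambda>s. (?g j s)\<^sup>2 * l) integrable_on {\<alpha>..\<alpha> + h}"
        using hl by (intro integrable_continuous_real continuous_intros) auto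
      have "continuous_on UNIV (\<lambda>s. integral (cbox \<beta> (\<beta> + l)) (\<lambda>y. (?U (s, y))\<^sup>2))"
        by (rule integral_continuous_on_param)
          (auto simp: case_prod_unfold intro!: continuous_intros continuous_on_tensor; use hl in simp)
      then show "(\<lambda>s. C * integral {\<beta>..\<beta> + l} (\<lambda>y. (?U (s, y))\<^sup>2)) integrable_on {\<alpha>..\<alpha> + h}"
        by (intro integrable_continuous_real continuous_intros) (auto intro: continuous_on_subset)
    qed (use C(1) in auto)
    also have "\<dots> = C\<^sup>2 * integral (cbox (\<alpha>, \<beta>) (\<alpha> + h, \<beta> + l)) (\<lambda>p. (?U p)\<^sup>2)"
      by (subst rectangle_Fubini(1)[OF contU]) (simp add: power2_eq_square)
    finally show ?thesis .
  qed
  then show ?thesis using C(1) by (intro exI[of _ "C\<^sup>2"]) auto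
qed

section \<open>The dual problem\<close>

lemma integral_square_le:
  fixes f :: "real \<Rightarrow> real"
  assumes "continuous_on UNIV f" "0 \<le> L"
  shows "(integral {a..a + L} f)\<^sup>2 \<le> L * integral {a..a + L} (\<lambda>s. (f s)\<^sup>2)"
proof (cases "L = 0")
  case False
  let ?I = "integral {a..a + L} f" and ?J = "integral {a..a + L} (\<lambda>s. (f s)\<^sup>2)"
  have f: "f integrable_on {a..a + L}"
    by (intro integrable_continuous_real continuous_on_subset[OF assms(1)]) auto
  note f2 = continuous_square_integrable[OF assms(1), of a "a + L"]
  have "0 \<le> integral {a..a + L} (\<lambda>s. (L * f s - ?I)\<^sup>2)"
    by (intro integral_nonneg continuous_square_integrable continuous_intros assms) auto
  also have "\<dots> = integral {a..a + L} (\<lambda>s. L\<^sup>2 * (f s)\<^sup>2 + (?I\<^sup>2 - 2 * L * ?I * f s))"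
    by (simp add: power2_diff power_mult_distrib algebra_simps)
  also have "\<dots> = L\<^sup>2 * ?J + (L * ?I\<^sup>2 - 2 * L * ?I * ?I)"
  proof -
    have i1: "(\<lambda>s. L\<^sup>2 * (f s)\<^sup>2) integrable_on {a..a + L}" using integrable_cmul[OF f2, of "L\<^sup>2"] by simp
    have i2: "(\<lambda>s. 2 * L * ?I * f s) integrable_on {a..a + L}" using integrable_cmul[OF f, of "2 * L * ?I"] by simp
    have i3: "(\<lambda>s. ?I\<^sup>2 - 2 * L * ?I * f s) integrable_on {a..a + L}"
      by (intro integrable_diff i2 integrable_const_ivl)
    show ?thesis
      using assms(2) Henstock_Kurzweil_Integration.integral_add[OF i1 i3] Henstock_Kurzweil_Integration.integral_diff[OF integrable_const_ivl i2, of "?I\<^sup>2"]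
      by simp
  qed
  finally have "0 \<le> L * (L * ?J - ?I\<^sup>2)" by (simp add: power2_eq_square algebra_simps)
  then show ?thesis using False assms(2) by (simp add: zero_le_mult_iff)
qed simp

lemma integral_le_support:
  fixes g :: "real \<Rightarrow> real"
  assumes "continuous_on UNIV g" "\<And>z. 0 \<le> g z" "\<And>z. z \<notin> {a..b} \<Longrightarrow> g z = 0"
  shows "integral {u..v} g \<le> integral {a..b} g"
proof -
  have int: "g integrable_on {c..d}" for c d
    by (intro integrable_continuous_real continuous_on_subset[OF assms(1)]) auto
  have "integral {u..v} g \<le> integral {min u a..max v b} g"
    by (intro integral_subset_le int) (auto simp: assms)
  also have "\<dots> = integral {a..b} g"
    using has_integral_on_superset[OF integrable_integral[OF int, of a b] assms(3), of "{min u a..max v b}"]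
    by (auto intro!: integral_unique)
  finally show ?thesis .
qed

text \<open>The solution, by the method of characteristics, of \<open>\<phi>\<^sub>t + \<sigma> \<phi>\<^sub>x = -
  \<omega>\<close> on \<open>[0, T]\<close> with zero final value, when \<open>\<omega>\<close> vanishes after time
  \<open>T\<close>. The interval of integration has fixed length so that the formula is smooth in \<open>p\<close>
  everywhere.\<close>

definition dual :: "real \<Rightarrow> real \<Rightarrow> (real \<times> real \<Rightarrow> real) \<Rightarrow> real \<times> real \<Rightarrow> real" where
  "dual \<sigma> T \<omega> p = integral {0..T} (\<lambda>r. \<omega> (p + r *\<^sub>R (1, \<sigma>)))"

lemma Ck_dual: "Ck n \<omega> \<Longrightarrow> Ck n (dual \<sigma> T \<omega>)"
  unfolding dual_def[abs_def] by (rule Ck_average_along_line(1))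

lemma pd_dual: "Ck 1 \<omega> \<Longrightarrow> pd d (dual \<sigma> T \<omega>) p = dual \<sigma> T (pd d \<omega>) p"
  using Ck_average_along_line(2)[of 0 \<omega> T "(1, \<sigma>)" p] unfolding dual_def[abs_def] One_nat_def
  by (rule pd_eqI)

lemma dual_equation:
  assumes "Ck 1 \<omega>" "0 \<le> T" "\<And>s y. T \<le> s \<Longrightarrow> \<omega> (s, y) = 0" "0 \<le> s"
  shows "pd (1, 0) (dual \<sigma> T \<omega>) (s, y) + \<sigma> * pd (0, 1) (dual \<sigma> T \<omega>) (s, y) = - \<omega> (s, y)"
proof -
  let ?F = "\<lambda>r. \<omega> ((s, y) + r *\<^sub>R (1, \<sigma>))"
  have dir: "(1, \<sigma>) = \<sigma> *\<^sub>R (0, 1) + (1::real, 0::real)" by simp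
  have "pd (1, 0) (dual \<sigma> T \<omega>) (s, y) + \<sigma> * pd (0, 1) (dual \<sigma> T \<omega>) (s, y) = pd (1, \<sigma>) (dual \<sigma> T \<omega>) (s, y)"
    unfolding dir by (subst pd_linear_direction[OF Ck_dual[OF assms(1)]]) simp
  also have "\<dots> = integral {0..T} (\<lambda>r. pd (1, \<sigma>) \<omega> ((s, y) + r *\<^sub>R (1, \<sigma>)))"
    by (simp add: pd_dual[OF assms(1)] dual_def)
  also have "\<dots> = ?F T - ?F 0"
    by (intro integral_unique fundamental_theorem_of_calculus[OF assms(2)] has_vector_derivative_along[OF assms(1)])
  also have "\<dots> = - \<omega> (s, y)" using assms(3)[of "s + T" "y + T * \<sigma>"] assms(4) by simp
  finally show ?thesis .
qed

lemma dual_zero: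
  assumes "\<And>r. 0 \<le> r \<Longrightarrow> r \<le> T \<Longrightarrow> \<omega> (s + r, y + r * \<sigma>) = 0"
  shows "dual \<sigma> T \<omega> (s, y) = 0"
  unfolding dual_def using assms
  by (intro integral_unique has_integral_is_0) auto

text \<open>Cauchy-Schwarz along each characteristic, followed by a translation of each time slice; the translated
  slices still see at most the whole support of \<open>\<omega>\<close>.\<close>

lemma dual_L2_bound:
  assumes cont: "continuous_on UNIV \<omega>" and T: "0 < T" and ab: "a \<le> b" and s: "0 \<le> s"
    and supp: "\<And>p. p \<notin> cbox (0, a) (T, b) \<Longrightarrow> \<omega> p = 0"
  shows "integral {a..b} (\<lambda>y. (dual \<sigma> T \<omega> (s, y))\<^sup>2) \<le> T * integral (cbox (0, a) (T, b)) (\<lambda>p. (\<omega> p)\<^sup>2)"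
proof -
  define F where "F z = integral {a..b} (\<lambda>y. (\<omega> (z, y))\<^sup>2)" for z
  have cF: "continuous_on UNIV F"
  proof -
    have "continuous_on UNIV (\<lambda>z. integral (cbox a b) (\<lambda>y. (\<omega> (z, y))\<^sup>2))"
      by (rule integral_continuous_on_param)
        (auto simp: case_prod_unfold intro!: continuous_intros continuous_on_subset[OF cont])
    then show ?thesis by (simp add: F_def)
  qed
  have F0: "0 \<le> F z" for z
    unfolding F_def by (intro integral_nonneg integrable_continuous_real continuous_intros continuous_on_compose2[OF cont]) auto
  have c\<omega>: "continuous_on S (\<lambda>q. (\<omega> (s + snd q, fst q + snd q * \<sigma>))\<^sup>2)" for S
    by (intro continuous_intros continuous_on_compose2[OF cont]) auto
  have cdual: "continuous_on UNIV (dual \<sigma> T \<omega>)"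
    using Ck_dual[of 0 \<omega>] cont by simp
  have "integral {a..b} (\<lambda>y. (dual \<sigma> T \<omega> (s, y))\<^sup>2)
      \<le> integral {a..b} (\<lambda>y. T * integral {0..T} (\<lambda>r. (\<omega> (s + r, y + r * \<sigma>))\<^sup>2))"
  proof (rule integral_le)
    show "(\<lambda>y. (dual \<sigma> T \<omega> (s, y))\<^sup>2) integrable_on {a..b}"
      by (intro continuous_square_integrable continuous_on_compose2[OF cdual] continuous_intros) auto
    have "continuous_on UNIV (\<lambda>y. integral (cbox 0 T) (\<lambda>r. (\<omega> (s + r, y + r * \<sigma>))\<^sup>2))"
      by (rule integral_continuous_on_param) (use c\<omega> in \<open>auto simp: case_prod_unfold\<close>)
    then show "(\<lambda>y. T * integral {0..T} (\<lambda>r. (\<omega> (s + r, y + r * \<sigma>))\<^sup>2)) integrable_on {a..b}"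
      by (intro integrable_continuous_real continuous_intros) (auto intro: continuous_on_subset)
    show "(dual \<sigma> T \<omega> (s, y))\<^sup>2 \<le> T * integral {0..T} (\<lambda>r. (\<omega> (s + r, y + r * \<sigma>))\<^sup>2)" for y
    proof -
      have "continuous_on UNIV (\<lambda>r. \<omega> (s + r, y + r * \<sigma>))"
        by (intro continuous_on_compose2[OF cont] continuous_intros) auto
      from integral_square_le[OF this, of T 0] show ?thesis using T by (simp add: dual_def)
    qed
  qed
  also have "\<dots> = T * integral {a..b} (\<lambda>y. integral {0..T} (\<lambda>r. (\<omega> (s + r, y + r * \<sigma>))\<^sup>2))" by simp
  also have "integral {a..b} (\<lambda>y. integral {0..T} (\<lambda>r. (\<omega> (s + r, y + r * \<sigma>))\<^sup>2))
      = integral {0..T} (\<lambda>r. integral {a..b} (\<lambda>y. (\<omega> (s + r, y + r * \<sigma>))\<^sup>2))"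
    using integral_swap_continuous[of a 0 b T "\<lambda>y r. (\<omega> (s + r, y + r * \<sigma>))\<^sup>2"] c\<omega>
    by (simp add: case_prod_unfold)
  also have "\<dots> \<le> integral {0..T} (\<lambda>r. F (s + r))"
  proof (rule integral_le)
    have "continuous_on UNIV (\<lambda>r. integral (cbox a b) (\<lambda>y. (\<omega> (s + r, y + r * \<sigma>))\<^sup>2))"
      by (rule integral_continuous_on_param)
        (auto simp: case_prod_unfold intro!: continuous_intros continuous_on_compose2[OF cont])
    then show "(\<lambda>r. integral {a..b} (\<lambda>y. (\<omega> (s + r, y + r * \<sigma>))\<^sup>2)) integrable_on {0..T}"
      by (intro integrable_continuous_real) (auto intro: continuous_on_subset)
    show "(\<lambda>r. F (s + r)) integrable_on {0..T}"
      by (intro integrable_continuous_real continuous_on_compose2[OF cF] continuous_intros) auto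
    show "integral {a..b} (\<lambda>y. (\<omega> (s + r, y + r * \<sigma>))\<^sup>2) \<le> F (s + r)" for r
    proof -
      let ?g = "\<lambda>y. (\<omega> (s + r, y))\<^sup>2"
      have "integral {a..b} (\<lambda>y. (\<omega> (s + r, y + r * \<sigma>))\<^sup>2) = integral {a + r * \<sigma>..b + r * \<sigma>} ?g"
        using integral_shift_Icc_real[of a b ?g "r * \<sigma>"] by (simp add: o_def add.commute)
      also have "\<dots> \<le> integral {a..b} ?g"
        by (rule integral_le_support) (auto intro!: continuous_intros continuous_on_compose2[OF cont] supp simp: cbox_Pair_eq)
      finally show ?thesis by (simp add: F_def)
    qed
  qed
  also have "\<dots> = integral {0 + s..T + s} F"
    using integral_shift_Icc_real[of 0 T F s] by (simp add: o_def add.commute)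
  also have "\<dots> \<le> integral {0..T} F"
  proof (rule integral_le_support[OF cF F0])
    fix z assume "z \<notin> {0..T}"
    then have "\<omega> (z, y) = 0" for y by (intro supp) (auto simp: cbox_Pair_eq)
    then show "F z = 0" by (simp add: F_def)
  qed
  also have "\<dots> = integral (cbox (0, a) (T, b)) (\<lambda>p. (\<omega> p)\<^sup>2)"
    unfolding F_def by (rule rectangle_Fubini(1)[symmetric]) (intro continuous_intros continuous_on_subset[OF cont]; simp)
  finally show ?thesis using T by simp
qed

section \<open>Products of functions of one variable\<close>

lemma AE_lebesgue_borel_representative:
  fixes f :: "'a::euclidean_space \<Rightarrow> real"
  assumes "integrable (lebesgue_on A) f" "A \<in> sets lebesgue"
  obtains g N where "g \<in> borel_measurable borel" "integrable lborel g" "N \<in> null_sets lborel"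
    "\<And>x. x \<notin> N \<Longrightarrow> indicator A x * f x = g x" "integral\<^sup>L lborel g = integral\<^sup>L (lebesgue_on A) f"
proof -
  let ?f = "\<lambda>x. indicator A x * f x"
  have f: "integrable lebesgue ?f" using assms by (simp add: integrable_restrict_space)
  obtain g where g: "g \<in> borel_measurable borel" "AE x in lborel. ?f x = g x"
    using completion_ex_borel_measurable_real[of ?f lborel] f by auto
  obtain N where N: "{x \<in> space lborel. ?f x \<noteq> g x} \<subseteq> N" "N \<in> null_sets lborel"
    using g(2) by (auto elim!: AE_E simp: null_sets_def)
  have ae: "AE x in lebesgue. ?f x = g x" using g(2) by (rule AE_completion)
  have gm: "g \<in> borel_measurable lebesgue" using g(1) by (intro measurable_completion) simp
  have "integrable lebesgue g"
    using integrable_cong_AE[OF _ gm ae] f by auto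
  then have gi: "integrable lborel g" using g(1) by (simp add: integrable_completion)
  have "integral\<^sup>L lborel g = integral\<^sup>L lebesgue g" using g(1) by (simp add: integral_completion)
  also have "\<dots> = integral\<^sup>L lebesgue ?f"
    using f ae gm by (intro integral_cong_AE) auto
  also have "\<dots> = integral\<^sup>L (lebesgue_on A) f" using assms(2) by (simp add: integral_restrict_space)
  finally show thesis using that[OF g(1) gi N(2)] N(1) by auto
qed

lemma negligible_product_line:
  fixes N :: "real set"
  assumes "N \<in> null_sets lborel"
  shows "AE p in (lebesgue :: (real \<times> real) measure). fst p \<notin> N"
    "AE p in (lebesgue :: (real \<times> real) measure). snd p \<notin> N"
proof -
  have N: "N \<in> sets borel" using assms by auto
  have "{p \<in> space (lborel \<Otimes>\<^sub>M lborel). fst p \<notin> N} = (UNIV - N) \<times> (UNIV :: real set)"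
    "{p \<in> space (lborel \<Otimes>\<^sub>M lborel). snd p \<notin> N} = (UNIV :: real set) \<times> (UNIV - N)"
    by (auto simp: space_pair_measure)
  then have m: "{p \<in> space (lborel \<Otimes>\<^sub>M (lborel :: real measure)). fst p \<notin> N} \<in> sets (lborel \<Otimes>\<^sub>M lborel)"
    "{p \<in> space ((lborel :: real measure) \<Otimes>\<^sub>M lborel). snd p \<notin> N} \<in> sets (lborel \<Otimes>\<^sub>M lborel)"
    using N by (auto intro!: pair_measureI)
  have "AE p in lborel \<Otimes>\<^sub>M (lborel :: real measure). fst p \<notin> N"
    by (rule lborel_pair.AE_pair_measure, rule m(1)) (use AE_not_in[OF assms] in auto)
  then show "AE p in (lebesgue :: (real \<times> real) measure). fst p \<notin> N"
    unfolding lborel_prod by (rule AE_completion)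
  have "AE p in (lborel :: real measure) \<Otimes>\<^sub>M lborel. snd p \<notin> N"
    by (rule lborel_pair.AE_pair_measure, rule m(2)) (use AE_not_in[OF assms] in auto)
  then show "AE p in (lebesgue :: (real \<times> real) measure). snd p \<notin> N"
    unfolding lborel_prod by (rule AE_completion)
qed

text \<open>Fubini for a product of Lebesgue measurable functions of one variable each; Borel representatives are used
  because the Lebesgue measure on the plane is the completion of the product measure.\<close>

lemma integral_product:
  fixes f g :: "real \<Rightarrow> real"
  assumes "integrable (lebesgue_on A) f" "integrable (lebesgue_on B) g" "A \<in> sets borel" "B \<in> sets borel"
  shows "integrable (lebesgue_on (A \<times> B)) (\<lambda>p. f (fst p) * g (snd p))"
    "(LINT p|lebesgue_on (A \<times> B). f (fst p) * g (snd p)) = (LINT s|lebesgue_on A. f s) * (LINT y|lebesgue_on B. g y)"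
proof -
  obtain f' N where f': "f' \<in> borel_measurable borel" "integrable lborel f'" "N \<in> null_sets lborel"
    "\<And>x. x \<notin> N \<Longrightarrow> indicator A x * f x = f' x" "integral\<^sup>L lborel f' = integral\<^sup>L (lebesgue_on A) f"
    by (rule AE_lebesgue_borel_representative[OF assms(1)]) (use assms in auto)
  obtain g' N' where g': "g' \<in> borel_measurable borel" "integrable lborel g'" "N' \<in> null_sets lborel"
    "\<And>x. x \<notin> N' \<Longrightarrow> indicator B x * g x = g' x" "integral\<^sup>L lborel g' = integral\<^sup>L (lebesgue_on B) g"
    by (rule AE_lebesgue_borel_representative[OF assms(2)]) (use assms in auto)
  let ?h = "\<lambda>p. f' (fst p) * g' (snd p)"
  have m: "?h \<in> borel_measurable (lborel \<Otimes>\<^sub>M lborel)"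
    using f'(1) g'(1) by (auto intro!: borel_measurable_times measurable_compose[of fst] measurable_compose[of snd])
  have h: "integrable (lborel \<Otimes>\<^sub>M lborel) ?h"
  proof (rule lborel_pair.Fubini_integrable[OF m])
    have "(\<lambda>x. LINT y|lborel. norm (?h (x, y))) = (\<lambda>x. \<bar>f' x\<bar> * (LINT y|lborel. \<bar>g' y\<bar>))"
      by (simp add: abs_mult)
    then show "integrable lborel (\<lambda>x. LINT y|lborel. norm (?h (x, y)))" using f'(2) by simp
    show "AE x in lborel. integrable lborel (\<lambda>y. ?h (x, y))" using g'(2) by simp
  qed
  have "integral\<^sup>L (lborel \<Otimes>\<^sub>M lborel) ?h = (LINT x|lborel. LINT y|lborel. ?h (x, y))"
    using lborel_pair.integral_fst'[OF h] by simp
  also have "\<dots> = integral\<^sup>L lborel f' * integral\<^sup>L lborel g'" by simp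
  finally have hI: "integral\<^sup>L lborel ?h = integral\<^sup>L lborel f' * integral\<^sup>L lborel g'" unfolding lborel_prod .
  have hb: "?h \<in> borel_measurable borel" using m unfolding lborel_prod by simp
  have h': "integrable lebesgue ?h" using h hb unfolding lborel_prod by (simp add: integrable_completion)
  have ae: "AE p in lebesgue. ?h p = indicator (A \<times> B) p * (f (fst p) * g (snd p))"
    using negligible_product_line(1)[OF f'(3)] negligible_product_line(2)[OF g'(3)]
  proof eventually_elim
    case (elim p)
    then show ?case using f'(4)[of "fst p"] g'(4)[of "snd p"]
      by (cases p) (auto simp: indicator_def split: if_splits)
  qed
  have AB: "A \<times> B \<in> sets lebesgue"
  proof -
    have "A \<times> B \<in> sets (lborel \<Otimes>\<^sub>M lborel)" using assms by (intro pair_measureI) auto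
    then show ?thesis unfolding lborel_prod by auto
  qed
  have m2: "(\<lambda>p. indicator (A \<times> B) p * (f (fst p) * g (snd p))) \<in> borel_measurable lebesgue"
    by (rule borel_measurable_AE[OF _ ae]) (use h' in auto)
  show "integrable (lebesgue_on (A \<times> B)) (\<lambda>p. f (fst p) * g (snd p))"
    using integrable_cong_AE[OF _ m2 ae] h' AB by (auto simp: integrable_restrict_space)
  have "(LINT p|lebesgue_on (A \<times> B). f (fst p) * g (snd p)) = integral\<^sup>L lebesgue ?h"
    using integral_cong_AE[OF _ m2 ae] h' AB by (auto simp: integral_restrict_space)
  also have "\<dots> = integral\<^sup>L lborel ?h" using hb by (simp add: integral_completion)
  finally show "(LINT p|lebesgue_on (A \<times> B). f (fst p) * g (snd p)) = (LINT s|lebesgue_on A. f s) * (LINT y|lebesgue_on B. g y)"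
    using hI f'(5) g'(5) by simp
qed

lemma L2_integrable:
  assumes "u \<in> L2 G" "bounded G" "G \<in> sets lebesgue"
  shows "integrable (lebesgue_on G) u"
proof -
  have one: "(\<lambda>_. 1::real) \<in> L2 G" by (rule continuous_L2) (use assms in auto)
  then show ?thesis using L2_scaleR_integrable[OF one assms(1)] by simp
qed

lemma integral_of_space_function:
  fixes f :: "real \<Rightarrow> real"
  assumes "integrable (lebesgue_on {a<..<b}) f" "s \<le> t"
  shows "integrable (lebesgue_on (box (s, a) (t, b))) (\<lambda>p. f (snd p))"
    "(LINT p|lebesgue_on (box (s, a) (t, b)). f (snd p)) = (t - s) * (LINT y|lebesgue_on {a<..<b}. f y)"
proof -
  have i: "integrable (lebesgue_on {s<..<t}) (\<lambda>_. 1::real)"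
    using rectangle_integral(1)[of s t "\<lambda>_. 1::real" "\<lambda>_. 1"] by simp
  have v: "(LINT y|lebesgue_on {s<..<t}. 1::real) = t - s"
    using rectangle_integral(2)[of s t "\<lambda>_. 1::real" "\<lambda>_. 1"] assms(2) by simp
  show "integrable (lebesgue_on (box (s, a) (t, b))) (\<lambda>p. f (snd p))"
    "(LINT p|lebesgue_on (box (s, a) (t, b)). f (snd p)) = (t - s) * (LINT y|lebesgue_on {a<..<b}. f y)"
    using integral_product[OF i assms(1)] v unfolding box_Pair by simp_all
qed

lemma L2_of_space_function:
  fixes f :: "real \<Rightarrow> real" and s t :: real
  assumes "f \<in> L2 {a<..<b}" "s \<le> t"
  shows "(\<lambda>p. f (snd p)) \<in> L2 (box (s, a) (t, b))"
proof -
  have "integrable (lebesgue_on {a<..<b}) f" by (rule L2_integrable[OF assms(1)]) auto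
  from integral_of_space_function(1)[OF this assms(2)] integral_of_space_function(1)[OF L2_integrable_square[OF assms(1)] assms(2)]
  show ?thesis by (auto simp: L2_def)
qed

section \<open>The exact solution tested with a smooth function\<close>

text \<open>The test function \<open>\<phi>\<close> is allowed to be nonzero at time 0 and at the lateral boundary. A
  cutoff in space costs nothing because \<open>V\<close> and \<open>\<beta>\<close> have compact support in space. The
  derivative of a cutoff in time is an approximate unit at time 0, and it produces the initial value by the averaged
  trace condition.\<close>

lemma exact_solution_tested:
  fixes V \<beta> \<phi> :: "real \<times> real \<Rightarrow> real" and V0 :: "real \<Rightarrow> real"
  assumes T: "0 < T" and ab: "a < \<kappa>1" "\<kappa>1 \<le> \<kappa>2" "\<kappa>2 < b"
    and V: "V \<in> L2 (box (0, a) (T, b))" and \<beta>: "\<beta> \<in> L2 (box (0, a) (T, b))" and V0: "V0 \<in> L2 {a<..<b}"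
    and V_supp: "\<And>s y. 0 < s \<Longrightarrow> s < T \<Longrightarrow> y \<notin> {\<kappa>1..\<kappa>2} \<Longrightarrow> V (s, y) = 0"
    and \<beta>_supp: "\<And>s y. 0 < s \<Longrightarrow> s < T \<Longrightarrow> y \<notin> {\<kappa>1..\<kappa>2} \<Longrightarrow> \<beta> (s, y) = 0"
    and weak: "\<And>\<Phi>. \<Phi> \<in> test_functions (box (0, a) (T, b)) \<Longrightarrow>
      (LINT p|lebesgue_on (box (0, a) (T, b)). \<Phi> p * \<beta> p)
      = - (LINT p|lebesgue_on (box (0, a) (T, b)). (pd (1, 0) \<Phi> p + \<sigma> * pd (0, 1) \<Phi> p) * V p)"
    and initial: "((\<lambda>\<epsilon>. (LINT p|lebesgue_on (box (0, a) (\<epsilon>, b)). (V p - V0 (snd p))\<^sup>2) / \<epsilon>) \<longlongrightarrow> 0) (at_right 0)"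
    and \<phi>: "\<And>n. Ck n \<phi>" and \<phi>_end: "T0 < T" "\<And>s y. T0 \<le> s \<Longrightarrow> \<phi> (s, y) = 0"
  shows "(LINT p|lebesgue_on (box (0, a) (T, b)). \<phi> p * \<beta> p)
    = - (LINT p|lebesgue_on (box (0, a) (T, b)). (pd (1, 0) \<phi> p + \<sigma> * pd (0, 1) \<phi> p) * V p)
      - (LINT y|lebesgue_on {a<..<b}. V0 y * \<phi> (0, y))"
proof -
  let ?Q = "box (0, a) (T, b)"
  define a1 where "a1 = (a + \<kappa>1) / 2"
  define b1 where "b1 = (b + \<kappa>2) / 2"
  have a1: "a < a1" "a1 < \<kappa>1" and b1: "\<kappa>2 < b1" "b1 < b" using ab by (auto simp: a1_def b1_def)
  (* The cutoff xi in space is 1 on the supports; the derivative of the cutoff kappa in time has integral 1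
     and concentrates at time 0. *)
  define sl where "sl y = step ((y - a1) / (\<kappa>1 - a1))" for y
  define sr where "sr y = step ((b1 - y) / (b1 - \<kappa>2))" for y
  define \<xi> where "\<xi> p = sl (snd p) * sr (snd p)" for p :: "real \<times> real"
  define \<kappa> where "\<kappa> \<epsilon> s = step (2 * s / \<epsilon> - 1)" for \<epsilon> s :: real
  have Ck\<xi>: "Ck n \<xi>" for n
  proof -
    have "Ck n (\<lambda>p::real\<times>real. sl (snd p))"
      using Ck_snd_compose[OF Ck_step, of n "- a1 / (\<kappa>1 - a1)" "1 / (\<kappa>1 - a1)"]
      by (simp add: sl_def diff_divide_distrib)
    moreover have "Ck n (\<lambda>p::real\<times>real. sr (snd p))"
      using Ck_snd_compose[OF Ck_step, of n "b1 / (b1 - \<kappa>2)" "- 1 / (b1 - \<kappa>2)"]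
      by (simp add: sr_def diff_divide_distrib)
    ultimately show ?thesis unfolding \<xi>_def[abs_def] by (rule Ck_mult)
  qed
  have \<xi>1: "\<xi> (s, y) = 1" if "y \<in> {\<kappa>1..\<kappa>2}" for s y
  proof -
    have "sl y = 1" "sr y = 1"
      unfolding sl_def sr_def using that a1 b1 by (auto intro!: step_1 simp: le_divide_eq)
    then show ?thesis by (simp add: \<xi>_def)
  qed
  have \<xi>0: "\<xi> (s, y) = 0" if "y \<notin> {a1..b1}" for s y
  proof -
    have "y < a1 \<or> b1 < y" using that by auto
    then have "sl y = 0 \<or> sr y = 0"
      unfolding sl_def sr_def using a1 b1 by (auto intro!: step_0 divide_nonpos_pos simp: disjI1 disjI2)
    then show ?thesis by (auto simp: \<xi>_def)
  qed
  have \<xi>d: "pd d \<xi> (s, y) = 0" if "y \<in> {\<kappa>1..\<kappa>2}" for d s y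
  proof -
    have "(sl has_field_derivative bump ((y - a1) / (\<kappa>1 - a1)) * (1 / (\<kappa>1 - a1))) (at y)"
      unfolding sl_def[abs_def] by (rule DERIV_chain2[OF step_has_derivative]) (use a1 in \<open>auto intro!: derivative_eq_intros\<close>)
    moreover have "bump ((y - a1) / (\<kappa>1 - a1)) = 0" using that a1 by (intro bump_outside) (auto simp: field_simps)
    ultimately have dl: "(sl has_field_derivative 0) (at y)" by simp
    have "(sr has_field_derivative bump ((b1 - y) / (b1 - \<kappa>2)) * (- 1 / (b1 - \<kappa>2))) (at y)"
      unfolding sr_def[abs_def] by (rule DERIV_chain2[OF step_has_derivative]) (use b1 in \<open>auto intro!: derivative_eq_intros simp: divide_simps\<close>)
    moreover have "bump ((b1 - y) / (b1 - \<kappa>2)) = 0" using that b1 by (intro bump_outside) (auto simp: field_simps)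
    ultimately have dr: "(sr has_field_derivative 0) (at y)" by simp
    have "((\<lambda>y. sl y * sr y) has_field_derivative 0) (at y)"
      using DERIV_mult[OF dl dr] by simp
    then show ?thesis unfolding \<xi>_def
      using pd_snd[of "\<lambda>y. sl y * sr y" 0 "(s, y)" d] by (simp add: has_real_derivative_iff_has_vector_derivative)
  qed
  have Ck\<kappa>: "Ck n (\<lambda>p::real\<times>real. \<kappa> \<epsilon> (fst p))" for n \<epsilon>
    using Ck_fst_compose[OF Ck_step, of n "- 1" "2 / \<epsilon>"] by (simp add: \<kappa>_def)
  have \<kappa>d: "(\<kappa> \<epsilon> has_field_derivative bump (2 * s / \<epsilon> - 1) * (2 / \<epsilon>)) (at s)" if "0 < \<epsilon>" for \<epsilon> s
    unfolding \<kappa>_def[abs_def] by (rule DERIV_chain2[OF step_has_derivative]) (use that in \<open>auto intro!: derivative_eq_intros\<close>)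
  have \<kappa>pd: "pd d (\<lambda>p. \<kappa> \<epsilon> (fst p)) p = fst d * (bump (2 * fst p / \<epsilon> - 1) * (2 / \<epsilon>))" if "0 < \<epsilon>" for d p :: "real \<times> real" and \<epsilon>
    using pd_fst[OF \<kappa>d[OF that, of "fst p", unfolded has_real_derivative_iff_has_vector_derivative], of d] by simp
  have \<kappa>b: "0 \<le> \<kappa> \<epsilon> s" "\<kappa> \<epsilon> s \<le> 1" for \<epsilon> s by (auto simp: \<kappa>_def step_bounds)
  let ?D = "\<lambda>p. pd (1, 0) \<phi> p + \<sigma> * pd (0, 1) \<phi> p"
  let ?k = "\<lambda>\<epsilon> p. bump (2 * fst p / \<epsilon> - 1) * (2 / \<epsilon>)"
  have C\<phi>: "continuous_on S \<phi>" for S by (rule Ck_continuous[OF \<phi>])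
  have CD: "continuous_on S ?D" for S by (intro continuous_intros Ck_pd \<phi>)
  have Ck: "continuous_on S (?k \<epsilon>)" if "0 < \<epsilon>" for S \<epsilon>
    by (intro continuous_intros continuous_on_compose2[OF continuous_bump[of UNIV]]) (use that in auto)
  have C\<kappa>: "continuous_on S (\<lambda>p::real\<times>real. \<kappa> \<epsilon> (fst p))" for S \<epsilon> by (rule Ck_continuous[OF Ck\<kappa>])
  have L: "f \<in> L2 ?Q" if "continuous_on UNIV f" for f :: "real \<times> real \<Rightarrow> real"
    using that by (rule continuous_L2) auto
  have id: "(LINT p|lebesgue_on ?Q. \<kappa> \<epsilon> (fst p) * \<phi> p * \<beta> p)
     = - (LINT p|lebesgue_on ?Q. ?k \<epsilon> p * \<phi> p * V p) - (LINT p|lebesgue_on ?Q. \<kappa> \<epsilon> (fst p) * ?D p * V p)"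
    if \<epsilon>: "0 < \<epsilon>" for \<epsilon>
  proof -
    define \<Phi> where "\<Phi> p = \<kappa> \<epsilon> (fst p) * (\<xi> p * \<phi> p)" for p
    have test: "\<Phi> \<in> test_functions ?Q"
    proof (rule test_functionI[where C="cbox (\<epsilon> / 2, a1) (T0, b1)"])
      show "Ck n \<Phi>" for n unfolding \<Phi>_def[abs_def] by (intro Ck_mult Ck\<kappa> Ck\<xi> \<phi>)
      show "cbox (\<epsilon> / 2, a1) (T0, b1) \<subseteq> ?Q" using a1 b1 \<phi>_end \<epsilon> by (auto simp: cbox_Pair_eq box_Pair)
      fix p assume "p \<notin> cbox (\<epsilon> / 2, a1) (T0, b1)"
      then consider "fst p < \<epsilon> / 2" | "T0 \<le> fst p" | "snd p \<notin> {a1..b1}" by (cases p) (auto simp: cbox_Pair_eq not_le)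
      then show "\<Phi> p = 0"
      proof cases
        case 1
        then have "\<kappa> \<epsilon> (fst p) = 0" unfolding \<kappa>_def using \<epsilon> by (intro step_0) (auto simp: field_simps)
        then show ?thesis by (simp add: \<Phi>_def)
      next
        case 2
        then show ?thesis using \<phi>_end(2)[of "fst p" "snd p"] by (simp add: \<Phi>_def)
      next
        case 3
        then show ?thesis using \<xi>0[of "snd p" "fst p"] by (simp add: \<Phi>_def)
      qed
    qed simp
    have pd\<Phi>: "pd (1, 0) \<Phi> p + \<sigma> * pd (0, 1) \<Phi> p = \<kappa> \<epsilon> (fst p) * (\<xi> p * ?D p + (pd (1, 0) \<xi> p + \<sigma> * pd (0, 1) \<xi> p) * \<phi> p) + ?k \<epsilon> p * (\<xi> p * \<phi> p)" for p
      unfolding \<Phi>_def[abs_def]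
      by (simp add: pd_mult Ck_mult Ck\<xi> Ck\<kappa> \<phi> \<kappa>pd[OF \<epsilon>]) (simp add: algebra_simps)
    have 1: "\<Phi> p * \<beta> p = \<kappa> \<epsilon> (fst p) * \<phi> p * \<beta> p" if "p \<in> ?Q" for p
      using that \<beta>_supp[of "fst p" "snd p"] \<xi>1[of "snd p" "fst p"]
      by (cases "snd p \<in> {\<kappa>1..\<kappa>2}") (auto simp: \<Phi>_def box_Pair)
    have 2: "(pd (1, 0) \<Phi> p + \<sigma> * pd (0, 1) \<Phi> p) * V p = ?k \<epsilon> p * \<phi> p * V p + \<kappa> \<epsilon> (fst p) * ?D p * V p" if "p \<in> ?Q" for p
    proof (cases "snd p \<in> {\<kappa>1..\<kappa>2}")
      case True
      then have "\<xi> p = 1" "pd d \<xi> p = 0" for d using \<xi>1[of "snd p" "fst p"] \<xi>d[of "snd p" "fst p" d] by simp_all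
      then show ?thesis unfolding pd\<Phi> by (simp add: algebra_simps)
    next
      case False
      then have "V p = 0" using that V_supp[of "fst p" "snd p"] by (auto simp: box_Pair)
      then show ?thesis by simp
    qed
    have "(LINT p|lebesgue_on ?Q. \<kappa> \<epsilon> (fst p) * \<phi> p * \<beta> p) = (LINT p|lebesgue_on ?Q. \<Phi> p * \<beta> p)"
      by (rule Bochner_Integration.integral_cong[OF refl], rule 1[symmetric]) simp
    also have "\<dots> = - (LINT p|lebesgue_on ?Q. (pd (1, 0) \<Phi> p + \<sigma> * pd (0, 1) \<Phi> p) * V p)" by (rule weak[OF test])
    also have "(LINT p|lebesgue_on ?Q. (pd (1, 0) \<Phi> p + \<sigma> * pd (0, 1) \<Phi> p) * V p)
       = (LINT p|lebesgue_on ?Q. ?k \<epsilon> p * \<phi> p * V p + \<kappa> \<epsilon> (fst p) * ?D p * V p)"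
      by (rule Bochner_Integration.integral_cong[OF refl], rule 2) simp
    also have "\<dots> = (LINT p|lebesgue_on ?Q. ?k \<epsilon> p * \<phi> p * V p) + (LINT p|lebesgue_on ?Q. \<kappa> \<epsilon> (fst p) * ?D p * V p)"
      by (intro Bochner_Integration.integral_add L2_mult_integrable[OF _ V] L continuous_intros Ck[OF \<epsilon>] C\<phi> C\<kappa> CD)
    finally show ?thesis by simp
  qed
  define e where "e n = T / (2 + real n)" for n
  have e: "0 < e n" "e n \<le> T" for n using T by (auto simp: e_def field_simps)
  have e_lim: "e \<longlonglongrightarrow> 0" unfolding e_def[abs_def]
    by (rule real_tendsto_divide_at_top[OF tendsto_const]) (intro filterlim_tendsto_add_at_top[OF tendsto_const] filterlim_real_sequentially)
  have \<kappa>lim: "(\<lambda>n. \<kappa> (e n) s) \<longlonglongrightarrow> 1" if "0 < s" for s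
  proof (rule tendsto_eventually)
    have "\<forall>\<^sub>F n in sequentially. e n < s" using e_lim that by (rule order_tendstoD)
    then show "\<forall>\<^sub>F n in sequentially. \<kappa> (e n) s = 1"
    proof eventually_elim
      case (elim n)
      then show ?case unfolding \<kappa>_def using e[of n] by (intro step_1) (auto simp: field_simps)
    qed
  qed
  have dom: "(\<lambda>n. LINT p|lebesgue_on ?Q. \<kappa> (e n) (fst p) * F p * w p) \<longlonglongrightarrow> (LINT p|lebesgue_on ?Q. 1 * F p * w p)"
    if F: "continuous_on UNIV F" and w: "w \<in> L2 ?Q" for F w
  proof (rule integral_dominated_convergence[where w="\<lambda>p. \<bar>F p * w p\<bar>"])
    show "(\<lambda>p. 1 * F p * w p) \<in> borel_measurable (lebesgue_on ?Q)"
      using L2_mult_integrable[OF L[OF F] w] by auto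
    show "(\<lambda>p. \<kappa> (e n) (fst p) * F p * w p) \<in> borel_measurable (lebesgue_on ?Q)" for n
      by (rule borel_measurable_integrable) (intro L2_mult_integrable[OF L w] continuous_intros F C\<kappa>)
    show "integrable (lebesgue_on ?Q) (\<lambda>p. \<bar>F p * w p\<bar>)"
      using L2_mult_integrable[OF L[OF F] w] by auto
    show "AE p in lebesgue_on ?Q. (\<lambda>n. \<kappa> (e n) (fst p) * F p * w p) \<longlonglongrightarrow> 1 * F p * w p"
      by (intro AE_I2 tendsto_mult tendsto_const \<kappa>lim) (auto simp: box_Pair)
    show "AE p in lebesgue_on ?Q. norm (\<kappa> (e n) (fst p) * F p * w p) \<le> \<bar>F p * w p\<bar>" for n
      using \<kappa>b by (intro AE_I2) (auto simp: abs_mult mult.assoc intro!: mult_left_le_one_le)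
  qed
  have V0i: "integrable (lebesgue_on {a<..<b}) V0" by (rule L2_integrable[OF V0]) auto
  have V0L: "(\<lambda>p. V0 (snd p)) \<in> L2 ?Q" by (rule L2_of_space_function[OF V0]) (use T in simp)
  have \<phi>0: "continuous_on UNIV (\<lambda>y. \<phi> (0, y))"
    by (rule continuous_on_compose2[OF C\<phi>]) (auto intro!: continuous_intros)
  have "compact (closure ?Q)" by simp
  then obtain c1 where c1: "\<And>p. p \<in> cbox (0, a) (T, b) \<Longrightarrow> \<bar>\<phi> p\<bar> \<le> c1" "0 \<le> c1"
    using compact_continuous_image[OF C\<phi>, of "cbox (0, a) (T, b)"] compact_imp_bounded bounded_iff
    by (metis (no_types, lifting) abs_ge_zero compact_cbox image_eqI linear order_trans real_norm_def)
  obtain c2 where c2: "\<And>p. p \<in> cbox (0, a) (T, b) \<Longrightarrow> \<bar>pd (1, 0) \<phi> p\<bar> \<le> c2" "0 \<le> c2"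
    using compact_continuous_image[OF Ck_pd[OF \<phi>], of "cbox (0, a) (T, b)"] compact_imp_bounded bounded_iff
    by (metis (no_types, lifting) abs_ge_zero compact_cbox image_eqI linear order_trans real_norm_def)
  obtain B where B: "\<And>z. bump z \<le> B" "0 \<le> B"
  proof -
    have "compact (bump ` {0..1})" by (intro compact_continuous_image continuous_bump) auto
    then obtain B where "\<forall>z\<in>bump ` {0..1}. norm z \<le> B" using compact_imp_bounded bounded_iff by blast
    then have "bump z \<le> max B 0" for z
    proof (cases "z \<in> {0..1}")
      case True
      then have "\<bar>bump z\<bar> \<le> B" using \<open>\<forall>z\<in>bump ` {0..1}. norm z \<le> B\<close> by auto
      then show ?thesis by linarith
    qed (use bump_outside[of z] in auto)
    then show thesis by (intro that[of "max B 0"]) auto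
  qed
  have lim2: "(\<lambda>n. LINT p|lebesgue_on ?Q. ?k (e n) p * \<phi> p * V p) \<longlonglongrightarrow> (LINT y|lebesgue_on {a<..<b}. V0 y * \<phi> (0, y))"
  proof -
    define I1 where "I1 n = (LINT p|lebesgue_on ?Q. ?k (e n) p * \<phi> p * (V p - V0 (snd p)))" for n
    define I2 where "I2 n = (LINT p|lebesgue_on ?Q. ?k (e n) p * (\<phi> p - \<phi> (0, snd p)) * V0 (snd p))" for n
    have k0: "?k (e n) p = 0" if "e n \<le> fst p" for n p
      using that e[of n] bump_outside[of "2 * fst p / e n - 1"] by (auto simp: field_simps)
    have kn: "0 \<le> ?k (e n) p" for n p using e[of n] bump_nonneg by simp
    have C\<phi>': "continuous_on S (\<lambda>p. \<phi> (0, snd p))" for S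
      by (rule continuous_on_compose2[OF C\<phi>]) (auto intro!: continuous_intros)
    have ki: "(LINT s|lebesgue_on {0<..<T}. bump (2 * s / e n - 1) * (2 / e n)) = 1"
      "integrable (lebesgue_on {0<..<T}) (\<lambda>s. bump (2 * s / e n - 1) * (2 / e n))" for n
    proof -
      let ?f = "\<lambda>s. bump (2 * s / e n - 1) * (2 / e n)"
      have c: "continuous_on {0..T} ?f"
        by (intro continuous_intros continuous_on_compose2[OF continuous_bump[of UNIV]]) (use e[of n] in auto)
      have "integral {0..T} ?f = \<kappa> (e n) T - \<kappa> (e n) 0"
        using \<kappa>d[OF e(1)] T by (intro integral_unique fundamental_theorem_of_calculus)
          (auto simp flip: has_real_derivative_iff_has_vector_derivative intro: has_field_derivative_at_within)
      also have "\<kappa> (e n) T = 1" unfolding \<kappa>_def using e[of n] by (intro step_1) (auto simp: field_simps)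
      also have "\<kappa> (e n) 0 = 0" unfolding \<kappa>_def by (intro step_0) auto
      finally show "(LINT s|lebesgue_on {0<..<T}. ?f s) = 1" "integrable (lebesgue_on {0<..<T}) ?f"
        using rectangle_integral[of 0 T ?f ?f] c by auto
    qed
    have I3: "(LINT p|lebesgue_on ?Q. ?k (e n) p * \<phi> (0, snd p) * V0 (snd p)) = (LINT y|lebesgue_on {a<..<b}. V0 y * \<phi> (0, y))" for n
    proof -
      have i: "integrable (lebesgue_on {a<..<b}) (\<lambda>y. V0 y * \<phi> (0, y))"
        by (intro L2_mult_integrable V0 continuous_L2 \<phi>0) auto
      have "(LINT p|lebesgue_on ?Q. ?k (e n) p * \<phi> (0, snd p) * V0 (snd p)) = (LINT p|lebesgue_on ?Q. ?k (e n) p * (V0 (snd p) * \<phi> (0, snd p)))"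
        by (intro Bochner_Integration.integral_cong) (simp_all only: mult_ac)
      also have "\<dots> = (LINT s|lebesgue_on {0<..<T}. bump (2 * s / e n - 1) * (2 / e n)) * (LINT y|lebesgue_on {a<..<b}. V0 y * \<phi> (0, y))"
        unfolding box_Pair by (rule integral_product(2)[OF ki(2) i]) auto
      finally show ?thesis by (simp only: ki(1) mult_1)
    qed
    have split: "(LINT p|lebesgue_on ?Q. ?k (e n) p * \<phi> p * V p) = I1 n + I2 n + (LINT y|lebesgue_on {a<..<b}. V0 y * \<phi> (0, y))" for n
    proof -
      have i1: "integrable (lebesgue_on ?Q) (\<lambda>p. ?k (e n) p * \<phi> p * (V p - V0 (snd p)))"
        by (intro L2_mult_integrable[OF L L2_diff[OF V V0L]] continuous_intros Ck e C\<phi>)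
      have i2: "integrable (lebesgue_on ?Q) (\<lambda>p. ?k (e n) p * (\<phi> p - \<phi> (0, snd p)) * V0 (snd p))"
        by (intro L2_mult_integrable[OF L V0L] continuous_intros Ck e C\<phi> C\<phi>')
      have i3: "integrable (lebesgue_on ?Q) (\<lambda>p. ?k (e n) p * \<phi> (0, snd p) * V0 (snd p))"
        by (intro L2_mult_integrable[OF L V0L] continuous_intros Ck e C\<phi>')
      have "(LINT p|lebesgue_on ?Q. ?k (e n) p * \<phi> p * V p) = (LINT p|lebesgue_on ?Q. ?k (e n) p * \<phi> p * (V p - V0 (snd p))
         + ?k (e n) p * (\<phi> p - \<phi> (0, snd p)) * V0 (snd p) + ?k (e n) p * \<phi> (0, snd p) * V0 (snd p))"
      proof (rule Bochner_Integration.integral_cong[OF refl])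
        have alg: "k * f * v = k * f * (v - w) + k * (f - g) * w + k * g * w" for k f v w g :: real
          by (simp add: algebra_simps)
        show "?k (e n) p * \<phi> p * V p = ?k (e n) p * \<phi> p * (V p - V0 (snd p))
         + ?k (e n) p * (\<phi> p - \<phi> (0, snd p)) * V0 (snd p) + ?k (e n) p * \<phi> (0, snd p) * V0 (snd p)" for p
          by (rule alg)
      qed
      also have "\<dots> = I1 n + I2 n + (LINT p|lebesgue_on ?Q. ?k (e n) p * \<phi> (0, snd p) * V0 (snd p))"
        using i1 i2 i3 unfolding I1_def I2_def by simp
      finally show ?thesis using I3 by simp
    qed
    have I1: "I1 \<longlonglongrightarrow> 0"
    proof -
      define W where "W \<epsilon> = (LINT p|lebesgue_on (box (0, a) (\<epsilon>, b)). (V p - V0 (snd p))\<^sup>2)" for \<epsilon>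
      have bound: "\<bar>I1 n\<bar> \<le> 2 * B * c1 * sqrt (b - a) * sqrt (W (e n) / e n)" for n
      proof -
        let ?R = "box (0, a) (e n, b)"
        have sub: "?R \<subseteq> ?Q" using e[of n] by (auto simp: box_Pair)
        have L2R: "(\<lambda>p. V p - V0 (snd p)) \<in> L2 ?R" by (rule L2_subset[OF L2_diff[OF V V0L] sub]) auto
        let ?g = "\<lambda>p. ?k (e n) p * \<phi> p"
        have gL: "?g \<in> L2 ?R" by (rule continuous_L2[OF continuous_on_mult[OF Ck[OF e(1)] C\<phi>]]) auto
        have "I1 n = (LINT p|lebesgue_on ?Q. (if p \<in> ?R then ?g p * (V p - V0 (snd p)) else 0))"
          unfolding I1_def
        proof (rule Bochner_Integration.integral_cong)
          fix p assume "p \<in> space (lebesgue_on ?Q)"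
          then have "p \<notin> ?R \<Longrightarrow> e n \<le> fst p" by (cases p) (auto simp: box_Pair not_less)
          then have "p \<notin> ?R \<Longrightarrow> ?k (e n) p = 0" using k0[of n p] by blast
          then show "?k (e n) p * \<phi> p * (V p - V0 (snd p)) = (if p \<in> ?R then ?g p * (V p - V0 (snd p)) else 0)"
            by (cases "p \<in> ?R") (simp_all only: if_True if_False mult_zero_left not_False_eq_True simp_thms)
        qed simp
        also have "\<dots> = (LINT p|lebesgue_on ?R. ?g p * (V p - V0 (snd p)))"
          by (rule integral_restrict[OF sub]) auto
        finally have "\<bar>I1 n\<bar> \<le> L2_norm ?R ?g * L2_norm ?R (\<lambda>p. V p - V0 (snd p))"
          using L2_Cauchy_Schwarz_real[OF gL L2R] by simp
        also have "L2_norm ?R ?g \<le> (2 * B * c1 / e n) * L2_norm ?R (\<lambda>_. 1::real)"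
        proof (rule L2_norm_bound)
          show "AE p in lebesgue_on ?R. norm (?g p) \<le> 2 * B * c1 / e n * norm (1::real)"
          proof (rule AE_I2)
            fix p assume "p \<in> space (lebesgue_on ?R)"
            then have "p \<in> cbox (0, a) (T, b)" using e[of n] by (auto simp: box_Pair cbox_Pair_eq)
            then have "\<bar>?k (e n) p\<bar> * \<bar>\<phi> p\<bar> \<le> (B * (2 / e n)) * c1"
            proof (intro mult_mono)
              have "?k (e n) p \<le> B * (2 / e n)" using B(1) e(1)[of n] by (intro mult_right_mono) auto
              then show "\<bar>?k (e n) p\<bar> \<le> B * (2 / e n)" using kn[of p n] by (simp only: abs_of_nonneg)
            qed (use B c1 e(1)[of n] in auto)
            then show "norm (?g p) \<le> 2 * B * c1 / e n * norm (1::real)" by (simp add: abs_mult mult_ac)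
          qed
        qed (use B c1 e[of n] in \<open>auto intro: continuous_L2\<close>)
        also have "L2_norm ?R (\<lambda>_. 1::real) = sqrt (e n * (b - a))"
        proof -
          have i: "integrable (lebesgue_on {a<..<b}) (\<lambda>_. 1::real)"
            "(LINT y|lebesgue_on {a<..<b}. 1::real) = b - a"
            using rectangle_integral[of a b "\<lambda>_. 1::real" "\<lambda>_. 1"] ab by auto
          show ?thesis unfolding L2_norm_def using integral_of_space_function(2)[OF i(1), of 0 "e n"] i(2) e[of n] by simp
        qed
        also have "L2_norm ?R (\<lambda>p. V p - V0 (snd p)) = sqrt (W (e n))" by (simp add: L2_norm_def W_def)
        finally have *: "\<bar>I1 n\<bar> \<le> 2 * B * c1 / e n * sqrt (e n * (b - a)) * sqrt (W (e n))"
          by (simp add: mult_right_mono[OF _ L2_norm_nonneg] W_def)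
        also have "\<dots> = 2 * B * c1 * sqrt (b - a) * (sqrt (W (e n)) * (sqrt (e n) / e n))"
          by (simp add: real_sqrt_mult)
        also have "sqrt (e n) / e n = 1 / sqrt (e n)" using e[of n] real_div_sqrt[of "e n"] by (simp add: field_simps)
        finally show ?thesis by (simp add: real_sqrt_divide)
      qed
      have "((\<lambda>n. W (e n) / e n) \<longlonglongrightarrow> 0)"
        using initial e_lim e(1) unfolding W_def
        by (intro filterlim_compose[OF initial]) (auto simp: filterlim_at less_imp_neq[OF e(1), symmetric])
      then have "(\<lambda>n. 2 * B * c1 * sqrt (b - a) * sqrt (W (e n) / e n)) \<longlonglongrightarrow> 2 * B * c1 * sqrt (b - a) * sqrt 0"
        by (intro tendsto_intros)
      then have lim: "(\<lambda>n. 2 * B * c1 * sqrt (b - a) * sqrt (W (e n) / e n)) \<longlonglongrightarrow> 0" by simp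
      have "\<forall>\<^sub>F n in sequentially. norm (I1 n) \<le> 2 * B * c1 * sqrt (b - a) * sqrt (W (e n) / e n)"
        unfolding real_norm_def by (rule always_eventually, rule allI, rule bound)
      from Lim_null_comparison[OF this lim] show ?thesis .
    qed
    have I2: "I2 \<longlonglongrightarrow> 0"
    proof -
      have bound: "\<bar>I2 n\<bar> \<le> c2 * e n * (LINT y|lebesgue_on {a<..<b}. \<bar>V0 y\<bar>)" for n
      proof -
        have "\<bar>I2 n\<bar> \<le> (LINT p|lebesgue_on ?Q. c2 * e n * (?k (e n) p * \<bar>V0 (snd p)\<bar>))"
          unfolding I2_def
        proof (rule integral_abs_bound[THEN order_trans], rule integral_mono)
          show "integrable (lebesgue_on ?Q) (\<lambda>p. \<bar>?k (e n) p * (\<phi> p - \<phi> (0, snd p)) * V0 (snd p)\<bar>)"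
            by (intro integrable_abs L2_mult_integrable[OF L V0L] continuous_intros Ck e C\<phi> C\<phi>')
          show "integrable (lebesgue_on ?Q) (\<lambda>p. c2 * e n * (?k (e n) p * \<bar>V0 (snd p)\<bar>))"
            unfolding box_Pair by (intro integrable_mult_right integral_product(1)[OF ki(2)[of n] integrable_abs[OF V0i]]) auto
          fix p assume p: "p \<in> space (lebesgue_on ?Q)"
          obtain s y where sy: "p = (s, y)" by (cases p)
          have s: "0 < s" "s < T" "a < y" "y < b" using p by (auto simp: box_Pair sy)
          show "\<bar>?k (e n) p * (\<phi> p - \<phi> (0, snd p)) * V0 (snd p)\<bar> \<le> c2 * e n * (?k (e n) p * \<bar>V0 (snd p)\<bar>)"
          proof (cases "e n \<le> s")
            case True
            then have "?k (e n) p = 0" using k0[of n p] sy by simp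
            then show ?thesis by (simp only: mult_zero_left mult_zero_right abs_zero order_refl)
          next
            case False
            have "norm (\<phi> (s, y) - \<phi> (0, y)) \<le> c2 * norm (s - 0)"
            proof (rule field_differentiable_bound[where S="{0..s}" and f="\<lambda>s. \<phi> (s, y)" and f'="\<lambda>s. pd (1, 0) \<phi> (s, y)"])
              show "((\<lambda>s. \<phi> (s, y)) has_field_derivative pd (1, 0) \<phi> (z, y)) (at z within {0..s})" for z
                using has_vector_derivative_along[OF \<phi>, of "(0, y)" "(1, 0)" z "{0..s}"]
                by (simp add: has_real_derivative_iff_has_vector_derivative)
              show "z \<in> {0..s} \<Longrightarrow> norm (pd (1, 0) \<phi> (z, y)) \<le> c2" for z
                using c2(1)[of "(z, y)"] s by (auto simp: cbox_Pair_eq)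
            qed (use s in auto)
            also have "\<dots> \<le> c2 * e n" using False s c2(2) by (intro mult_left_mono) auto
            finally have "\<bar>?k (e n) p\<bar> * \<bar>\<phi> p - \<phi> (0, snd p)\<bar> * \<bar>V0 (snd p)\<bar> \<le> ?k (e n) p * (c2 * e n) * \<bar>V0 (snd p)\<bar>"
            proof (intro mult_right_mono mult_mono)
              show "\<bar>?k (e n) p\<bar> \<le> ?k (e n) p" using kn[of p n] by (simp only: abs_of_nonneg order_refl)
              show "0 \<le> ?k (e n) p" by (rule kn)
            qed (use sy in auto)
            moreover have "?k (e n) p * (c2 * e n) * \<bar>V0 (snd p)\<bar> = c2 * e n * (?k (e n) p * \<bar>V0 (snd p)\<bar>)"
              by (simp only: mult_ac)
            ultimately show ?thesis by (simp only: abs_mult)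
          qed
        qed
        also have "\<dots> = c2 * e n * (LINT p|lebesgue_on ?Q. ?k (e n) p * \<bar>V0 (snd p)\<bar>)"
          by (rule integral_mult_right_zero)
        also have "(LINT p|lebesgue_on ?Q. ?k (e n) p * \<bar>V0 (snd p)\<bar>)
          = (LINT s|lebesgue_on {0<..<T}. bump (2 * s / e n - 1) * (2 / e n)) * (LINT y|lebesgue_on {a<..<b}. \<bar>V0 y\<bar>)"
          unfolding box_Pair by (rule integral_product(2)[OF ki(2) integrable_abs[OF V0i]]) auto
        also have "\<dots> = (LINT y|lebesgue_on {a<..<b}. \<bar>V0 y\<bar>)" by (simp only: ki(1) mult_1)
        finally show ?thesis .
      qed
      have "(\<lambda>n. c2 * e n * (LINT y|lebesgue_on {a<..<b}. \<bar>V0 y\<bar>)) \<longlonglongrightarrow> c2 * 0 * (LINT y|lebesgue_on {a<..<b}. \<bar>V0 y\<bar>)"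
        by (intro tendsto_intros e_lim)
      then have lim: "(\<lambda>n. c2 * e n * (LINT y|lebesgue_on {a<..<b}. \<bar>V0 y\<bar>)) \<longlonglongrightarrow> 0" by simp
      have "\<forall>\<^sub>F n in sequentially. norm (I2 n) \<le> c2 * e n * (LINT y|lebesgue_on {a<..<b}. \<bar>V0 y\<bar>)"
        unfolding real_norm_def by (rule always_eventually, rule allI, rule bound)
      from Lim_null_comparison[OF this lim] show ?thesis .
    qed
    show ?thesis unfolding split using tendsto_add[OF tendsto_add[OF I1 I2] tendsto_const] by simp
  qed
  have "(\<lambda>n. - (LINT p|lebesgue_on ?Q. ?k (e n) p * \<phi> p * V p) - (LINT p|lebesgue_on ?Q. \<kappa> (e n) (fst p) * ?D p * V p))
     \<longlonglongrightarrow> - (LINT y|lebesgue_on {a<..<b}. V0 y * \<phi> (0, y)) - (LINT p|lebesgue_on ?Q. 1 * ?D p * V p)"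
    by (intro tendsto_intros lim2 dom CD V)
  then have "(\<lambda>n. LINT p|lebesgue_on ?Q. \<kappa> (e n) (fst p) * \<phi> p * \<beta> p)
     \<longlonglongrightarrow> - (LINT y|lebesgue_on {a<..<b}. V0 y * \<phi> (0, y)) - (LINT p|lebesgue_on ?Q. 1 * ?D p * V p)"
    by (simp only: id[OF e(1)])
  from LIMSEQ_unique[OF dom[OF C\<phi> \<beta>] this] show ?thesis by simp
qed

section \<open>Functions on the space-time mesh\<close>

text \<open>The meshes in time and in space together; \<open>k\<close> is the polynomial degree.\<close>

locale spacetime_mesh = tm: partition t M + xm: partition x N
  for t :: "nat \<Rightarrow> real" and M and x :: "nat \<Rightarrow> real" and N +
  fixes h :: real and k :: nat
  assumes t0: "t 0 = 0" and h_pos: "0 < h" and t_step: "m \<in> {1..M} \<Longrightarrow> t m = t (m - 1) + h"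
    and x_step: "j \<in> {1..N} \<Longrightarrow> x j - x (j - 1) \<le> h" and k_pos: "1 \<le> k"
begin

abbreviation Q where "Q \<equiv> box (0, x 0) (t M, x N)"
abbreviation S where "S m \<equiv> box (t (m - 1), x 0) (t m, x N)"
abbreviation cell where "cell m j \<equiv> box (t (m - 1), x (j - 1)) (t m, x j)"
abbreviation ccell where "ccell m j \<equiv> cbox (t (m - 1), x (j - 1)) (t m, x j)"
abbreviation \<Omega> where "\<Omega> \<equiv> {x 0<..<x N}"

text \<open>The maximum only fixes a legal index for points outside of the domain.\<close>

definition cell_of :: "real \<Rightarrow> nat" where "cell_of y = max 1 (xm.elem y)"

definition assemble :: "(nat \<Rightarrow> nat \<Rightarrow> real \<times> real \<Rightarrow> real) \<Rightarrow> real \<times> real \<Rightarrow> real" where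
  "assemble F p = F (tm.elem (fst p)) (cell_of (snd p)) p"

definition slabwise :: "(nat \<Rightarrow> real \<Rightarrow> real) \<Rightarrow> real \<times> real \<Rightarrow> real" where
  "slabwise f p = f (tm.elem (fst p)) (snd p)"

lemma cell_of_eq: "j \<in> {1..N} \<Longrightarrow> x (j - 1) < y \<Longrightarrow> y \<le> x j \<Longrightarrow> cell_of y = j"
  using xm.elem_eq[of j y] by (auto simp: cell_of_def)

lemma cell_of_cases: "y \<in> \<Omega> \<Longrightarrow> cell_of y \<in> {1..N} \<and> x (cell_of y - 1) < y \<and> y \<le> x (cell_of y)"
  using xm.elem_props[of y] by (auto simp: cell_of_def max_def)

lemma ti_eq: "m \<in> {1..M} \<Longrightarrow> p \<in> S m \<Longrightarrow> tm.elem (fst p) = m"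
  by (rule tm.elem_eq) (auto simp: box_Pair)

lemma assemble_slab: "m \<in> {1..M} \<Longrightarrow> p \<in> S m \<Longrightarrow> assemble F p = F m (cell_of (snd p)) p"
  by (simp add: assemble_def ti_eq)

lemma cell_subset_S: "j \<in> {1..N} \<Longrightarrow> p \<in> cell m j \<Longrightarrow> p \<in> S m"
  using xm.cell_subset[of j] by (auto simp: box_Pair)

lemma assemble_cell: "m \<in> {1..M} \<Longrightarrow> j \<in> {1..N} \<Longrightarrow> p \<in> cell m j \<Longrightarrow> assemble F p = F m j p"
  using assemble_slab[OF _ cell_subset_S, of m j p F] cell_of_eq[of j "snd p"] by (auto simp: box_Pair)

lemma Q_columns: "box (t 0, x 0) (t M, x N) = Q" by (simp add: t0)

lemma S_subset_Q: "m \<in> {1..M} \<Longrightarrow> S m \<subseteq> Q"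
  using tm.cell_subset[of m] t0 by (auto simp: box_Pair)

lemma tM_pos: "0 < t M" using tm.x_less[of 0 M] tm.N_pos t0 by simp
lemma x_pos: "x 0 < x N" using xm.x_less[of 0 N] xm.N_pos by simp
lemma t_less: "m \<in> {1..M} \<Longrightarrow> t (m - 1) < t m" by (rule tm.x_inc)
lemma t_nonneg: "m \<le> M \<Longrightarrow> 0 \<le> t m" using tm.x_le[of 0 m] t0 by simp

lemma Q_slabs:
  fixes f :: "real \<times> real \<Rightarrow> real"
  assumes "\<And>m. m \<in> {1..M} \<Longrightarrow> integrable (lebesgue_on (S m)) f"
  shows "integrable (lebesgue_on Q) f" "(LINT p|lebesgue_on Q. f p) = (\<Sum>m=1..M. LINT p|lebesgue_on (S m). f p)"
  using tm.integral_over_columns[of "x 0" "x N" f] assms unfolding Q_columns by auto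

lemma Q_integral:
  fixes f :: "real \<times> real \<Rightarrow> real"
  assumes "\<And>m j. m \<in> {1..M} \<Longrightarrow> j \<in> {1..N} \<Longrightarrow> continuous_on UNIV (F m j)"
    and "\<And>m j p. m \<in> {1..M} \<Longrightarrow> j \<in> {1..N} \<Longrightarrow> p \<in> cell m j \<Longrightarrow> f p = F m j p"
  shows "integrable (lebesgue_on Q) f" "(LINT p|lebesgue_on Q. f p) = (\<Sum>m=1..M. \<Sum>j=1..N. integral (ccell m j) (F m j))"
proof -
  have *: "integrable (lebesgue_on (S m)) f" "(LINT p|lebesgue_on (S m). f p) = (\<Sum>j=1..N. integral (ccell m j) (F m j))"
    if "m \<in> {1..M}" for m
    using xm.slab_integral[of "F m" "t (m - 1)" "t m" f] assms that by auto
  show "integrable (lebesgue_on Q) f" by (rule Q_slabs(1)[OF *(1)])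
  show "(LINT p|lebesgue_on Q. f p) = (\<Sum>m=1..M. \<Sum>j=1..N. integral (ccell m j) (F m j))"
    by (subst Q_slabs(2)[OF *(1)]) (auto intro!: sum.cong *(2))
qed

lemma Q_L2:
  fixes f :: "real \<times> real \<Rightarrow> real"
  assumes "\<And>m j. m \<in> {1..M} \<Longrightarrow> j \<in> {1..N} \<Longrightarrow> continuous_on UNIV (F m j)"
    and "\<And>m j p. m \<in> {1..M} \<Longrightarrow> j \<in> {1..N} \<Longrightarrow> p \<in> cell m j \<Longrightarrow> f p = F m j p"
  shows "f \<in> L2 Q"
proof -
  have "integrable (lebesgue_on Q) (\<lambda>p. (norm (f p))\<^sup>2)"
    by (rule Q_integral(1)[where F="\<lambda>m j p. (norm (F m j p))\<^sup>2"]) (use assms in \<open>auto intro!: continuous_intros\<close>)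
  then show ?thesis using Q_integral(1)[OF assms] by (auto simp: L2_def)
qed

lemma assemble_L2:
  assumes "\<And>m j. m \<in> {1..M} \<Longrightarrow> j \<in> {1..N} \<Longrightarrow> continuous_on UNIV (F m j)"
  shows "assemble F \<in> L2 Q"
  by (rule Q_L2[where F=F]) (auto intro: assms assemble_cell)

lemma L2_slab_of_Q:
  fixes f :: "real \<times> real \<Rightarrow> real"
  shows "f \<in> L2 Q \<Longrightarrow> m \<in> {1..M} \<Longrightarrow> f \<in> L2 (S m)"
  by (rule L2_subset) (auto intro: S_subset_Q[THEN subsetD])

lemma slabwise_L2:
  assumes "\<And>m. m \<in> {1..M} \<Longrightarrow> f m \<in> L2 \<Omega>"
  shows "slabwise f \<in> L2 Q"
proof -
  have *: "integrable (lebesgue_on (S m)) (slabwise f)" "integrable (lebesgue_on (S m)) (\<lambda>p. (norm (slabwise f p))\<^sup>2)"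
    if m: "m \<in> {1..M}" for m
  proof -
    have L: "(\<lambda>p. f m (snd p)) \<in> L2 (S m)"
      by (rule L2_of_space_function[OF assms[OF m]]) (use t_less[OF m] in simp)
    have e: "slabwise f p = f m (snd p)" if "p \<in> S m" for p
      using ti_eq[OF m that] by (simp add: slabwise_def)
    have "integrable (lebesgue_on (S m)) (slabwise f) = integrable (lebesgue_on (S m)) (\<lambda>p. f m (snd p))"
      by (intro Bochner_Integration.integrable_cong) (auto simp: e)
    moreover have "integrable (lebesgue_on (S m)) (\<lambda>p. (norm (slabwise f p))\<^sup>2) = integrable (lebesgue_on (S m)) (\<lambda>p. (norm (f m (snd p)))\<^sup>2)"
      by (intro Bochner_Integration.integrable_cong) (auto simp: e)
    ultimately show "integrable (lebesgue_on (S m)) (slabwise f)" "integrable (lebesgue_on (S m)) (\<lambda>p. (norm (slabwise f p))\<^sup>2)"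
      using L2_integrable[OF L] L2_integrable_square[OF L] by auto
  qed
  show ?thesis
    using Q_slabs(1)[OF *(1)] Q_slabs(1)[OF *(2)] by (auto simp: L2_def)
qed

lemma slabwise_mult_integral:
  assumes "\<And>m. m \<in> {1..M} \<Longrightarrow> f m \<in> L2 \<Omega>" "\<And>m. m \<in> {1..M} \<Longrightarrow> g m \<in> L2 \<Omega>"
  shows "(LINT p|lebesgue_on Q. slabwise f p * slabwise g p) = h * (\<Sum>m=1..M. LINT y|lebesgue_on \<Omega>. f m y * g m y)"
proof -
  have int: "integrable (lebesgue_on (S m)) (\<lambda>p. slabwise f p * slabwise g p)" if "m \<in> {1..M}" for m
    using L2_mult_integrable[OF L2_slab_of_Q L2_slab_of_Q, OF slabwise_L2 _ slabwise_L2] assms that by blast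
  have "(LINT p|lebesgue_on (S m). slabwise f p * slabwise g p) = h * (LINT y|lebesgue_on \<Omega>. f m y * g m y)" if m: "m \<in> {1..M}" for m
  proof -
    have i: "integrable (lebesgue_on \<Omega>) (\<lambda>y. f m y * g m y)" by (intro L2_mult_integrable assms m)
    have "(LINT p|lebesgue_on (S m). slabwise f p * slabwise g p) = (LINT p|lebesgue_on (S m). f m (snd p) * g m (snd p))"
      using ti_eq[OF m] by (intro Bochner_Integration.integral_cong) (auto simp: slabwise_def)
    also have "\<dots> = (t m - t (m - 1)) * (LINT y|lebesgue_on \<Omega>. f m y * g m y)"
      by (rule integral_of_space_function(2)[OF i]) (use t_less[OF m] in simp)
    finally show ?thesis using t_step[OF m] by simp
  qed
  then show ?thesis by (subst Q_slabs(2)[OF int]) (auto simp: sum_distrib_left)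
qed

text \<open>A polynomial in the local coordinates of an element, which run over the unit square.\<close>

definition loc :: "nat \<Rightarrow> nat \<Rightarrow> (nat \<Rightarrow> nat \<Rightarrow> real) \<Rightarrow> real \<times> real \<Rightarrow> real" where
  "loc m j c p = tensor k c ((fst p - t (m - 1)) / h) ((snd p - x (j - 1)) / (x j - x (j - 1)))"

lemma Ck_loc: "Ck n (loc m j c)"
  unfolding loc_def[abs_def] by (rule Ck_tensor)

lemma slice_continuous: "Ck n F \<Longrightarrow> continuous_on S' (\<lambda>y. F (s, y))"
  by (rule continuous_on_compose2[of UNIV F]) (auto intro: Ck_continuous intro!: continuous_intros)

lemma slice_continuous_t: "Ck n F \<Longrightarrow> continuous_on S' (\<lambda>s. F (s, y))"
  by (rule continuous_on_compose2[of UNIV F]) (auto intro: Ck_continuous intro!: continuous_intros)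

text \<open>A member of the discrete space, given together with its polynomial pieces.\<close>

definition discrete :: "(real \<times> real \<Rightarrow> real) \<Rightarrow> (nat \<Rightarrow> nat \<Rightarrow> real \<times> real \<Rightarrow> real) \<Rightarrow> bool" where
  "discrete g G \<longleftrightarrow> (\<forall>m\<in>{1..M}. \<forall>j\<in>{1..N}. (\<exists>c. G m j = loc m j c)
       \<and> (\<forall>s\<in>{t (m - 1)<..t m}. \<forall>y\<in>{x (j - 1)..x j}. g (s, y) = G m j (s, y)))
     \<and> (\<forall>m\<in>{1..M}. \<forall>s\<in>{t (m - 1)<..t m}. g (s, x 0) = 0 \<and> g (s, x N) = 0)"

lemma discrete_Ck: "discrete g G \<Longrightarrow> m \<in> {1..M} \<Longrightarrow> j \<in> {1..N} \<Longrightarrow> Ck n (G m j)"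
  unfolding discrete_def using Ck_loc by metis

lemma discrete_piecewise: "discrete g G \<Longrightarrow> m \<in> {1..M} \<Longrightarrow> xm.piecewise (t (m - 1)) (t m) g (G m)"
  using discrete_Ck[of g G m _ 1] unfolding xm.piecewise_def discrete_def by simp

lemma discrete_eq:
  "discrete g G \<Longrightarrow> m \<in> {1..M} \<Longrightarrow> j \<in> {1..N} \<Longrightarrow> s \<in> {t (m - 1)<..t m} \<Longrightarrow> y \<in> {x (j - 1)..x j} \<Longrightarrow> g (s, y) = G m j (s, y)"
  unfolding discrete_def by blast

lemma discrete_zero:
  "discrete g G \<Longrightarrow> m \<in> {1..M} \<Longrightarrow> s \<in> {t (m - 1)<..t m} \<Longrightarrow> g (s, x 0) = 0 \<and> g (s, x N) = 0"
  unfolding discrete_def by blast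

text \<open>Only the nodes have to be checked: matching there makes the assembled function single-valued on closed
  elements.\<close>

lemma discreteI:
  assumes loc: "\<And>m j. m \<in> {1..M} \<Longrightarrow> j \<in> {1..N} \<Longrightarrow> \<exists>c. G m j = loc m j c"
    and node: "\<And>m j s. m \<in> {1..M} \<Longrightarrow> j \<in> {1..N} \<Longrightarrow> Suc j \<le> N \<Longrightarrow> s \<in> {t (m - 1)<..t m} \<Longrightarrow> G m j (s, x j) = G m (Suc j) (s, x j)"
    and bd: "\<And>m s. m \<in> {1..M} \<Longrightarrow> s \<in> {t (m - 1)<..t m} \<Longrightarrow> G m 1 (s, x 0) = 0 \<and> G m N (s, x N) = 0"
  shows "discrete (assemble G) G"
proof -
  have eq: "assemble G (s, y) = G m j (s, y)" if m: "m \<in> {1..M}" and j: "j \<in> {1..N}" and s: "s \<in> {t (m - 1)<..t m}" and y: "y \<in> {x (j - 1)..x j}" for m j s y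
  proof -
    have tm: "tm.elem s = m" using tm.elem_eq[OF m, of s] s by simp
    show ?thesis
    proof (cases "x (j - 1) < y")
      case True
      then show ?thesis using cell_of_eq[OF j, of y] y tm by (simp add: assemble_def)
    next
      case False
      then have y: "y = x (j - 1)" using y by simp
      show ?thesis
      proof (cases "j = 1")
        case True
        then have "xm.elem y = 0" unfolding xm.elem_def using y by (intro Least_eq_0) simp
        then show ?thesis using True tm by (simp add: assemble_def cell_of_def)
      next
        case False
        then obtain i where i: "j = Suc i" "i \<in> {1..N}" "Suc i \<le> N" using j by (cases j) auto
        then have "cell_of y = i" using y xm.x_inc[OF i(2)] by (intro cell_of_eq) auto
        then show ?thesis using node[OF m i(2,3) s] y i tm by (simp add: assemble_def)
      qed
    qed
  qed
  have b: "assemble G (s, x 0) = 0 \<and> assemble G (s, x N) = 0" if m: "m \<in> {1..M}" and s: "s \<in> {t (m - 1)<..t m}" for m s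
    using eq[OF m _ s, of 1 "x 0"] eq[OF m _ s, of N "x N"] bd[OF m s] xm.N_pos xm.x_inc[of 1] xm.x_inc[of N] by auto
  show ?thesis unfolding discrete_def using loc eq b by blast
qed

lemma discrete_boundary:
  assumes "discrete g G" "m \<in> {1..M}" "s \<in> {t (m - 1)..t m}"
  shows "G m 1 (s, x 0) = 0" "G m N (s, x N) = 0"
proof -
  have N: "1 \<in> {1..N}" "N \<in> {1..N}" using xm.N_pos by auto
  have Wh_coeff: "closure {t (m - 1)<..<t m} = {t (m - 1)..t m}" using t_less[OF assms(2)] by simp
  have z: "G m 1 (s, x 0) = 0 \<and> G m N (s, x N) = 0" if s: "s \<in> {t (m - 1)<..t m}" for s
  proof -
    have "g (s, x 0) = G m 1 (s, x 0)" "g (s, x N) = G m N (s, x N)"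
      using discrete_eq[OF assms(1,2) N(1) s, of "x 0"] discrete_eq[OF assms(1,2) N(2) s, of "x N"]
        xm.x_inc[OF N(1)] xm.x_inc[OF N(2)] by auto
    then show ?thesis using discrete_zero[OF assms(1,2) s] by simp
  qed
  show "G m 1 (s, x 0) = 0"
    by (rule continuous_constant_on_closure[of "{t (m - 1)<..<t m}" "\<lambda>s. G m 1 (s, x 0)"])
      (use z assms Wh_coeff slice_continuous_t[OF discrete_Ck[OF assms(1,2) N(1)]] in auto)
  show "G m N (s, x N) = 0"
    by (rule continuous_constant_on_closure[of "{t (m - 1)<..<t m}" "\<lambda>s. G m N (s, x N)"])
      (use z assms Wh_coeff slice_continuous_t[OF discrete_Ck[OF assms(1,2) N(2)]] in auto)
qed

definition trace :: "(nat \<Rightarrow> nat \<Rightarrow> real \<times> real \<Rightarrow> real) \<Rightarrow> nat \<Rightarrow> real \<Rightarrow> real \<Rightarrow> real" where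
  "trace F m s y = F m (cell_of y) (s, y)"

lemma trace_L2:
  assumes "\<And>j. j \<in> {1..N} \<Longrightarrow> Ck 0 (F m j)"
  shows "trace F m s \<in> L2 \<Omega>"
  by (rule xm.cells_L2[where F="\<lambda>j y. F m j (s, y)"]) (use cell_of_eq slice_continuous[OF assms] in \<open>auto simp: trace_def\<close>)

lemma trace_mult_integral:
  assumes "\<And>j. j \<in> {1..N} \<Longrightarrow> Ck 0 (F m j)" "\<And>j. j \<in> {1..N} \<Longrightarrow> Ck 0 (G m j)"
  shows "(LINT y|lebesgue_on \<Omega>. trace F m s y * trace G m s y) = (\<Sum>j=1..N. integral {x (j - 1)..x j} (\<lambda>y. F m j (s, y) * G m j (s, y)))"
  by (rule xm.cells_integral(2)[where F="\<lambda>j y. F m j (s, y) * G m j (s, y)"])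
    (use cell_of_eq slice_continuous[OF assms(1)] slice_continuous[OF assms(2)] in \<open>auto simp: trace_def intro!: continuous_intros\<close>)

text \<open>Integration by parts on one slab for piecewise smooth functions; there is no boundary term in space
  because \<open>u\<close> vanishes at both ends.\<close>

lemma slab_Green:
  assumes U: "discrete u U" and W: "m \<in> {1..M}" "xm.piecewise (t (m - 1)) (t m) w (W m)"
  shows "(LINT p|lebesgue_on (S m). (assemble (\<lambda>m j. pd (1, 0) (U m j)) p + \<sigma> * assemble (\<lambda>m j. pd (0, 1) (U m j)) p) * assemble W p)
    + (LINT p|lebesgue_on (S m). assemble U p * (assemble (\<lambda>m j. pd (1, 0) (W m j)) p + \<sigma> * assemble (\<lambda>m j. pd (0, 1) (W m j)) p))
    = (LINT y|lebesgue_on \<Omega>. trace U m (t m) y * trace W m (t m) y)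
      - (LINT y|lebesgue_on \<Omega>. trace U m (t (m - 1)) y * trace W m (t (m - 1)) y)"
proof -
  note CU = discrete_Ck[OF U W(1)]
  note CW = xm.piecewise_Ck[OF W(2)]
  note pw = xm.piecewise_mult[OF discrete_piecewise[OF U W(1)] W(2)]
  let ?F = "\<lambda>j p. U m j p * W m j p"
  have N: "1 \<in> {1..N}" "N \<in> {1..N}" using xm.N_pos by auto
  have Gx: "(LINT p|lebesgue_on (S m). xm.glue (\<lambda>j. pd (0, 1) (?F j)) p) = 0"
  proof -
    have "integral {t (m - 1)..t m} (\<lambda>s. U m N (s, x N) * W m N (s, x N)) = 0"
      "integral {t (m - 1)..t m} (\<lambda>s. U m 1 (s, x 0) * W m 1 (s, x 0)) = 0"
      using discrete_boundary[OF U W(1)] by (auto intro!: integral_unique has_integral_is_0)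
    then show ?thesis using xm.piecewise_Green_x[OF pw t_less[OF W(1)]] by simp
  qed
  have C0: "j \<in> {1..N} \<Longrightarrow> Ck 0 (W m j)" for j
    by (rule Ck_mono[of 0 1, OF _ CW]) auto
  have Gt: "(LINT p|lebesgue_on (S m). xm.glue (\<lambda>j. pd (1, 0) (?F j)) p)
     = (LINT y|lebesgue_on \<Omega>. trace U m (t m) y * trace W m (t m) y)
      - (LINT y|lebesgue_on \<Omega>. trace U m (t (m - 1)) y * trace W m (t (m - 1)) y)"
    using xm.piecewise_Green_t[OF pw less_imp_le[OF t_less[OF W(1)]]]
      trace_mult_integral[of U m W "t m", OF CU C0] trace_mult_integral[of U m W "t (m - 1)", OF CU C0] by simp
  have L: "assemble F \<in> L2 (S m)" if "\<And>j. j \<in> {1..N} \<Longrightarrow> continuous_on UNIV (F m j)" for F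
    by (rule xm.slab_L2[where F="F m"]) (auto intro: that assemble_cell W(1))
  have LL: "assemble U \<in> L2 (S m)" "assemble W \<in> L2 (S m)" "assemble (\<lambda>m j. pd d (U m j)) \<in> L2 (S m)" "assemble (\<lambda>m j. pd d (W m j)) \<in> L2 (S m)" for d
    by (intro L Ck_continuous[OF CU] Ck_continuous[OF CW] Ck_pd CU CW; assumption)+
  have gi: "integrable (lebesgue_on (S m)) (xm.glue (\<lambda>j. pd d (?F j)))" for d
    by (rule xm.slab_integral(1)[where F="\<lambda>j. pd d (?F j)"]) (auto intro!: Ck_pd Ck_mult CU CW xm.glue_eq)
  have prod: "xm.glue (\<lambda>j. pd d (?F j)) p = assemble U p * assemble (\<lambda>m j. pd d (W m j)) p + assemble (\<lambda>m j. pd d (U m j)) p * assemble W p" if p: "p \<in> S m" for d p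
  proof -
    have "snd p \<in> \<Omega>" using p by (auto simp: box_Pair)
    then have j: "cell_of (snd p) \<in> {1..N}" "xm.elem (snd p) = cell_of (snd p)"
      using cell_of_cases[of "snd p"] xm.elem_props[of "snd p"] by (auto simp: cell_of_def)
    show ?thesis unfolding assemble_slab[OF W(1) p] xm.glue_def j(2) by (rule pd_mult[OF CU[OF j(1)] CW[OF j(1)]])
  qed
  let ?A = "\<lambda>p. (assemble (\<lambda>m j. pd (1, 0) (U m j)) p + \<sigma> * assemble (\<lambda>m j. pd (0, 1) (U m j)) p) * assemble W p"
  let ?B = "\<lambda>p. assemble U p * (assemble (\<lambda>m j. pd (1, 0) (W m j)) p + \<sigma> * assemble (\<lambda>m j. pd (0, 1) (W m j)) p)"
  have iA: "integrable (lebesgue_on (S m)) ?A" "integrable (lebesgue_on (S m)) ?B"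
    by (intro L2_mult_integrable L2_add L2_cmult LL)+
  have "(LINT p|lebesgue_on (S m). ?A p) + (LINT p|lebesgue_on (S m). ?B p) = (LINT p|lebesgue_on (S m). ?A p + ?B p)"
    using iA by simp
  also have "\<dots> = (LINT p|lebesgue_on (S m). xm.glue (\<lambda>j. pd (1, 0) (?F j)) p + \<sigma> * xm.glue (\<lambda>j. pd (0, 1) (?F j)) p)"
    by (rule Bochner_Integration.integral_cong[OF refl]) (simp add: prod algebra_simps)
  also have "\<dots> = (LINT p|lebesgue_on (S m). xm.glue (\<lambda>j. pd (1, 0) (?F j)) p) + \<sigma> * (LINT p|lebesgue_on (S m). xm.glue (\<lambda>j. pd (0, 1) (?F j)) p)"
    using gi by simp
  finally show ?thesis using Gx Gt by simp
qed

lemma cell_bound_L2: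
  assumes "\<And>m j. m \<in> {1..M} \<Longrightarrow> j \<in> {1..N} \<Longrightarrow> continuous_on UNIV (F m j)"
    and "\<And>m j p. m \<in> {1..M} \<Longrightarrow> j \<in> {1..N} \<Longrightarrow> p \<in> ccell m j \<Longrightarrow> (F m j p)\<^sup>2 \<le> B m j"
  shows "(L2_norm Q (assemble F))\<^sup>2 \<le> (\<Sum>m=1..M. \<Sum>j=1..N. B m j * (h * (x j - x (j - 1))))"
proof -
  have "(L2_norm Q (assemble F))\<^sup>2 = (\<Sum>m=1..M. \<Sum>j=1..N. integral (ccell m j) (\<lambda>p. (F m j p)\<^sup>2))"
    unfolding L2_norm_square
    by (rule Q_integral(2)) (use assms(1) in \<open>auto intro!: continuous_intros simp: assemble_cell\<close>)
  also have "\<dots> \<le> (\<Sum>m=1..M. \<Sum>j=1..N. B m j * (h * (x j - x (j - 1))))"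
  proof (intro sum_mono)
    fix m j assume mj: "m \<in> {1..M}" "j \<in> {1..N}"
    have "integral (ccell m j) (\<lambda>p. (F m j p)\<^sup>2) \<le> integral (ccell m j) (\<lambda>p. B m j)"
      by (rule integral_le)
        (use assms mj in \<open>auto intro!: integrable_continuous continuous_intros continuous_on_subset[OF assms(1)]\<close>)
    also have "\<dots> = B m j * (h * (x j - x (j - 1)))"
      using t_less[OF mj(1)] xm.x_inc[OF mj(2)] t_step[OF mj(1)] by (simp add: content_Pair)
    finally show "integral (ccell m j) (\<lambda>p. (F m j p)\<^sup>2) \<le> B m j * (h * (x j - x (j - 1)))" .
  qed
  finally show ?thesis .
qed

end

context spacetime_mesh begin

lemma discrete_assemble:
  assumes "discrete g G" "z \<in> Q"
  shows "g z = assemble G z"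
proof -
  obtain s y where z: "z = (s, y)" by (cases z)
  have s: "t 0 < s" "s \<le> t M" and y: "y \<in> \<Omega>" using assms(2) t0 by (auto simp: z box_Pair)
  note m = tm.elem_props[OF s]
  note j = cell_of_cases[OF y]
  have "g (s, y) = G (tm.elem s) (cell_of y) (s, y)"
    by (rule discrete_eq[OF assms(1) m(1)]) (use m j in auto)
  then show ?thesis by (simp add: z assemble_def)
qed

definition jump :: "(real \<Rightarrow> real) \<Rightarrow> (nat \<Rightarrow> nat \<Rightarrow> real \<times> real \<Rightarrow> real) \<Rightarrow> nat \<Rightarrow> real \<Rightarrow> real" where
  "jump V0 F m y = trace F m (t (m - 1)) y - (if m = 1 then V0 y else trace F (m - 1) (t (m - 1)) y)"

end

section \<open>Local stability of the scheme next to the inflow boundary\<close>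

text \<open>What is left of the scheme after contraction with a characteristic vector: \<open>U\<close> is the
  discrete solution, \<open>r\<close> its residual in the transport equation, and \<open>p\<close>, \<open>q\<close>
  are the residuals that the stabilization tests with the space and time derivatives. The jumps enter as functions
  that are constant in time on each slab, whence the factor \<open>1 / h\<close>.\<close>

locale scalar_scheme = spacetime_mesh +
  fixes \<sigma> \<delta> :: real and U :: "nat \<Rightarrow> nat \<Rightarrow> real \<times> real \<Rightarrow> real" and V0 :: "real \<Rightarrow> real"
    and \<beta> r p q :: "real \<times> real \<Rightarrow> real"
  assumes \<sigma>: "\<sigma> = 1 \<or> \<sigma> = -1" and \<delta>: "0 \<le> \<delta>"
    and U: "discrete (assemble U) U" and V0: "V0 \<in> L2 {x 0<..<x N}"
    and \<beta>L: "\<beta> \<in> L2 Q" and rL: "r \<in> L2 Q" and pL: "p \<in> L2 Q" and qL: "q \<in> L2 Q"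
    and r_eq: "AE z in lebesgue_on Q. r z = \<beta> z - (assemble (\<lambda>m j. pd (1, 0) (U m j)) z + \<sigma> * assemble (\<lambda>m j. pd (0, 1) (U m j)) z)"
    and orth: "\<And>g G. discrete g G \<Longrightarrow>
      (LINT z|lebesgue_on Q. r z * assemble G z) + \<delta> * (LINT z|lebesgue_on Q. p z * assemble (\<lambda>m j. pd (0, 1) (G m j)) z)
        + \<delta> * (LINT z|lebesgue_on Q. q z * assemble (\<lambda>m j. pd (1, 0) (G m j)) z)
      = 1 / h * (LINT z|lebesgue_on Q. slabwise (jump V0 U) z * slabwise (\<lambda>m. trace G m (t (m - 1))) z)"
begin

abbreviation J where "J \<equiv> slabwise (jump V0 U)"
abbreviation Ut where "Ut \<equiv> assemble (\<lambda>m j. pd (1, 0) (U m j))"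
abbreviation Ux where "Ux \<equiv> assemble (\<lambda>m j. pd (0, 1) (U m j))"

lemma CU: "m \<in> {1..M} \<Longrightarrow> j \<in> {1..N} \<Longrightarrow> Ck n (U m j)"
  by (rule discrete_Ck[OF U])

lemma jump_L2: "m \<in> {1..M} \<Longrightarrow> jump V0 U m \<in> L2 \<Omega>"
proof -
  assume m: "m \<in> {1..M}"
  have a: "trace U m (t (m - 1)) \<in> L2 \<Omega>" by (rule trace_L2) (rule CU[OF m])
  show ?thesis
  proof (cases "m = 1")
    case True
    then show ?thesis using L2_diff[OF a V0] by (simp add: jump_def[abs_def])
  next
    case False
    then have "m - 1 \<in> {1..M}" using m by auto
    then have "trace U (m - 1) (t (m - 1)) \<in> L2 \<Omega>" by (intro trace_L2 CU)
    then show ?thesis using L2_diff[OF a] False by (simp add: jump_def[abs_def])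
  qed
qed

lemma JL: "J \<in> L2 Q" by (rule slabwise_L2[OF jump_L2])

end

text \<open>A weight \<open>\<psi>\<close> that is affine on every element: on the elements where it does not vanish its
  slope is \<open>- \<sigma>\<close>, and the data vanish there.\<close>

locale weighted_scheme = scalar_scheme +
  fixes \<psi> :: "real \<Rightarrow> real" and sl :: "nat \<Rightarrow> real"
  assumes sl: "j \<in> {1..N} \<Longrightarrow> sl j = 0 \<or> sl j = - \<sigma>"
    and \<psi>_affine: "j \<in> {1..N} \<Longrightarrow> y \<in> {x (j - 1)..x j} \<Longrightarrow> \<psi> y = \<psi> (x (j - 1)) + sl j * (y - x (j - 1))"
    and \<psi>_zero: "j \<in> {1..N} \<Longrightarrow> sl j = 0 \<Longrightarrow> y \<in> {x (j - 1)..x j} \<Longrightarrow> \<psi> y = 0"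
    and \<psi>_nonneg: "0 \<le> \<psi> y"
    and data0: "AE z in lebesgue_on Q. sl (cell_of (snd z)) \<noteq> 0 \<longrightarrow> \<beta> z = 0 \<and> p z * Ux z + q z * Ut z \<le> 0"
    and V00: "y \<in> {x 0<..<x N} \<Longrightarrow> sl (cell_of y) \<noteq> 0 \<Longrightarrow> V0 y = 0"
begin

text \<open>The affine extension of \<open>\<psi>\<close> from one element to the plane.\<close>

definition \<Psi> :: "nat \<Rightarrow> real \<times> real \<Rightarrow> real" where
  "\<Psi> j z = \<psi> (x (j - 1)) + sl j * (snd z - x (j - 1))"

text \<open>The indicator of the elements that carry the weight.\<close>

definition strip :: "nat \<Rightarrow> real" where "strip j = (if sl j = 0 then 0 else 1)"

abbreviation U_strip where "U_strip \<equiv> assemble (\<lambda>m j z. strip j * U m j z)"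

lemma \<Psi>_eq: "j \<in> {1..N} \<Longrightarrow> y \<in> {x (j - 1)..x j} \<Longrightarrow> \<Psi> j (s, y) = \<psi> y"
  unfolding \<Psi>_def snd_conv by (rule \<psi>_affine[symmetric])

lemma \<Psi>_0: "j \<in> {1..N} \<Longrightarrow> sl j = 0 \<Longrightarrow> \<Psi> j z = 0"
  using \<psi>_zero[of j "x (j - 1)"] xm.x_inc[of j] by (simp add: \<Psi>_def)

lemma Ck_\<Psi>: "Ck n (\<Psi> j)"
  unfolding \<Psi>_def[abs_def] by (intro Ck_add Ck_mult Ck_diff Ck_const Ck_snd)

lemma pd_\<Psi>: "pd d (\<Psi> j) z = sl j * snd d"
  unfolding \<Psi>_def[abs_def] by (rule pd_eqI) (auto intro!: derivative_eq_intros)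

lemma sl_\<sigma>: "j \<in> {1..N} \<Longrightarrow> \<sigma> * sl j = - strip j" "j \<in> {1..N} \<Longrightarrow> \<bar>sl j\<bar> = strip j"
  using sl[of j] \<sigma> by (auto simp: strip_def)

lemma strip_sq: "strip j * strip j = strip j" "0 \<le> strip j" by (auto simp: strip_def)

lemma \<Psi>_strip: "j \<in> {1..N} \<Longrightarrow> strip j * \<Psi> j z = \<Psi> j z"
  using \<Psi>_0 by (auto simp: strip_def)

abbreviation W where "W \<equiv> \<lambda>m j z. \<Psi> j z * U m j z"

lemma CW: "m \<in> {1..M} \<Longrightarrow> j \<in> {1..N} \<Longrightarrow> Ck n (W m j)"
  by (intro Ck_mult Ck_\<Psi> CU)

lemma W_piecewise: "m \<in> {1..M} \<Longrightarrow> xm.piecewise (t (m - 1)) (t m) (\<lambda>z. \<psi> (snd z) * assemble U z) (W m)"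
  using CW[of m _ 1] \<Psi>_eq discrete_eq[OF U] unfolding xm.piecewise_def by simp

lemma traces:
  assumes "y \<in> \<Omega>"
  shows "trace W m s y = \<psi> y * trace U m s y"
  using cell_of_cases[OF assms] \<Psi>_eq[of "cell_of y" y s] by (simp add: trace_def)

text \<open>The weighted energies at the ends of the slabs telescope; at each node the jump term completes the square
  \<open>\<psi> (U\<^sub>+ - U\<^sub>-)\<^sup>2 / 2\<close>.\<close>

lemma time_terms_nonneg:
  "0 \<le> (\<Sum>m=1..M. 1/2 * (LINT y|lebesgue_on \<Omega>. trace U m (t m) y * trace W m (t m) y)
      - 1/2 * (LINT y|lebesgue_on \<Omega>. trace U m (t (m - 1)) y * trace W m (t (m - 1)) y)
      + (LINT y|lebesgue_on \<Omega>. jump V0 U m y * trace W m (t (m - 1)) y))"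
proof -
  (* Half the weighted energy at time t m; at time 0 it vanishes because V0 does so on the strip. *)
  define e where "e m = (if m = 0 then 0 else 1/2 * (LINT y|lebesgue_on \<Omega>. trace U m (t m) y * trace W m (t m) y))" for m
  have LU: "trace U m s \<in> L2 \<Omega>" and LW: "trace W m s \<in> L2 \<Omega>" if "m \<in> {1..M}" for m s
    using that by (auto intro!: trace_L2 CU CW)
  have iUW: "integrable (lebesgue_on \<Omega>) (\<lambda>y. trace U m s y * trace W m s' y)" if "m \<in> {1..M}" for m s s'
    by (rule L2_mult_integrable[OF LU[OF that] LW[OF that]])
  have e0: "0 \<le> e m" if "m \<le> M" for m
  proof (cases "m = 0")
    case False
    have "0 \<le> (LINT y|lebesgue_on \<Omega>. trace U m (t m) y * trace W m (t m) y)"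
      by (rule integral_nonneg_AE, rule AE_I2) (use \<psi>_nonneg in \<open>simp add: traces mult.left_commute\<close>)
    then show ?thesis using False by (simp add: e_def)
  qed (simp add: e_def)
  have step: "e m - e (m - 1) \<le> 1/2 * (LINT y|lebesgue_on \<Omega>. trace U m (t m) y * trace W m (t m) y)
      - 1/2 * (LINT y|lebesgue_on \<Omega>. trace U m (t (m - 1)) y * trace W m (t (m - 1)) y)
      + (LINT y|lebesgue_on \<Omega>. jump V0 U m y * trace W m (t (m - 1)) y)" if m: "m \<in> {1..M}" for m
  proof -
    have iJ: "integrable (lebesgue_on \<Omega>) (\<lambda>y. jump V0 U m y * trace W m (t (m - 1)) y)"
      by (rule L2_mult_integrable[OF jump_L2[OF m] LW[OF m]])
    have "1/2 * (LINT y|lebesgue_on \<Omega>. trace U m (t (m - 1)) y * trace W m (t (m - 1)) y)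
       - (LINT y|lebesgue_on \<Omega>. jump V0 U m y * trace W m (t (m - 1)) y) \<le> e (m - 1)"
    proof -
      have "1/2 * (LINT y|lebesgue_on \<Omega>. trace U m (t (m - 1)) y * trace W m (t (m - 1)) y)
       - (LINT y|lebesgue_on \<Omega>. jump V0 U m y * trace W m (t (m - 1)) y)
        = (LINT y|lebesgue_on \<Omega>. 1/2 * (trace U m (t (m - 1)) y * trace W m (t (m - 1)) y) - jump V0 U m y * trace W m (t (m - 1)) y)"
        using iUW[OF m] iJ by simp
      also have "\<dots> \<le> (LINT y|lebesgue_on \<Omega>. (if m = 1 then 0 else 1/2 * (trace U (m - 1) (t (m - 1)) y * trace W (m - 1) (t (m - 1)) y)))"
      proof (rule integral_mono)
        show "integrable (lebesgue_on \<Omega>) (\<lambda>y. 1/2 * (trace U m (t (m - 1)) y * trace W m (t (m - 1)) y) - jump V0 U m y * trace W m (t (m - 1)) y)"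
          using iUW[OF m] iJ by simp
        show "integrable (lebesgue_on \<Omega>) (\<lambda>y. if m = 1 then 0 else 1/2 * (trace U (m - 1) (t (m - 1)) y * trace W (m - 1) (t (m - 1)) y))"
        proof (cases "m = 1")
          case False
          then have "m - 1 \<in> {1..M}" using m by auto
          from iUW[OF this] False show ?thesis by simp
        qed simp
        fix y assume "y \<in> space (lebesgue_on \<Omega>)"
        then have y: "y \<in> \<Omega>" by simp
        define a where "a = trace U m (t (m - 1)) y"
        define b where "b = trace U (m - 1) (t (m - 1)) y"
        have V: "\<psi> y * V0 y = 0"
        proof (cases "sl (cell_of y) = 0")
          case True
          then show ?thesis using \<psi>_zero[of "cell_of y" y] cell_of_cases[OF y] by auto
        qed (use V00[OF y] in auto)
        have sq: "1/2 * (a * (\<psi> y * a)) - (a - b) * (\<psi> y * a) \<le> 1/2 * (b * (\<psi> y * b))" for a b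
        proof -
          have "0 \<le> 1/2 * (\<psi> y * ((a - b) * (a - b)))" using \<psi>_nonneg[of y] by simp
          then show ?thesis by (simp add: algebra_simps)
        qed
        have z: "1/2 * (a * (\<psi> y * a)) - (a - V0 y) * (\<psi> y * a) \<le> 0"
        proof -
          have "(a - V0 y) * (\<psi> y * a) = \<psi> y * (a * a) - (\<psi> y * V0 y) * a" by (simp add: algebra_simps)
          also have "\<dots> = \<psi> y * (a * a)" using V by simp
          finally have "1/2 * (a * (\<psi> y * a)) - (a - V0 y) * (\<psi> y * a) = - (1/2 * (\<psi> y * (a * a)))" by (simp add: algebra_simps)
          also have "\<dots> \<le> 0" using \<psi>_nonneg[of y] by simp
          finally show ?thesis .
        qed
        show "1/2 * (trace U m (t (m - 1)) y * trace W m (t (m - 1)) y) - jump V0 U m y * trace W m (t (m - 1)) y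
          \<le> (if m = 1 then 0 else 1/2 * (trace U (m - 1) (t (m - 1)) y * trace W (m - 1) (t (m - 1)) y))"
          unfolding traces[OF y] jump_def a_def[symmetric] b_def[symmetric] using sq[of a b] z by (cases "m = 1") simp_all
      qed
      also have "\<dots> = e (m - 1)" using m by (auto simp: e_def)
      finally show ?thesis .
    qed
    moreover have "e m = 1/2 * (LINT y|lebesgue_on \<Omega>. trace U m (t m) y * trace W m (t m) y)" using m by (auto simp: e_def)
    ultimately show ?thesis by linarith
  qed
  have "e M - e 0 = (\<Sum>m=1..M. e m - e (m - 1))"
  proof -
    have "(\<Sum>m=1..n. e m - e (m - 1)) = e n - e 0" for n by (induction n) auto
    then show ?thesis by simp
  qed
  also have "\<dots> \<le> (\<Sum>m=1..M. 1/2 * (LINT y|lebesgue_on \<Omega>. trace U m (t m) y * trace W m (t m) y)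
      - 1/2 * (LINT y|lebesgue_on \<Omega>. trace U m (t (m - 1)) y * trace W m (t (m - 1)) y)
      + (LINT y|lebesgue_on \<Omega>. jump V0 U m y * trace W m (t (m - 1)) y))"
    by (rule sum_mono) (rule step)
  finally show ?thesis using e0[of M] by (simp add: e_def)
qed

lemma assemble_pull: "assemble (\<lambda>m j z. F m j z + G m j z) z = assemble F z + assemble G z"
  "assemble (\<lambda>m j z. F m j z - G m j z) z = assemble F z - assemble G z"
  "assemble (\<lambda>m j z. F m j z * G m j z) z = assemble F z * assemble G z"
  by (simp_all add: assemble_def)

lemma assemble_cong_Q:
  assumes "\<And>m j. m \<in> {1..M} \<Longrightarrow> j \<in> {1..N} \<Longrightarrow> F m j z = G m j z" "z \<in> Q"
  shows "assemble F z = assemble G z"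
proof -
  have "tm.elem (fst z) \<in> {1..M}" "cell_of (snd z) \<in> {1..N}"
    using assms(2) tm.elem_props[of "fst z"] cell_of_cases[of "snd z"] t0 by (auto simp: box_Pair)
  then show ?thesis using assms(1) by (simp add: assemble_def)
qed

text \<open>Since \<open>\<sigma> \<psi>\<^sub>x = - 1\<close> on the strip, differentiating the weight produces the
  square of the norm of \<open>U\<close> there.\<close>

lemma energy_identity:
  "2 * (LINT z|lebesgue_on Q. (Ut z + \<sigma> * Ux z) * assemble W z) = (L2_norm Q U_strip)\<^sup>2
    + (\<Sum>m=1..M. (LINT y|lebesgue_on \<Omega>. trace U m (t m) y * trace W m (t m) y)
      - (LINT y|lebesgue_on \<Omega>. trace U m (t (m - 1)) y * trace W m (t (m - 1)) y))"
proof -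
  have LU: "Ut \<in> L2 Q" "Ux \<in> L2 Q" "assemble W \<in> L2 Q" "U_strip \<in> L2 Q" "assemble U \<in> L2 Q"
    by (intro assemble_L2 Ck_pd CU Ck_continuous[OF CU] Ck_continuous[OF CW] continuous_on_mult continuous_on_const; assumption)+
  have iW: "integrable (lebesgue_on Q) (\<lambda>z. (Ut z + \<sigma> * Ux z) * assemble W z)"
    by (intro L2_mult_integrable L2_add L2_cmult LU)
  have iS: "integrable (lebesgue_on Q) (\<lambda>z. U_strip z * U_strip z)" by (intro L2_mult_integrable LU)
  have slabI: "2 * (LINT z|lebesgue_on (S m). (Ut z + \<sigma> * Ux z) * assemble W z) - (LINT z|lebesgue_on (S m). U_strip z * U_strip z)
     = (LINT y|lebesgue_on \<Omega>. trace U m (t m) y * trace W m (t m) y)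
      - (LINT y|lebesgue_on \<Omega>. trace U m (t (m - 1)) y * trace W m (t (m - 1)) y)" if m: "m \<in> {1..M}" for m
  proof -
    have SQ: "z \<in> S m \<Longrightarrow> z \<in> Q" for z using S_subset_Q[OF m] by blast
    have "assemble (\<lambda>m j. pd (1, 0) (W m j)) z + \<sigma> * assemble (\<lambda>m j. pd (0, 1) (W m j)) z
        = assemble (\<lambda>m j z. \<Psi> j z * (pd (1, 0) (U m j) z + \<sigma> * pd (0, 1) (U m j) z) - strip j * U m j z) z" if z: "z \<in> Q" for z
    proof -
      have a: "assemble (\<lambda>m j. pd (1, 0) (W m j)) z = assemble (\<lambda>m j z. \<Psi> j z * pd (1, 0) (U m j) z) z"
        by (rule assemble_cong_Q[OF _ z]) (simp add: pd_mult[OF Ck_\<Psi> CU] pd_\<Psi>)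
      have b: "assemble (\<lambda>m j. pd (0, 1) (W m j)) z = assemble (\<lambda>m j z. \<Psi> j z * pd (0, 1) (U m j) z + sl j * U m j z) z"
        by (rule assemble_cong_Q[OF _ z]) (simp add: pd_mult[OF Ck_\<Psi> CU] pd_\<Psi>)
      have "cell_of (snd z) \<in> {1..N}" using z cell_of_cases[of "snd z"] by (auto simp: box_Pair)
      note s = sl_\<sigma>(1)[OF this]
      have alg: "P * a + \<sigma> * (P * b + l * u) = P * (a + \<sigma> * b) - i * u" if "\<sigma> * l = - i" for P a b l u i
      proof -
        have "\<sigma> * (l * u) = - (i * u)" using that by (metis mult.assoc mult_minus_left)
        then show ?thesis by (simp add: algebra_simps)
      qed
      show ?thesis unfolding a b unfolding assemble_def by (rule alg[OF s])
    qed
    moreover have "assemble U z * assemble (\<lambda>m j z. \<Psi> j z * (pd (1, 0) (U m j) z + \<sigma> * pd (0, 1) (U m j) z) - strip j * U m j z) z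
       = (Ut z + \<sigma> * Ux z) * assemble W z - U_strip z * U_strip z" for z
    proof -
      have alg: "u * (P * D - i * u) = D * (P * u) - i * u * (i * u)" if "i * i = i" for u P D i :: real
      proof -
        have "i * u * (i * u) = (i * i) * u * u" by (simp only: mult_ac)
        then show ?thesis using that by (simp add: algebra_simps)
      qed
      show ?thesis unfolding assemble_def by (rule alg[OF strip_sq(1)])
    qed
    ultimately have "assemble U z * (assemble (\<lambda>m j. pd (1, 0) (W m j)) z + \<sigma> * assemble (\<lambda>m j. pd (0, 1) (W m j)) z)
       = (Ut z + \<sigma> * Ux z) * assemble W z - U_strip z * U_strip z" if "z \<in> S m" for z
      using SQ[OF that] by simp
    then have "(LINT z|lebesgue_on (S m). assemble U z * (assemble (\<lambda>m j. pd (1, 0) (W m j)) z + \<sigma> * assemble (\<lambda>m j. pd (0, 1) (W m j)) z))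
       = (LINT z|lebesgue_on (S m). (Ut z + \<sigma> * Ux z) * assemble W z - U_strip z * U_strip z)"
      by (intro Bochner_Integration.integral_cong) auto
    also have "\<dots> = (LINT z|lebesgue_on (S m). (Ut z + \<sigma> * Ux z) * assemble W z) - (LINT z|lebesgue_on (S m). U_strip z * U_strip z)"
      using integrable_subset[OF iW S_subset_Q[OF m]] integrable_subset[OF iS S_subset_Q[OF m]] by simp
    finally show ?thesis using slab_Green[where W=W and U=U and \<sigma>=\<sigma>, OF U m W_piecewise[OF m]] by simp
  qed
  have "(LINT z|lebesgue_on Q. (Ut z + \<sigma> * Ux z) * assemble W z) = (\<Sum>m=1..M. LINT z|lebesgue_on (S m). (Ut z + \<sigma> * Ux z) * assemble W z)"
    by (rule Q_slabs(2)) (intro integrable_subset[OF iW S_subset_Q]; simp)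
  moreover have "(LINT z|lebesgue_on Q. U_strip z * U_strip z) = (\<Sum>m=1..M. LINT z|lebesgue_on (S m). U_strip z * U_strip z)"
    by (rule Q_slabs(2)) (intro integrable_subset[OF iS S_subset_Q]; simp)
  moreover have "(L2_norm Q U_strip)\<^sup>2 = (LINT z|lebesgue_on Q. U_strip z * U_strip z)"
    unfolding L2_norm_square by (simp add: power2_eq_square)
  ultimately have "2 * (LINT z|lebesgue_on Q. (Ut z + \<sigma> * Ux z) * assemble W z) - (L2_norm Q U_strip)\<^sup>2
     = (\<Sum>m=1..M. 2 * (LINT z|lebesgue_on (S m). (Ut z + \<sigma> * Ux z) * assemble W z) - (LINT z|lebesgue_on (S m). U_strip z * U_strip z))"
    by (simp add: sum_subtractf sum_distrib_left)
  also have "\<dots> = (\<Sum>m=1..M. (LINT y|lebesgue_on \<Omega>. trace U m (t m) y * trace W m (t m) y)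
      - (LINT y|lebesgue_on \<Omega>. trace U m (t (m - 1)) y * trace W m (t (m - 1)) y))"
    by (rule sum.cong[OF refl slabI])
  finally show ?thesis by simp
qed

text \<open>A discrete test function \<open>G\<close> close to \<open>W = \<psi> U\<close> bounds the solution on the
  strip. There \<open>\<beta> = 0\<close>, so \<open>- r\<close> is the transport operator applied to \<open>U\<close>
  and \<open>energy_identity\<close> applies; the weighted stabilization term has a good sign by the hypothesis on
  \<open>p\<close> and \<open>q\<close>, and all terms with \<open>R = W - G\<close> are absorbed through its bounds
  by \<open>U\<close>.\<close>

lemma weighted_energy_bound:
  assumes G: "discrete g G" and GR: "\<And>m j z. m \<in> {1..M} \<Longrightarrow> j \<in> {1..N} \<Longrightarrow> G m j z = W m j z - R m j z"
    and CR: "\<And>m j n. m \<in> {1..M} \<Longrightarrow> j \<in> {1..N} \<Longrightarrow> Ck n (R m j)"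
    and R0: "L2_norm Q (assemble R) \<le> h * B * L2_norm Q U_strip"
    and Rt: "L2_norm Q (assemble (\<lambda>m j. pd (1, 0) (R m j))) \<le> B * L2_norm Q U_strip"
    and Rx: "L2_norm Q (assemble (\<lambda>m j. pd (0, 1) (R m j))) \<le> B * L2_norm Q U_strip"
    and Rtr: "L2_norm Q (slabwise (\<lambda>m. trace R m (t (m - 1)))) \<le> h * B * L2_norm Q U_strip"
    and B: "0 \<le> B"
  shows "L2_norm Q U_strip \<le> 2 * (h * B * L2_norm Q r + \<delta> * (B + 1) * (L2_norm Q p + L2_norm Q q) + B * L2_norm Q J)"
proof -
  let ?n = "L2_norm Q U_strip"
  let ?Rx = "assemble (\<lambda>m j. pd (0, 1) (R m j))" and ?Rt = "assemble (\<lambda>m j. pd (1, 0) (R m j))"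
  let ?tR = "slabwise (\<lambda>m. trace R m (t (m - 1)))" and ?tW = "slabwise (\<lambda>m. trace W m (t (m - 1)))"
  let ?P = "assemble (\<lambda>m. \<Psi>)" and ?sU = "assemble (\<lambda>m j z. sl j * U m j z)"
  note CG = discrete_Ck[OF G]
  have LU: "Ut \<in> L2 Q" "Ux \<in> L2 Q" "assemble W \<in> L2 Q" "U_strip \<in> L2 Q" "assemble U \<in> L2 Q" "?sU \<in> L2 Q"
    by (intro assemble_L2 Ck_pd CU Ck_continuous[OF CU] Ck_continuous[OF CW] continuous_on_mult continuous_on_const; assumption)+
  have LPU: "(\<lambda>z. ?P z * Ux z) \<in> L2 Q" "(\<lambda>z. ?P z * Ut z) \<in> L2 Q"
    unfolding assemble_pull(3)[symmetric]
    by (intro assemble_L2 continuous_on_mult Ck_continuous[OF Ck_\<Psi>] Ck_pd CU; assumption)+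
  have LR: "assemble R \<in> L2 Q" "?Rx \<in> L2 Q" "?Rt \<in> L2 Q"
    by (intro assemble_L2 Ck_pd CR Ck_continuous[OF CR]; assumption)+
  have LT: "?tR \<in> L2 Q" "?tW \<in> L2 Q"
    by (intro slabwise_L2 trace_L2 CR CW; assumption)+
  have eqG: "assemble G z = assemble W z - assemble R z" if "z \<in> Q" for z
    using assemble_cong_Q[OF _ that, of G "\<lambda>m j z. W m j z - R m j z"] GR by (simp add: assemble_pull)
  have G_fun: "G m j = (\<lambda>z. W m j z - R m j z)" if "m \<in> {1..M}" "j \<in> {1..N}" for m j
    using GR that by auto
  have eqx: "assemble (\<lambda>m j. pd (0, 1) (G m j)) z = ?P z * Ux z + ?sU z - ?Rx z" if "z \<in> Q" for z
  proof -
    have "assemble (\<lambda>m j. pd (0, 1) (G m j)) z = assemble (\<lambda>m j z. \<Psi> j z * pd (0, 1) (U m j) z + sl j * U m j z - pd (0, 1) (R m j) z) z"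
      by (rule assemble_cong_Q[OF _ that]) (simp add: G_fun pd_diff[OF CW CR] pd_mult[OF Ck_\<Psi> CU] pd_\<Psi>)
    then show ?thesis by (simp add: assemble_pull)
  qed
  have eqt: "assemble (\<lambda>m j. pd (1, 0) (G m j)) z = ?P z * Ut z - ?Rt z" if "z \<in> Q" for z
  proof -
    have "assemble (\<lambda>m j. pd (1, 0) (G m j)) z = assemble (\<lambda>m j z. \<Psi> j z * pd (1, 0) (U m j) z - pd (1, 0) (R m j) z) z"
      by (rule assemble_cong_Q[OF _ that]) (simp add: G_fun pd_diff[OF CW CR] pd_mult[OF Ck_\<Psi> CU] pd_\<Psi>)
    then show ?thesis by (simp add: assemble_pull)
  qed
  have eqtr: "slabwise (\<lambda>m. trace G m (t (m - 1))) z = ?tW z - ?tR z" if "z \<in> Q" for z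
  proof -
    have "tm.elem (fst z) \<in> {1..M}" "cell_of (snd z) \<in> {1..N}"
      using that tm.elem_props[of "fst z"] cell_of_cases[of "snd z"] t0 by (auto simp: box_Pair)
    then show ?thesis by (simp add: slabwise_def trace_def GR)
  qed
  have I1: "(LINT z|lebesgue_on Q. r z * assemble G z) = (LINT z|lebesgue_on Q. r z * assemble W z) - (LINT z|lebesgue_on Q. r z * assemble R z)"
  proof -
    have "(LINT z|lebesgue_on Q. r z * assemble G z) = (LINT z|lebesgue_on Q. r z * assemble W z - r z * assemble R z)"
      by (intro Bochner_Integration.integral_cong) (auto simp: eqG right_diff_distrib)
    then show ?thesis using L2_mult_integrable[OF rL LU(3)] L2_mult_integrable[OF rL LR(1)] by simp
  qed
  have I2: "(LINT z|lebesgue_on Q. p z * assemble (\<lambda>m j. pd (0, 1) (G m j)) z) + (LINT z|lebesgue_on Q. q z * assemble (\<lambda>m j. pd (1, 0) (G m j)) z)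
     = (LINT z|lebesgue_on Q. ?P z * (p z * Ux z + q z * Ut z)) + (LINT z|lebesgue_on Q. p z * ?sU z)
       - (LINT z|lebesgue_on Q. p z * ?Rx z) - (LINT z|lebesgue_on Q. q z * ?Rt z)"
  proof -
    note i = L2_mult_integrable[OF pL LPU(1)] L2_mult_integrable[OF qL LPU(2)] L2_mult_integrable[OF pL LU(6)]
      L2_mult_integrable[OF pL LR(2)] L2_mult_integrable[OF qL LR(3)]
    have "(LINT z|lebesgue_on Q. p z * assemble (\<lambda>m j. pd (0, 1) (G m j)) z) = (LINT z|lebesgue_on Q. p z * (?P z * Ux z) + p z * ?sU z - p z * ?Rx z)"
      by (intro Bochner_Integration.integral_cong) (auto simp: eqx algebra_simps)
    also have "\<dots> = (LINT z|lebesgue_on Q. p z * (?P z * Ux z)) + (LINT z|lebesgue_on Q. p z * ?sU z) - (LINT z|lebesgue_on Q. p z * ?Rx z)"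
      using i by simp
    finally have a: "(LINT z|lebesgue_on Q. p z * assemble (\<lambda>m j. pd (0, 1) (G m j)) z) = \<dots>" .
    have "(LINT z|lebesgue_on Q. q z * assemble (\<lambda>m j. pd (1, 0) (G m j)) z) = (LINT z|lebesgue_on Q. q z * (?P z * Ut z) - q z * ?Rt z)"
      by (intro Bochner_Integration.integral_cong) (auto simp: eqt algebra_simps)
    also have "\<dots> = (LINT z|lebesgue_on Q. q z * (?P z * Ut z)) - (LINT z|lebesgue_on Q. q z * ?Rt z)"
      using i by simp
    finally have b: "(LINT z|lebesgue_on Q. q z * assemble (\<lambda>m j. pd (1, 0) (G m j)) z) = \<dots>" .
    have "(LINT z|lebesgue_on Q. ?P z * (p z * Ux z + q z * Ut z)) = (LINT z|lebesgue_on Q. p z * (?P z * Ux z) + q z * (?P z * Ut z))"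
      by (intro Bochner_Integration.integral_cong) (auto simp: algebra_simps)
    also have "\<dots> = (LINT z|lebesgue_on Q. p z * (?P z * Ux z)) + (LINT z|lebesgue_on Q. q z * (?P z * Ut z))" using i by simp
    finally show ?thesis using a b by simp
  qed
  have I3: "(LINT z|lebesgue_on Q. J z * slabwise (\<lambda>m. trace G m (t (m - 1))) z)
     = (LINT z|lebesgue_on Q. J z * ?tW z) - (LINT z|lebesgue_on Q. J z * ?tR z)"
  proof -
    have "(LINT z|lebesgue_on Q. J z * slabwise (\<lambda>m. trace G m (t (m - 1))) z) = (LINT z|lebesgue_on Q. J z * ?tW z - J z * ?tR z)"
      by (intro Bochner_Integration.integral_cong) (auto simp: eqtr right_diff_distrib)
    then show ?thesis using L2_mult_integrable[OF JL LT(1)] L2_mult_integrable[OF JL LT(2)] by simp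
  qed
  have I4: "(LINT z|lebesgue_on Q. J z * ?tW z) = h * (\<Sum>m=1..M. LINT y|lebesgue_on \<Omega>. jump V0 U m y * trace W m (t (m - 1)) y)"
    by (rule slabwise_mult_integral[OF jump_L2]) (assumption, intro trace_L2 CW)
  have I5: "(LINT z|lebesgue_on Q. r z * assemble W z) = - (LINT z|lebesgue_on Q. (Ut z + \<sigma> * Ux z) * assemble W z)"
  proof -
    have "(LINT z|lebesgue_on Q. r z * assemble W z) = (LINT z|lebesgue_on Q. - ((Ut z + \<sigma> * Ux z) * assemble W z))"
    proof (rule integral_cong_AE)
      show "(\<lambda>z. r z * assemble W z) \<in> borel_measurable (lebesgue_on Q)"
        by (rule borel_measurable_integrable[OF L2_mult_integrable[OF rL LU(3)]])
      show "(\<lambda>z. - ((Ut z + \<sigma> * Ux z) * assemble W z)) \<in> borel_measurable (lebesgue_on Q)"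
        by (intro borel_measurable_integrable integrable_minus L2_mult_integrable L2_add L2_cmult LU)
      have inQ: "AE z in lebesgue_on Q. z \<in> Q" by (intro AE_I2) simp
      show "AE z in lebesgue_on Q. r z * assemble W z = - ((Ut z + \<sigma> * Ux z) * assemble W z)"
        using r_eq data0 inQ
      proof eventually_elim
        case (elim z)
        have j: "cell_of (snd z) \<in> {1..N}" using elim(3) cell_of_cases[of "snd z"] by (auto simp: box_Pair)
        show ?case
        proof (cases "sl (cell_of (snd z)) = 0")
          case True
          then have "assemble W z = 0" using \<Psi>_0[OF j True] by (simp add: assemble_def)
          then show ?thesis by simp
        next
          case False
          then have "r z = - (Ut z + \<sigma> * Ux z)" using elim(1,2) by simp
          then show ?thesis by (simp only: mult_minus_left)
        qed
      qed
    qed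
    then show ?thesis by simp
  qed
  have I6: "(LINT z|lebesgue_on Q. ?P z * (p z * Ux z + q z * Ut z)) \<le> 0"
  proof -
    have inQ: "AE z in lebesgue_on Q. z \<in> Q" by (intro AE_I2) simp
    have "AE z in lebesgue_on Q. 0 \<le> - (?P z * (p z * Ux z + q z * Ut z))"
      using data0 inQ
    proof eventually_elim
      case (elim z)
      have j: "cell_of (snd z) \<in> {1..N}" "snd z \<in> {x (cell_of (snd z) - 1)..x (cell_of (snd z))}"
        using elim(2) cell_of_cases[of "snd z"] by (auto simp: box_Pair)
      show ?case
      proof (cases "sl (cell_of (snd z)) = 0")
        case True
        then show ?thesis using \<Psi>_0[OF j(1) True] by (simp add: assemble_def)
      next
        case False
        have "0 \<le> ?P z" using \<psi>_nonneg[of "snd z"] \<Psi>_eq[OF j, of "fst z"] by (simp add: assemble_def)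
        then show ?thesis using False elim(1) by (simp add: mult_nonneg_nonpos)
      qed
    qed
    from integral_nonneg_AE[OF this] show ?thesis by simp
  qed
  have T: "0 \<le> 1/2 * (\<Sum>m=1..M. (LINT y|lebesgue_on \<Omega>. trace U m (t m) y * trace W m (t m) y)
      - (LINT y|lebesgue_on \<Omega>. trace U m (t (m - 1)) y * trace W m (t (m - 1)) y))
      + (\<Sum>m=1..M. LINT y|lebesgue_on \<Omega>. jump V0 U m y * trace W m (t (m - 1)) y)"
    using time_terms_nonneg by (simp add: sum.distrib sum_subtractf sum_distrib_left right_diff_distrib)
  have sU: "L2_norm Q ?sU \<le> 1 * ?n"
  proof (rule L2_norm_bound[OF LU(4)], rule AE_I2)
    fix z assume "z \<in> space (lebesgue_on Q)"
    then have "cell_of (snd z) \<in> {1..N}" using cell_of_cases[of "snd z"] by (auto simp: box_Pair)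
    from sl_\<sigma>(2)[OF this] strip_sq(2) show "norm (?sU z) \<le> 1 * norm (U_strip z)" by (simp add: assemble_def abs_mult)
  qed simp
  note n0 = L2_norm_nonneg
  have cs: "\<bar>LINT z|lebesgue_on Q. f z * w z\<bar> \<le> L2_norm Q f * (K * ?n)" if "f \<in> L2 Q" "w \<in> L2 Q" "L2_norm Q w \<le> K * ?n" for f w :: "real \<times> real \<Rightarrow> real" and K
    using order_trans[OF L2_Cauchy_Schwarz_real[OF that(1,2)] mult_left_mono[OF that(3) n0]] .
  have b1: "\<bar>LINT z|lebesgue_on Q. r z * assemble R z\<bar> \<le> L2_norm Q r * (h * B * ?n)" by (rule cs[OF rL LR(1) R0])
  have b2: "\<bar>LINT z|lebesgue_on Q. p z * ?sU z\<bar> \<le> L2_norm Q p * (1 * ?n)" by (rule cs[OF pL LU(6) sU])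
  have b3: "\<bar>LINT z|lebesgue_on Q. p z * ?Rx z\<bar> \<le> L2_norm Q p * (B * ?n)" by (rule cs[OF pL LR(2) Rx])
  have b4: "\<bar>LINT z|lebesgue_on Q. q z * ?Rt z\<bar> \<le> L2_norm Q q * (B * ?n)" by (rule cs[OF qL LR(3) Rt])
  have b5: "\<bar>LINT z|lebesgue_on Q. J z * ?tR z\<bar> \<le> L2_norm Q J * (h * B * ?n)" by (rule cs[OF JL LT(1) Rtr])
  define X where "X = (\<Sum>m=1..M. LINT y|lebesgue_on \<Omega>. jump V0 U m y * trace W m (t (m - 1)) y)"
  define A0 where "A0 = (LINT z|lebesgue_on Q. (Ut z + \<sigma> * Ux z) * assemble W z)"
  define A1 where "A1 = (LINT z|lebesgue_on Q. r z * assemble R z)"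
  define A2 where "A2 = (LINT z|lebesgue_on Q. p z * ?sU z)"
  define A3 where "A3 = (LINT z|lebesgue_on Q. p z * ?Rx z)"
  define A4 where "A4 = (LINT z|lebesgue_on Q. q z * ?Rt z)"
  define A5 where "A5 = (LINT z|lebesgue_on Q. J z * ?tR z)"
  define A6 where "A6 = (LINT z|lebesgue_on Q. ?P z * (p z * Ux z + q z * Ut z))"
  have orth': "- A0 - A1 + \<delta> * (A6 + A2 - A3 - A4) = 1 / h * (h * X - A5)"
  proof -
    have "(LINT z|lebesgue_on Q. r z * assemble G z) + \<delta> * ((LINT z|lebesgue_on Q. p z * assemble (\<lambda>m j. pd (0, 1) (G m j)) z)
        + (LINT z|lebesgue_on Q. q z * assemble (\<lambda>m j. pd (1, 0) (G m j)) z))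
      = 1 / h * (LINT z|lebesgue_on Q. J z * slabwise (\<lambda>m. trace G m (t (m - 1))) z)"
      using orth[OF G] by (simp only: distrib_left add.assoc)
    then show ?thesis
      unfolding I1 I2 I3 I4 I5 A0_def[symmetric] A1_def[symmetric] A2_def[symmetric] A3_def[symmetric]
        A4_def[symmetric] A5_def[symmetric] A6_def[symmetric] X_def[symmetric] .
  qed
  have "1 / h * (h * X - A5) = X - A5 / h" using h_pos by (simp add: field_simps)
  then have o2: "A0 = - A1 + \<delta> * A6 + \<delta> * A2 - \<delta> * A3 - \<delta> * A4 - X + A5 / h"
    using orth' by (simp add: algebra_simps)
  have "1/2 * ?n\<^sup>2 \<le> - A1 + \<delta> * A6 + \<delta> * A2 - \<delta> * A3 - \<delta> * A4 + A5 / h"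
  proof -
    define Y where "Y = (\<Sum>m=1..M. (LINT y|lebesgue_on \<Omega>. trace U m (t m) y * trace W m (t m) y)
      - (LINT y|lebesgue_on \<Omega>. trace U m (t (m - 1)) y * trace W m (t (m - 1)) y))"
    have "2 * A0 = ?n\<^sup>2 + Y" using energy_identity unfolding A0_def Y_def .
    moreover have "0 \<le> 1/2 * Y + X" using T unfolding X_def Y_def .
    ultimately show ?thesis using o2 by linarith
  qed
  also have "\<dots> \<le> \<bar>A1\<bar> + \<delta> * \<bar>A2\<bar> + \<delta> * \<bar>A3\<bar> + \<delta> * \<bar>A4\<bar> + \<bar>A5\<bar> / h"
  proof -
    have "\<delta> * A6 \<le> 0" using I6 \<delta> unfolding A6_def by (rule mult_nonneg_nonpos[rotated])
    moreover have "\<delta> * A2 \<le> \<delta> * \<bar>A2\<bar>" "\<delta> * (- A3) \<le> \<delta> * \<bar>A3\<bar>" "\<delta> * (- A4) \<le> \<delta> * \<bar>A4\<bar>"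
      using \<delta> by (intro mult_left_mono; simp)+
    moreover have "A5 / h \<le> \<bar>A5\<bar> / h" using h_pos by (intro divide_right_mono) auto
    ultimately show ?thesis by simp
  qed
  also have "\<dots> \<le> L2_norm Q r * (h * B * ?n) + \<delta> * (L2_norm Q p * (1 * ?n)) + \<delta> * (L2_norm Q p * (B * ?n))
     + \<delta> * (L2_norm Q q * (B * ?n)) + L2_norm Q J * (h * B * ?n) / h"
    using b1 b2 b3 b4 b5 \<delta> h_pos unfolding A1_def A2_def A3_def A4_def A5_def
    by (intro add_mono mult_left_mono divide_right_mono) auto
  also have "\<dots> \<le> ?n * (h * B * L2_norm Q r + \<delta> * (B + 1) * (L2_norm Q p + L2_norm Q q) + B * L2_norm Q J)"
  proof -
    have "L2_norm Q J * (h * B * ?n) / h = ?n * (B * L2_norm Q J)" using h_pos by simp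
    moreover have "0 \<le> ?n * (\<delta> * L2_norm Q q)" using n0 \<delta> by (intro mult_nonneg_nonneg) auto
    ultimately show ?thesis by (simp add: algebra_simps)
  qed
  finally have fin: "1/2 * ?n\<^sup>2 \<le> ?n * (h * B * L2_norm Q r + \<delta> * (B + 1) * (L2_norm Q p + L2_norm Q q) + B * L2_norm Q J)" .
  show ?thesis
  proof (cases "?n = 0")
    case True
    then show ?thesis using n0 h_pos B \<delta> by (auto intro!: add_nonneg_nonneg mult_nonneg_nonneg)
  next
    case False
    then have "0 < ?n" using n0[of Q U_strip] by simp
    then have "?n * ?n \<le> ?n * (2 * (h * B * L2_norm Q r + \<delta> * (B + 1) * (L2_norm Q p + L2_norm Q q) + B * L2_norm Q J))"
      using fin by (simp add: power2_eq_square algebra_simps)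
    then show ?thesis using \<open>0 < ?n\<close> by (rule mult_left_le_imp_le)
  qed
qed

end

text \<open>Multiplication by the local coordinate, with the term of excess degree split off.\<close>

lemma sum_shift_power:
  fixes u :: "nat \<Rightarrow> real"
  shows "(\<Sum>b\<le>k. (if 1 \<le> b then u (b - 1) else 0) * w ^ b) = w * (\<Sum>b\<le>k. u b * w ^ b) - u k * w ^ Suc k"
  by (induction k) (auto simp: algebra_simps)

context weighted_scheme begin

definition U_coeff :: "nat \<Rightarrow> nat \<Rightarrow> nat \<Rightarrow> nat \<Rightarrow> real" where
  "U_coeff m j = (SOME c. U m j = loc m j c)"

lemma U_eq_loc: "m \<in> {1..M} \<Longrightarrow> j \<in> {1..N} \<Longrightarrow> U m j = loc m j (U_coeff m j)"
  using U unfolding discrete_def U_coeff_def by (metis (mono_tags, lifting) someI_ex)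

abbreviation l where "l j \<equiv> x j - x (j - 1)"

lemma l_pos: "j \<in> {1..N} \<Longrightarrow> 0 < l j" using xm.x_inc by simp

definition Rf :: "nat \<Rightarrow> nat \<Rightarrow> real \<Rightarrow> real" where
  "Rf m j s = (\<Sum>a\<le>k. U_coeff m j a k * ((s - t (m - 1)) / h) ^ a)"

text \<open>The factor \<open>w ^ (k + 1) - w ^ k\<close> in the local coordinate \<open>w\<close> cancels the term of
  degree \<open>k + 1\<close> in \<open>\<psi> U\<close> and vanishes at both nodes, so that the corrected function
  stays continuous.\<close>

definition Rg :: "nat \<Rightarrow> real \<Rightarrow> real" where
  "Rg j y = sl j * l j * (((y - x (j - 1)) / l j) ^ Suc k - ((y - x (j - 1)) / l j) ^ k)"

definition R :: "nat \<Rightarrow> nat \<Rightarrow> real \<times> real \<Rightarrow> real" where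
  "R m j z = Rf m j (fst z) * Rg j (snd z)"

text \<open>The product \<open>\<psi> U\<close> with its power of degree \<open>k + 1\<close> in space lowered to
  degree \<open>k\<close>.\<close>

definition G :: "nat \<Rightarrow> nat \<Rightarrow> real \<times> real \<Rightarrow> real" where
  "G m j = loc m j (\<lambda>a b. \<psi> (x (j - 1)) * U_coeff m j a b
     + sl j * l j * ((if 1 \<le> b then U_coeff m j a (b - 1) else 0) + (if b = k then U_coeff m j a k else 0)))"

lemma G_eq:
  assumes "m \<in> {1..M}" "j \<in> {1..N}"
  shows "G m j z = W m j z - R m j z"
proof -
  define \<tau> where "\<tau> = (fst z - t (m - 1)) / h"
  define \<xi> where "\<xi> = (snd z - x (j - 1)) / l j"
  let ?c = "U_coeff m j" and ?P = "\<psi> (x (j - 1))" and ?L = "sl j * l j"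
  have inner: "(\<Sum>b\<le>k. (?P * ?c a b + ?L * ((if 1 \<le> b then ?c a (b - 1) else 0) + (if b = k then ?c a k else 0))) * \<tau> ^ a * \<xi> ^ b)
     = (?P + ?L * \<xi>) * (\<Sum>b\<le>k. ?c a b * \<tau> ^ a * \<xi> ^ b) - ?c a k * \<tau> ^ a * (?L * (\<xi> ^ Suc k - \<xi> ^ k))" for a
  proof -
    have "(\<Sum>b\<le>k. (if b = k then ?c a k else 0) * \<xi> ^ b) = ?c a k * \<xi> ^ k"
    proof -
      have "(\<Sum>b\<le>k. (if b = k then ?c a k else 0) * \<xi> ^ b) = (\<Sum>b\<le>k. if b = k then ?c a k * \<xi> ^ k else 0)"
        by (intro sum.cong) auto
      then show ?thesis by simp
    qed
    moreover have "(\<Sum>b\<le>k. (?P * ?c a b + ?L * ((if 1 \<le> b then ?c a (b - 1) else 0) + (if b = k then ?c a k else 0))) * \<tau> ^ a * \<xi> ^ b)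
      = \<tau> ^ a * (?P * (\<Sum>b\<le>k. ?c a b * \<xi> ^ b) + ?L * ((\<Sum>b\<le>k. (if 1 \<le> b then ?c a (b - 1) else 0) * \<xi> ^ b) + (\<Sum>b\<le>k. (if b = k then ?c a k else 0) * \<xi> ^ b)))"
    proof -
      have "(?P * ?c a b + ?L * (A + B)) * \<tau> ^ a * \<xi> ^ b = \<tau> ^ a * (?P * (?c a b * \<xi> ^ b) + ?L * (A * \<xi> ^ b + B * \<xi> ^ b))" for b A B
        by (simp add: algebra_simps)
      then have "(\<Sum>b\<le>k. (?P * ?c a b + ?L * ((if 1 \<le> b then ?c a (b - 1) else 0) + (if b = k then ?c a k else 0))) * \<tau> ^ a * \<xi> ^ b)
        = (\<Sum>b\<le>k. \<tau> ^ a * (?P * (?c a b * \<xi> ^ b) + ?L * ((if 1 \<le> b then ?c a (b - 1) else 0) * \<xi> ^ b + (if b = k then ?c a k else 0) * \<xi> ^ b)))"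
        by (intro sum.cong refl)
      then show ?thesis by (simp only: sum_distrib_left[symmetric] sum.distrib)
    qed
    moreover have "(\<Sum>b\<le>k. ?c a b * \<tau> ^ a * \<xi> ^ b) = \<tau> ^ a * (\<Sum>b\<le>k. ?c a b * \<xi> ^ b)"
      by (simp add: sum_distrib_left mult_ac)
    ultimately show ?thesis unfolding sum_shift_power by (simp add: algebra_simps)
  qed
  have "G m j z = (\<Sum>a\<le>k. (?P + ?L * \<xi>) * (\<Sum>b\<le>k. ?c a b * \<tau> ^ a * \<xi> ^ b) - ?c a k * \<tau> ^ a * (?L * (\<xi> ^ Suc k - \<xi> ^ k)))"
    unfolding G_def loc_def tensor_def \<tau>_def[symmetric] \<xi>_def[symmetric] by (rule sum.cong[OF refl inner])
  also have "\<dots> = (?P + ?L * \<xi>) * tensor k ?c \<tau> \<xi> - (\<Sum>a\<le>k. ?c a k * \<tau> ^ a) * (?L * (\<xi> ^ Suc k - \<xi> ^ k))"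
    unfolding tensor_def by (simp only: sum_subtractf sum_distrib_left sum_distrib_right)
  also have "?P + ?L * \<xi> = \<Psi> j z" using l_pos[OF assms(2)] by (simp add: \<Psi>_def \<xi>_def)
  also have "tensor k ?c \<tau> \<xi> = U m j z" by (simp add: U_eq_loc[OF assms] loc_def \<tau>_def \<xi>_def)
  finally show ?thesis by (simp add: R_def Rf_def Rg_def \<tau>_def \<xi>_def)
qed

lemma Rg_nodes: "j \<in> {1..N} \<Longrightarrow> Rg j (x j) = 0" "Rg j (x (j - 1)) = 0"
  using l_pos[of j] k_pos by (auto simp: Rg_def power_0_left)

lemma G_discrete: "discrete (assemble G) G"
proof (rule discreteI)
  show "\<exists>c. G m j = loc m j c" for m j unfolding G_def by blast
next
  fix m j s assume m: "m \<in> {1..M}" and j: "j \<in> {1..N}" "Suc j \<le> N" and s: "s \<in> {t (m - 1)<..t m}"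
  have j': "Suc j \<in> {1..N}" using j by auto
  have in1: "x j \<in> {x (j - 1)..x j}" "x j \<in> {x (Suc j - 1)..x (Suc j)}" using xm.x_inc[OF j(1)] xm.x_inc[OF j'] by auto
  have "U m j (s, x j) = U m (Suc j) (s, x j)"
    using discrete_eq[OF U m j(1) s in1(1)] discrete_eq[OF U m j' s in1(2)] by simp
  then show "G m j (s, x j) = G m (Suc j) (s, x j)"
    unfolding G_eq[OF m j(1)] G_eq[OF m j'] using \<Psi>_eq[OF j(1) in1(1), of s] \<Psi>_eq[OF j' in1(2), of s] Rg_nodes(1)[OF j(1)] Rg_nodes(2)[of "Suc j"]
    by (simp add: R_def)
next
  fix m s assume m: "m \<in> {1..M}" and s: "s \<in> {t (m - 1)<..t m}"
  have N: "1 \<in> {1..N}" "N \<in> {1..N}" using xm.N_pos by auto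
  have s': "s \<in> {t (m - 1)..t m}" using s by auto
  show "G m 1 (s, x 0) = 0 \<and> G m N (s, x N) = 0"
    unfolding G_eq[OF m N(1)] G_eq[OF m N(2)]
    using discrete_boundary[OF U m s'] Rg_nodes(1)[OF N(2)] Rg_nodes(2)[of 1] by (simp add: R_def)
qed

definition Rf' :: "nat \<Rightarrow> nat \<Rightarrow> real \<Rightarrow> real" where
  "Rf' m j s = (\<Sum>a\<le>k. U_coeff m j a k * (real a * ((s - t (m - 1)) / h) ^ (a - 1) / h))"

definition Rg' :: "nat \<Rightarrow> real \<Rightarrow> real" where
  "Rg' j y = sl j * (real (Suc k) * ((y - x (j - 1)) / l j) ^ k - real k * ((y - x (j - 1)) / l j) ^ (k - 1))"

lemma CR: "m \<in> {1..M} \<Longrightarrow> j \<in> {1..N} \<Longrightarrow> Ck n (R m j)"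
proof -
  assume mj: "m \<in> {1..M}" "j \<in> {1..N}"
  have "R m j = (\<lambda>z. W m j z - G m j z)" using G_eq[OF mj] by auto
  then show ?thesis using Ck_diff[OF CW[OF mj] discrete_Ck[OF G_discrete mj]] by simp
qed

lemma pd_R:
  assumes "j \<in> {1..N}"
  shows "pd (1, 0) (R m j) z = Rf' m j (fst z) * Rg j (snd z)" "pd (0, 1) (R m j) z = Rf m j (fst z) * Rg' j (snd z)"
proof -
  have f: "(Rf m j has_field_derivative Rf' m j s) (at s)" for s
    unfolding Rf_def[abs_def] Rf'_def
  proof (rule DERIV_sum)
    have "((\<lambda>s. (s - t (m - 1)) / h) has_field_derivative 1 / h) (at s)"
      using h_pos by (auto intro!: derivative_eq_intros)
    from DERIV_cmult[OF DERIV_power[OF this]]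
    show "((\<lambda>s. U_coeff m j a k * ((s - t (m - 1)) / h) ^ a) has_field_derivative
      U_coeff m j a k * (real a * ((s - t (m - 1)) / h) ^ (a - 1) / h)) (at s)" for a
      by (rule DERIV_cong) (simp add: One_nat_def)
  qed
  have g: "(Rg j has_field_derivative Rg' j y) (at y)" for y
  proof -
    have "((\<lambda>y. (y - x (j - 1)) / l j) has_field_derivative 1 / l j) (at y)"
      using l_pos[OF assms] by (auto intro!: derivative_eq_intros)
    from DERIV_cmult[OF DERIV_diff[OF DERIV_power[OF this, of "Suc k"] DERIV_power[OF this, of k]], of "sl j * l j"]
    have "(Rg j has_field_derivative sl j * l j * (real (Suc k) * (1 / l j * ((y - x (j - 1)) / l j) ^ (Suc k - 1)) - real k * (1 / l j * ((y - x (j - 1)) / l j) ^ (k - 1)))) (at y)"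
      unfolding Rg_def[abs_def] One_nat_def .
    moreover have "s * L * (A * (1 / L * B) - C * (1 / L * D)) = s * (A * B - C * D)" if "L \<noteq> 0" for s L A B C D :: real
      using that by (simp add: field_simps)
    from this[of "l j"] have E: "sl j * l j * (A * (1 / l j * B) - C * (1 / l j * D)) = sl j * (A * B - C * D)" for A B C D
      using l_pos[OF assms] by simp
    ultimately show ?thesis unfolding Rg'_def by (simp only: E diff_Suc_1)
  qed
  have "((\<lambda>z. Rf m j (fst z) * Rg j (snd z)) has_derivative
     (\<lambda>d. Rf m j (fst z) * (Rg' j (snd z) * snd d) + Rf' m j (fst z) * fst d * Rg j (snd z))) (at z)"
  proof (rule has_derivative_mult)
    show "((\<lambda>z. Rf m j (fst z)) has_derivative (\<lambda>d. Rf' m j (fst z) * fst d)) (at z)"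
      by (rule has_derivative_compose[OF has_derivative_fst[OF has_derivative_ident] f[THEN has_field_derivative_imp_has_derivative]])
    show "((\<lambda>z. Rg j (snd z)) has_derivative (\<lambda>d. Rg' j (snd z) * snd d)) (at z)"
      by (rule has_derivative_compose[OF has_derivative_snd[OF has_derivative_ident] g[THEN has_field_derivative_imp_has_derivative]])
  qed
  from pd_eqI[OF this]
  show "pd (1, 0) (R m j) z = Rf' m j (fst z) * Rg j (snd z)" "pd (0, 1) (R m j) z = Rf m j (fst z) * Rg' j (snd z)"
    unfolding R_def[abs_def] by simp_all
qed

text \<open>On an element of size \<open>h\<close> times \<open>l j\<close> all polynomial coefficients are controlled
  by the mean of the square of the polynomial. The correction \<open>R\<close> carries the factor \<open>l j \<le>
  h\<close>, which makes it of size \<open>h\<close> relative to \<open>U\<close> while its derivatives are of size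
  1.\<close>

theorem inflow_stability:
  assumes C: "0 < C" and inv: "\<And>c \<alpha> \<beta> h l i j. 0 < h \<Longrightarrow> 0 < l \<Longrightarrow> i \<le> k \<Longrightarrow> j \<le> k \<Longrightarrow> (c i j)\<^sup>2 * (h * l)
     \<le> C * integral (cbox (\<alpha>, \<beta>) (\<alpha> + h, \<beta> + l)) (\<lambda>p. (tensor k c ((fst p - \<alpha>) / h) ((snd p - \<beta>) / l))\<^sup>2)"
    and B: "B = real (Suc k) * real (2 * k + 1) * sqrt C"
  shows "L2_norm Q U_strip \<le> 2 * (h * B * L2_norm Q r + \<delta> * (B + 1) * (L2_norm Q p + L2_norm Q q) + B * L2_norm Q J)"
proof (rule weighted_energy_bound[OF G_discrete G_eq CR])
  define E where "E m j = C / (h * l j) * (strip j * integral (ccell m j) (\<lambda>z. (U m j z)\<^sup>2))" for m j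
  define K where "K = real (Suc k) * real (2 * k + 1)"
  have K: "0 \<le> K" "real (Suc k) \<le> K" "real (Suc k) * real k \<le> K" unfolding K_def by (auto simp: algebra_simps)
  have intU: "0 \<le> integral (ccell m j) (\<lambda>z. (U m j z)\<^sup>2)" if "m \<in> {1..M}" "j \<in> {1..N}" for m j
    by (intro integral_nonneg integrable_continuous continuous_intros Ck_continuous[OF CU[OF that]]) auto
  have E0: "0 \<le> E m j" if "m \<in> {1..M}" "j \<in> {1..N}" for m j
    unfolding E_def using C h_pos l_pos[OF that(2)] intU[OF that] strip_sq(2)[of j] by simp
  have coef: "\<bar>U_coeff m j a b\<bar> \<le> sqrt (E m j)" if mj: "m \<in> {1..M}" "j \<in> {1..N}" and ab: "a \<le> k" "b \<le> k" and i: "strip j = 1" for m j a b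
  proof -
    have "cbox (t (m - 1), x (j - 1)) (t (m - 1) + h, x (j - 1) + l j) = ccell m j"
      using t_step[OF mj(1)] by simp
    then have "(U_coeff m j a b)\<^sup>2 * (h * l j) \<le> C * integral (ccell m j) (\<lambda>z. (U m j z)\<^sup>2)"
      using inv[OF h_pos l_pos[OF mj(2)] ab, of "U_coeff m j" "t (m - 1)" "x (j - 1)"] by (simp add: U_eq_loc[OF mj] loc_def)
    then have "(U_coeff m j a b)\<^sup>2 \<le> E m j"
      unfolding E_def i using h_pos l_pos[OF mj(2)] by (simp add: field_simps)
    then show ?thesis using real_sqrt_le_mono[of "(U_coeff m j a b)\<^sup>2" "E m j"] by simp
  qed
  have sumE: "(\<Sum>m=1..M. \<Sum>j=1..N. E m j * (h * l j)) = C * (L2_norm Q U_strip)\<^sup>2"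
  proof -
    have n: "(L2_norm Q U_strip)\<^sup>2 = (\<Sum>m=1..M. \<Sum>j=1..N. integral (ccell m j) (\<lambda>z. strip j * (U m j z)\<^sup>2))"
      unfolding L2_norm_square
    proof (rule Q_integral(2))
      show "continuous_on UNIV (\<lambda>z. strip j * (U m j z)\<^sup>2)" if "m \<in> {1..M}" "j \<in> {1..N}" for m j
        by (intro continuous_intros Ck_continuous[OF CU[OF that]])
      show "(norm (U_strip z))\<^sup>2 = strip j * (U m j z)\<^sup>2" if "m \<in> {1..M}" "j \<in> {1..N}" "z \<in> cell m j" for m j z
        using strip_sq(1)[of j] by (simp add: assemble_cell[OF that] power_mult_distrib) (simp add: power2_eq_square)
    qed
    show ?thesis
      unfolding n sum_distrib_left
    proof (intro sum.cong refl)
      fix m j assume "j \<in> {1..N}"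
      then have "h * l j \<noteq> 0" using h_pos l_pos[of j] by auto
      moreover have "C / a * I * a = C * I" if "a \<noteq> 0" for a I :: real using that by simp
      ultimately have "C / (h * l j) * I * (h * l j) = C * I" for I by blast
      then show "E m j * (h * l j) = C * integral (ccell m j) (\<lambda>z. strip j * (U m j z)\<^sup>2)"
        unfolding E_def by (simp only: integral_mult_right)
    qed
  qed
  have norm_bound: "L2_norm Q (assemble F) \<le> K' * sqrt C * L2_norm Q U_strip"
    if F: "\<And>m j. m \<in> {1..M} \<Longrightarrow> j \<in> {1..N} \<Longrightarrow> continuous_on UNIV (F m j)" and K': "0 \<le> K'"
      and bd: "\<And>m j z. m \<in> {1..M} \<Longrightarrow> j \<in> {1..N} \<Longrightarrow> z \<in> ccell m j \<Longrightarrow> \<bar>F m j z\<bar> \<le> K' * sqrt (E m j)" for F K'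
  proof -
    have "(L2_norm Q (assemble F))\<^sup>2 \<le> (\<Sum>m=1..M. \<Sum>j=1..N. (K'\<^sup>2 * E m j) * (h * l j))"
    proof (rule cell_bound_L2[OF F])
      fix m j z assume mj: "m \<in> {1..M}" "j \<in> {1..N}" and z: "z \<in> ccell m j"
      have "(F m j z)\<^sup>2 \<le> (K' * sqrt (E m j))\<^sup>2"
        using bd[OF mj z] by (metis abs_le_square_iff abs_of_nonneg abs_ge_zero order_trans)
      then show "(F m j z)\<^sup>2 \<le> K'\<^sup>2 * E m j" using E0[OF mj] by (simp add: power_mult_distrib)
    qed
    also have "\<dots> = K'\<^sup>2 * (C * (L2_norm Q U_strip)\<^sup>2)" unfolding sumE[symmetric] by (simp add: sum_distrib_left mult.assoc)
    also have "\<dots> = (K' * sqrt C * L2_norm Q U_strip)\<^sup>2" using C by (simp add: power_mult_distrib)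
    finally show ?thesis by (rule power2_le_imp_le) (use K' C L2_norm_nonneg in \<open>auto intro!: mult_nonneg_nonneg\<close>)
  qed
  have local_coords: "0 \<le> (s - t (m - 1)) / h" "(s - t (m - 1)) / h \<le> 1" "0 \<le> (y - x (j - 1)) / l j" "(y - x (j - 1)) / l j \<le> 1"
    if "m \<in> {1..M}" "j \<in> {1..N}" "(s, y) \<in> ccell m j" for m j s y
    using that h_pos l_pos[OF that(2)] t_step[OF that(1)] by (auto simp: cbox_Pair_eq field_simps)
  have unit: "\<bar>w ^ i\<bar> \<le> 1" if "0 \<le> w" "w \<le> 1" for w :: real and i using that by (simp add: power_le_one)
  have bRf: "\<bar>Rf m j s\<bar> \<le> real (Suc k) * sqrt (E m j)" "\<bar>Rf' m j s\<bar> \<le> real (Suc k) * real k / h * sqrt (E m j)"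
    "\<bar>Rg j y\<bar> \<le> l j" "\<bar>Rg' j y\<bar> \<le> real (2 * k + 1)"
    if mj: "m \<in> {1..M}" "j \<in> {1..N}" and sy: "(s, y) \<in> ccell m j" and i: "strip j = 1" for m j s y
  proof -
    note lc = local_coords[OF mj sy]
    define \<tau> where "\<tau> = (s - t (m - 1)) / h"
    define \<xi> where "\<xi> = (y - x (j - 1)) / l j"
    have a: "\<bar>U_coeff m j a k * \<tau> ^ a\<bar> \<le> sqrt (E m j)" if "a \<le> k" for a
      using mult_mono[OF coef[OF mj that order_refl i] unit[of \<tau> a]] lc E0[OF mj] by (simp add: abs_mult \<tau>_def)
    have "\<bar>Rf m j s\<bar> \<le> (\<Sum>a\<le>k. sqrt (E m j))"
      unfolding Rf_def \<tau>_def[symmetric] by (rule order_trans[OF sum_abs sum_mono]) (use a in auto)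
    then show "\<bar>Rf m j s\<bar> \<le> real (Suc k) * sqrt (E m j)" by simp
    have b: "\<bar>U_coeff m j a k * (real a * \<tau> ^ (a - 1) / h)\<bar> \<le> sqrt (E m j) * (real k / h)" if "a \<le> k" for a
    proof -
      have "\<bar>U_coeff m j a k\<bar> * (real a * \<bar>\<tau> ^ (a - 1)\<bar> / h) \<le> sqrt (E m j) * (real k * 1 / h)"
        using coef[OF mj that order_refl i] unit[of \<tau> "a - 1"] lc E0[OF mj] h_pos that
        by (intro mult_mono divide_right_mono) (auto simp: \<tau>_def)
      then show ?thesis using h_pos by (simp add: abs_mult)
    qed
    have "\<bar>Rf' m j s\<bar> \<le> (\<Sum>a\<le>k. sqrt (E m j) * (real k / h))"
      unfolding Rf'_def \<tau>_def[symmetric] by (rule order_trans[OF sum_abs sum_mono]) (use b in auto)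
    then show "\<bar>Rf' m j s\<bar> \<le> real (Suc k) * real k / h * sqrt (E m j)" by (simp add: mult_ac)
    have sl1: "\<bar>sl j\<bar> = 1" using sl_\<sigma>(2)[OF mj(2)] i by simp
    have \<xi>: "0 \<le> \<xi>" "\<xi> \<le> 1" using lc by (auto simp: \<xi>_def)
    have "\<bar>\<xi> ^ Suc k - \<xi> ^ k\<bar> \<le> 1"
    proof -
      have "\<xi> ^ Suc k - \<xi> ^ k = - (\<xi> ^ k * (1 - \<xi>))" by (simp add: algebra_simps)
      moreover have "0 \<le> \<xi> ^ k * (1 - \<xi>)" "\<xi> ^ k * (1 - \<xi>) \<le> 1" using \<xi> by (auto intro!: mult_le_one power_le_one)
      ultimately show ?thesis by simp
    qed
    then have "\<bar>sl j\<bar> * \<bar>l j\<bar> * \<bar>\<xi> ^ Suc k - \<xi> ^ k\<bar> \<le> 1 * l j * 1"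
      using sl1 l_pos[OF mj(2)] by (intro mult_mono) auto
    then show "\<bar>Rg j y\<bar> \<le> l j" unfolding Rg_def \<xi>_def[symmetric] by (simp only: abs_mult mult_1 mult_1_right)
    have "\<bar>real (Suc k) * \<xi> ^ k - real k * \<xi> ^ (k - 1)\<bar> \<le> \<bar>real (Suc k) * \<xi> ^ k\<bar> + \<bar>real k * \<xi> ^ (k - 1)\<bar>" by (rule abs_triangle_ineq4)
    also have "\<dots> \<le> real (Suc k) * 1 + real k * 1"
      unfolding abs_mult abs_of_nat using unit[OF \<xi>] by (intro add_mono mult_left_mono) auto
    finally show "\<bar>Rg' j y\<bar> \<le> real (2 * k + 1)" unfolding Rg'_def \<xi>_def[symmetric] abs_mult sl1 by simp
  qed
  have R_0: "R m j z = 0" "pd (1, 0) (R m j) z = 0" "pd (0, 1) (R m j) z = 0" if j: "j \<in> {1..N}" and i: "strip j \<noteq> 1" for m j z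
  proof -
    have "sl j = 0" using i by (auto simp: strip_def split: if_splits)
    then show "R m j z = 0" "pd (1, 0) (R m j) z = 0" "pd (0, 1) (R m j) z = 0"
      unfolding pd_R[OF j] by (simp_all add: R_def Rg_def Rg'_def)
  qed
  have lh: "l j \<le> h" "0 < l j" if "j \<in> {1..N}" for j using x_step[OF that] l_pos[OF that] by auto
  have R_bound: "\<bar>R m j (s, y)\<bar> \<le> h * K * sqrt (E m j)" if mj: "m \<in> {1..M}" "j \<in> {1..N}" and sy: "(s, y) \<in> ccell m j" for m j s y
  proof (cases "strip j = 1")
    case True
    have "\<bar>Rf m j s\<bar> * \<bar>Rg j y\<bar> \<le> (real (Suc k) * sqrt (E m j)) * h"
      using bRf[OF mj sy True] lh[OF mj(2)] E0[OF mj] by (intro mult_mono) auto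
    also have "\<dots> \<le> (K * sqrt (E m j)) * h" using K E0[OF mj] h_pos by (intro mult_right_mono) auto
    finally show ?thesis by (simp add: R_def abs_mult mult_ac)
  next
    case False
    show ?thesis unfolding R_0(1)[OF mj(2) False] using K E0[OF mj] h_pos by simp
  qed
  have "L2_norm Q (assemble R) \<le> h * K * sqrt C * L2_norm Q U_strip"
  proof (rule norm_bound)
    fix m j z assume "m \<in> {1..M}" "j \<in> {1..N}" "z \<in> ccell m j"
    then show "\<bar>R m j z\<bar> \<le> h * K * sqrt (E m j)" using R_bound[of m j "fst z" "snd z"] by simp
  qed (use K h_pos Ck_continuous[OF CR] in auto)
  then show "L2_norm Q (assemble R) \<le> h * B * L2_norm Q U_strip" by (simp add: B K_def mult_ac)
  have "L2_norm Q (assemble (\<lambda>m j. pd (1, 0) (R m j))) \<le> K * sqrt C * L2_norm Q U_strip"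
  proof (rule norm_bound)
    fix m j z assume mj: "m \<in> {1..M}" "j \<in> {1..N}" and z: "z \<in> ccell m j"
    obtain s y where sy: "z = (s, y)" by (cases z)
    show "\<bar>pd (1, 0) (R m j) z\<bar> \<le> K * sqrt (E m j)"
    proof (cases "strip j = 1")
      case True
      have "\<bar>Rf' m j s\<bar> * \<bar>Rg j y\<bar> \<le> (real (Suc k) * real k / h * sqrt (E m j)) * h"
        using bRf[OF mj z[unfolded sy] True] lh[OF mj(2)] E0[OF mj] h_pos by (intro mult_mono) auto
      also have "\<dots> = real (Suc k) * real k * sqrt (E m j)" using h_pos by simp
      also have "\<dots> \<le> K * sqrt (E m j)" using K E0[OF mj] by (intro mult_right_mono) auto
      finally show ?thesis unfolding pd_R[OF mj(2)] sy by (simp add: abs_mult)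
    next
      case False
      show ?thesis unfolding R_0(2)[OF mj(2) False] using K E0[OF mj] by simp
    qed
  qed (use K Ck_pd[OF CR] in auto)
  then show "L2_norm Q (assemble (\<lambda>m j. pd (1, 0) (R m j))) \<le> B * L2_norm Q U_strip" by (simp add: B K_def)
  have "L2_norm Q (assemble (\<lambda>m j. pd (0, 1) (R m j))) \<le> K * sqrt C * L2_norm Q U_strip"
  proof (rule norm_bound)
    fix m j z assume mj: "m \<in> {1..M}" "j \<in> {1..N}" and z: "z \<in> ccell m j"
    obtain s y where sy: "z = (s, y)" by (cases z)
    show "\<bar>pd (0, 1) (R m j) z\<bar> \<le> K * sqrt (E m j)"
    proof (cases "strip j = 1")
      case True
      have "\<bar>Rf m j s\<bar> * \<bar>Rg' j y\<bar> \<le> (real (Suc k) * sqrt (E m j)) * real (2 * k + 1)"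
        using bRf[OF mj z[unfolded sy] True] E0[OF mj] by (intro mult_mono) auto
      also have "\<dots> = K * sqrt (E m j)" by (simp add: K_def mult_ac)
      finally show ?thesis unfolding pd_R[OF mj(2)] sy by (simp add: abs_mult)
    next
      case False
      show ?thesis unfolding R_0(3)[OF mj(2) False] using K E0[OF mj] by simp
    qed
  qed (use K Ck_pd[OF CR] in auto)
  then show "L2_norm Q (assemble (\<lambda>m j. pd (0, 1) (R m j))) \<le> B * L2_norm Q U_strip" by (simp add: B K_def)
  have "L2_norm Q (assemble (\<lambda>m j z. R m j (t (m - 1), snd z))) \<le> h * K * sqrt C * L2_norm Q U_strip"
  proof (rule norm_bound)
    fix m j z assume mj: "m \<in> {1..M}" "j \<in> {1..N}" "z \<in> ccell m j"
    then have "(t (m - 1), snd z) \<in> ccell m j" using t_less[OF mj(1)] by (cases z) (auto simp: cbox_Pair_eq)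
    then show "\<bar>R m j (t (m - 1), snd z)\<bar> \<le> h * K * sqrt (E m j)" using R_bound[OF mj(1,2)] by blast
  next
    fix m j assume mj: "m \<in> {1..M}" "j \<in> {1..N}"
    show "continuous_on UNIV (\<lambda>z. R m j (t (m - 1), snd z))"
      by (rule continuous_on_compose2[OF Ck_continuous[OF CR[OF mj], of UNIV]]) (auto intro!: continuous_intros)
  qed (use K h_pos in auto)
  moreover have "assemble (\<lambda>m j z. R m j (t (m - 1), snd z)) = slabwise (\<lambda>m. trace R m (t (m - 1)))"
    by (auto simp: assemble_def slabwise_def trace_def)
  ultimately show "L2_norm Q (slabwise (\<lambda>m. trace R m (t (m - 1)))) \<le> h * B * L2_norm Q U_strip" by (simp add: B K_def mult_ac)
  show "0 \<le> B" using C by (simp add: B)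
qed

end

lemma L2_norm_add_square:
  assumes "u \<in> L2 A" "w \<in> L2 A"
  shows "(L2_norm A (\<lambda>p. u p + w p))\<^sup>2 \<le> 2 * (L2_norm A u)\<^sup>2 + 2 * (L2_norm A w)\<^sup>2"
proof -
  note i = L2_integrable_square[OF assms(1)] L2_integrable_square[OF assms(2)] L2_integrable_square[OF L2_add[OF assms]]
  have "(LINT p|lebesgue_on A. (norm (u p + w p))\<^sup>2) \<le> (LINT p|lebesgue_on A. 2 * (norm (u p))\<^sup>2 + 2 * (norm (w p))\<^sup>2)"
  proof (rule integral_mono)
    fix p
    have "(norm (u p + w p))\<^sup>2 \<le> (norm (u p) + norm (w p))\<^sup>2" by (intro power_mono norm_triangle_ineq) auto
    also have "\<dots> \<le> 2 * (norm (u p))\<^sup>2 + 2 * (norm (w p))\<^sup>2"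
      using sum_squares_bound[of "norm (u p)" "norm (w p)"] by (simp add: power2_sum)
    finally show "(norm (u p + w p))\<^sup>2 \<le> 2 * (norm (u p))\<^sup>2 + 2 * (norm (w p))\<^sup>2" .
  qed (use i in auto)
  also have "\<dots> = 2 * (LINT p|lebesgue_on A. (norm (u p))\<^sup>2) + 2 * (LINT p|lebesgue_on A. (norm (w p))\<^sup>2)" using i by simp
  finally show ?thesis by (simp add: L2_norm_square)
qed

section \<open>Representation of the error by the residuals\<close>

text \<open>The exact solution enters only through the identity \<open>exact\<close>, tested with the dual solution of
  \<open>\<omega>\<close>.\<close>

locale tested_scheme = weighted_scheme +
  fixes \<omega> V :: "real \<times> real \<Rightarrow> real" and \<mu> :: real
  assumes \<omega>: "\<omega> \<in> test_functions Q" and V: "V \<in> L2 Q" and \<mu>: "0 \<le> \<mu>" and \<mu>\<psi>: "\<mu> * \<psi> y \<le> 1"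
    and exact: "(LINT z|lebesgue_on Q. dual \<sigma> (t M) \<omega> z * \<beta> z)
      = - (LINT z|lebesgue_on Q. (pd (1, 0) (dual \<sigma> (t M) \<omega>) z + \<sigma> * pd (0, 1) (dual \<sigma> (t M) \<omega>) z) * V z)
        - (LINT y|lebesgue_on {x 0<..<x N}. V0 y * dual \<sigma> (t M) \<omega> (0, y))"
begin

abbreviation \<phi> where "\<phi> \<equiv> dual \<sigma> (t M) \<omega>"
abbreviation N0 where "N0 \<equiv> L2_norm Q \<omega>"
abbreviation N1 where "N1 \<equiv> L2_norm Q (pd (0, 1) \<omega>)"

text \<open>The dual solution, damped so that it vanishes at the inflow end once \<open>\<mu> \<psi> = 1\<close>
  there.\<close>

definition \<theta> :: "nat \<Rightarrow> nat \<Rightarrow> real \<times> real \<Rightarrow> real" where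
  "\<theta> m j z = (1 - \<mu> * \<Psi> j z) * \<phi> z"

lemma C\<omega>: "Ck n \<omega>" by (rule test_function_Ck[OF \<omega>])
lemma C\<phi>: "Ck n \<phi>" by (rule Ck_dual[OF C\<omega>])

lemma C\<theta>: "Ck n (\<theta> m j)"
  unfolding \<theta>_def[abs_def] by (intro Ck_mult Ck_diff Ck_const Ck_\<Psi> C\<phi>)

lemma \<omega>_zero: "z \<notin> Q \<Longrightarrow> \<omega> z = 0" by (rule test_function_zero[OF \<omega>])

lemma \<phi>_eq: "0 \<le> s \<Longrightarrow> pd (1, 0) \<phi> (s, y) + \<sigma> * pd (0, 1) \<phi> (s, y) = - \<omega> (s, y)"
  by (rule dual_equation[OF C\<omega>]) (use tM_pos \<omega>_zero in \<open>auto simp: box_Pair\<close>)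

lemma \<phi>_final: "\<phi> (t M, y) = 0"
  by (rule dual_zero) (use \<omega>_zero in \<open>auto simp: box_Pair\<close>)

lemma pd_\<theta>: "pd d (\<theta> m j) z = (1 - \<mu> * \<Psi> j z) * pd d \<phi> z - \<mu> * sl j * snd d * \<phi> z"
proof -
  have "pd d (\<lambda>z. 1 - \<mu> * \<Psi> j z) z = - (\<mu> * (sl j * snd d))"
    unfolding \<Psi>_def[abs_def] by (rule pd_eqI) (auto intro!: derivative_eq_intros)
  then show ?thesis unfolding \<theta>_def[abs_def]
    by (subst pd_mult[OF _ C\<phi>]) (auto intro!: Ck_diff Ck_const Ck_mult Ck_\<Psi> simp: algebra_simps)
qed

lemma \<theta>_piecewise: "xm.piecewise (t (m - 1)) (t m) (\<lambda>z. (1 - \<mu> * \<psi> (snd z)) * \<phi> z) (\<theta> m)"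
  using C\<theta>[of 1] \<Psi>_eq unfolding xm.piecewise_def by (simp add: \<theta>_def)

lemma \<beta>\<Psi>: "AE z in lebesgue_on Q. \<beta> z * assemble (\<lambda>m. \<Psi>) z = 0"
proof -
  have inQ: "AE z in lebesgue_on Q. z \<in> Q" by (intro AE_I2) simp
  show ?thesis using data0 inQ
  proof eventually_elim
    case (elim z)
    have j: "cell_of (snd z) \<in> {1..N}" using elim(2) cell_of_cases[of "snd z"] by (auto simp: box_Pair)
    show ?case using elim(1) \<Psi>_0[OF j] by (cases "sl (cell_of (snd z)) = 0") (simp_all add: assemble_def)
  qed
qed

text \<open>The transport operator maps \<open>\<theta>\<close> to \<open>- (1 - \<mu> \<psi>) \<omega>\<close> plus
  \<open>\<mu> \<phi>\<close> on the strip. Compared with \<open>- \<omega>\<close>, the difference lives on the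
  strip, and tested with \<open>U\<close> it is the last term. The weight does not change the terms with the exact
  data because these vanish on the strip.\<close>

lemma error_representation:
  "(LINT z|lebesgue_on Q. (V z - assemble U z) * \<omega> z) = (LINT z|lebesgue_on Q. r z * assemble \<theta> z)
     - 1 / h * (LINT z|lebesgue_on Q. J z * slabwise (\<lambda>m. trace \<theta> m (t (m - 1))) z)
     - (LINT z|lebesgue_on Q. U_strip z * (\<mu> * (assemble (\<lambda>m. \<Psi>) z * \<omega> z + \<phi> z)))"
proof -
  let ?P = "assemble (\<lambda>m. \<Psi>)"
  let ?X = "\<lambda>z. U_strip z * (\<mu> * (?P z * \<omega> z + \<phi> z))"
  have LU: "Ut \<in> L2 Q" "Ux \<in> L2 Q" "assemble \<theta> \<in> L2 Q" "U_strip \<in> L2 Q" "assemble U \<in> L2 Q"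
    by (intro assemble_L2 Ck_pd CU Ck_continuous[OF CU] Ck_continuous[OF C\<theta>] continuous_on_mult continuous_on_const; assumption)+
  have L\<omega>: "\<omega> \<in> L2 Q" by (rule continuous_L2[OF Ck_continuous[OF C\<omega>]]) auto
  have L\<phi>: "\<phi> \<in> L2 Q" by (rule continuous_L2[OF Ck_continuous[OF C\<phi>]]) auto
  have LX: "(\<lambda>z. \<mu> * (?P z * \<omega> z + \<phi> z)) \<in> L2 Q"
  proof -
    have "assemble (\<lambda>m j z. \<mu> * (\<Psi> j z * \<omega> z + \<phi> z)) \<in> L2 Q"
      by (intro assemble_L2 continuous_intros Ck_continuous[OF Ck_\<Psi>] Ck_continuous[OF C\<omega>] Ck_continuous[OF C\<phi>])
    moreover have "assemble (\<lambda>m j z. \<mu> * (\<Psi> j z * \<omega> z + \<phi> z)) = (\<lambda>z. \<mu> * (?P z * \<omega> z + \<phi> z))" by (auto simp: assemble_def)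
    ultimately show ?thesis by simp
  qed
  have i1: "integrable (lebesgue_on Q) (\<lambda>z. (Ut z + \<sigma> * Ux z) * assemble \<theta> z)"
    by (intro L2_mult_integrable L2_add L2_cmult LU)
  have i2: "integrable (lebesgue_on Q) (\<lambda>z. assemble U z * \<omega> z)" by (intro L2_mult_integrable LU L\<omega>)
  have i3: "integrable (lebesgue_on Q) ?X" by (intro L2_mult_integrable LU LX)
  define A where "A m = (LINT y|lebesgue_on \<Omega>. trace U m (t m) y * trace \<theta> m (t m) y)" for m
  define Bm where "Bm m = (LINT y|lebesgue_on \<Omega>. trace U m (t (m - 1)) y * trace \<theta> m (t (m - 1)) y)" for m
  have slabI: "(LINT z|lebesgue_on (S m). (Ut z + \<sigma> * Ux z) * assemble \<theta> z) - (LINT z|lebesgue_on (S m). assemble U z * \<omega> z)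
      + (LINT z|lebesgue_on (S m). ?X z) = A m - Bm m" if m: "m \<in> {1..M}" for m
  proof -
    have eq: "assemble U z * (assemble (\<lambda>m j. pd (1, 0) (\<theta> m j)) z + \<sigma> * assemble (\<lambda>m j. pd (0, 1) (\<theta> m j)) z) = ?X z - assemble U z * \<omega> z" if z: "z \<in> S m" for z
    proof -
      have zQ: "z \<in> Q" using S_subset_Q[OF m] z by blast
      then have j: "cell_of (snd z) \<in> {1..N}" using cell_of_cases[of "snd z"] by (auto simp: box_Pair)
      have ph: "pd (1, 0) \<phi> z + \<sigma> * pd (0, 1) \<phi> z = - \<omega> z"
        using \<phi>_eq[of "fst z" "snd z"] zQ by (auto simp: box_Pair)
      have alg: "u * ((1 - \<mu> * P) * a - \<mu> * l * 0 * f + \<sigma> * ((1 - \<mu> * P) * b - \<mu> * l * 1 * f)) = i * u * (\<mu> * (P * w + f)) - u * w"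
        if "a + \<sigma> * b = - w" "\<sigma> * l = - i" "i * P = P" for u P a b l f i w
      proof -
        have "u * ((1 - \<mu> * P) * a - \<mu> * l * 0 * f + \<sigma> * ((1 - \<mu> * P) * b - \<mu> * l * 1 * f))
           = u * ((1 - \<mu> * P) * (a + \<sigma> * b) - \<mu> * (\<sigma> * l) * f)" by (simp add: algebra_simps)
        also have "\<dots> = - u * w + \<mu> * P * u * w + \<mu> * i * u * f" unfolding that(1,2) by (simp add: algebra_simps)
        also have "\<mu> * P * u * w = \<mu> * (i * P) * u * w" unfolding that(3) ..
        finally show ?thesis by (simp add: algebra_simps)
      qed
      show ?thesis unfolding assemble_def pd_\<theta> fst_conv snd_conv
        by (rule alg[OF ph sl_\<sigma>(1)[OF j] \<Psi>_strip[OF j]])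
    qed
    have "(LINT z|lebesgue_on (S m). assemble U z * (assemble (\<lambda>m j. pd (1, 0) (\<theta> m j)) z + \<sigma> * assemble (\<lambda>m j. pd (0, 1) (\<theta> m j)) z))
       = (LINT z|lebesgue_on (S m). ?X z - assemble U z * \<omega> z)"
      by (rule Bochner_Integration.integral_cong[OF refl], rule eq) simp
    also have "\<dots> = (LINT z|lebesgue_on (S m). ?X z) - (LINT z|lebesgue_on (S m). assemble U z * \<omega> z)"
      using integrable_subset[OF i2 S_subset_Q[OF m]] integrable_subset[OF i3 S_subset_Q[OF m]] by simp
    finally show ?thesis
      using slab_Green[where W=\<theta> and U=U and \<sigma>=\<sigma>, OF U m \<theta>_piecewise] unfolding A_def Bm_def by simp
  qed
  have sumI: "(LINT z|lebesgue_on Q. (Ut z + \<sigma> * Ux z) * assemble \<theta> z) - (LINT z|lebesgue_on Q. assemble U z * \<omega> z)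
      + (LINT z|lebesgue_on Q. ?X z) = (\<Sum>m=1..M. A m - Bm m)"
  proof -
    have *: "(LINT z|lebesgue_on Q. f z) = (\<Sum>m=1..M. LINT z|lebesgue_on (S m). f z)"
      if "integrable (lebesgue_on Q) f" for f :: "real \<times> real \<Rightarrow> real"
      by (rule Q_slabs(2)) (intro integrable_subset[OF that S_subset_Q]; simp)
    show ?thesis
      unfolding *[OF i1] *[OF i2] *[OF i3] sum.distrib[symmetric] sum_subtractf[symmetric]
      by (rule sum.cong[OF refl slabI])
  qed
  have tr: "trace \<theta> m s y = (1 - \<mu> * \<psi> y) * \<phi> (s, y)" if "y \<in> \<Omega>" for m s y
    using cell_of_cases[OF that] \<Psi>_eq[of "cell_of y" y s] by (simp add: trace_def \<theta>_def)
  have trL: "trace \<theta> m s \<in> L2 \<Omega>" for m s by (intro trace_L2 C\<theta>)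
  define A' where "A' m = (if m = 0 then (LINT y|lebesgue_on \<Omega>. V0 y * \<phi> (0, y)) else A m)" for m
  have V0\<psi>: "V0 y * \<psi> y = 0" if y: "y \<in> \<Omega>" for y
  proof (cases "sl (cell_of y) = 0")
    case True
    then show ?thesis using \<psi>_zero[of "cell_of y" y] cell_of_cases[OF y] by auto
  qed (use V00[OF y] in auto)
  have jumpI: "(LINT y|lebesgue_on \<Omega>. jump V0 U m y * trace \<theta> m (t (m - 1)) y) = Bm m - A' (m - 1)" if m: "m \<in> {1..M}" for m
  proof -
    let ?old = "\<lambda>y. if m = 1 then V0 y else trace U (m - 1) (t (m - 1)) y"
    have oldL: "?old \<in> L2 \<Omega>"
    proof (cases "m = 1")
      case False
      then have "m - 1 \<in> {1..M}" using m by auto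
      then show ?thesis using False by (auto intro!: trace_L2 CU)
    qed (use V0 in simp)
    have a: "(LINT y|lebesgue_on \<Omega>. ?old y * trace \<theta> m (t (m - 1)) y) = A' (m - 1)"
    proof (cases "m = 1")
      case True
      have "(LINT y|lebesgue_on \<Omega>. V0 y * trace \<theta> m 0 y) = (LINT y|lebesgue_on \<Omega>. V0 y * \<phi> (0, y))"
      proof (rule Bochner_Integration.integral_cong[OF refl])
        fix y assume "y \<in> space (lebesgue_on \<Omega>)"
        then have y: "y \<in> \<Omega>" by simp
        have "V0 y * ((1 - \<mu> * \<psi> y) * \<phi> (0, y)) = V0 y * \<phi> (0, y) - \<mu> * (V0 y * \<psi> y) * \<phi> (0, y)" by (simp add: algebra_simps)
        then show "V0 y * trace \<theta> m 0 y = V0 y * \<phi> (0, y)" unfolding tr[OF y] V0\<psi>[OF y] by simp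
      qed
      then show ?thesis using True t0 by (simp add: A'_def)
    next
      case False
      have "(LINT y|lebesgue_on \<Omega>. trace U (m - 1) (t (m - 1)) y * trace \<theta> m (t (m - 1)) y) = A (m - 1)"
        unfolding A_def by (rule Bochner_Integration.integral_cong) (simp_all add: tr)
      then show ?thesis using False m by (auto simp: A'_def)
    qed
    have "(LINT y|lebesgue_on \<Omega>. jump V0 U m y * trace \<theta> m (t (m - 1)) y)
       = (LINT y|lebesgue_on \<Omega>. trace U m (t (m - 1)) y * trace \<theta> m (t (m - 1)) y - ?old y * trace \<theta> m (t (m - 1)) y)"
      unfolding jump_def by (simp add: left_diff_distrib)
    also have "\<dots> = Bm m - (LINT y|lebesgue_on \<Omega>. ?old y * trace \<theta> m (t (m - 1)) y)"
      unfolding Bm_def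
      by (rule Bochner_Integration.integral_diff) (intro L2_mult_integrable trL oldL trace_L2 CU[OF m]; assumption)+
    finally show ?thesis unfolding a .
  qed
  have Jsum: "1 / h * (LINT z|lebesgue_on Q. J z * slabwise (\<lambda>m. trace \<theta> m (t (m - 1))) z) = (\<Sum>m=1..M. Bm m - A' (m - 1))"
    using slabwise_mult_integral[of "jump V0 U" "\<lambda>m. trace \<theta> m (t (m - 1))", OF jump_L2 trL] h_pos sum.cong[OF refl jumpI, of "{1..M}"]
    by simp
  have AM: "A M = 0"
    unfolding A_def by (rule integral_eq_zero_AE, rule AE_I2) (simp add: tr \<phi>_final)
  have telescope: "(\<Sum>m=1..n. A m - Bm m) + (\<Sum>m=1..n. Bm m - A' (m - 1)) = A' n - A' 0" for n
    by (induction n) (auto simp: A'_def)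
  have tele: "(\<Sum>m=1..M. A m - Bm m) = - 1 / h * (LINT z|lebesgue_on Q. J z * slabwise (\<lambda>m. trace \<theta> m (t (m - 1))) z)
      - (LINT y|lebesgue_on \<Omega>. V0 y * \<phi> (0, y))"
    using telescope[of M] AM tm.N_pos Jsum by (simp add: A'_def)
  have \<beta>I: "(LINT z|lebesgue_on Q. (Ut z + \<sigma> * Ux z) * assemble \<theta> z) = (LINT z|lebesgue_on Q. \<phi> z * \<beta> z) - (LINT z|lebesgue_on Q. r z * assemble \<theta> z)"
  proof -
    have ib: "integrable (lebesgue_on Q) (\<lambda>z. \<phi> z * \<beta> z)" "integrable (lebesgue_on Q) (\<lambda>z. r z * assemble \<theta> z)"
      by (intro L2_mult_integrable L\<phi> \<beta>L rL LU)+
    have "(LINT z|lebesgue_on Q. (Ut z + \<sigma> * Ux z) * assemble \<theta> z) = (LINT z|lebesgue_on Q. \<phi> z * \<beta> z - r z * assemble \<theta> z)"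
    proof (rule integral_cong_AE)
      show "AE z in lebesgue_on Q. (Ut z + \<sigma> * Ux z) * assemble \<theta> z = \<phi> z * \<beta> z - r z * assemble \<theta> z"
        using r_eq \<beta>\<Psi>
      proof eventually_elim
        case (elim z)
        have "\<beta> z * assemble \<theta> z = \<beta> z * \<phi> z - \<mu> * (\<beta> z * ?P z) * \<phi> z" by (simp add: assemble_def \<theta>_def algebra_simps)
        then have b: "\<beta> z * assemble \<theta> z = \<phi> z * \<beta> z" unfolding elim(2) by simp
        have "(Ut z + \<sigma> * Ux z) * assemble \<theta> z = \<beta> z * assemble \<theta> z - r z * assemble \<theta> z" unfolding elim(1) by (simp only: left_diff_distrib)
        then show ?case unfolding b .
      qed
    qed (use i1 ib in auto)
    then show ?thesis using ib by simp
  qed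
  have exact': "(LINT z|lebesgue_on Q. \<phi> z * \<beta> z) = (LINT z|lebesgue_on Q. V z * \<omega> z) - (LINT y|lebesgue_on \<Omega>. V0 y * \<phi> (0, y))"
  proof -
    have "(LINT z|lebesgue_on Q. (pd (1, 0) \<phi> z + \<sigma> * pd (0, 1) \<phi> z) * V z) = (LINT z|lebesgue_on Q. - (V z * \<omega> z))"
    proof (rule Bochner_Integration.integral_cong[OF refl])
      fix z assume "z \<in> space (lebesgue_on Q)"
      then have "pd (1, 0) \<phi> z + \<sigma> * pd (0, 1) \<phi> z = - \<omega> z"
        using \<phi>_eq[of "fst z" "snd z"] by (auto simp: box_Pair)
      then show "(pd (1, 0) \<phi> z + \<sigma> * pd (0, 1) \<phi> z) * V z = - (V z * \<omega> z)" by simp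
    qed
    then show ?thesis using exact by simp
  qed
  have "(LINT z|lebesgue_on Q. (V z - assemble U z) * \<omega> z) = (LINT z|lebesgue_on Q. V z * \<omega> z) - (LINT z|lebesgue_on Q. assemble U z * \<omega> z)"
    using L2_mult_integrable[OF V L\<omega>] i2 by (simp add: left_diff_distrib)
  then show ?thesis using sumI tele \<beta>I exact' by simp
qed

section \<open>Bounds for the dual solution and its interpolant\<close>

lemma integral_cells_sum:
  fixes f :: "real \<Rightarrow> real"
  assumes "continuous_on UNIV f"
  shows "(\<Sum>j=1..N. integral {x (j - 1)..x j} f) = integral {x 0..x N} f"
  using xm.cells_integral(2)[of "\<lambda>_. f" f] rectangle_integral(2)[of "x 0" "x N" f f] assms
  by (simp add: continuous_on_subset[OF assms])

lemma dual_slices: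
  assumes w: "w \<in> test_functions Q" and s: "0 \<le> s"
  shows "integral {x 0..x N} (\<lambda>y. (dual \<sigma> (t M) w (s, y))\<^sup>2) \<le> t M * (L2_norm Q w)\<^sup>2"
proof -
  have cw: "continuous_on UNIV w" by (rule Ck_continuous[OF test_function_Ck[OF w]])
  have "(L2_norm Q w)\<^sup>2 = integral (cbox (0, x 0) (t M, x N)) (\<lambda>p. (w p)\<^sup>2)"
    unfolding L2_norm_square by (rule rectangle_integral(2)) (auto intro!: continuous_intros continuous_on_subset[OF cw])
  then show ?thesis
    using dual_L2_bound[OF cw tM_pos less_imp_le[OF x_pos] s, of \<sigma>] test_function_zero[OF w] box_subset_cbox[of "(0, x 0)" "(t M, x N)"]
    by auto
qed

lemma dual_norm:
  assumes w: "w \<in> test_functions Q"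
  shows "L2_norm Q (dual \<sigma> (t M) w) \<le> t M * L2_norm Q w"
proof -
  have c: "continuous_on UNIV (dual \<sigma> (t M) w)" by (rule Ck_continuous[OF Ck_dual[OF test_function_Ck[OF w]]])
  have c2: "continuous_on A (\<lambda>p. (dual \<sigma> (t M) w p)\<^sup>2)" for A by (intro continuous_intros continuous_on_subset[OF c]) auto
  have "(L2_norm Q (dual \<sigma> (t M) w))\<^sup>2 = integral (cbox (0, x 0) (t M, x N)) (\<lambda>p. (dual \<sigma> (t M) w p)\<^sup>2)"
    unfolding L2_norm_square by (rule rectangle_integral(2)) (auto intro: c2)
  also have "\<dots> = integral {0..t M} (\<lambda>s. integral {x 0..x N} (\<lambda>y. (dual \<sigma> (t M) w (s, y))\<^sup>2))"
    by (rule rectangle_Fubini(1)[OF c2])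
  also have "\<dots> \<le> integral {0..t M} (\<lambda>s. t M * (L2_norm Q w)\<^sup>2)"
  proof (rule integral_le)
    have "continuous_on UNIV (\<lambda>s. integral (cbox (x 0) (x N)) (\<lambda>y. (dual \<sigma> (t M) w (s, y))\<^sup>2))"
      by (rule integral_continuous_on_param) (auto simp: case_prod_unfold intro!: c2)
    then show "(\<lambda>s. integral {x 0..x N} (\<lambda>y. (dual \<sigma> (t M) w (s, y))\<^sup>2)) integrable_on {0..t M}"
      by (intro integrable_continuous_real) (auto intro: continuous_on_subset)
  qed (use dual_slices[OF w] in auto)
  also have "\<dots> = (t M * L2_norm Q w)\<^sup>2" using tM_pos by (simp add: power2_eq_square)
  finally show ?thesis by (rule power2_le_imp_le) (use tM_pos L2_norm_nonneg in \<open>auto intro!: mult_nonneg_nonneg\<close>)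
qed

lemma \<omega>x: "pd (0, 1) \<omega> \<in> test_functions Q" by (rule test_function_derivative[OF \<omega>])

lemma \<phi>x: "pd (0, 1) \<phi> z = dual \<sigma> (t M) (pd (0, 1) \<omega>) z" by (rule pd_dual[OF C\<omega>])

lemma \<eta>: "j \<in> {1..N} \<Longrightarrow> y \<in> {x (j - 1)..x j} \<Longrightarrow> 0 \<le> 1 - \<mu> * \<Psi> j (s, y) \<and> 1 - \<mu> * \<Psi> j (s, y) \<le> 1"
  using \<Psi>_eq[of j y s] \<mu>\<psi>[of y] \<mu> \<psi>_nonneg[of y] by simp

definition Z where "Z = 2 * t M * (N1\<^sup>2 + \<mu>\<^sup>2 * N0\<^sup>2)"

text \<open>The slope of \<open>\<theta>\<close> consists of that of \<open>\<phi>\<close> and of the slope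
  \<open>\<mu>\<close> of the weight times \<open>\<phi>\<close>.\<close>

lemma slope_bound:
  assumes s: "0 \<le> s"
  shows "(\<Sum>j=1..N. integral {x (j - 1)..x j} (\<lambda>y. (pd (0, 1) (\<theta> m j) (s, y))\<^sup>2)) \<le> Z"
proof -
  let ?b = "\<lambda>y. 2 * (pd (0, 1) \<phi> (s, y))\<^sup>2 + 2 * \<mu>\<^sup>2 * (\<phi> (s, y))\<^sup>2"
  have c1: "continuous_on A (\<lambda>y. pd d F (s, y))" if "Ck 2 F" for A d and F :: "real \<times> real \<Rightarrow> real"
    using Ck_SucD[of 1 F d] that by (intro slice_continuous[of 1]) (simp add: numeral_2_eq_2 One_nat_def)
  have c\<phi>: "continuous_on A (\<lambda>y. \<phi> (s, y))" for A by (rule slice_continuous[OF C\<phi>])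
  have cb: "continuous_on A ?b" for A by (intro continuous_intros c1 C\<phi> c\<phi>)
  have "(\<Sum>j=1..N. integral {x (j - 1)..x j} (\<lambda>y. (pd (0, 1) (\<theta> m j) (s, y))\<^sup>2)) \<le> (\<Sum>j=1..N. integral {x (j - 1)..x j} ?b)"
  proof (intro sum_mono integral_le)
    fix j y assume j: "j \<in> {1..N}" and y: "y \<in> {x (j - 1)..x j}"
    define e where "e = 1 - \<mu> * \<Psi> j (s, y)"
    define a where "a = pd (0, 1) \<phi> (s, y)"
    define b where "b = \<phi> (s, y)"
    have e: "0 \<le> e" "e \<le> 1" using \<eta>[OF j y, of s] by (simp_all add: e_def)
    have sl2: "(sl j)\<^sup>2 \<le> 1" using sl[OF j] \<sigma> by auto
    have "(e * a - \<mu> * sl j * b)\<^sup>2 \<le> 2 * (e * a)\<^sup>2 + 2 * (\<mu> * sl j * b)\<^sup>2"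
      using sum_squares_bound[of "e * a" "- (\<mu> * sl j * b)"] by (simp add: power2_diff)
    also have "\<dots> \<le> 2 * a\<^sup>2 + 2 * \<mu>\<^sup>2 * b\<^sup>2"
    proof -
      have "e\<^sup>2 * a\<^sup>2 \<le> 1 * a\<^sup>2" using e by (intro mult_right_mono power_le_one) auto
      moreover have "(sl j)\<^sup>2 * (\<mu>\<^sup>2 * b\<^sup>2) \<le> 1 * (\<mu>\<^sup>2 * b\<^sup>2)" using sl2 by (intro mult_right_mono) auto
      ultimately show ?thesis by (simp add: power_mult_distrib mult_ac)
    qed
    finally show "(pd (0, 1) (\<theta> m j) (s, y))\<^sup>2 \<le> ?b y" by (simp add: pd_\<theta> e_def a_def b_def)
  next
    fix j show "(\<lambda>y. (pd (0, 1) (\<theta> m j) (s, y))\<^sup>2) integrable_on {x (j - 1)..x j}"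
      by (intro integrable_continuous_real continuous_intros c1 C\<theta>)
    show "?b integrable_on {x (j - 1)..x j}" by (intro integrable_continuous_real cb)
  qed
  also have "\<dots> = integral {x 0..x N} ?b" by (rule integral_cells_sum[OF cb])
  also have "\<dots> = 2 * integral {x 0..x N} (\<lambda>y. (pd (0, 1) \<phi> (s, y))\<^sup>2) + 2 * \<mu>\<^sup>2 * integral {x 0..x N} (\<lambda>y. (\<phi> (s, y))\<^sup>2)"
  proof -
    have "(\<lambda>y. 2 * (pd (0, 1) \<phi> (s, y))\<^sup>2) integrable_on {x 0..x N}" "(\<lambda>y. 2 * \<mu>\<^sup>2 * (\<phi> (s, y))\<^sup>2) integrable_on {x 0..x N}"
      by (intro integrable_continuous_real continuous_intros c1 C\<phi> c\<phi>)+
    from Henstock_Kurzweil_Integration.integral_add[OF this] show ?thesis by simp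
  qed
  also have "\<dots> \<le> 2 * (t M * N1\<^sup>2) + 2 * \<mu>\<^sup>2 * (t M * N0\<^sup>2)"
    unfolding \<phi>x using dual_slices[OF \<omega>x s] dual_slices[OF \<omega> s] by (intro add_mono mult_left_mono) auto
  also have "\<dots> = Z" by (simp add: Z_def algebra_simps)
  finally show ?thesis .
qed

text \<open>The piecewise linear interpolant in space of \<open>\<theta>\<close> at the beginning of the slab,
  constant in time.\<close>

definition interpolant :: "nat \<Rightarrow> nat \<Rightarrow> real \<times> real \<Rightarrow> real" where
  "interpolant m j z = \<theta> m j (t (m - 1), x (j - 1))
     + (\<theta> m j (t (m - 1), x j) - \<theta> m j (t (m - 1), x (j - 1))) * ((snd z - x (j - 1)) / l j)"

text \<open>A bound for the squared variation of \<open>\<theta>\<close> over one element, by Cauchy-Schwarz.\<close>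

definition Y :: "nat \<Rightarrow> nat \<Rightarrow> real" where
  "Y m j = l j * integral {x (j - 1)..x j} (\<lambda>y. (pd (0, 1) (\<theta> m j) (t (m - 1), y))\<^sup>2)"

lemma variation_bound:
  assumes j: "j \<in> {1..N}" and y: "y \<in> {x (j - 1)..x j}"
  shows "(\<theta> m j (t (m - 1), y) - \<theta> m j (t (m - 1), x (j - 1)))\<^sup>2 \<le> Y m j"
proof -
  let ?f = "\<lambda>y. pd (0, 1) (\<theta> m j) (t (m - 1), y)"
  have U_coeff: "continuous_on A ?f" for A
    using Ck_SucD[of 1 "\<theta> m j"] C\<theta>[of 2] by (intro slice_continuous[of 1]) (simp add: numeral_2_eq_2 One_nat_def)
  have "\<theta> m j (t (m - 1), y) - \<theta> m j (t (m - 1), x (j - 1)) = integral {x (j - 1)..y} ?f"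
    using integral_pd_x[OF C\<theta>, of "x (j - 1)" y m j "t (m - 1)"] y by simp
  then have "(\<theta> m j (t (m - 1), y) - \<theta> m j (t (m - 1), x (j - 1)))\<^sup>2 \<le> (y - x (j - 1)) * integral {x (j - 1)..y} (\<lambda>y. (?f y)\<^sup>2)"
    using integral_square_le[OF U_coeff, of "y - x (j - 1)" "x (j - 1)"] y by simp
  also have "\<dots> \<le> Y m j"
    unfolding Y_def using y
    by (intro mult_mono integral_subset_le integral_nonneg integrable_continuous_real continuous_intros U_coeff) auto
  finally show ?thesis .
qed

lemma sum_Y: "(\<Sum>m=1..M. \<Sum>j=1..N. Y m j / l j * h) \<le> t M * Z"
proof -
  have "(\<Sum>m=1..M. \<Sum>j=1..N. Y m j / l j * h) = (\<Sum>m=1..M. h * (\<Sum>j=1..N. integral {x (j - 1)..x j} (\<lambda>y. (pd (0, 1) (\<theta> m j) (t (m - 1), y))\<^sup>2)))"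
    unfolding sum_distrib_left
  proof (intro sum.cong refl)
    fix m j assume "j \<in> {1..N}"
    then have "l j \<noteq> 0" using l_pos[of j] by simp
    moreover have "a * b / a * h = h * b" if "a \<noteq> 0" for a b :: real using that by simp
    ultimately show "Y m j / l j * h = h * integral {x (j - 1)..x j} (\<lambda>y. (pd (0, 1) (\<theta> m j) (t (m - 1), y))\<^sup>2)"
      unfolding Y_def by blast
  qed
  also have "\<dots> \<le> (\<Sum>m=1..M. h * Z)"
    using h_pos t_nonneg by (intro sum_mono mult_left_mono slope_bound) auto
  also have "\<dots> = (real M * h) * Z" by simp
  also have "real M * h = t M"
  proof -
    have "t m = real m * h" if "m \<le> M" for m using that
    proof (induction m)
      case (Suc m)
      then show ?case using t_step[of "Suc m"] by (simp add: algebra_simps)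
    qed (simp add: t0)
    then show ?thesis by simp
  qed
  finally show ?thesis .
qed

lemma Y_nonneg: "j \<in> {1..N} \<Longrightarrow> 0 \<le> Y m j"
  using variation_bound[of j "x (j - 1)" m] l_pos[of j] by simp

lemma interpolation_error:
  "(L2_norm Q (assemble (\<lambda>m j z. \<theta> m j (t (m - 1), snd z) - interpolant m j z)))\<^sup>2 \<le> 4 * h\<^sup>2 * (t M * Z)"
proof -
  have "(L2_norm Q (assemble (\<lambda>m j z. \<theta> m j (t (m - 1), snd z) - interpolant m j z)))\<^sup>2 \<le> (\<Sum>m=1..M. \<Sum>j=1..N. (4 * Y m j) * (h * l j))"
  proof (rule cell_bound_L2)
    fix m j assume mj: "m \<in> {1..M}" "j \<in> {1..N}"
    show "continuous_on UNIV (\<lambda>z. \<theta> m j (t (m - 1), snd z) - interpolant m j z)"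
      unfolding interpolant_def using l_pos[OF mj(2)]
      by (intro continuous_intros continuous_on_compose2[OF Ck_continuous[OF C\<theta>, of UNIV]]) auto
    fix z assume z: "z \<in> ccell m j"
    then have y: "snd z \<in> {x (j - 1)..x j}" by (cases z) (auto simp: cbox_Pair_eq)
    define a where "a = \<theta> m j (t (m - 1), snd z) - \<theta> m j (t (m - 1), x (j - 1))"
    define b where "b = \<theta> m j (t (m - 1), x j) - \<theta> m j (t (m - 1), x (j - 1))"
    define w where "w = (snd z - x (j - 1)) / l j"
    have w: "0 \<le> w" "w \<le> 1" using y l_pos[OF mj(2)] by (auto simp: w_def field_simps)
    have ab: "a\<^sup>2 \<le> Y m j" "b\<^sup>2 \<le> Y m j"
      using variation_bound[OF mj(2) y, of m] variation_bound[OF mj(2), of "x j" m] l_pos[OF mj(2)] by (auto simp: a_def b_def)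
    have "(a - b * w)\<^sup>2 \<le> 2 * a\<^sup>2 + 2 * (b * w)\<^sup>2"
      using sum_squares_bound[of a "- (b * w)"] by (simp add: power2_diff)
    also have "(b * w)\<^sup>2 \<le> b\<^sup>2"
      using w by (simp add: power_mult_distrib mult_left_le power_le_one)
    finally have "(a - b * w)\<^sup>2 \<le> 4 * Y m j" using ab by linarith
    moreover have "\<theta> m j (t (m - 1), snd z) - interpolant m j z = a - b * w" by (simp add: interpolant_def a_def b_def w_def)
    ultimately show "(\<theta> m j (t (m - 1), snd z) - interpolant m j z)\<^sup>2 \<le> 4 * Y m j" by simp
  qed
  also have "\<dots> \<le> (\<Sum>m=1..M. \<Sum>j=1..N. 4 * h\<^sup>2 * (Y m j / l j * h))"
  proof (intro sum_mono)
    fix m j assume j: "j \<in> {1..N}"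
    have "l j * l j \<le> h * h" using x_step[OF j] l_pos[OF j] h_pos by (intro mult_mono) auto
    then have "4 * (Y m j / l j * h) * (l j * l j) \<le> 4 * (Y m j / l j * h) * (h * h)"
      using Y_nonneg[OF j, of m] l_pos[OF j] h_pos by (intro mult_left_mono) auto
    moreover have "4 * (Y m j / l j * h) * (l j * l j) = 4 * Y m j * (h * l j)" using l_pos[OF j] by (simp add: field_simps)
    ultimately show "4 * Y m j * (h * l j) \<le> 4 * h\<^sup>2 * (Y m j / l j * h)" by (simp only: power2_eq_square mult_ac)
  qed
  also have "\<dots> = 4 * h\<^sup>2 * (\<Sum>m=1..M. \<Sum>j=1..N. Y m j / l j * h)" by (simp only: sum_distrib_left)
  also have "\<dots> \<le> 4 * h\<^sup>2 * (t M * Z)" by (intro mult_left_mono sum_Y) auto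
  finally show ?thesis .
qed

lemma pd_interpolant: "pd d (interpolant m j) z = (\<theta> m j (t (m - 1), x j) - \<theta> m j (t (m - 1), x (j - 1))) * (snd d / l j)" if "j \<in> {1..N}"
  unfolding interpolant_def[abs_def] using l_pos[OF that]
  by (intro pd_eqI) (auto intro!: derivative_eq_intros)

lemma interpolant_slope: "(L2_norm Q (assemble (\<lambda>m j. pd (0, 1) (interpolant m j))))\<^sup>2 \<le> t M * Z"
proof -
  have "(L2_norm Q (assemble (\<lambda>m j. pd (0, 1) (interpolant m j))))\<^sup>2 \<le> (\<Sum>m=1..M. \<Sum>j=1..N. (Y m j / (l j)\<^sup>2) * (h * l j))"
  proof (rule cell_bound_L2)
    fix m j assume mj: "m \<in> {1..M}" "j \<in> {1..N}"
    show "continuous_on UNIV (\<lambda>z. pd (0, 1) (interpolant m j) z)" by (simp add: pd_interpolant[OF mj(2)])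
    fix z
    show "(pd (0, 1) (interpolant m j) z)\<^sup>2 \<le> Y m j / (l j)\<^sup>2"
      unfolding pd_interpolant[OF mj(2)] using variation_bound[OF mj(2), of "x j" m] l_pos[OF mj(2)]
      by (simp add: power_mult_distrib power_divide divide_right_mono)
  qed
  also have "\<dots> = (\<Sum>m=1..M. \<Sum>j=1..N. Y m j / l j * h)"
  proof (intro sum.cong refl)
    fix m j assume j: "j \<in> {1..N}"
    have "a / (b\<^sup>2) * (h * b) = a / b * h" if "b \<noteq> 0" for a b :: real using that by (simp add: power2_eq_square)
    from this[of "l j" "Y m j"] show "Y m j / (l j)\<^sup>2 * (h * l j) = Y m j / l j * h" using l_pos[OF j] by simp
  qed
  also have "\<dots> \<le> t M * Z" by (rule sum_Y)
  finally show ?thesis .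
qed

text \<open>The time derivative of \<open>\<theta>\<close> is \<open>1 - \<mu> \<psi>\<close> times that of
  \<open>\<phi>\<close>, and the dual equation bounds the latter by \<open>\<omega>\<close> and
  \<open>\<phi>\<^sub>x\<close>; no slope of the weight enters.\<close>

lemma time_difference:
  "(L2_norm Q (assemble (\<lambda>m j z. \<theta> m j z - \<theta> m j (t (m - 1), snd z))))\<^sup>2 \<le> h\<^sup>2 * (2 * N0\<^sup>2 + 2 * (t M * N1)\<^sup>2)"
proof -
  have c0: "continuous_on A (\<lambda>z. \<theta> m j z - \<theta> m j (t (m - 1), snd z))" for m j A
    by (intro continuous_intros Ck_continuous[OF C\<theta>] continuous_on_compose2[OF Ck_continuous[OF C\<theta>, of UNIV]]) auto
  have c1: "continuous_on A (pd (1, 0) (\<theta> m j))" for m j A by (rule Ck_pd[OF C\<theta>])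
  have "(L2_norm Q (assemble (\<lambda>m j z. \<theta> m j z - \<theta> m j (t (m - 1), snd z))))\<^sup>2
      = (\<Sum>m=1..M. \<Sum>j=1..N. integral (ccell m j) (\<lambda>z. (\<theta> m j z - \<theta> m j (t (m - 1), snd z))\<^sup>2))"
    unfolding L2_norm_square
    by (rule Q_integral(2)) (auto intro!: continuous_intros c0 simp: assemble_cell)
  also have "\<dots> \<le> (\<Sum>m=1..M. \<Sum>j=1..N. h\<^sup>2 * integral (ccell m j) (\<lambda>z. (pd (1, 0) (\<theta> m j) z)\<^sup>2))"
  proof (intro sum_mono)
    fix m j assume mj: "m \<in> {1..M}" "j \<in> {1..N}"
    let ?I = "\<lambda>y. integral {t (m - 1)..t m} (\<lambda>s. (pd (1, 0) (\<theta> m j) (s, y))\<^sup>2)"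
    have tm: "t m - t (m - 1) = h" using t_step[OF mj(1)] by simp
    have cI: "continuous_on UNIV (\<lambda>y. integral (cbox (t (m - 1)) (t m)) (\<lambda>s. (pd (1, 0) (\<theta> m j) (s, y))\<^sup>2))"
      by (rule integral_continuous_on_param)
        (auto simp: case_prod_unfold intro!: continuous_intros continuous_on_compose2[OF c1[of UNIV]])
    have cIx: "continuous_on A ?I" for A using continuous_on_subset[OF cI] by simp
    have sl_bound: "(\<theta> m j (s, y) - \<theta> m j (t (m - 1), y))\<^sup>2 \<le> h * ?I y" if s: "s \<in> {t (m - 1)..t m}" for s y
    proof -
      let ?f = "\<lambda>s. pd (1, 0) (\<theta> m j) (s, y)"
      have U_coeff: "continuous_on A ?f" for A
        by (rule continuous_on_compose2[OF c1[of UNIV]]) (auto intro!: continuous_intros)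
      have "\<theta> m j (s, y) - \<theta> m j (t (m - 1), y) = integral {t (m - 1)..s} ?f"
        using integral_pd_t[OF C\<theta>, of "t (m - 1)" s m j y] s by simp
      then have "(\<theta> m j (s, y) - \<theta> m j (t (m - 1), y))\<^sup>2 \<le> (s - t (m - 1)) * integral {t (m - 1)..s} (\<lambda>s. (?f s)\<^sup>2)"
        using integral_square_le[OF U_coeff, of "s - t (m - 1)" "t (m - 1)"] s by simp
      also have "\<dots> \<le> h * ?I y"
        using s tm h_pos
        by (intro mult_mono integral_subset_le integral_nonneg integrable_continuous_real continuous_intros U_coeff) auto
      finally show ?thesis .
    qed
    have "integral (ccell m j) (\<lambda>z. (\<theta> m j z - \<theta> m j (t (m - 1), snd z))\<^sup>2)
       = integral {x (j - 1)..x j} (\<lambda>y. integral {t (m - 1)..t m} (\<lambda>s. (\<theta> m j (s, y) - \<theta> m j (t (m - 1), y))\<^sup>2))"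
      by (subst rectangle_Fubini(2)) (auto intro!: continuous_intros c0)
    also have "\<dots> \<le> integral {x (j - 1)..x j} (\<lambda>y. h * (h * ?I y))"
    proof (rule integral_le)
      have "continuous_on UNIV (\<lambda>y. integral (cbox (t (m - 1)) (t m)) (\<lambda>s. (\<theta> m j (s, y) - \<theta> m j (t (m - 1), y))\<^sup>2))"
        by (rule integral_continuous_on_param)
          (auto simp: case_prod_unfold intro!: continuous_intros continuous_on_compose2[OF Ck_continuous[OF C\<theta>, of UNIV]])
      then show "(\<lambda>y. integral {t (m - 1)..t m} (\<lambda>s. (\<theta> m j (s, y) - \<theta> m j (t (m - 1), y))\<^sup>2)) integrable_on {x (j - 1)..x j}"
        by (intro integrable_continuous_real) (auto intro: continuous_on_subset)
      show "(\<lambda>y. h * (h * ?I y)) integrable_on {x (j - 1)..x j}"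
        by (intro integrable_continuous_real continuous_intros cIx)
      fix y
      have "integral {t (m - 1)..t m} (\<lambda>s. (\<theta> m j (s, y) - \<theta> m j (t (m - 1), y))\<^sup>2) \<le> integral {t (m - 1)..t m} (\<lambda>s. h * ?I y)"
        using sl_bound by (intro integral_le integrable_continuous_real continuous_intros slice_continuous_t[OF C\<theta>]) auto
      also have "\<dots> = h * (h * ?I y)" using tm h_pos by simp
      finally show "integral {t (m - 1)..t m} (\<lambda>s. (\<theta> m j (s, y) - \<theta> m j (t (m - 1), y))\<^sup>2) \<le> h * (h * ?I y)" .
    qed
    also have "\<dots> = h\<^sup>2 * integral {x (j - 1)..x j} ?I" by (simp add: power2_eq_square)
    also have "integral {x (j - 1)..x j} ?I = integral (ccell m j) (\<lambda>z. (pd (1, 0) (\<theta> m j) z)\<^sup>2)"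
      by (subst rectangle_Fubini(2)) (auto intro!: continuous_intros c1)
    finally show "integral (ccell m j) (\<lambda>z. (\<theta> m j z - \<theta> m j (t (m - 1), snd z))\<^sup>2) \<le> h\<^sup>2 * integral (ccell m j) (\<lambda>z. (pd (1, 0) (\<theta> m j) z)\<^sup>2)" .
  qed
  also have "\<dots> = h\<^sup>2 * (L2_norm Q (assemble (\<lambda>m j. pd (1, 0) (\<theta> m j))))\<^sup>2"
  proof -
    have "(L2_norm Q (assemble (\<lambda>m j. pd (1, 0) (\<theta> m j))))\<^sup>2 = (\<Sum>m=1..M. \<Sum>j=1..N. integral (ccell m j) (\<lambda>z. (pd (1, 0) (\<theta> m j) z)\<^sup>2))"
      unfolding L2_norm_square
      by (rule Q_integral(2)) (auto intro!: continuous_intros c1 simp: assemble_cell)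
    then show ?thesis by (simp only: sum_distrib_left)
  qed
  also have "\<dots> \<le> h\<^sup>2 * (2 * N0\<^sup>2 + 2 * (t M * N1)\<^sup>2)"
  proof (rule mult_left_mono)
    have L\<omega>: "\<omega> \<in> L2 Q" by (rule continuous_L2[OF Ck_continuous[OF C\<omega>]]) auto
    have L\<phi>x: "pd (0, 1) \<phi> \<in> L2 Q" by (rule continuous_L2[OF Ck_pd[OF C\<phi>]]) auto
    have L\<phi>t: "pd (1, 0) \<phi> \<in> L2 Q" by (rule continuous_L2[OF Ck_pd[OF C\<phi>]]) auto
    have "L2_norm Q (assemble (\<lambda>m j. pd (1, 0) (\<theta> m j))) \<le> 1 * L2_norm Q (pd (1, 0) \<phi>)"
    proof (rule L2_norm_bound[OF L\<phi>t], rule AE_I2)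
      fix z assume "z \<in> space (lebesgue_on Q)"
      then have j: "cell_of (snd z) \<in> {1..N}" "snd z \<in> {x (cell_of (snd z) - 1)..x (cell_of (snd z))}"
        using cell_of_cases[of "snd z"] by (auto simp: box_Pair)
      from \<eta>[OF j, of "fst z"] have "\<bar>1 - \<mu> * \<Psi> (cell_of (snd z)) z\<bar> \<le> 1" by simp
      then have "\<bar>1 - \<mu> * \<Psi> (cell_of (snd z)) z\<bar> * \<bar>pd (1, 0) \<phi> z\<bar> \<le> 1 * \<bar>pd (1, 0) \<phi> z\<bar>" by (rule mult_right_mono) simp
      then show "norm (assemble (\<lambda>m j. pd (1, 0) (\<theta> m j)) z) \<le> 1 * norm (pd (1, 0) \<phi> z)"
        by (simp add: assemble_def pd_\<theta> abs_mult)
    qed simp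
    then have "(L2_norm Q (assemble (\<lambda>m j. pd (1, 0) (\<theta> m j))))\<^sup>2 \<le> (L2_norm Q (pd (1, 0) \<phi>))\<^sup>2"
      using L2_norm_nonneg by (intro power_mono) auto
    also have "L2_norm Q (pd (1, 0) \<phi>) = L2_norm Q (\<lambda>z. - \<omega> z + - \<sigma> * pd (0, 1) \<phi> z)"
    proof -
      have "pd (1, 0) \<phi> z = - \<omega> z + - \<sigma> * pd (0, 1) \<phi> z" if "z \<in> Q" for z
        using \<phi>_eq[of "fst z" "snd z"] that by (auto simp: box_Pair)
      then have "(LINT z|lebesgue_on Q. (norm (pd (1, 0) \<phi> z))\<^sup>2) = (LINT z|lebesgue_on Q. (norm (- \<omega> z + - \<sigma> * pd (0, 1) \<phi> z))\<^sup>2)"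
        by (intro Bochner_Integration.integral_cong) auto
      then show ?thesis by (simp only: L2_norm_def)
    qed
    also have "(L2_norm Q (\<lambda>z. - \<omega> z + - \<sigma> * pd (0, 1) \<phi> z))\<^sup>2 \<le> 2 * (L2_norm Q (\<lambda>z. - \<omega> z))\<^sup>2 + 2 * (L2_norm Q (\<lambda>z. - \<sigma> * pd (0, 1) \<phi> z))\<^sup>2"
      by (intro L2_norm_add_square L2_minus L2_cmult L\<omega> L\<phi>x)
    also have "L2_norm Q (\<lambda>z. - \<omega> z) = N0" by (simp add: L2_norm_def)
    also have "L2_norm Q (\<lambda>z. - \<sigma> * pd (0, 1) \<phi> z) = L2_norm Q (pd (0, 1) \<phi>)"
      unfolding L2_norm_cmult using \<sigma> by auto
    also have "(L2_norm Q (pd (0, 1) \<phi>))\<^sup>2 \<le> (t M * N1)\<^sup>2"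
      unfolding \<phi>x using dual_norm[OF \<omega>x] L2_norm_nonneg by (intro power_mono) auto
    finally show "(L2_norm Q (assemble (\<lambda>m j. pd (1, 0) (\<theta> m j))))\<^sup>2 \<le> 2 * N0\<^sup>2 + 2 * (t M * N1)\<^sup>2" by simp
  qed simp
  finally show ?thesis .
qed

end

section \<open>The error of a scalar component\<close>

context tested_scheme begin

definition D where "D = sqrt (N0\<^sup>2 + N1\<^sup>2)"

definition K1 where "K1 = 4 + 4 * (t M)\<^sup>2 + 16 * (t M)\<^sup>2 * (1 + \<mu>\<^sup>2)"

lemma D_sq: "D\<^sup>2 = N0\<^sup>2 + N1\<^sup>2" "0 \<le> D" "N0\<^sup>2 \<le> D\<^sup>2" "N1\<^sup>2 \<le> D\<^sup>2"
  by (simp_all add: D_def)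

lemma K1_nonneg: "0 \<le> K1" unfolding K1_def by simp

lemma norm_by_D:
  assumes "(L2_norm Q f)\<^sup>2 \<le> e\<^sup>2 * (K1 * D\<^sup>2)" "0 \<le> e"
  shows "L2_norm Q f \<le> e * (sqrt K1 * D)"
proof (rule power2_le_imp_le)
  show "(L2_norm Q f)\<^sup>2 \<le> (e * (sqrt K1 * D))\<^sup>2"
    using assms(1) K1_nonneg by (simp add: power_mult_distrib)
  show "0 \<le> e * (sqrt K1 * D)" using assms(2) D_sq(2) K1_nonneg by simp
qed

lemma Z_bound: "8 * (t M * Z) \<le> 16 * (t M)\<^sup>2 * (1 + \<mu>\<^sup>2) * D\<^sup>2"
proof -
  have "N1\<^sup>2 + \<mu>\<^sup>2 * N0\<^sup>2 \<le> (1 + \<mu>\<^sup>2) * D\<^sup>2" unfolding D_sq(1) by (simp add: algebra_simps)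
  then have "16 * (t M)\<^sup>2 * (N1\<^sup>2 + \<mu>\<^sup>2 * N0\<^sup>2) \<le> 16 * (t M)\<^sup>2 * ((1 + \<mu>\<^sup>2) * D\<^sup>2)" by (intro mult_left_mono) auto
  moreover have "8 * (t M * Z) = 16 * (t M)\<^sup>2 * (N1\<^sup>2 + \<mu>\<^sup>2 * N0\<^sup>2)"
    unfolding Z_def by (simp add: power2_eq_square mult_ac)
  ultimately show ?thesis by (simp only: mult.assoc)
qed

text \<open>At the outflow end \<open>\<theta>\<close> vanishes because characteristics leave the domain there, and at
  the inflow end because of the weight.\<close>

lemma interpolant_discrete:
  assumes inflow: "\<mu> * \<psi> (if \<sigma> = 1 then x 0 else x N) = 1"
  shows "discrete (assemble interpolant) interpolant"
proof (rule discreteI)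
  fix m j
  let ?A = "\<theta> m j (t (m - 1), x (j - 1))" and ?B = "\<theta> m j (t (m - 1), x j) - \<theta> m j (t (m - 1), x (j - 1))"
  let ?c = "\<lambda>a b. if a = 0 then (if b = 0 then ?A else if b = 1 then ?B else 0) else 0"
  have "tensor k ?c z w = ?A + ?B * w" for z w
  proof -
    have "tensor k ?c z w = (\<Sum>a\<le>k. if a = 0 then (\<Sum>b\<le>k. (if b = 0 then ?A else 0) + (if b = 1 then ?B * w else 0)) else 0)"
      unfolding tensor_def by (intro sum.cong refl) (auto intro!: sum.cong)
    also have "\<dots> = ?A + ?B * w" using k_pos by (simp add: sum.distrib)
    finally show ?thesis .
  qed
  then have "interpolant m j = loc m j ?c" unfolding interpolant_def[abs_def] loc_def[abs_def] by simp
  then show "\<exists>c. interpolant m j = loc m j c" by blast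
next
  fix m j s assume j: "j \<in> {1..N}" "Suc j \<le> N"
  have j': "Suc j \<in> {1..N}" using j by auto
  have "interpolant m j (s, x j) = \<theta> m j (t (m - 1), x j)" using l_pos[OF j(1)] by (simp add: interpolant_def)
  moreover have "interpolant m (Suc j) (s, x j) = \<theta> m (Suc j) (t (m - 1), x j)" by (simp add: interpolant_def)
  moreover have "\<Psi> j (t (m - 1), x j) = \<Psi> (Suc j) (t (m - 1), x j)"
    using \<Psi>_eq[OF j(1), of "x j"] \<Psi>_eq[OF j', of "x j"] l_pos[OF j(1)] l_pos[OF j'] by simp
  ultimately show "interpolant m j (s, x j) = interpolant m (Suc j) (s, x j)" by (simp add: \<theta>_def)
next
  fix m s assume m: "m \<in> {1..M}"
  have N: "1 \<in> {1..N}" "N \<in> {1..N}" using xm.N_pos by auto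
  have tm0: "0 \<le> t (m - 1)" using m by (intro t_nonneg) auto
  have "interpolant m 1 (s, x 0) = \<theta> m 1 (t (m - 1), x 0)" by (simp add: interpolant_def)
  also have "\<dots> = (1 - \<mu> * \<psi> (x 0)) * \<phi> (t (m - 1), x 0)"
    using \<Psi>_eq[OF N(1), of "x 0"] l_pos[OF N(1)] by (simp add: \<theta>_def)
  also have "\<dots> = 0"
  proof (cases "\<sigma> = 1")
    case False
    then have "\<phi> (t (m - 1), x 0) = 0"
      using \<sigma> by (intro dual_zero \<omega>_zero) (auto simp: box_Pair)
    then show ?thesis by simp
  qed (use inflow in simp)
  finally have a: "interpolant m 1 (s, x 0) = 0" .
  have "interpolant m N (s, x N) = \<theta> m N (t (m - 1), x N)" using l_pos[OF N(2)] by (simp add: interpolant_def)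
  also have "\<dots> = (1 - \<mu> * \<psi> (x N)) * \<phi> (t (m - 1), x N)"
    using \<Psi>_eq[OF N(2), of "x N"] l_pos[OF N(2)] by (simp add: \<theta>_def)
  also have "\<dots> = 0"
  proof (cases "\<sigma> = 1")
    case True
    then have "\<phi> (t (m - 1), x N) = 0"
      by (intro dual_zero \<omega>_zero) (auto simp: box_Pair)
    then show ?thesis by simp
  qed (use inflow in simp)
  finally show "interpolant m 1 (s, x 0) = 0 \<and> interpolant m N (s, x N) = 0" using a by simp
qed

text \<open>Orthogonality allows the interpolant to be subtracted from \<open>\<theta>\<close> in
  \<open>error_representation\<close>. The remaining differences are of size \<open>h\<close>, and the stabilization
  contributes only the slope of the interpolant, because the interpolant is constant in time on each slab.\<close>

lemma fine_mesh_estimate: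
  assumes inflow: "\<mu> * \<psi> (if \<sigma> = 1 then x 0 else x N) = 1"
  shows "\<bar>LINT z|lebesgue_on Q. (V z - assemble U z) * \<omega> z\<bar>
    \<le> sqrt K1 * D * (h * L2_norm Q r + L2_norm Q J + \<delta> * L2_norm Q p + L2_norm Q U_strip)"
proof -
  let ?tr = "slabwise (\<lambda>m. trace \<theta> m (t (m - 1)))" and ?tg = "slabwise (\<lambda>m. trace interpolant m (t (m - 1)))"
  let ?X = "\<lambda>z. \<mu> * (assemble (\<lambda>m. \<Psi>) z * \<omega> z + \<phi> z)"
  let ?gx = "assemble (\<lambda>m j. pd (0, 1) (interpolant m j))"
  note disc = interpolant_discrete[OF inflow]
  note CG = discrete_Ck[OF disc]
  have LG: "assemble interpolant \<in> L2 Q" "?gx \<in> L2 Q" by (intro assemble_L2 Ck_pd CG Ck_continuous[OF CG]; assumption)+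
  have L\<theta>: "assemble \<theta> \<in> L2 Q" by (intro assemble_L2 Ck_continuous[OF C\<theta>])
  have LT: "?tr \<in> L2 Q" "?tg \<in> L2 Q" by (intro slabwise_L2 trace_L2 C\<theta> CG; assumption)+
  have LUS: "U_strip \<in> L2 Q" by (intro assemble_L2 continuous_on_mult continuous_on_const Ck_continuous[OF CU])
  have L\<omega>: "\<omega> \<in> L2 Q" by (rule continuous_L2[OF Ck_continuous[OF C\<omega>]]) auto
  have L\<phi>: "\<phi> \<in> L2 Q" by (rule continuous_L2[OF Ck_continuous[OF C\<phi>]]) auto
  have cP: "continuous_on A (\<lambda>z. \<mu> * \<Psi> j z * \<omega> z)" for A j
    by (intro continuous_intros Ck_continuous[OF Ck_\<Psi>] Ck_continuous[OF C\<omega>])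
  have LP: "(\<lambda>z. \<mu> * assemble (\<lambda>m. \<Psi>) z * \<omega> z) \<in> L2 Q"
  proof -
    have "assemble (\<lambda>m j z. \<mu> * \<Psi> j z * \<omega> z) \<in> L2 Q" by (intro assemble_L2 cP)
    moreover have "assemble (\<lambda>m j z. \<mu> * \<Psi> j z * \<omega> z) = (\<lambda>z. \<mu> * assemble (\<lambda>m. \<Psi>) z * \<omega> z)" by (auto simp: assemble_def)
    ultimately show ?thesis by simp
  qed
  have X_eq: "?X = (\<lambda>z. \<mu> * assemble (\<lambda>m. \<Psi>) z * \<omega> z + \<mu> * \<phi> z)" by (auto simp: algebra_simps)
  have LX: "?X \<in> L2 Q" unfolding X_eq by (intro L2_add LP L2_cmult L\<phi>)
  have g_t: "assemble (\<lambda>m j. pd (1, 0) (interpolant m j)) z = 0" if "z \<in> Q" for z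
  proof -
    have "cell_of (snd z) \<in> {1..N}" using that cell_of_cases[of "snd z"] by (auto simp: box_Pair)
    from pd_interpolant[OF this] show ?thesis by (simp add: assemble_def)
  qed
  have "(LINT z|lebesgue_on Q. q z * assemble (\<lambda>m j. pd (1, 0) (interpolant m j)) z) = 0"
    by (rule integral_eq_zero_AE, rule AE_I2) (simp add: g_t)
  then have o: "(LINT z|lebesgue_on Q. r z * assemble interpolant z) + \<delta> * (LINT z|lebesgue_on Q. p z * ?gx z)
      = 1 / h * (LINT z|lebesgue_on Q. J z * ?tg z)"
    using orth[OF disc] by simp
  have rd: "(LINT z|lebesgue_on Q. r z * (assemble \<theta> z - assemble interpolant z)) = (LINT z|lebesgue_on Q. r z * assemble \<theta> z) - (LINT z|lebesgue_on Q. r z * assemble interpolant z)"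
    using L2_mult_integrable[OF rL L\<theta>] L2_mult_integrable[OF rL LG(1)] by (simp add: right_diff_distrib)
  have jd: "(LINT z|lebesgue_on Q. J z * (?tr z - ?tg z)) = (LINT z|lebesgue_on Q. J z * ?tr z) - (LINT z|lebesgue_on Q. J z * ?tg z)"
    using L2_mult_integrable[OF JL LT(1)] L2_mult_integrable[OF JL LT(2)] by (simp add: right_diff_distrib)
  have rep: "(LINT z|lebesgue_on Q. (V z - assemble U z) * \<omega> z) = (LINT z|lebesgue_on Q. r z * (assemble \<theta> z - assemble interpolant z))
     - 1 / h * (LINT z|lebesgue_on Q. J z * (?tr z - ?tg z)) - \<delta> * (LINT z|lebesgue_on Q. p z * ?gx z)
     - (LINT z|lebesgue_on Q. U_strip z * ?X z)"
    unfolding rd jd right_diff_distrib[of "1 / h"] using error_representation o by linarith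
  have t2: "0 \<le> (t M)\<^sup>2" by simp
  have timed: "(L2_norm Q (assemble (\<lambda>m j z. \<theta> m j z - \<theta> m j (t (m - 1), snd z))))\<^sup>2 \<le> h\<^sup>2 * ((2 + 2 * (t M)\<^sup>2) * D\<^sup>2)"
  proof -
    have "2 * N0\<^sup>2 + 2 * (t M * N1)\<^sup>2 \<le> (2 + 2 * (t M)\<^sup>2) * D\<^sup>2"
      unfolding D_sq(1) by (simp add: power_mult_distrib algebra_simps)
    then show ?thesis using order_trans[OF time_difference mult_left_mono] by auto
  qed
  have interp: "(L2_norm Q (assemble (\<lambda>m j z. \<theta> m j (t (m - 1), snd z) - interpolant m j z)))\<^sup>2 \<le> h\<^sup>2 * (8 * (t M)\<^sup>2 * (1 + \<mu>\<^sup>2) * D\<^sup>2)"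
  proof -
    have "4 * (t M * Z) \<le> 8 * (t M)\<^sup>2 * (1 + \<mu>\<^sup>2) * D\<^sup>2" using Z_bound by simp
    from mult_left_mono[OF this, of "h\<^sup>2"] show ?thesis using interpolation_error by (simp add: mult_ac)
  qed
  have n1: "L2_norm Q (\<lambda>z. assemble \<theta> z - assemble interpolant z) \<le> h * (sqrt K1 * D)"
  proof (rule norm_by_D)
    have La: "assemble (\<lambda>m j z. \<theta> m j z - \<theta> m j (t (m - 1), snd z)) \<in> L2 Q"
      by (intro assemble_L2 continuous_intros Ck_continuous[OF C\<theta>] continuous_on_compose2[OF Ck_continuous[OF C\<theta>, of UNIV]]) auto
    have Lb: "assemble (\<lambda>m j z. \<theta> m j (t (m - 1), snd z) - interpolant m j z) \<in> L2 Q"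
      by (intro assemble_L2 continuous_intros Ck_continuous[OF CG] continuous_on_compose2[OF Ck_continuous[OF C\<theta>, of UNIV]]) auto
    have "(\<lambda>z. assemble \<theta> z - assemble interpolant z) = (\<lambda>z. assemble (\<lambda>m j z. \<theta> m j z - \<theta> m j (t (m - 1), snd z)) z + assemble (\<lambda>m j z. \<theta> m j (t (m - 1), snd z) - interpolant m j z) z)"
      by (auto simp: assemble_def)
    then have "(L2_norm Q (\<lambda>z. assemble \<theta> z - assemble interpolant z))\<^sup>2 \<le> 2 * (h\<^sup>2 * ((2 + 2 * (t M)\<^sup>2) * D\<^sup>2)) + 2 * (h\<^sup>2 * (8 * (t M)\<^sup>2 * (1 + \<mu>\<^sup>2) * D\<^sup>2))"
      using L2_norm_add_square[OF La Lb] timed interp by simp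
    also have "\<dots> = h\<^sup>2 * (K1 * D\<^sup>2)" unfolding K1_def by (simp add: algebra_simps)
    finally show "(L2_norm Q (\<lambda>z. assemble \<theta> z - assemble interpolant z))\<^sup>2 \<le> h\<^sup>2 * (K1 * D\<^sup>2)" .
  qed (use h_pos in simp)
  have n2: "L2_norm Q (\<lambda>z. ?tr z - ?tg z) \<le> h * (sqrt K1 * D)"
  proof (rule norm_by_D)
    have "(\<lambda>z. ?tr z - ?tg z) = assemble (\<lambda>m j z. \<theta> m j (t (m - 1), snd z) - interpolant m j z)"
      by (auto simp: assemble_def slabwise_def trace_def interpolant_def)
    then have "(L2_norm Q (\<lambda>z. ?tr z - ?tg z))\<^sup>2 \<le> h\<^sup>2 * (8 * (t M)\<^sup>2 * (1 + \<mu>\<^sup>2) * D\<^sup>2)" using interp by simp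
    also have "8 * (t M)\<^sup>2 * (1 + \<mu>\<^sup>2) * D\<^sup>2 \<le> K1 * D\<^sup>2"
      unfolding K1_def by (intro mult_right_mono) (simp_all add: algebra_simps)
    finally show "(L2_norm Q (\<lambda>z. ?tr z - ?tg z))\<^sup>2 \<le> h\<^sup>2 * (K1 * D\<^sup>2)" by (simp add: mult_left_mono)
  qed (use h_pos in simp)
  have n3: "L2_norm Q ?gx \<le> 1 * (sqrt K1 * D)"
  proof (rule norm_by_D)
    have "0 \<le> t M * Z" using interpolant_slope zero_le_power2 order_trans by blast
    then have "(L2_norm Q ?gx)\<^sup>2 \<le> 16 * (t M)\<^sup>2 * (1 + \<mu>\<^sup>2) * D\<^sup>2" using interpolant_slope Z_bound by linarith
    also have "\<dots> \<le> K1 * D\<^sup>2" unfolding K1_def by (intro mult_right_mono) auto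
    finally show "(L2_norm Q ?gx)\<^sup>2 \<le> 1\<^sup>2 * (K1 * D\<^sup>2)" by simp
  qed simp
  have n4: "L2_norm Q ?X \<le> 1 * (sqrt K1 * D)"
  proof (rule norm_by_D)
    have "L2_norm Q (\<lambda>z. \<mu> * assemble (\<lambda>m. \<Psi>) z * \<omega> z) \<le> 1 * N0"
    proof (rule L2_norm_bound[OF L\<omega>], rule AE_I2)
      fix z assume "z \<in> space (lebesgue_on Q)"
      then have j: "cell_of (snd z) \<in> {1..N}" "snd z \<in> {x (cell_of (snd z) - 1)..x (cell_of (snd z))}"
        using cell_of_cases[of "snd z"] by (auto simp: box_Pair)
      from \<eta>[OF j, of "fst z"] have "\<bar>\<mu> * assemble (\<lambda>m. \<Psi>) z\<bar> \<le> 1" by (simp add: assemble_def)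
      then have "\<bar>\<mu> * assemble (\<lambda>m. \<Psi>) z\<bar> * \<bar>\<omega> z\<bar> \<le> 1 * \<bar>\<omega> z\<bar>" by (rule mult_right_mono) simp
      then show "norm (\<mu> * assemble (\<lambda>m. \<Psi>) z * \<omega> z) \<le> 1 * norm (\<omega> z)" by (simp add: abs_mult)
    qed simp
    then have a: "(L2_norm Q (\<lambda>z. \<mu> * assemble (\<lambda>m. \<Psi>) z * \<omega> z))\<^sup>2 \<le> D\<^sup>2"
      using L2_norm_nonneg D_sq(3) by (auto intro: order_trans[OF power_mono])
    have "L2_norm Q (\<lambda>z. \<mu> * \<phi> z) \<le> \<mu> * (t M * N0)"
      unfolding L2_norm_cmult using dual_norm[OF \<omega>] \<mu> by (simp add: mult_left_mono)
    then have "(L2_norm Q (\<lambda>z. \<mu> * \<phi> z))\<^sup>2 \<le> (\<mu> * (t M * N0))\<^sup>2" using L2_norm_nonneg by (intro power_mono) auto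
    also have "\<dots> = (\<mu>\<^sup>2 * (t M)\<^sup>2) * N0\<^sup>2" by (simp add: power_mult_distrib mult_ac)
    also have "\<dots> \<le> (\<mu>\<^sup>2 * (t M)\<^sup>2) * D\<^sup>2" using D_sq(3) by (intro mult_left_mono) auto
    finally have "(L2_norm Q ?X)\<^sup>2 \<le> 2 * D\<^sup>2 + 2 * ((\<mu>\<^sup>2 * (t M)\<^sup>2) * D\<^sup>2)"
      unfolding X_eq using a L2_norm_add_square[OF LP L2_cmult[OF L\<phi>, of \<mu>]] by linarith
    also have "\<dots> = (2 + 2 * (\<mu>\<^sup>2 * (t M)\<^sup>2)) * D\<^sup>2" by (simp add: algebra_simps)
    also have "\<dots> \<le> K1 * D\<^sup>2" unfolding K1_def by (intro mult_right_mono) (simp_all add: algebra_simps)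
    finally show "(L2_norm Q ?X)\<^sup>2 \<le> 1\<^sup>2 * (K1 * D\<^sup>2)" by simp
  qed simp
  note n0 = L2_norm_nonneg
  have cs: "\<bar>LINT z|lebesgue_on Q. f z * w z\<bar> \<le> L2_norm Q f * (e * (sqrt K1 * D))" if "f \<in> L2 Q" "w \<in> L2 Q" "L2_norm Q w \<le> e * (sqrt K1 * D)" for f w :: "real \<times> real \<Rightarrow> real" and e
    using order_trans[OF L2_Cauchy_Schwarz_real[OF that(1,2)] mult_left_mono[OF that(3) n0]] .
  have b1: "\<bar>LINT z|lebesgue_on Q. r z * (assemble \<theta> z - assemble interpolant z)\<bar> \<le> L2_norm Q r * (h * (sqrt K1 * D))" by (intro cs rL L2_diff L\<theta> LG n1)
  have b2: "\<bar>LINT z|lebesgue_on Q. J z * (?tr z - ?tg z)\<bar> \<le> L2_norm Q J * (h * (sqrt K1 * D))" by (intro cs JL L2_diff LT n2)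
  have b3: "\<bar>LINT z|lebesgue_on Q. p z * ?gx z\<bar> \<le> L2_norm Q p * (1 * (sqrt K1 * D))" by (intro cs pL LG n3)
  have b4: "\<bar>LINT z|lebesgue_on Q. U_strip z * ?X z\<bar> \<le> L2_norm Q U_strip * (1 * (sqrt K1 * D))" by (intro cs LUS LX n4)
  define A1 where "A1 = (LINT z|lebesgue_on Q. r z * (assemble \<theta> z - assemble interpolant z))"
  define A2 where "A2 = (LINT z|lebesgue_on Q. J z * (?tr z - ?tg z))"
  define A3 where "A3 = (LINT z|lebesgue_on Q. p z * ?gx z)"
  define A4 where "A4 = (LINT z|lebesgue_on Q. U_strip z * ?X z)"
  have "\<bar>A1 - 1 / h * A2 - \<delta> * A3 - A4\<bar> \<le> \<bar>A1\<bar> + \<bar>1 / h * A2\<bar> + \<bar>\<delta> * A3\<bar> + \<bar>A4\<bar>" by linarith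
  also have "\<dots> = \<bar>A1\<bar> + 1 / h * \<bar>A2\<bar> + \<delta> * \<bar>A3\<bar> + \<bar>A4\<bar>" using h_pos \<delta> by (simp add: abs_mult)
  also have "\<dots> \<le> L2_norm Q r * (h * (sqrt K1 * D)) + 1 / h * (L2_norm Q J * (h * (sqrt K1 * D))) + \<delta> * (L2_norm Q p * (1 * (sqrt K1 * D))) + L2_norm Q U_strip * (1 * (sqrt K1 * D))"
    using b1 b2 b3 b4 h_pos \<delta> unfolding A1_def A2_def A3_def A4_def by (intro add_mono mult_left_mono) auto
  also have "1 / h * (L2_norm Q J * (h * (sqrt K1 * D))) = L2_norm Q J * (sqrt K1 * D)" using h_pos by simp
  finally show ?thesis unfolding rep A1_def A2_def A3_def A4_def by (simp add: algebra_simps)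
qed

text \<open>The representation alone, without weight and without a discrete test function.\<close>

lemma coarse_mesh_estimate:
  assumes \<mu>0: "\<mu> = 0"
  shows "\<bar>LINT z|lebesgue_on Q. (V z - assemble U z) * \<omega> z\<bar> \<le> t M * D * (L2_norm Q r + L2_norm Q J / h)"
proof -
  let ?tr = "slabwise (\<lambda>m. trace \<theta> m (t (m - 1)))"
  have \<theta>: "\<theta> m j = \<phi>" for m j unfolding \<theta>_def[abs_def] using \<mu>0 by simp
  have L\<phi>: "\<phi> \<in> L2 Q" by (rule continuous_L2[OF Ck_continuous[OF C\<phi>]]) auto
  have trL: "trace \<theta> m s \<in> L2 \<Omega>" for m s by (intro trace_L2 C\<theta>)
  have LT: "?tr \<in> L2 Q" by (intro slabwise_L2 trL)
  have g\<theta>: "assemble \<theta> = \<phi>" by (auto simp: assemble_def \<theta>)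
  have ND: "N0 \<le> D" using D_sq L2_norm_nonneg by (intro power2_le_imp_le[of N0 D]) auto
  have n1: "L2_norm Q \<phi> \<le> t M * D"
    using order_trans[OF dual_norm[OF \<omega>] mult_left_mono[OF ND]] tM_pos by simp
  have n2: "L2_norm Q ?tr \<le> t M * D"
  proof (rule power2_le_imp_le)
    have tr: "(LINT y|lebesgue_on \<Omega>. trace \<theta> m (t (m - 1)) y * trace \<theta> m (t (m - 1)) y) \<le> t M * N0\<^sup>2" if m: "m \<in> {1..M}" for m
    proof -
      have c: "continuous_on A (\<lambda>y. (\<phi> (t (m - 1), y))\<^sup>2)" for A by (intro continuous_intros slice_continuous[OF C\<phi>])
      have "(LINT y|lebesgue_on \<Omega>. trace \<theta> m (t (m - 1)) y * trace \<theta> m (t (m - 1)) y) = integral {x 0..x N} (\<lambda>y. (\<phi> (t (m - 1), y))\<^sup>2)"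
        using rectangle_integral(2)[of "x 0" "x N" "\<lambda>y. (\<phi> (t (m - 1), y))\<^sup>2" "\<lambda>y. trace \<theta> m (t (m - 1)) y * trace \<theta> m (t (m - 1)) y"] c
        by (simp add: trace_def \<theta> power2_eq_square)
      also have "\<dots> \<le> t M * N0\<^sup>2" using m by (intro dual_slices[OF \<omega>] t_nonneg) auto
      finally show ?thesis .
    qed
    have Mh: "real M * h = t M"
    proof -
      have "t m = real m * h" if "m \<le> M" for m using that
      proof (induction m)
        case (Suc m)
        then show ?case using t_step[of "Suc m"] by (simp add: algebra_simps)
      qed (simp add: t0)
      then show ?thesis by simp
    qed
    have "(L2_norm Q ?tr)\<^sup>2 = (LINT z|lebesgue_on Q. ?tr z * ?tr z)"
      unfolding L2_norm_square by (simp add: power2_eq_square)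
    also have "\<dots> = h * (\<Sum>m=1..M. LINT y|lebesgue_on \<Omega>. trace \<theta> m (t (m - 1)) y * trace \<theta> m (t (m - 1)) y)"
      by (rule slabwise_mult_integral) (intro trL)+
    also have "\<dots> \<le> h * (\<Sum>m=1..M. t M * N0\<^sup>2)" using h_pos tr by (intro mult_left_mono sum_mono) auto
    also have "\<dots> = (real M * h) * (t M * N0\<^sup>2)" by simp
    also have "\<dots> = (t M)\<^sup>2 * N0\<^sup>2" unfolding Mh by (simp add: power2_eq_square mult_ac)
    also have "\<dots> \<le> (t M)\<^sup>2 * D\<^sup>2" by (intro mult_left_mono D_sq(3)) auto
    also have "\<dots> = (t M * D)\<^sup>2" by (simp only: power_mult_distrib)
    finally show "(L2_norm Q ?tr)\<^sup>2 \<le> (t M * D)\<^sup>2" .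
    show "0 \<le> t M * D" using tM_pos D_sq(2) by simp
  qed
  note n0 = L2_norm_nonneg
  have b1: "\<bar>LINT z|lebesgue_on Q. r z * \<phi> z\<bar> \<le> L2_norm Q r * (t M * D)"
    using order_trans[OF L2_Cauchy_Schwarz_real[OF rL L\<phi>] mult_left_mono[OF n1 n0]] .
  have b2: "\<bar>LINT z|lebesgue_on Q. J z * ?tr z\<bar> \<le> L2_norm Q J * (t M * D)"
    using order_trans[OF L2_Cauchy_Schwarz_real[OF JL LT] mult_left_mono[OF n2 n0]] .
  have rep: "(LINT z|lebesgue_on Q. (V z - assemble U z) * \<omega> z) = (LINT z|lebesgue_on Q. r z * \<phi> z) - 1 / h * (LINT z|lebesgue_on Q. J z * ?tr z)"
    using error_representation \<mu>0 g\<theta> by simp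
  have "\<bar>(LINT z|lebesgue_on Q. r z * \<phi> z) - 1 / h * (LINT z|lebesgue_on Q. J z * ?tr z)\<bar> \<le> \<bar>LINT z|lebesgue_on Q. r z * \<phi> z\<bar> + 1 / h * \<bar>LINT z|lebesgue_on Q. J z * ?tr z\<bar>"
    using abs_triangle_ineq4[of "LINT z|lebesgue_on Q. r z * \<phi> z" "1 / h * (LINT z|lebesgue_on Q. J z * ?tr z)"] h_pos
    by (simp add: abs_mult)
  also have "\<dots> \<le> L2_norm Q r * (t M * D) + 1 / h * (L2_norm Q J * (t M * D))"
    using b1 b2 h_pos by (intro add_mono mult_left_mono) auto
  finally show ?thesis unfolding rep by (simp add: algebra_simps)
qed

end

context scalar_scheme begin

text \<open>The strip ends at the last node before the support of the data. Because the elements have length at most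
  \<open>h\<close>, it covers at least half of the gap, which bounds \<open>\<mu>\<close> independently of the
  mesh.\<close>

lemma inflow_weight:
  assumes \<kappa>: "x 0 < \<kappa>1" "\<kappa>2 < x N" "\<kappa>1 \<le> \<kappa>2" and small: "h \<le> (\<kappa>1 - x 0) / 2" "h \<le> (x N - \<kappa>2) / 2"
    and data: "AE z in lebesgue_on Q. snd z \<notin> {\<kappa>1<..<\<kappa>2} \<longrightarrow> \<beta> z = 0 \<and> p z * Ux z + q z * Ut z \<le> 0"
    and V0z: "\<And>y. y \<notin> {\<kappa>1<..<\<kappa>2} \<Longrightarrow> V0 y = 0"
  obtains \<psi> sl \<mu> where "weighted_scheme t M x N h k \<sigma> \<delta> U V0 \<beta> r p q \<psi> sl"
    "0 \<le> \<mu>" "\<mu> \<le> max (2 / (\<kappa>1 - x 0)) (2 / (x N - \<kappa>2))" "\<And>y. \<mu> * \<psi> y \<le> 1"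
    "\<mu> * \<psi> (if \<sigma> = 1 then x 0 else x N) = 1"
proof (cases "\<sigma> = 1")
  case True
  (* The weight descends with slope -1 from the inflow end x 0 to the last node x j0 before the data. *)
  define j0 where "j0 = Max {j. j \<le> N \<and> x j \<le> \<kappa>1}"
  have fin: "finite {j. j \<le> N \<and> x j \<le> \<kappa>1}" "0 \<in> {j. j \<le> N \<and> x j \<le> \<kappa>1}" using \<kappa>(1) by auto
  have j0: "j0 \<le> N" "x j0 \<le> \<kappa>1" using Max_in[OF fin(1)] fin(2) unfolding j0_def by blast+
  have far: "(\<kappa>1 - x 0) / 2 \<le> x j0 - x 0"
  proof (cases "j0 = N")
    case True
    then show ?thesis using j0 \<kappa> by simp
  next
    case False
    then have S: "Suc j0 \<in> {1..N}" using j0 by auto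
    have "\<not> x (Suc j0) \<le> \<kappa>1"
    proof
      assume "x (Suc j0) \<le> \<kappa>1"
      then have "Suc j0 \<le> j0" unfolding j0_def using S by (intro Max_ge fin) (auto simp: j0_def)
      then show False by simp
    qed
    then show ?thesis using x_step[OF S] small(1) by (simp add: field_simps)
  qed
  define \<psi> where "\<psi> y = max 0 (x j0 - max y (x 0))" for y
  define sl where "sl j = (if j \<le> j0 then -1 else 0 :: real)" for j
  have left: "y \<le> x j0" if "j \<in> {1..N}" "j \<le> j0" "y \<le> x j" for j y
    using that xm.x_le[of j j0] j0 by simp
  have right: "x j0 \<le> y" if "j \<in> {1..N}" "\<not> j \<le> j0" "x (j - 1) \<le> y" for j y
    using that xm.x_le[of j0 "j - 1"] by force
  have ge0: "x 0 \<le> y" if "j \<in> {1..N}" "x (j - 1) \<le> y" for j y using that xm.cell_subset(1)[of j] by simp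
  have act: "y \<notin> {\<kappa>1<..<\<kappa>2}" if "y \<in> \<Omega>" "sl (cell_of y) \<noteq> 0" for y
    using left[of "cell_of y" y] cell_of_cases[OF that(1)] that(2) j0(2) by (auto simp: sl_def split: if_splits)
  have "weighted_scheme_axioms t M x N \<sigma> U V0 \<beta> p q \<psi> sl"
  proof
    show "sl j = 0 \<or> sl j = - \<sigma>" for j using True by (simp add: sl_def)
    show "\<psi> y = \<psi> (x (j - 1)) + sl j * (y - x (j - 1))" if "j \<in> {1..N}" "y \<in> {x (j - 1)..x j}" for j y
    proof (cases "j \<le> j0")
      case True
      then show ?thesis using that left[of j y] left[of j "x (j - 1)"] ge0[of j y] ge0[of j "x (j - 1)"] xm.x_inc[of j]
        by (simp add: \<psi>_def sl_def)
    next
      case False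
      then show ?thesis using that right[of j y] right[of j "x (j - 1)"] ge0[of j y] ge0[of j "x (j - 1)"]
        by (simp add: \<psi>_def sl_def)
    qed
    show "\<psi> y = 0" if "j \<in> {1..N}" "sl j = 0" "y \<in> {x (j - 1)..x j}" for j y
    proof -
      have "\<not> j \<le> j0" using that(2) by (simp add: sl_def split: if_splits)
      then show ?thesis using that right[of j y] by (simp add: \<psi>_def)
    qed
    show "0 \<le> \<psi> y" for y by (simp add: \<psi>_def)
    have inQ: "AE z in lebesgue_on Q. z \<in> Q" by (intro AE_I2) simp
    show "AE z in lebesgue_on Q. sl (cell_of (snd z)) \<noteq> 0 \<longrightarrow> \<beta> z = 0 \<and> p z * Ux z + q z * Ut z \<le> 0"
      using data inQ by eventually_elim (use act in \<open>auto simp: box_Pair\<close>)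
    show "V0 y = 0" if "y \<in> {x 0<..<x N}" "sl (cell_of y) \<noteq> 0" for y using V0z[OF act[OF that]] .
  qed
  then have W: "weighted_scheme t M x N h k \<sigma> \<delta> U V0 \<beta> r p q \<psi> sl"
    using scalar_scheme_axioms by (simp add: weighted_scheme_def)
  define \<mu> where "\<mu> = 1 / (x j0 - x 0)"
  have pos: "0 < x j0 - x 0" using far \<kappa>(1) by simp
  show thesis
  proof (rule that[OF W])
    show "0 \<le> \<mu>" using pos by (simp add: \<mu>_def)
    have "1 / (x j0 - x 0) \<le> 1 / ((\<kappa>1 - x 0) / 2)" using far pos \<kappa>(1) by (intro divide_left_mono) auto
    then show "\<mu> \<le> max (2 / (\<kappa>1 - x 0)) (2 / (x N - \<kappa>2))" by (simp add: \<mu>_def)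
    show "\<mu> * \<psi> y \<le> 1" for y unfolding \<mu>_def \<psi>_def using pos by (simp add: field_simps)
    show "\<mu> * \<psi> (if \<sigma> = 1 then x 0 else x N) = 1" unfolding \<mu>_def \<psi>_def using pos True by simp
  qed
next
  case False
  then have \<sigma>m: "\<sigma> = -1" using \<sigma> by simp
  define j0 where "j0 = Min {j. j \<le> N \<and> \<kappa>2 \<le> x j}"
  have fin: "finite {j. j \<le> N \<and> \<kappa>2 \<le> x j}" "N \<in> {j. j \<le> N \<and> \<kappa>2 \<le> x j}" using \<kappa>(2) by auto
  have j0: "j0 \<le> N" "\<kappa>2 \<le> x j0" using Min_in[OF fin(1)] fin(2) unfolding j0_def by blast+
  have far: "(x N - \<kappa>2) / 2 \<le> x N - x j0"
  proof (cases "j0 = 0")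
    case True
    then show ?thesis using j0 \<kappa> by simp
  next
    case False
    then have S: "j0 \<in> {1..N}" using j0 by auto
    have "\<not> \<kappa>2 \<le> x (j0 - 1)"
    proof
      assume "\<kappa>2 \<le> x (j0 - 1)"
      then have "j0 \<le> j0 - 1" using S fin(1) unfolding j0_def by (intro Min_le) (auto simp: j0_def)
      then show False using False by simp
    qed
    then show ?thesis using x_step[OF S] small(2) by (simp add: field_simps)
  qed
  define \<psi> where "\<psi> y = max 0 (min y (x N) - x j0)" for y
  define sl where "sl j = (if j0 < j then 1 else 0 :: real)" for j
  have right: "x j0 \<le> y" if "j \<in> {1..N}" "j0 < j" "x (j - 1) \<le> y" for j y
    using that xm.x_le[of j0 "j - 1"] by force
  have left: "y \<le> x j0" if "j \<in> {1..N}" "\<not> j0 < j" "y \<le> x j" for j y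
    using that xm.x_le[of j j0] j0 by simp
  have le: "y \<le> x N" if "j \<in> {1..N}" "y \<le> x j" for j y using that xm.cell_subset(2)[of j] by simp
  have act: "y \<notin> {\<kappa>1<..<\<kappa>2}" if "y \<in> \<Omega>" "sl (cell_of y) \<noteq> 0" for y
    using right[of "cell_of y" y] cell_of_cases[OF that(1)] that(2) j0(2) by (auto simp: sl_def split: if_splits)
  have "weighted_scheme_axioms t M x N \<sigma> U V0 \<beta> p q \<psi> sl"
  proof
    show "sl j = 0 \<or> sl j = - \<sigma>" for j using \<sigma>m by (simp add: sl_def)
    show "\<psi> y = \<psi> (x (j - 1)) + sl j * (y - x (j - 1))" if "j \<in> {1..N}" "y \<in> {x (j - 1)..x j}" for j y
    proof (cases "j0 < j")
      case True
      then show ?thesis using that right[of j y] right[of j "x (j - 1)"] le[of j y] le[of j "x (j - 1)"] xm.x_inc[of j]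
        by (simp add: \<psi>_def sl_def)
    next
      case False
      then show ?thesis using that left[of j y] left[of j "x (j - 1)"] le[of j y] le[of j "x (j - 1)"] xm.x_inc[of j]
        by (simp add: \<psi>_def sl_def)
    qed
    show "\<psi> y = 0" if "j \<in> {1..N}" "sl j = 0" "y \<in> {x (j - 1)..x j}" for j y
    proof -
      have "\<not> j0 < j" using that(2) by (simp add: sl_def split: if_splits)
      then show ?thesis using that left[of j y] by (simp add: \<psi>_def)
    qed
    show "0 \<le> \<psi> y" for y by (simp add: \<psi>_def)
    have inQ: "AE z in lebesgue_on Q. z \<in> Q" by (intro AE_I2) simp
    show "AE z in lebesgue_on Q. sl (cell_of (snd z)) \<noteq> 0 \<longrightarrow> \<beta> z = 0 \<and> p z * Ux z + q z * Ut z \<le> 0"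
      using data inQ by eventually_elim (use act in \<open>auto simp: box_Pair\<close>)
    show "V0 y = 0" if "y \<in> {x 0<..<x N}" "sl (cell_of y) \<noteq> 0" for y using V0z[OF act[OF that]] .
  qed
  then have W: "weighted_scheme t M x N h k \<sigma> \<delta> U V0 \<beta> r p q \<psi> sl"
    using scalar_scheme_axioms by (simp add: weighted_scheme_def)
  define \<mu> where "\<mu> = 1 / (x N - x j0)"
  have pos: "0 < x N - x j0" using far \<kappa>(2) by simp
  show thesis
  proof (rule that[OF W])
    show "0 \<le> \<mu>" using pos by (simp add: \<mu>_def)
    have "1 / (x N - x j0) \<le> 1 / ((x N - \<kappa>2) / 2)" using far pos \<kappa>(2) by (intro divide_left_mono) auto
    then show "\<mu> \<le> max (2 / (\<kappa>1 - x 0)) (2 / (x N - \<kappa>2))" by (simp add: \<mu>_def)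
    show "\<mu> * \<psi> y \<le> 1" for y unfolding \<mu>_def \<psi>_def using pos by (simp add: field_simps)
    show "\<mu> * \<psi> (if \<sigma> = 1 then x 0 else x N) = 1" unfolding \<mu>_def \<psi>_def using pos False by simp
  qed
qed

end

text \<open>The weight and the energy estimate are available as soon as the strip fits between the boundary and the
  data; for the remaining coarse meshes \<open>h\<close> is bounded below.\<close>

theorem scalar_error_estimate:
  fixes T a b \<kappa>1 \<kappa>2 c :: real and k :: nat
  assumes T: "0 < T" and \<kappa>: "a < \<kappa>1" "\<kappa>2 < b" "\<kappa>1 \<le> \<kappa>2" and c: "0 < c"
  shows "\<exists>C\<ge>0. \<forall>t M x N h \<sigma> U V0 \<beta> r p q \<omega> V.
    scalar_scheme t M x N h k \<sigma> (c * h) U V0 \<beta> r p q \<longrightarrow> t M = T \<longrightarrow> x 0 = a \<longrightarrow> x N = b \<longrightarrow>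
    (AE z in lebesgue_on (box (0, a) (T, b)). snd z \<notin> {\<kappa>1<..<\<kappa>2} \<longrightarrow> \<beta> z = 0
        \<and> p z * spacetime_mesh.assemble t x (\<lambda>m j. pd (0, 1) (U m j)) z + q z * spacetime_mesh.assemble t x (\<lambda>m j. pd (1, 0) (U m j)) z \<le> 0) \<longrightarrow>
    (\<forall>y. y \<notin> {\<kappa>1<..<\<kappa>2} \<longrightarrow> V0 y = 0) \<longrightarrow>
    \<omega> \<in> test_functions (box (0, a) (T, b)) \<longrightarrow> V \<in> L2 (box (0, a) (T, b)) \<longrightarrow>
    (LINT z|lebesgue_on (box (0, a) (T, b)). dual \<sigma> T \<omega> z * \<beta> z)
      = - (LINT z|lebesgue_on (box (0, a) (T, b)). (pd (1, 0) (dual \<sigma> T \<omega>) z + \<sigma> * pd (0, 1) (dual \<sigma> T \<omega>) z) * V z)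
        - (LINT y|lebesgue_on {a<..<b}. V0 y * dual \<sigma> T \<omega> (0, y)) \<longrightarrow>
    \<bar>LINT z|lebesgue_on (box (0, a) (T, b)). (V z - spacetime_mesh.assemble t x U z) * \<omega> z\<bar>
      \<le> C * sqrt ((L2_norm (box (0, a) (T, b)) \<omega>)\<^sup>2 + (L2_norm (box (0, a) (T, b)) (pd (0, 1) \<omega>))\<^sup>2)
        * (h * (L2_norm (box (0, a) (T, b)) r + L2_norm (box (0, a) (T, b)) p + L2_norm (box (0, a) (T, b)) q)
           + L2_norm (box (0, a) (T, b)) (spacetime_mesh.slabwise t (spacetime_mesh.jump t x V0 U)))"
proof -
  obtain C0 where C0: "0 < C0" and inv: "\<forall>c \<alpha> \<beta> h l. 0 < h \<longrightarrow> 0 < l \<longrightarrow> (\<forall>i\<le>k. \<forall>j\<le>k. (c i j)\<^sup>2 * (h * l)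
     \<le> C0 * integral (cbox (\<alpha>, \<beta>) (\<alpha> + h, \<beta> + l)) (\<lambda>p. (tensor k c ((fst p - \<alpha>) / h) ((snd p - \<beta>) / l))\<^sup>2))"
    using tensor_inverse_estimate[of k] by (elim exE conjE) (rule that)
  define B where "B = real (Suc k) * real (2 * k + 1) * sqrt C0"
  define \<Lambda> where "\<Lambda> = max (2 / (\<kappa>1 - a)) (2 / (b - \<kappa>2))"
  (* Below h0 the strip reaches at least half way from either end to the data. *)
  define h0 where "h0 = min ((\<kappa>1 - a) / 2) ((b - \<kappa>2) / 2)"
  define KK where "KK = 4 + 4 * T\<^sup>2 + 16 * T\<^sup>2 * (1 + \<Lambda>\<^sup>2)"
  define C1 where "C1 = sqrt KK * (1 + 2 * B + c + 2 * c * (B + 1))"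
  define C2 where "C2 = T / h0"
  have B0: "0 \<le> B" using C0 by (simp add: B_def)
  have h0: "0 < h0" using \<kappa> by (simp add: h0_def)
  have KK0: "0 \<le> KK" by (simp add: KK_def)
  have C1_nonneg: "0 \<le> C1" unfolding C1_def using KK0 B0 c by (auto intro!: mult_nonneg_nonneg add_nonneg_nonneg)
  have C2_nonneg: "0 \<le> C2" unfolding C2_def using T h0 by simp
  show ?thesis
  proof (rule exI[of _ "max C1 C2"], intro conjI allI impI)
    show "0 \<le> max C1 C2" using C1_nonneg by simp
    fix t M x N h \<sigma> U V0 \<beta> r p q \<omega> V
    assume sch: "scalar_scheme t M x N h k \<sigma> (c * h) U V0 \<beta> r p q" and tM: "t M = T" and x0: "x 0 = a" and xN: "x N = b"
    interpret scalar_scheme t M x N h k \<sigma> "c * h" U V0 \<beta> r p q by fact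
    let ?Q = "box (0, a) (T, b)"
    have Qeq: "Q = ?Q" by (simp add: tM x0 xN)
    assume data: "AE z in lebesgue_on ?Q. snd z \<notin> {\<kappa>1<..<\<kappa>2} \<longrightarrow> \<beta> z = 0 \<and> p z * Ux z + q z * Ut z \<le> 0"
      and V0z: "\<forall>y. y \<notin> {\<kappa>1<..<\<kappa>2} \<longrightarrow> V0 y = 0"
      and \<omega>: "\<omega> \<in> test_functions ?Q" and V: "V \<in> L2 ?Q"
      and exact: "(LINT z|lebesgue_on ?Q. dual \<sigma> T \<omega> z * \<beta> z)
      = - (LINT z|lebesgue_on ?Q. (pd (1, 0) (dual \<sigma> T \<omega>) z + \<sigma> * pd (0, 1) (dual \<sigma> T \<omega>) z) * V z)
        - (LINT y|lebesgue_on {a<..<b}. V0 y * dual \<sigma> T \<omega> (0, y))"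
    define n where "n = L2_norm ?Q r + L2_norm ?Q p + L2_norm ?Q q"
    define DD where "DD = sqrt ((L2_norm ?Q \<omega>)\<^sup>2 + (L2_norm ?Q (pd (0, 1) \<omega>))\<^sup>2)"
    have n0: "0 \<le> L2_norm ?Q f" for f :: "real \<times> real \<Rightarrow> real" by (rule L2_norm_nonneg)
    have nn: "0 \<le> n" "L2_norm ?Q r \<le> n" "L2_norm ?Q p \<le> n" "L2_norm ?Q p + L2_norm ?Q q \<le> n"
      using n0[of r] n0[of p] n0[of q] by (auto simp: n_def)
    have DD0: "0 \<le> DD" by (simp add: DD_def)
    have J0: "0 \<le> L2_norm ?Q J" by (rule L2_norm_nonneg)
    have main: "\<bar>LINT z|lebesgue_on ?Q. (V z - assemble U z) * \<omega> z\<bar> \<le> max C1 C2 * DD * (h * n + L2_norm ?Q J)"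
    proof (cases "h \<le> h0")
      case True
      obtain \<psi> sl \<mu> where W: "weighted_scheme t M x N h k \<sigma> (c * h) U V0 \<beta> r p q \<psi> sl"
        and \<mu>: "0 \<le> \<mu>" "\<mu> \<le> max (2 / (\<kappa>1 - x 0)) (2 / (x N - \<kappa>2))" "\<And>y. \<mu> * \<psi> y \<le> 1"
          "\<mu> * \<psi> (if \<sigma> = 1 then x 0 else x N) = 1"
      proof (rule inflow_weight[of \<kappa>1 \<kappa>2])
        show "AE z in lebesgue_on Q. snd z \<notin> {\<kappa>1<..<\<kappa>2} \<longrightarrow> \<beta> z = 0 \<and> p z * Ux z + q z * Ut z \<le> 0"
          using data unfolding Qeq .
      qed (use True \<kappa> x0 xN V0z in \<open>auto simp: h0_def\<close>)
      interpret ws: tested_scheme t M x N h k \<sigma> "c * h" U V0 \<beta> r p q \<psi> sl \<omega> V \<mu>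
        using W \<omega> V \<mu> exact by (simp add: tested_scheme_def tested_scheme_axioms_def tM x0 xN)
      have K1: "ws.K1 \<le> KK"
      proof -
        have "\<mu> \<le> \<Lambda>" using \<mu>(2) by (simp add: \<Lambda>_def x0 xN)
        then have "\<mu>\<^sup>2 \<le> \<Lambda>\<^sup>2" using \<mu>(1) by (rule power_mono)
        then have "16 * T\<^sup>2 * (1 + \<mu>\<^sup>2) \<le> 16 * T\<^sup>2 * (1 + \<Lambda>\<^sup>2)" by (intro mult_left_mono) auto
        then show ?thesis unfolding ws.K1_def KK_def tM by simp
      qed
      have U_strip: "L2_norm ?Q ws.U_strip \<le> 2 * (h * B * L2_norm ?Q r + c * h * (B + 1) * (L2_norm ?Q p + L2_norm ?Q q) + B * L2_norm ?Q J)"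
        using ws.inflow_stability[OF C0 inv[rule_format] B_def] unfolding Qeq .
      have est: "\<bar>LINT z|lebesgue_on ?Q. (V z - assemble U z) * \<omega> z\<bar>
         \<le> sqrt ws.K1 * ws.D * (h * L2_norm ?Q r + L2_norm ?Q J + c * h * L2_norm ?Q p + L2_norm ?Q ws.U_strip)"
        using ws.fine_mesh_estimate[OF \<mu>(4)] unfolding Qeq .
      have "h * L2_norm ?Q r + L2_norm ?Q J + c * h * L2_norm ?Q p + L2_norm ?Q ws.U_strip
         \<le> h * n + L2_norm ?Q J + c * h * n + 2 * (h * B * n + c * h * (B + 1) * n + B * L2_norm ?Q J)"
      proof -
        have "h * L2_norm ?Q r \<le> h * n" "c * h * L2_norm ?Q p \<le> c * h * n" "h * B * L2_norm ?Q r \<le> h * B * n"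
          "c * h * (B + 1) * (L2_norm ?Q p + L2_norm ?Q q) \<le> c * h * (B + 1) * n"
          using nn h_pos B0 c by (intro mult_left_mono; simp)+
        moreover have "A1 + j + A2 + u \<le> B1 + j + B2 + 2 * (B3 + B4 + e)"
          if "A1 \<le> B1" "A2 \<le> B2" "A3 \<le> B3" "A4 \<le> B4" "u \<le> 2 * (A3 + A4 + e)"
          for A1 A2 A3 A4 B1 B2 B3 B4 j u e :: real
          using add_mono[OF add_mono[OF that(1) that(2)] add_mono[OF that(3) that(4)]] that by (simp add: algebra_simps)
        ultimately show ?thesis using U_strip by blast
      qed
      also have "\<dots> \<le> (1 + 2 * B + c + 2 * c * (B + 1)) * (h * n + L2_norm ?Q J)"
      proof -
        have "0 \<le> c * L2_norm ?Q J" "0 \<le> c * (B + 1) * L2_norm ?Q J" using c B0 J0 by (auto intro!: mult_nonneg_nonneg)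
        then show ?thesis by (simp add: algebra_simps)
      qed
      finally have s: "h * L2_norm ?Q r + L2_norm ?Q J + c * h * L2_norm ?Q p + L2_norm ?Q ws.U_strip
        \<le> (1 + 2 * B + c + 2 * c * (B + 1)) * (h * n + L2_norm ?Q J)" .
      have DDw: "ws.D = DD" unfolding ws.D_def DD_def Qeq ..
      have "sqrt ws.K1 * ws.D * (h * L2_norm ?Q r + L2_norm ?Q J + c * h * L2_norm ?Q p + L2_norm ?Q ws.U_strip)
         \<le> (sqrt KK * DD) * ((1 + 2 * B + c + 2 * c * (B + 1)) * (h * n + L2_norm ?Q J))"
        unfolding DDw
      proof (intro mult_mono s mult_right_mono real_sqrt_le_mono K1 DD0)
        show "0 \<le> sqrt KK * DD" using KK0 DD0 by simp
        show "0 \<le> h * L2_norm ?Q r + L2_norm ?Q J + c * h * L2_norm ?Q p + L2_norm ?Q ws.U_strip"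
          using h_pos c n0 by (auto intro!: add_nonneg_nonneg mult_nonneg_nonneg)
      qed (use KK0 in simp_all)
      also have "\<dots> = C1 * DD * (h * n + L2_norm ?Q J)" by (simp add: C1_def mult_ac)
      also have "\<dots> \<le> max C1 C2 * DD * (h * n + L2_norm ?Q J)"
        using DD0 nn(1) h_pos J0 by (intro mult_right_mono) auto
      finally show ?thesis using est by linarith
    next
      case False
      have W: "weighted_scheme t M x N h k \<sigma> (c * h) U V0 \<beta> r p q (\<lambda>_. 0) (\<lambda>_. 0)"
        using scalar_scheme_axioms by (simp add: weighted_scheme_def weighted_scheme_axioms_def)
      interpret ws: tested_scheme t M x N h k \<sigma> "c * h" U V0 \<beta> r p q "\<lambda>_. 0" "\<lambda>_. 0" \<omega> V 0
        using W \<omega> V exact by (simp add: tested_scheme_def tested_scheme_axioms_def tM x0 xN)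
      have DDw: "ws.D = DD" unfolding ws.D_def DD_def Qeq ..
      have est: "\<bar>LINT z|lebesgue_on ?Q. (V z - assemble U z) * \<omega> z\<bar> \<le> T * DD * (L2_norm ?Q r + L2_norm ?Q J / h)"
        using ws.coarse_mesh_estimate[OF refl] unfolding Qeq DDw unfolding tM .
      have "L2_norm ?Q r + L2_norm ?Q J / h \<le> (h * n + L2_norm ?Q J) / h0"
      proof -
        have "L2_norm ?Q r * h0 \<le> n * h" using nn False h0 h_pos by (intro mult_mono) auto
        moreover have "L2_norm ?Q J / h \<le> L2_norm ?Q J / h0" using False h0 h_pos J0 by (intro divide_left_mono) auto
        ultimately show ?thesis using h0 by (simp add: field_simps)
      qed
      then have "T * DD * (L2_norm ?Q r + L2_norm ?Q J / h) \<le> T * DD * ((h * n + L2_norm ?Q J) / h0)"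
        using T DD0 by (intro mult_left_mono) auto
      also have "\<dots> = C2 * DD * (h * n + L2_norm ?Q J)" by (simp add: C2_def)
      also have "\<dots> \<le> max C1 C2 * DD * (h * n + L2_norm ?Q J)"
        using DD0 nn(1) h_pos J0 by (intro mult_right_mono) auto
      finally show ?thesis using est by linarith
    qed
    then show "\<bar>LINT z|lebesgue_on ?Q. (V z - assemble U z) * \<omega> z\<bar>
      \<le> max C1 C2 * sqrt ((L2_norm ?Q \<omega>)\<^sup>2 + (L2_norm ?Q (pd (0, 1) \<omega>))\<^sup>2)
        * (h * (L2_norm ?Q r + L2_norm ?Q p + L2_norm ?Q q) + L2_norm ?Q J)"
      by (simp only: n_def DD_def)
  qed
qed

section \<open>Splitting the Maxwell system into scalar transport equations\<close>

lemma vector_4: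
  "(vector [a, b, c, d] :: 'a::zero^4) $ 1 = a" "(vector [a, b, c, d] :: 'a^4) $ 2 = b"
  "(vector [a, b, c, d] :: 'a^4) $ 3 = c" "(vector [a, b, c, d] :: 'a^4) $ 4 = d"
  unfolding vector_def by simp_all

lemma M1_mult: "M1 *v y = vector [0, y $ 1, y $ 2, y $ 3]"
  unfolding M1_def by (simp add: vec_eq_iff matrix_vector_mult_def forall_4 sum_3 vector_4)

lemma M2_mult: "M2 *v y = vector [y $ 1, 0, y $ 3, y $ 2]"
  unfolding M2_def by (simp add: vec_eq_iff matrix_vector_mult_def forall_4 sum_3 vector_4)

lemma inner_3: "v \<bullet> w = v $ 1 * w $ 1 + v $ 2 * w $ 2 + v $ 3 * w $ 3" for v w :: "real^3"
  by (simp add: inner_vec_def sum_3)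

lemma inner_4: "v \<bullet> w = v $ 1 * w $ 1 + v $ 2 * w $ 2 + v $ 3 * w $ 3 + v $ 4 * w $ 4" for v w :: "real^4"
  by (simp add: inner_vec_def sum_4)

text \<open>Left eigenvectors of the system with their speeds. The first component is transported with speed 1 because the
  two equations for it enter the scheme added up.\<close>

definition characteristic :: "real^3 \<Rightarrow> real \<Rightarrow> bool" where
  "characteristic v \<sigma> \<longleftrightarrow> (v = vector [1, 0, 0] \<and> \<sigma> = 1) \<or> (v = vector [0, 1, 1] \<and> \<sigma> = 1)
     \<or> (v = vector [0, 1, -1] \<and> \<sigma> = -1)"

lemma characteristic_speed: "characteristic v \<sigma> \<Longrightarrow> \<sigma> = 1 \<or> \<sigma> = -1"
  by (auto simp: characteristic_def)

lemma characteristic_equation: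
  "characteristic v \<sigma> \<Longrightarrow> hat v \<bullet> (M1 *v y + M2 *v z) = v \<bullet> y + \<sigma> * (v \<bullet> z)"
  unfolding characteristic_def by (auto simp: hat_def M1_mult M2_mult inner_3 inner_4 vector_4)

text \<open>In each of the three cases the expression is a sum of squares. This is the sign that the energy estimate
  asks of the stabilization term.\<close>

lemma characteristic_dissipative:
  "characteristic v \<sigma> \<Longrightarrow> 0 \<le> ((M2 *v v) \<bullet> (M1 *v y + M2 *v z)) * (v \<bullet> z) + ((M1 *v v) \<bullet> (M1 *v y + M2 *v z)) * (v \<bullet> y)"
proof -
  have e: "0 \<le> (a + b) * a + (a + b) * b" for a b :: real
  proof -
    have "(a + b) * a + (a + b) * b = (a + b)\<^sup>2" by (simp add: power2_eq_square algebra_simps)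
    then show ?thesis by simp
  qed
  have e': "0 \<le> (a - b) * a - (a - b) * b" for a b :: real
  proof -
    have "(a - b) * a - (a - b) * b = (a - b)\<^sup>2" by (simp add: power2_eq_square algebra_simps)
    then show ?thesis by simp
  qed
  assume "characteristic v \<sigma>"
  then consider "v = vector [1, 0, 0]" | "v = vector [0, 1, 1]" | "v = vector [0, 1, -1]"
    by (auto simp: characteristic_def)
  then show ?thesis
  proof cases
    case 1
    then show ?thesis by (simp add: M1_mult M2_mult inner_3 inner_4 vector_4)
  next
    case 2
    have "0 \<le> (y $ 2 + y $ 3 + z $ 2 + z $ 3)\<^sup>2" by simp
    then show ?thesis using 2 by (simp add: M1_mult M2_mult inner_3 inner_4 vector_4 power2_eq_square algebra_simps)
  next
    case 3
    have "0 \<le> (y $ 2 - y $ 3 + z $ 3 - z $ 2)\<^sup>2" by simp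
    then show ?thesis using 3 by (simp add: M1_mult M2_mult inner_3 inner_4 vector_4 power2_eq_square algebra_simps)
  qed
qed

lemma characteristic_norms:
  assumes "characteristic v \<sigma>"
  shows "norm v \<le> 2" "norm (hat v) \<le> 2" "norm (M1 *v v) \<le> 2" "norm (M2 *v v) \<le> 2"
proof -
  have "sqrt 2 \<le> 2" using real_sqrt_le_mono[of 2 4] by simp
  then show "norm v \<le> 2" "norm (hat v) \<le> 2" "norm (M1 *v v) \<le> 2" "norm (M2 *v v) \<le> 2"
    using assms unfolding characteristic_def norm_eq_sqrt_inner
    by (auto simp: hat_def M1_mult M2_mult inner_3 inner_4 vector_4)
qed

text \<open>The vectors on the right are the dual basis of the characteristic vectors.\<close>

lemma characteristic_sum:
  "e \<bullet> w = (vector [1, 0, 0] \<bullet> e) * (vector [1, 0, 0] \<bullet> w)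
    + (vector [0, 1, 1] \<bullet> e) * (vector [0, 1/2, 1/2] \<bullet> w) + (vector [0, 1, -1] \<bullet> e) * (vector [0, 1/2, -1/2] \<bullet> w)"
  for e w :: "real^3"
  by (simp add: inner_3 algebra_simps)

lemma inner_M1: "y \<bullet> (M1 *v (r *\<^sub>R v)) = r * ((M1 *v v) \<bullet> y)"
  and inner_M2: "y \<bullet> (M2 *v (r *\<^sub>R v)) = r * ((M2 *v v) \<bullet> y)"
  and inner_hat: "y \<bullet> hat (r *\<^sub>R v) = r * (hat v \<bullet> y)"
  by (simp_all add: M1_mult M2_mult hat_def inner_4 vector_4 algebra_simps)

lemma bounded_linear_M: "bounded_linear (\<lambda>y. M1 *v y)" "bounded_linear (\<lambda>y. M2 *v y)"
  by (simp_all add: matrix_vector_mul_bounded_linear)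

text \<open>Lebesgue measure is complete, so measurability passes to functions that agree almost everywhere.\<close>

lemma L2_AE:
  fixes u w :: "'a::euclidean_space \<Rightarrow> 'b::euclidean_space"
  assumes u: "u \<in> L2 G" and eq: "AE z in lebesgue_on G. u z = w z" and G: "G \<in> sets lebesgue"
  shows "w \<in> L2 G"
proof (rule L2_bound[OF u, of _ 1])
  have "AE z in lebesgue. indicator G z *\<^sub>R u z = indicator G z *\<^sub>R w z"
    using eq G by (subst (asm) AE_restrict_space_iff) (auto elim!: eventually_mono simp: indicator_def)
  moreover have "(\<lambda>z. indicator G z *\<^sub>R u z) \<in> borel_measurable lebesgue"
    using u G by (simp add: L2_def borel_measurable_restrict_space_iff mult.commute)
  ultimately have "(\<lambda>z. indicator G z *\<^sub>R w z) \<in> borel_measurable lebesgue"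
    by (rule borel_measurable_AE[rotated])
  then show "w \<in> borel_measurable (lebesgue_on G)"
    using G by (simp add: borel_measurable_restrict_space_iff)
  show "AE z in lebesgue_on G. norm (w z) \<le> 1 * norm (u z)"
    using eq by (auto elim!: eventually_mono)
qed

lemma L2_components:
  fixes u :: "'a::euclidean_space \<Rightarrow> real^3"
  assumes "\<And>l. (\<lambda>z. u z $ l) \<in> L2 G"
  shows "u \<in> L2 G"
proof -
  have "u = (\<lambda>z. \<Sum>l\<in>UNIV. u z $ l *\<^sub>R axis l 1)"
    using basis_expansion[of "u _"] by (auto simp: scalar_mult_eq_scaleR)
  moreover have "(\<lambda>z. u z $ l *\<^sub>R axis l (1::real)) \<in> L2 G" for l :: 3
    by (rule L2_bounded_linear[OF assms bounded_linear_scaleR_left])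
  then have "(\<lambda>z. \<Sum>l\<in>UNIV. u z $ l *\<^sub>R axis l (1::real)) \<in> L2 G"
    by (simp only: sum_3 L2_add)
  ultimately show ?thesis by simp
qed

section \<open>The discrete solution as a scalar scheme\<close>

context spacetime_mesh begin

lemma AE_Q_slabs:
  assumes "\<And>m. m \<in> {1..M} \<Longrightarrow> AE z in lebesgue_on (S m). P z"
  shows "AE z in lebesgue_on Q. P z"
proof -
  have 1: "AE z in lebesgue. \<forall>m\<in>{1..M}. z \<in> S m \<longrightarrow> P z"
  proof (rule AE_ball_countable[THEN iffD2, rule_format])
    show "countable {1..M}" by (intro countable_finite) simp
    fix m assume "m \<in> {1..M}"
    from assms[OF this] show "AE z in lebesgue. z \<in> S m \<longrightarrow> P z"
      by (subst (asm) AE_restrict_space_iff) auto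
  qed
  have "negligible (\<Union>m\<in>{1..M}. {p::real \<times> real. fst p = t m})"
    by (intro negligible_Union) (auto intro: negligible_fst)
  then have 2: "AE z in lebesgue. z \<notin> (\<Union>m\<in>{1..M}. {p::real \<times> real. fst p = t m})"
    by (intro AE_not_in) (simp add: negligible_iff_null_sets)
  have "AE z in lebesgue. z \<in> Q \<longrightarrow> P z"
    using 1 2
  proof eventually_elim
    case (elim z)
    show ?case
    proof
      assume z: "z \<in> Q"
      then have s: "t 0 < fst z" "fst z < t M" using t0 by (auto simp: box_Pair)
      from tm.node_or_inside[OF s] obtain m where "m \<in> {1..M}" "t (m - 1) < fst z" "fst z < t m" using elim(2) by auto
      then have "z \<in> S m" using z by (auto simp: box_Pair)
      then show "P z" using elim(1) \<open>m \<in> {1..M}\<close> by blast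
    qed
  qed
  then show ?thesis by (subst AE_restrict_space_iff) auto
qed

lemma discrete_of_pieces:
  assumes "discrete g G"
  shows "discrete (assemble G) G"
proof (rule discreteI)
  show "\<exists>c. G m j = loc m j c" if "m \<in> {1..M}" "j \<in> {1..N}" for m j
    using assms that unfolding discrete_def by blast
  show "G m j (s, x j) = G m (Suc j) (s, x j)" if "m \<in> {1..M}" "j \<in> {1..N}" "Suc j \<le> N" "s \<in> {t (m - 1)<..t m}" for m j s
  proof -
    have j': "Suc j \<in> {1..N}" using that by auto
    show ?thesis
      using discrete_eq[OF assms that(1,2,4), of "x j"] discrete_eq[OF assms that(1) j' that(4), of "x j"] xm.x_inc[OF that(2)] xm.x_inc[OF j'] by auto
  qed
  show "G m 1 (s, x 0) = 0 \<and> G m N (s, x N) = 0" if "m \<in> {1..M}" "s \<in> {t (m - 1)<..t m}" for m s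
    using discrete_boundary[OF assms that(1), of s] that by auto
qed

lemma slab_eq: "slab {x 0<..<x N} t m = S m"
  by (simp add: slab_def box_Pair)

text \<open>Tensor product polynomials are invariant under affine changes of each variable, so global and local
  coordinates give the same spaces.\<close>

lemma tensor_poly_local:
  assumes mj: "m \<in> {1..M}" "j \<in> {1..N}"
    and "tensor_poly_on k ({t (m - 1)<..t m} \<times> {x (j - 1)..x j}) g"
  shows "\<exists>c. \<forall>s\<in>{t (m - 1)<..t m}. \<forall>y\<in>{x (j - 1)..x j}. g (s, y) = loc m j c (s, y)"
proof -
  let ?l = "x j - x (j - 1)"
  obtain c where c: "\<And>s y. s \<in> {t (m - 1)<..t m} \<Longrightarrow> y \<in> {x (j - 1)..x j} \<Longrightarrow> g (s, y) = tensor k c s y"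
    using assms(3) unfolding tensor_poly_on_def tensor_def by blast
  obtain c' where c': "\<And>z w. tensor k c (t (m - 1) + h * z) (x (j - 1) + ?l * w) = tensor k c' z w"
    using tensor_affine by blast
  have "tensor k c s y = loc m j c' (s, y)" for s y
    using c'[of "(s - t (m - 1)) / h" "(y - x (j - 1)) / ?l"] h_pos xm.x_inc[OF mj(2)] by (simp add: loc_def)
  then show ?thesis using c by metis
qed

lemma loc_tensor_poly:
  "tensor_poly_on k A (loc m j c)"
proof -
  let ?l = "x j - x (j - 1)"
  obtain c' where c': "\<And>z w. tensor k c (- t (m - 1) / h + 1 / h * z) (- x (j - 1) / ?l + 1 / ?l * w) = tensor k c' z w"
    using tensor_affine by blast
  have "loc m j c (s, y) = tensor k c' s y" for s y
    using c'[of s y] by (simp add: loc_def diff_divide_distrib)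
  then show ?thesis unfolding tensor_poly_on_def tensor_def by blast
qed

lemma Lim_at_right_continuous:
  fixes f :: "real \<Rightarrow> 'b::t2_space"
  assumes "continuous_on UNIV f" "s < s'" "\<And>r. r \<in> {s<..s'} \<Longrightarrow> g r = f r"
  shows "Lim (at_right s) g = f s"
proof (rule tendsto_Lim)
  have f: "(f \<longlongrightarrow> f s) (at_right s)" using assms(1) by (auto simp: continuous_on_def intro: tendsto_within_subset)
  have "\<forall>\<^sub>F r in at_right s. g r = f r"
    unfolding eventually_at_right_field using assms(2,3) by (intro exI[of _ s']) auto
  then show "(g \<longlongrightarrow> f s) (at_right s)" using f by (simp add: tendsto_cong)
qed simp

lemma Lim_at_left_continuous:
  fixes f :: "real \<Rightarrow> 'b::t2_space"
  assumes "continuous_on UNIV f" "s' < s" "\<And>r. r \<in> {s'<..s} \<Longrightarrow> g r = f r"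
  shows "Lim (at_left s) g = f s"
proof (rule tendsto_Lim)
  have f: "(f \<longlongrightarrow> f s) (at_left s)" using assms(1) by (auto simp: continuous_on_def intro: tendsto_within_subset)
  have "\<forall>\<^sub>F r in at_left s. g r = f r"
    unfolding eventually_at_left_field using assms(2,3) by (intro exI[of _ s']) auto
  then show "(g \<longlongrightarrow> f s) (at_left s)" using f by (simp add: tendsto_cong)
qed simp

text \<open>Test functions of the vector scheme that are scalar multiples of a fixed vector; inserting a
  characteristic vector contracts the scheme.\<close>

lemma Vh_scalar:
  assumes g: "discrete g G"
  shows "(\<lambda>z. g z *\<^sub>R v) \<in> Vh k {x 0<..<x N} M t N x"
  unfolding Vh_def
proof (intro CollectI ballI conjI allI)
  fix m assume m: "m \<in> {1..M}"
  have pw: "xm.piecewise (t (m - 1)) (t m) (\<lambda>z. g z *\<^sub>R v) (\<lambda>j z. G m j z *\<^sub>R v)"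
    using discrete_piecewise[OF g m] unfolding xm.piecewise_def by (auto intro!: Ck_scaleR)
  show "(\<lambda>z. g z *\<^sub>R v) \<in> H1 (slab {x 0<..<x N} t m)"
    unfolding slab_eq by (rule xm.piecewise_H1[OF pw t_less[OF m]])
  show "g (s, y) *\<^sub>R v = 0" if "s \<in> {t (m - 1)<..t m}" "y \<in> frontier {x 0<..<x N}" for s y
    using discrete_zero[OF g m that(1)] that(2) x_pos by (auto simp: frontier_def)
  fix j l assume j: "j \<in> {1..N}"
  obtain c where c: "G m j = loc m j c" using g m j unfolding discrete_def by blast
  obtain c' where c': "\<And>s y. loc m j c (s, y) = (\<Sum>a\<le>k. \<Sum>b\<le>k. c' a b * s ^ a * y ^ b)"
    using loc_tensor_poly[of UNIV m j c] unfolding tensor_poly_on_def by auto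
  show "tensor_poly_on k ({t (m - 1)<..t m} \<times> {x (j - 1)..x j}) (\<lambda>p. (g p *\<^sub>R v) $ l)"
    unfolding tensor_poly_on_def
  proof (intro exI[of _ "\<lambda>a b. v $ l * c' a b"] ballI)
    fix p assume "p \<in> {t (m - 1)<..t m} \<times> {x (j - 1)..x j}"
    then show "case p of (s, y) \<Rightarrow> (g (s, y) *\<^sub>R v) $ l = (\<Sum>a\<le>k. \<Sum>b\<le>k. v $ l * c' a b * s ^ a * y ^ b)"
      using discrete_eq[OF g m j] c c' by (auto simp: sum_distrib_left mult_ac)
  qed
qed

end

locale maxwell_scheme = spacetime_mesh +
  fixes \<delta> :: real and b :: "real \<times> real \<Rightarrow> real^4" and W0 :: "real \<Rightarrow> real^3" and Wh :: "real \<times> real \<Rightarrow> real^3"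
  assumes \<delta>: "0 \<le> \<delta>" and b: "b \<in> L2 Q" and W0: "W0 \<in> L2 {x 0<..<x N}"
    and sd: "sd_solution k \<delta> {x 0<..<x N} M t N x b W0 Wh"
begin

definition Wh_coeff :: "nat \<Rightarrow> nat \<Rightarrow> 3 \<Rightarrow> nat \<Rightarrow> nat \<Rightarrow> real" where
  "Wh_coeff m j l = (SOME c. \<forall>s\<in>{t (m - 1)<..t m}. \<forall>y\<in>{x (j - 1)..x j}. Wh (s, y) $ l = loc m j c (s, y))"

text \<open>The polynomial that the discrete solution equals on one element.\<close>

definition Wh_piece :: "nat \<Rightarrow> nat \<Rightarrow> real \<times> real \<Rightarrow> real^3" where
  "Wh_piece m j z = (\<Sum>l\<in>UNIV. loc m j (Wh_coeff m j l) z *\<^sub>R axis l 1)"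

lemma Wh_Vh: "Wh \<in> Vh k {x 0<..<x N} M t N x"
  using sd by (simp add: sd_solution_def)

lemma Wh_piece_nth: "Wh_piece m j z $ l = loc m j (Wh_coeff m j l) z"
proof -
  have "Wh_piece m j z $ l = (\<Sum>i\<in>UNIV. if i = l then loc m j (Wh_coeff m j i) z else 0)"
    unfolding Wh_piece_def sum_component by (intro sum.cong) (auto simp: axis_def)
  then show ?thesis by simp
qed

lemma Wh_eq:
  assumes mj: "m \<in> {1..M}" "j \<in> {1..N}" and "s \<in> {t (m - 1)<..t m}" "y \<in> {x (j - 1)..x j}"
  shows "Wh (s, y) = Wh_piece m j (s, y)"
proof -
  have "\<exists>c. \<forall>s\<in>{t (m - 1)<..t m}. \<forall>y\<in>{x (j - 1)..x j}. Wh (s, y) $ l = loc m j c (s, y)" for l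
    by (rule tensor_poly_local[OF mj]) (use Wh_Vh mj in \<open>auto simp: Vh_def\<close>)
  then have "Wh (s, y) $ l = loc m j (Wh_coeff m j l) (s, y)" for l
    unfolding Wh_coeff_def using someI_ex[of "\<lambda>c. \<forall>s\<in>{t (m - 1)<..t m}. \<forall>y\<in>{x (j - 1)..x j}. Wh (s, y) $ l = loc m j c (s, y)"] assms(3,4) by blast
  then show ?thesis by (simp add: vec_eq_iff Wh_piece_nth)
qed

lemma CWl: "Ck n (Wh_piece m j)"
  unfolding Wh_piece_def[abs_def] by (intro Ck_sum Ck_scaleR Ck_loc Ck_const)

lemma Wh_piecewise: "m \<in> {1..M} \<Longrightarrow> xm.piecewise (t (m - 1)) (t m) Wh (Wh_piece m)"
  unfolding xm.piecewise_def using CWl Wh_eq by blast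

definition component :: "real^3 \<Rightarrow> nat \<Rightarrow> nat \<Rightarrow> real \<times> real \<Rightarrow> real" where
  "component v m j z = v \<bullet> Wh_piece m j z"

lemma component_discrete: "discrete (\<lambda>z. v \<bullet> Wh z) (component v)"
  unfolding discrete_def
proof (intro conjI ballI)
  fix m j assume mj: "m \<in> {1..M}" "j \<in> {1..N}"
  have "component v m j = loc m j (\<lambda>a b. \<Sum>l\<in>UNIV. v $ l * Wh_coeff m j l a b)"
  proof
    fix z
    have "component v m j z = (\<Sum>l\<in>UNIV. v $ l * loc m j (Wh_coeff m j l) z)" by (simp add: component_def inner_vec_def Wh_piece_nth)
    then show "component v m j z = loc m j (\<lambda>a b. \<Sum>l\<in>UNIV. v $ l * Wh_coeff m j l a b) z"
      unfolding loc_def tensor_def sum_3 by (simp add: sum_distrib_left sum.distrib[symmetric] algebra_simps)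
  qed
  then show "\<exists>c. component v m j = loc m j c" by blast
  show "v \<bullet> Wh (s, y) = component v m j (s, y)" if "s \<in> {t (m - 1)<..t m}" "y \<in> {x (j - 1)..x j}" for s y
    using Wh_eq[OF mj that] by (simp add: component_def)
next
  fix m s assume "m \<in> {1..M}" "s \<in> {t (m - 1)<..t m}"
  moreover have "x 0 \<in> frontier {x 0<..<x N}" "x N \<in> frontier {x 0<..<x N}" using x_pos by (auto simp: frontier_def)
  ultimately show "v \<bullet> Wh (s, x 0) = 0" "v \<bullet> Wh (s, x N) = 0" using Wh_Vh by (auto simp: Vh_def)
qed

abbreviation R1 where "R1 \<equiv> residual1 {x 0<..<x N} t b Wh"
abbreviation R2 where "R2 \<equiv> residual2 h t W0 Wh"

definition Wh_derivative :: "real \<times> real \<Rightarrow> real \<times> real \<Rightarrow> real^3" where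
  "Wh_derivative d z = pd d (Wh_piece (tm.elem (fst z)) (cell_of (snd z))) z"

lemma Wh_derivative_inner: "v \<bullet> Wh_derivative d z = assemble (\<lambda>m j. pd d (component v m j)) z"
proof -
  have "pd d (\<lambda>z. v \<bullet> Wh_piece m j z) z = v \<bullet> pd d (Wh_piece m j) z" for m j z
    by (rule pd_bounded_linear[OF bounded_linear_inner_right CWl])
  then show ?thesis by (simp add: Wh_derivative_def assemble_def component_def[abs_def])
qed

lemma slab_index_eq: "slab_index t s = tm.elem s"
  by (simp add: slab_index_def tm.elem_def)

lemma wderiv_slab:
  assumes m: "m \<in> {1..M}" and d: "d = (1, 0) \<or> d = (0, 1)"
  shows "AE z in lebesgue_on (S m). wderiv (S m) d Wh z = Wh_derivative d z"
proof -
  have "AE z in lebesgue_on (S m). z \<in> S m" by (intro AE_I2) simp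
  with xm.piecewise_wderiv(1)[OF Wh_piecewise[OF m] t_less[OF m] d]
  show ?thesis
  proof eventually_elim
    case (elim z)
    have "snd z \<in> \<Omega>" using elim(2) by (auto simp: box_Pair)
    then have "xm.elem (snd z) = cell_of (snd z)" using xm.elem_props[of "snd z"] by (auto simp: cell_of_def)
    then show ?case using elim(1) ti_eq[OF m elim(2)] by (simp add: Wh_derivative_def xm.glue_def)
  qed
qed

lemma maxwell_op_slab:
  assumes m: "m \<in> {1..M}"
  shows "AE z in lebesgue_on (S m). maxwell_op (S m) Wh z = M1 *v Wh_derivative (1, 0) z + M2 *v Wh_derivative (0, 1) z"
  using wderiv_slab[OF m, of "(1, 0)"] wderiv_slab[OF m, of "(0, 1)"]
  unfolding maxwell_op_def by (auto elim: eventually_elim2)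

lemma maxwell_op_slab_L2: "m \<in> {1..M} \<Longrightarrow> maxwell_op (S m) Wh \<in> L2 (S m)"
  unfolding maxwell_op_def
  using xm.piecewise_wderiv(2)[OF Wh_piecewise t_less]
  by (intro L2_add L2_bounded_linear[OF _ bounded_linear_M(1)] L2_bounded_linear[OF _ bounded_linear_M(2)]) auto

lemma residual1_slab:
  assumes m: "m \<in> {1..M}" and z: "z \<in> S m"
  shows "R1 z = b z - maxwell_op (S m) Wh z"
  using ti_eq[OF m z] by (simp add: residual1_def slab_index_eq slab_eq)

lemma residual1_AE: "AE z in lebesgue_on Q. R1 z = b z - (M1 *v Wh_derivative (1, 0) z + M2 *v Wh_derivative (0, 1) z)"
proof (rule AE_Q_slabs)
  fix m assume m: "m \<in> {1..M}"
  have "AE z in lebesgue_on (S m). z \<in> S m" by (intro AE_I2) simp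
  with maxwell_op_slab[OF m] show "AE z in lebesgue_on (S m). R1 z = b z - (M1 *v Wh_derivative (1, 0) z + M2 *v Wh_derivative (0, 1) z)"
    by eventually_elim (simp add: residual1_slab[OF m])
qed

lemma Wh_derivative_L2: "Wh_derivative d \<in> L2 Q"
proof (rule L2_components)
  fix l
  have "(\<lambda>z. Wh_derivative d z $ l) = assemble (\<lambda>m j. pd d (component (axis l 1) m j))"
    using Wh_derivative_inner[of "axis l 1" d] by (simp add: inner_axis' fun_eq_iff)
  moreover have "assemble (\<lambda>m j. pd d (component (axis l 1) m j)) \<in> L2 Q"
    by (rule assemble_L2) (rule Ck_pd[OF discrete_Ck[OF component_discrete]])
  ultimately show "(\<lambda>z. Wh_derivative d z $ l) \<in> L2 Q" by simp
qed

lemma residual1_L2: "R1 \<in> L2 Q"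
proof (rule L2_AE)
  show "(\<lambda>z. b z - (M1 *v Wh_derivative (1, 0) z + M2 *v Wh_derivative (0, 1) z)) \<in> L2 Q"
    by (intro L2_diff b L2_add L2_bounded_linear[OF Wh_derivative_L2 bounded_linear_M(1)] L2_bounded_linear[OF Wh_derivative_L2 bounded_linear_M(2)])
  show "AE z in lebesgue_on Q. b z - (M1 *v Wh_derivative (1, 0) z + M2 *v Wh_derivative (0, 1) z) = R1 z"
    using residual1_AE by (auto elim!: eventually_mono)
qed simp

lemma limit_plus_Wh:
  assumes m: "m \<in> {1..M}" and y: "y \<in> \<Omega>"
  shows "limit_plus Wh (t (m - 1)) y = Wh_piece m (cell_of y) (t (m - 1), y)"
  unfolding limit_plus_def
  by (rule Lim_at_right_continuous[OF slice_continuous_t[OF CWl] t_less[OF m]]) (use Wh_eq[OF m] cell_of_cases[OF y] in auto)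

lemma limit_minus_Wh:
  assumes m: "m \<in> {1..M}" and y: "y \<in> \<Omega>"
  shows "v \<bullet> limit_minus W0 Wh (t (m - 1)) y = (if m = 1 then v \<bullet> W0 y else trace (component v) (m - 1) (t (m - 1)) y)"
proof (cases "m = 1")
  case True
  then show ?thesis by (simp add: limit_minus_def t0)
next
  case False
  then have m': "m - 1 \<in> {1..M}" using m by auto
  have "t 0 < t (m - 1)" by (rule tm.x_less) (use m m' in auto)
  then have s0: "t (m - 1) \<noteq> 0" using t0 by simp
  have "Lim (at_left (t (m - 1))) (\<lambda>r. Wh (r, y)) = Wh_piece (m - 1) (cell_of y) (t (m - 1), y)"
    by (rule Lim_at_left_continuous[OF slice_continuous_t[OF CWl] t_less[OF m']]) (use Wh_eq[OF m'] cell_of_cases[OF y] in auto)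
  then show ?thesis using False s0 by (simp add: limit_minus_def trace_def component_def)
qed

text \<open>The scheme tested with \<open>g v\<close>; moving the matrices to the residual side turns the
  stabilization into the residuals \<open>p\<close> and \<open>q\<close> of \<open>scalar_scheme\<close>.\<close>

lemma sd_scalar_slab:
  assumes m: "m \<in> {1..M}" and g: "discrete g G"
  shows "(LINT z|lebesgue_on (S m). (hat v \<bullet> R1 z) * assemble G z)
     + \<delta> * (LINT z|lebesgue_on (S m). ((M2 *v v) \<bullet> R1 z) * assemble (\<lambda>m j. pd (0, 1) (G m j)) z)
     + \<delta> * (LINT z|lebesgue_on (S m). ((M1 *v v) \<bullet> R1 z) * assemble (\<lambda>m j. pd (1, 0) (G m j)) z)
     = (LINT y|lebesgue_on \<Omega>. jump (\<lambda>y. v \<bullet> W0 y) (component v) m y * trace G m (t (m - 1)) y)"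
proof -
  let ?gv = "\<lambda>z. g z *\<^sub>R v"
  have gV: "?gv \<in> Vh k \<Omega> M t N x" by (rule Vh_scalar[OF g])
  have pw: "xm.piecewise (t (m - 1)) (t m) ?gv (\<lambda>j z. G m j z *\<^sub>R v)"
    using discrete_piecewise[OF g m] unfolding xm.piecewise_def by (auto intro!: Ck_scaleR)
  define th where "th z = hat (?gv z) + \<delta> *\<^sub>R maxwell_op (S m) ?gv z" for z
  have eq: "L2_ip (S m) (maxwell_op (S m) Wh) th + L2_ip \<Omega> (limit_plus Wh (t (m - 1))) (limit_plus ?gv (t (m - 1)))
      = L2_ip (S m) b th + L2_ip \<Omega> (limit_minus W0 Wh (t (m - 1))) (limit_plus ?gv (t (m - 1)))"
    using sd[unfolded sd_solution_def Let_def slab_eq, THEN conjunct2, rule_format, OF m gV] unfolding th_def .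
  have wd: "AE z in lebesgue_on (S m). wderiv (S m) d ?gv z = assemble (\<lambda>m j. pd d (G m j)) z *\<^sub>R v" if d: "d = (1, 0) \<or> d = (0, 1)" for d
  proof -
    have "AE z in lebesgue_on (S m). z \<in> S m" by (intro AE_I2) simp
    with xm.piecewise_wderiv(1)[OF pw t_less[OF m] d]
    show ?thesis
    proof eventually_elim
      case (elim z)
      have "snd z \<in> \<Omega>" using elim(2) by (auto simp: box_Pair)
      then have j: "xm.elem (snd z) = cell_of (snd z)" "cell_of (snd z) \<in> {1..N}"
        using xm.elem_props[of "snd z"] cell_of_cases[of "snd z"] by (auto simp: cell_of_def)
      have "pd d (\<lambda>z'. G m (cell_of (snd z)) z' *\<^sub>R v) z = pd d (G m (cell_of (snd z))) z *\<^sub>R v"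
        by (rule pd_bounded_linear[OF bounded_linear_scaleR_left discrete_Ck[OF g m j(2)]])
      then show ?case using elim(1) ti_eq[OF m elim(2)] j(1) by (simp add: assemble_def xm.glue_def)
    qed
  qed
  have gz: "g z = assemble G z" if "z \<in> S m" for z
    using discrete_assemble[OF g] S_subset_Q[OF m] that by blast
  have inS: "AE z in lebesgue_on (S m). z \<in> S m" by (intro AE_I2) simp
  let ?gt = "assemble (\<lambda>m j. pd (1, 0) (G m j))" and ?gx = "assemble (\<lambda>m j. pd (0, 1) (G m j))"
  have thL: "th \<in> L2 (S m)"
  proof -
    have "(\<lambda>z. hat (?gv z)) \<in> L2 (S m)"
      by (rule L2_bounded_linear[OF xm.piecewise_L2(1)[OF pw]])
        (auto intro!: linear_conv_bounded_linear[THEN iffD1] linearI simp: hat_def vec_eq_iff forall_4 vector_4)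
    moreover have "maxwell_op (S m) ?gv \<in> L2 (S m)"
      unfolding maxwell_op_def using xm.piecewise_wderiv(2)[OF pw t_less[OF m]]
      by (intro L2_add L2_bounded_linear[OF _ bounded_linear_M(1)] L2_bounded_linear[OF _ bounded_linear_M(2)]) auto
    ultimately show ?thesis unfolding th_def by (intro L2_add L2_scaleR)
  qed
  have bL: "b \<in> L2 (S m)" by (rule L2_subset[OF b S_subset_Q[OF m]]) auto
  have RL: "R1 \<in> L2 (S m)" by (rule L2_subset[OF residual1_L2 S_subset_Q[OF m]]) auto
  have CG: "j \<in> {1..N} \<Longrightarrow> Ck n (G m j)" for n j by (rule discrete_Ck[OF g m])
  have gL: "assemble G \<in> L2 (S m)" "?gt \<in> L2 (S m)" "?gx \<in> L2 (S m)"
    using L2_slab_of_Q[OF assemble_L2 m] discrete_Ck[OF g] by (auto intro!: Ck_continuous Ck_pd L2_slab_of_Q[OF assemble_L2 m])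
  have lhs: "L2_ip (S m) b th - L2_ip (S m) (maxwell_op (S m) Wh) th
     = (LINT z|lebesgue_on (S m). (hat v \<bullet> R1 z) * assemble G z) + \<delta> * (LINT z|lebesgue_on (S m). ((M2 *v v) \<bullet> R1 z) * ?gx z)
     + \<delta> * (LINT z|lebesgue_on (S m). ((M1 *v v) \<bullet> R1 z) * ?gt z)"
  proof -
    have "L2_ip (S m) b th - L2_ip (S m) (maxwell_op (S m) Wh) th = (LINT z|lebesgue_on (S m). b z \<bullet> th z - maxwell_op (S m) Wh z \<bullet> th z)"
      unfolding L2_ip_def using L2_inner_integrable[OF bL thL] L2_inner_integrable[OF maxwell_op_slab_L2[OF m] thL] by simp
    also have "\<dots> = (LINT z|lebesgue_on (S m). R1 z \<bullet> th z)"
      by (intro Bochner_Integration.integral_cong) (auto simp: residual1_slab[OF m] inner_diff_left)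
    also have "\<dots> = (LINT z|lebesgue_on (S m). (hat v \<bullet> R1 z) * assemble G z + \<delta> * (((M2 *v v) \<bullet> R1 z) * ?gx z) + \<delta> * (((M1 *v v) \<bullet> R1 z) * ?gt z))"
    proof (rule integral_cong_AE)
      show "AE z in lebesgue_on (S m). R1 z \<bullet> th z = (hat v \<bullet> R1 z) * assemble G z + \<delta> * (((M2 *v v) \<bullet> R1 z) * ?gx z) + \<delta> * (((M1 *v v) \<bullet> R1 z) * ?gt z)"
        using wd[of "(1, 0)", simplified] wd[of "(0, 1)", simplified] inS
      proof eventually_elim
        case (elim z)
        show ?case
          unfolding th_def maxwell_op_def elim(1,2) gz[OF elim(3)] inner_add_right inner_scaleR_right inner_hat inner_M1 inner_M2
          by (simp add: algebra_simps)
      qed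
      show "(\<lambda>z. R1 z \<bullet> th z) \<in> borel_measurable (lebesgue_on (S m))"
        by (rule borel_measurable_integrable[OF L2_inner_integrable[OF RL thL]])
      show "(\<lambda>z. (hat v \<bullet> R1 z) * assemble G z + \<delta> * (((M2 *v v) \<bullet> R1 z) * ?gx z) + \<delta> * (((M1 *v v) \<bullet> R1 z) * ?gt z)) \<in> borel_measurable (lebesgue_on (S m))"
        by (intro borel_measurable_add borel_measurable_integrable integrable_mult_right L2_mult_integrable L2_inner_const RL gL)
    qed
    also have "\<dots> = (LINT z|lebesgue_on (S m). (hat v \<bullet> R1 z) * assemble G z) + \<delta> * (LINT z|lebesgue_on (S m). ((M2 *v v) \<bullet> R1 z) * ?gx z)
     + \<delta> * (LINT z|lebesgue_on (S m). ((M1 *v v) \<bullet> R1 z) * ?gt z)"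
      using L2_mult_integrable[OF L2_inner_const[OF RL] gL(1)] L2_mult_integrable[OF L2_inner_const[OF RL] gL(2)] L2_mult_integrable[OF L2_inner_const[OF RL] gL(3)]
      by simp
    finally show ?thesis .
  qed
  let ?s = "t (m - 1)"
  note lp1 = limit_plus_Wh[OF m] and lm = limit_minus_Wh[OF m]
  have lp2: "limit_plus ?gv ?s y = trace G m ?s y *\<^sub>R v" if y: "y \<in> \<Omega>" for y
  proof -
    note j = cell_of_cases[OF y]
    have "limit_plus ?gv ?s y = G m (cell_of y) (?s, y) *\<^sub>R v" unfolding limit_plus_def
      by (rule Lim_at_right_continuous[where f="\<lambda>s. G m (cell_of y) (s, y) *\<^sub>R v" and s'="t m"])
        (use discrete_eq[OF g m] j t_less[OF m] in \<open>auto intro!: continuous_intros slice_continuous_t[OF CG]\<close>)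
    then show ?thesis by (simp add: trace_def)
  qed
  have CUv: "m' \<in> {1..M} \<Longrightarrow> j \<in> {1..N} \<Longrightarrow> Ck n (component v m' j)" for m' j n by (rule discrete_Ck[OF component_discrete])
  have trG: "trace G m ?s \<in> L2 \<Omega>" by (rule trace_L2[where m=m]) (rule CG)
  have trU: "trace (component v) m ?s \<in> L2 \<Omega>" by (rule trace_L2) (rule CUv[OF m])
  have oldL: "(\<lambda>y. if m = 1 then v \<bullet> W0 y else trace (component v) (m - 1) ?s y) \<in> L2 \<Omega>"
  proof (cases "m = 1")
    case False
    then have "m - 1 \<in> {1..M}" using m by auto
    then have "trace (component v) (m - 1) ?s \<in> L2 \<Omega>" by (intro trace_L2 CUv)
    then show ?thesis using False by simp
  qed (simp add: L2_inner_const[OF W0])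
  have ip: "L2_ip \<Omega> (limit_plus Wh ?s) (limit_plus ?gv ?s) = (LINT y|lebesgue_on \<Omega>. trace (component v) m ?s y * trace G m ?s y)"
    unfolding L2_ip_def by (intro Bochner_Integration.integral_cong) (auto simp: lp1 lp2 trace_def component_def inner_commute)
  have im: "L2_ip \<Omega> (limit_minus W0 Wh ?s) (limit_plus ?gv ?s) = (LINT y|lebesgue_on \<Omega>. (if m = 1 then v \<bullet> W0 y else trace (component v) (m - 1) ?s y) * trace G m ?s y)"
    unfolding L2_ip_def
  proof (rule Bochner_Integration.integral_cong[OF refl])
    fix y assume "y \<in> space (lebesgue_on \<Omega>)"
    then have y: "y \<in> \<Omega>" by simp
    show "limit_minus W0 Wh ?s y \<bullet> limit_plus ?gv ?s y = (if m = 1 then v \<bullet> W0 y else trace (component v) (m - 1) ?s y) * trace G m ?s y"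
      unfolding lp2[OF y] lm[OF y, symmetric] by (simp add: inner_commute)
  qed
  have "L2_ip \<Omega> (limit_plus Wh ?s) (limit_plus ?gv ?s) - L2_ip \<Omega> (limit_minus W0 Wh ?s) (limit_plus ?gv ?s)
     = (LINT y|lebesgue_on \<Omega>. trace (component v) m ?s y * trace G m ?s y - (if m = 1 then v \<bullet> W0 y else trace (component v) (m - 1) ?s y) * trace G m ?s y)"
    unfolding ip im
    by (rule Bochner_Integration.integral_diff[symmetric]) (intro L2_mult_integrable trU trG oldL)+
  also have "\<dots> = (LINT y|lebesgue_on \<Omega>. jump (\<lambda>y. v \<bullet> W0 y) (component v) m y * trace G m ?s y)"
    unfolding jump_def by (simp add: left_diff_distrib)
  finally show ?thesis using eq lhs by simp
qed

lemma jumps_L2: "slabwise (jump (\<lambda>y. v \<bullet> W0 y) (component v)) \<in> L2 Q"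
  and jump_vector_L2: "m \<in> {1..M} \<Longrightarrow> jump (\<lambda>y. v \<bullet> W0 y) (component v) m \<in> L2 \<Omega>"
proof -
  have C: "m \<in> {1..M} \<Longrightarrow> j \<in> {1..N} \<Longrightarrow> Ck n (component v m j)" for m j n by (rule discrete_Ck[OF component_discrete])
  have L: "jump (\<lambda>y. v \<bullet> W0 y) (component v) m \<in> L2 \<Omega>" if m: "m \<in> {1..M}" for m
  proof (cases "m = 1")
    case True
    have "trace (component v) m (t (m - 1)) \<in> L2 \<Omega>" by (intro trace_L2 C m)
    then show ?thesis unfolding jump_def[abs_def] using True L2_diff[OF _ L2_inner_const[OF W0]] by simp
  next
    case False
    then have "m - 1 \<in> {1..M}" using m by auto
    then have "trace (component v) m (t (m - 1)) \<in> L2 \<Omega>" "trace (component v) (m - 1) (t (m - 1)) \<in> L2 \<Omega>"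
      by (intro trace_L2 C m; simp)+
    then show ?thesis unfolding jump_def[abs_def] using False by (simp add: L2_diff)
  qed
  then show "m \<in> {1..M} \<Longrightarrow> jump (\<lambda>y. v \<bullet> W0 y) (component v) m \<in> L2 \<Omega>" .
  show "slabwise (jump (\<lambda>y. v \<bullet> W0 y) (component v)) \<in> L2 Q" by (rule slabwise_L2) (fact L)
qed

lemma scalar_scheme_of:
  assumes ch: "characteristic v \<sigma>"
  shows "scalar_scheme t M x N h k \<sigma> \<delta> (component v) (\<lambda>y. v \<bullet> W0 y) (\<lambda>z. hat v \<bullet> b z) (\<lambda>z. hat v \<bullet> R1 z) (\<lambda>z. (M2 *v v) \<bullet> R1 z) (\<lambda>z. (M1 *v v) \<bullet> R1 z)"
proof (unfold scalar_scheme_def, intro conjI spacetime_mesh_axioms, unfold_locales)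
  show "\<sigma> = 1 \<or> \<sigma> = -1" by (rule characteristic_speed[OF ch])
  show "0 \<le> \<delta>" by (rule \<delta>)
  show "discrete (assemble (component v)) (component v)" by (rule discrete_of_pieces[OF component_discrete])
  show "(\<lambda>y. v \<bullet> W0 y) \<in> L2 {x 0<..<x N}" by (rule L2_inner_const[OF W0])
  show "(\<lambda>z. hat v \<bullet> b z) \<in> L2 Q" by (rule L2_inner_const[OF b])
  show RL: "(\<lambda>z. hat v \<bullet> R1 z) \<in> L2 Q" "(\<lambda>z. (M2 *v v) \<bullet> R1 z) \<in> L2 Q" "(\<lambda>z. (M1 *v v) \<bullet> R1 z) \<in> L2 Q"
    by (rule L2_inner_const[OF residual1_L2])+
  show "AE z in lebesgue_on Q. hat v \<bullet> R1 z = hat v \<bullet> b z - (assemble (\<lambda>m j. pd (1, 0) (component v m j)) z + \<sigma> * assemble (\<lambda>m j. pd (0, 1) (component v m j)) z)"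
    using residual1_AE by eventually_elim (simp only: inner_diff_right characteristic_equation[OF ch] Wh_derivative_inner)
  fix g G assume g: "discrete g G"
  have gL: "assemble G \<in> L2 Q" "assemble (\<lambda>m j. pd d (G m j)) \<in> L2 Q" for d
    by (auto intro!: assemble_L2 Ck_continuous[OF discrete_Ck[OF g]] Ck_pd discrete_Ck[OF g])
  have split: "(LINT z|lebesgue_on Q. f z * w z) = (\<Sum>m=1..M. LINT z|lebesgue_on (S m). f z * w z)" if "f \<in> L2 Q" "w \<in> L2 Q" for f w :: "real \<times> real \<Rightarrow> real"
    by (rule Q_slabs(2)) (intro integrable_subset[OF L2_mult_integrable[OF that] S_subset_Q]; simp)
  have trL: "trace G m (t (m - 1)) \<in> L2 \<Omega>" if "m \<in> {1..M}" for m
    by (intro trace_L2 discrete_Ck[OF g that])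
  have jumps: "(LINT z|lebesgue_on Q. slabwise (jump (\<lambda>y. v \<bullet> W0 y) (component v)) z * slabwise (\<lambda>m. trace G m (t (m - 1))) z)
      = h * (\<Sum>m=1..M. LINT y|lebesgue_on \<Omega>. jump (\<lambda>y. v \<bullet> W0 y) (component v) m y * trace G m (t (m - 1)) y)"
    by (rule slabwise_mult_integral) (fact jump_vector_L2, fact trL)
  show "(LINT z|lebesgue_on Q. (hat v \<bullet> R1 z) * assemble G z) + \<delta> * (LINT z|lebesgue_on Q. ((M2 *v v) \<bullet> R1 z) * assemble (\<lambda>m j. pd (0, 1) (G m j)) z)
      + \<delta> * (LINT z|lebesgue_on Q. ((M1 *v v) \<bullet> R1 z) * assemble (\<lambda>m j. pd (1, 0) (G m j)) z)
      = 1 / h * (LINT z|lebesgue_on Q. slabwise (jump (\<lambda>y. v \<bullet> W0 y) (component v)) z * slabwise (\<lambda>m. trace G m (t (m - 1))) z)"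
    unfolding split[OF RL(1) gL(1)] split[OF RL(2) gL(2)] split[OF RL(3) gL(2)] jumps
    using h_pos sd_scalar_slab[OF _ g, of _ v] by (simp add: sum_distrib_left sum.distrib[symmetric])
qed

text \<open>The jumps of the contracted solution are those of the scheme, so that their norm is bounded by the second
  residual.\<close>

lemma jump_residual2:
  assumes "z \<in> Q"
  shows "slabwise (jump (\<lambda>y. v \<bullet> W0 y) (component v)) z = v \<bullet> (h *\<^sub>R R2 z)"
proof -
  obtain s y where z: "z = (s, y)" by (cases z)
  have s: "t 0 < s" "s \<le> t M" and y: "y \<in> \<Omega>" using assms t0 by (auto simp: z box_Pair)
  define m where "m = tm.elem s"
  have m: "m \<in> {1..M}" using tm.elem_props[OF s] by (simp add: m_def)
  let ?s = "t (m - 1)"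
  note p = limit_plus_Wh[OF m y] and lm = limit_minus_Wh[OF m y]
  have "h *\<^sub>R R2 z = limit_plus Wh ?s y - limit_minus W0 Wh ?s y"
    unfolding residual2_def z using h_pos by (simp add: slab_index_eq m_def Let_def)
  then have "v \<bullet> (h *\<^sub>R R2 z) = trace (component v) m ?s y - (if m = 1 then v \<bullet> W0 y else trace (component v) (m - 1) ?s y)"
    unfolding inner_diff_right lm[symmetric] by (simp add: inner_diff_right p trace_def component_def)
  then show ?thesis by (simp add: slabwise_def jump_def z m_def)
qed

end

section \<open>The exact solution in characteristic variables\<close>

lemma L2_congruence:
  fixes u w :: "'a::euclidean_space \<Rightarrow> 'b::euclidean_space"
  assumes "u \<in> L2 G" "\<And>z. z \<in> G \<Longrightarrow> u z = w z" "G \<in> sets lebesgue"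
  shows "w \<in> L2 G"
  by (rule L2_AE[OF assms(1) _ assms(3)]) (use assms(2) in \<open>auto intro: AE_I2\<close>)

lemma vector_of_space_function_L2:
  fixes g :: "real \<Rightarrow> real^3" and s t :: real
  assumes "g \<in> L2 {a<..<b}" "s \<le> t"
  shows "(\<lambda>z. g (snd z)) \<in> L2 (box (s, a) (t, b))"
proof (rule L2_components)
  fix l
  have "(\<lambda>y. g y $ l) \<in> L2 {a<..<b}"
    using L2_inner_const[OF assms(1), of "axis l 1"] by (simp add: inner_axis')
  then show "(\<lambda>z. g (snd z) $ l) \<in> L2 (box (s, a) (t, b))" by (rule L2_of_space_function) fact
qed

lemma test_function_component:
  assumes "\<psi> \<in> test_functions G"
  shows "(\<lambda>z. w \<bullet> \<psi> z) \<in> test_functions G" "pd d (\<lambda>z. w \<bullet> \<psi> z) z = w \<bullet> pd d \<psi> z"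
proof -
  show "(\<lambda>z. w \<bullet> \<psi> z) \<in> test_functions G"
  proof (rule test_functionI)
    show "Ck n (\<lambda>z. w \<bullet> \<psi> z)" for n
      by (rule Ck_bounded_linear_compose[OF bounded_linear_inner_right test_function_Ck[OF assms]])
    show "compact (closure {p. \<psi> p \<noteq> 0})" "closure {p. \<psi> p \<noteq> 0} \<subseteq> G"
      using assms by (auto simp: test_functions_def)
    show "w \<bullet> \<psi> p = 0" if "p \<notin> closure {p. \<psi> p \<noteq> 0}" for p
    proof -
      have "p \<notin> {p. \<psi> p \<noteq> 0}" by (rule contra_subsetD[OF closure_subset that])
      then show ?thesis by simp
    qed
  qed
  show "pd d (\<lambda>z. w \<bullet> \<psi> z) z = w \<bullet> pd d \<psi> z"
    by (rule pd_bounded_linear[OF bounded_linear_inner_right test_function_Ck[OF assms]])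
qed

lemma test_function_final_time:
  fixes T a b :: real and \<omega> :: "real \<times> real \<Rightarrow> real"
  assumes \<omega>: "\<omega> \<in> test_functions (box (0, a) (T, b))" and T: "0 < T"
  obtains T0 where "T0 < T" "\<And>s y. T0 \<le> s \<Longrightarrow> \<omega> (s, y) = 0"
proof -
  let ?K = "closure {p. \<omega> p \<noteq> 0}"
  have K: "compact ?K" "?K \<subseteq> box (0, a) (T, b)" using \<omega> by (auto simp: test_functions_def)
  have z: "\<omega> p = 0" if "p \<notin> ?K" for p using that closure_subset[of "{p. \<omega> p \<noteq> 0}"] by auto
  show ?thesis
  proof (cases "?K = {}")
    case True
    have "\<omega> p = 0" for p by (rule z) (simp only: True empty_iff not_False_eq_True)
    then show ?thesis by (intro that[of 0] T)
  next
    case False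
    have "compact (fst ` ?K)" by (intro compact_continuous_image K continuous_intros)
    from compact_attains_sup[OF this] False obtain s where s: "s \<in> fst ` ?K" "\<And>r. r \<in> fst ` ?K \<Longrightarrow> r \<le> s" by auto
    have "s < T" using s(1) K(2) by (auto simp: box_Pair)
    show ?thesis
    proof (rule that[of "(s + T) / 2"])
      show "(s + T) / 2 < T" using \<open>s < T\<close> by simp
      fix r y assume "(s + T) / 2 \<le> r"
      then have "\<not> r \<le> s" using \<open>s < T\<close> by (simp add: field_simps)
      then have "(r, y) \<notin> ?K" using s(2)[of r] by force
      then show "\<omega> (r, y) = 0" by (rule z)
    qed
  qed
qed

lemma H1_weak_derivative:
  fixes u :: "real \<times> real \<Rightarrow> 'b::euclidean_space"
  assumes "u \<in> H1 G" and d: "d = (1, 0) \<or> d = (0, 1)"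
  shows "wderiv G d u \<in> L2 G" "weak_derivative G d u (wderiv G d u)"
proof -
  have "d \<in> Basis" using d by (auto simp: Basis_prod_def)
  then have "\<exists>w. w \<in> L2 G \<and> weak_derivative G d u w" using assms(1) by (auto simp: H1_def)
  from someI_ex[OF this] show "wderiv G d u \<in> L2 G" "weak_derivative G d u (wderiv G d u)"
    by (simp_all add: wderiv_def)
qed

lemma maxwell_source_L2:
  assumes W: "maxwell_solution T {a<..<b} K \<beta> g W"
  shows "\<beta> \<in> L2 (box (0, a) (T, b))"
proof -
  let ?Q = "box (0, a) (T, b)"
  have H: "W \<in> H1 ?Q" and AE: "AE z in lebesgue_on ?Q. M1 *v wderiv ?Q (1, 0) W z + M2 *v wderiv ?Q (0, 1) W z = \<beta> z"
    using W unfolding maxwell_solution_def Let_def box_Pair by simp_all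
  show ?thesis
  proof (rule L2_AE[OF _ AE])
    show "(\<lambda>z. M1 *v wderiv ?Q (1, 0) W z + M2 *v wderiv ?Q (0, 1) W z) \<in> L2 ?Q"
      by (intro L2_add L2_bounded_linear[OF _ bounded_linear_M(1)] L2_bounded_linear[OF _ bounded_linear_M(2)] H1_weak_derivative[OF H]; simp)
  qed simp
qed

text \<open>The weak derivatives of the components of an \<open>H\<^sup>1\<close> function are contracted under the
  integral, which gives the scalar equation tested with scalar test functions.\<close>

lemma characteristic_weak_equation:
  assumes W: "maxwell_solution T {a<..<b} K \<beta> g W" and ch: "characteristic v \<sigma>"
    and \<Phi>: "\<Phi> \<in> test_functions (box (0, a) (T, b))"
  shows "(LINT z|lebesgue_on (box (0, a) (T, b)). \<Phi> z * (hat v \<bullet> \<beta> z))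
    = - (LINT z|lebesgue_on (box (0, a) (T, b)). (pd (1, 0) \<Phi> z + \<sigma> * pd (0, 1) \<Phi> z) * (v \<bullet> W z))"
proof -
  let ?Q = "box (0, a) (T, b)"
  let ?D = "\<lambda>d. wderiv ?Q d W"
  have H: "W \<in> H1 ?Q" and AE: "AE z in lebesgue_on ?Q. M1 *v ?D (1, 0) z + M2 *v ?D (0, 1) z = \<beta> z"
    using W unfolding maxwell_solution_def Let_def box_Pair by simp_all
  have WL: "W \<in> L2 ?Q" using H by (simp add: H1_def)
  have \<Phi>L: "\<Phi> \<in> L2 ?Q" "pd d \<Phi> \<in> L2 ?Q" for d
    using test_function_L2[OF \<Phi>] test_function_L2[OF test_function_derivative[OF \<Phi>]] by auto
  have DL: "?D d \<in> L2 ?Q" if "d = (1, 0) \<or> d = (0, 1)" for d by (rule H1_weak_derivative(1)[OF H that])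
  have part: "(LINT z|lebesgue_on ?Q. \<Phi> z * (v \<bullet> ?D d z)) = - (LINT z|lebesgue_on ?Q. pd d \<Phi> z * (v \<bullet> W z))"
    if d: "d = (1, 0) \<or> d = (0, 1)" for d
  proof -
    have e: "(LINT z|lebesgue_on ?Q. pd d \<Phi> z *\<^sub>R W z) = - (LINT z|lebesgue_on ?Q. \<Phi> z *\<^sub>R ?D d z)"
      using H1_weak_derivative(2)[OF H d] \<Phi> by (simp add: weak_derivative_def)
    have "(LINT z|lebesgue_on ?Q. \<Phi> z * (v \<bullet> ?D d z)) = (LINT z|lebesgue_on ?Q. v \<bullet> (\<Phi> z *\<^sub>R ?D d z))" by simp
    also have "\<dots> = v \<bullet> (LINT z|lebesgue_on ?Q. \<Phi> z *\<^sub>R ?D d z)"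
      by (rule integral_inner_right) (rule L2_scaleR_integrable[OF \<Phi>L(1) DL[OF d]])
    also have "\<dots> = - (v \<bullet> (LINT z|lebesgue_on ?Q. pd d \<Phi> z *\<^sub>R W z))" using e by simp
    also have "v \<bullet> (LINT z|lebesgue_on ?Q. pd d \<Phi> z *\<^sub>R W z) = (LINT z|lebesgue_on ?Q. v \<bullet> (pd d \<Phi> z *\<^sub>R W z))"
      by (rule integral_inner_right[symmetric]) (rule L2_scaleR_integrable[OF \<Phi>L(2) WL])
    finally show ?thesis by simp
  qed
  have i: "integrable (lebesgue_on ?Q) (\<lambda>z. \<Phi> z * (v \<bullet> ?D d z))" if "d = (1, 0) \<or> d = (0, 1)" for d
    by (intro L2_mult_integrable \<Phi>L L2_inner_const DL that)
  have i': "integrable (lebesgue_on ?Q) (\<lambda>z. pd d \<Phi> z * (v \<bullet> W z))" for d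
    by (intro L2_mult_integrable \<Phi>L L2_inner_const WL)
  have "(LINT z|lebesgue_on ?Q. \<Phi> z * (hat v \<bullet> \<beta> z))
      = (LINT z|lebesgue_on ?Q. \<Phi> z * (v \<bullet> ?D (1, 0) z) + \<sigma> * (\<Phi> z * (v \<bullet> ?D (0, 1) z)))"
  proof (rule integral_cong_AE)
    show "(\<lambda>z. \<Phi> z * (hat v \<bullet> \<beta> z)) \<in> borel_measurable (lebesgue_on ?Q)"
      by (intro borel_measurable_integrable L2_mult_integrable \<Phi>L L2_inner_const maxwell_source_L2[OF W])
    show "(\<lambda>z. \<Phi> z * (v \<bullet> ?D (1, 0) z) + \<sigma> * (\<Phi> z * (v \<bullet> ?D (0, 1) z))) \<in> borel_measurable (lebesgue_on ?Q)"
      by (intro borel_measurable_add borel_measurable_integrable integrable_mult_right i) auto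
    show "AE z in lebesgue_on ?Q. \<Phi> z * (hat v \<bullet> \<beta> z) = \<Phi> z * (v \<bullet> ?D (1, 0) z) + \<sigma> * (\<Phi> z * (v \<bullet> ?D (0, 1) z))"
      using AE
    proof eventually_elim
      case (elim z)
      show ?case unfolding elim[symmetric] characteristic_equation[OF ch] by (simp add: algebra_simps)
    qed
  qed
  also have "\<dots> = - ((LINT z|lebesgue_on ?Q. pd (1, 0) \<Phi> z * (v \<bullet> W z)) + \<sigma> * (LINT z|lebesgue_on ?Q. pd (0, 1) \<Phi> z * (v \<bullet> W z)))"
    using i[of "(1, 0)"] i[of "(0, 1)"] part[of "(1, 0)"] part[of "(0, 1)"] by simp
  also have "(LINT z|lebesgue_on ?Q. pd (1, 0) \<Phi> z * (v \<bullet> W z)) + \<sigma> * (LINT z|lebesgue_on ?Q. pd (0, 1) \<Phi> z * (v \<bullet> W z))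
      = (LINT z|lebesgue_on ?Q. (pd (1, 0) \<Phi> z + \<sigma> * pd (0, 1) \<Phi> z) * (v \<bullet> W z))"
    using i'[of "(1, 0)"] i'[of "(0, 1)"] by (simp add: distrib_right mult.assoc)
  finally show ?thesis .
qed

lemma characteristic_initial_trace:
  assumes W: "initial_trace {a<..<b} W g" and WL: "W \<in> L2 (box (0, a) (T, b))" and T: "0 < T" and v: "norm v \<le> 2"
  shows "((\<lambda>\<epsilon>. (LINT z|lebesgue_on (box (0, a) (\<epsilon>, b)). (v \<bullet> W z - v \<bullet> g (snd z))\<^sup>2) / \<epsilon>) \<longlongrightarrow> 0) (at_right 0)"
proof (rule Lim_null_comparison)
  let ?F = "\<lambda>\<epsilon>. (LINT z|lebesgue_on (box (0, a) (\<epsilon>, b)). (norm (W z - g (snd z)))\<^sup>2) / \<epsilon>"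
  have g: "g \<in> L2 {a<..<b}" and lim: "(?F \<longlongrightarrow> 0) (at_right 0)"
    using W unfolding initial_trace_def box_Pair by simp_all
  show "((\<lambda>\<epsilon>. 4 * ?F \<epsilon>) \<longlongrightarrow> 0) (at_right 0)" using tendsto_mult_right_zero[OF lim, of 4] by simp
  have "\<forall>\<^sub>F \<epsilon> in at_right 0. 0 < \<epsilon> \<and> \<epsilon> < T"
    using T by (auto simp: eventually_at_right_field intro!: exI[of _ T])
  then show "\<forall>\<^sub>F \<epsilon> in at_right 0. norm ((LINT z|lebesgue_on (box (0, a) (\<epsilon>, b)). (v \<bullet> W z - v \<bullet> g (snd z))\<^sup>2) / \<epsilon>) \<le> 4 * ?F \<epsilon>"
  proof eventually_elim
    case (elim \<epsilon>)
    let ?S = "box (0, a) (\<epsilon>, b)"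
    have "W \<in> L2 ?S"
    proof (rule L2_subset[OF WL])
      show "?S \<subseteq> box (0, a) (T, b)" using elim by (auto simp: box_Pair)
    qed simp_all
    then have "(\<lambda>z. W z - g (snd z)) \<in> L2 ?S"
      by (intro L2_diff vector_of_space_function_L2 g) (use elim in auto)
    then have i: "integrable (lebesgue_on ?S) (\<lambda>z. 4 * (norm (W z - g (snd z)))\<^sup>2)"
      by (intro integrable_mult_right L2_integrable_square)
    have "(v \<bullet> W z - v \<bullet> g (snd z))\<^sup>2 \<le> 4 * (norm (W z - g (snd z)))\<^sup>2" for z
    proof -
      have "\<bar>v \<bullet> (W z - g (snd z))\<bar> \<le> norm v * norm (W z - g (snd z))" by (rule Cauchy_Schwarz_ineq2)
      also have "\<dots> \<le> 2 * norm (W z - g (snd z))" using v by (intro mult_right_mono) auto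
      finally have "\<bar>v \<bullet> (W z - g (snd z))\<bar>\<^sup>2 \<le> (2 * norm (W z - g (snd z)))\<^sup>2" by (intro power_mono) auto
      then show ?thesis by (simp add: inner_diff_right power_mult_distrib)
    qed
    then have "(LINT z|lebesgue_on ?S. (v \<bullet> W z - v \<bullet> g (snd z))\<^sup>2) \<le> (LINT z|lebesgue_on ?S. 4 * (norm (W z - g (snd z)))\<^sup>2)"
      by (intro integral_mono_AE' i) auto
    also have "\<dots> = 4 * (LINT z|lebesgue_on ?S. (norm (W z - g (snd z)))\<^sup>2)" by simp
    finally have le: "(LINT z|lebesgue_on ?S. (v \<bullet> W z - v \<bullet> g (snd z))\<^sup>2) \<le> 4 * (LINT z|lebesgue_on ?S. (norm (W z - g (snd z)))\<^sup>2)" .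
    have "0 \<le> (LINT z|lebesgue_on ?S. (v \<bullet> W z - v \<bullet> g (snd z))\<^sup>2)" by simp
    then show ?case using divide_right_mono[OF le, of \<epsilon>] elim by simp
  qed
qed

section \<open>The estimate for the Maxwell system\<close>

context maxwell_scheme begin

lemma R2_L2: "(\<lambda>z. h *\<^sub>R R2 z) \<in> L2 Q"
proof (rule L2_components)
  fix l
  show "(\<lambda>z. (h *\<^sub>R R2 z) $ l) \<in> L2 Q"
    by (rule L2_congruence[OF jumps_L2[of "axis l 1"]])
      (use jump_residual2[of _ "axis l 1"] in \<open>simp_all add: inner_axis'\<close>)
qed

lemma Wh_L2: "Wh \<in> L2 Q"
proof (rule L2_components)
  fix l
  have "assemble (component (axis l 1)) \<in> L2 Q" by (rule assemble_L2[OF Ck_continuous]) (rule discrete_Ck[OF component_discrete])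
  then show "(\<lambda>z. Wh z $ l) \<in> L2 Q"
    by (rule L2_congruence) (use discrete_assemble[OF component_discrete, of _ "axis l 1"] in \<open>simp_all add: inner_axis'\<close>)
qed

lemma inner_norm_bound:
  assumes "u \<in> L2 Q" "norm v \<le> c"
  shows "L2_norm Q (\<lambda>z. v \<bullet> u z) \<le> c * L2_norm Q u"
proof (rule L2_norm_bound[OF assms(1)])
  show "AE z in lebesgue_on Q. norm (v \<bullet> u z) \<le> c * norm (u z)"
  proof (rule AE_I2)
    fix z
    have "norm (v \<bullet> u z) \<le> norm v * norm (u z)" using Cauchy_Schwarz_ineq2[of v "u z"] by simp
    also have "\<dots> \<le> c * norm (u z)" using assms(2) by (intro mult_right_mono) auto
    finally show "norm (v \<bullet> u z) \<le> c * norm (u z)" .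
  qed
  show "0 \<le> c" using norm_ge_zero[of v] assms(2) by linarith
qed

lemma jump_norm_bound:
  assumes "norm v \<le> 2"
  shows "L2_norm Q (slabwise (jump (\<lambda>y. v \<bullet> W0 y) (component v))) \<le> 2 * L2_norm Q (\<lambda>z. h *\<^sub>R R2 z)"
proof -
  have "L2_norm Q (slabwise (jump (\<lambda>y. v \<bullet> W0 y) (component v))) = L2_norm Q (\<lambda>z. v \<bullet> (h *\<^sub>R R2 z))"
    unfolding L2_norm_def by (rule arg_cong[of _ _ sqrt], rule Bochner_Integration.integral_cong) (auto simp: jump_residual2)
  then show ?thesis using inner_norm_bound[OF R2_L2 assms] by simp
qed

text \<open>Where the source vanishes the residual is minus the Maxwell operator applied to the discrete solution, so
  \<open>characteristic_dissipative\<close> applies.\<close>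

lemma dissipative_off_source:
  assumes ch: "characteristic v \<sigma>"
  shows "AE z in lebesgue_on Q. b z = 0 \<longrightarrow>
    ((M2 *v v) \<bullet> R1 z) * assemble (\<lambda>m j. pd (0, 1) (component v m j)) z + ((M1 *v v) \<bullet> R1 z) * assemble (\<lambda>m j. pd (1, 0) (component v m j)) z \<le> 0"
  using residual1_AE
proof eventually_elim
  case (elim z)
  show ?case
  proof
    assume "b z = 0"
    define y where "y = M1 *v Wh_derivative (1, 0) z + M2 *v Wh_derivative (0, 1) z"
    have "R1 z = - y" using elim \<open>b z = 0\<close> by (simp add: y_def)
    then show "((M2 *v v) \<bullet> R1 z) * assemble (\<lambda>m j. pd (0, 1) (component v m j)) z
      + ((M1 *v v) \<bullet> R1 z) * assemble (\<lambda>m j. pd (1, 0) (component v m j)) z \<le> 0"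
      using characteristic_dissipative[OF ch, of "Wh_derivative (1, 0) z" "Wh_derivative (0, 1) z", folded y_def]
      unfolding Wh_derivative_inner[symmetric] by simp
  qed
qed

end

lemma test_function_norms:
  fixes T a b :: real and \<psi> :: "real \<times> real \<Rightarrow> 'b::euclidean_space"
  assumes \<psi>: "\<psi> \<in> test_functions (box (0, a) (T, b))" and w: "norm w \<le> 1"
  shows "sqrt ((L2_norm (box (0, a) (T, b)) (\<lambda>z. w \<bullet> \<psi> z))\<^sup>2
      + (L2_norm (box (0, a) (T, b)) (pd (0, 1) (\<lambda>z. w \<bullet> \<psi> z)))\<^sup>2) \<le> H1_norm (box (0, a) (T, b)) \<psi>"
proof -
  let ?Q = "box (0, a) (T, b)"
  have bd: "L2_norm ?Q (\<lambda>z. w \<bullet> u z) \<le> L2_norm ?Q u" if "u \<in> L2 ?Q" for u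
  proof -
    have "norm (w \<bullet> u z) \<le> 1 * norm (u z)" for z
      using Cauchy_Schwarz_ineq2[of w "u z"] mult_right_mono[OF w, of "norm (u z)"] by simp
    then show ?thesis using L2_norm_bound[OF that, of "\<lambda>z. w \<bullet> u z" 1] by simp
  qed
  have L: "\<psi> \<in> L2 ?Q" "pd (0, 1) \<psi> \<in> L2 ?Q"
    using test_function_L2[OF \<psi>] test_function_L2[OF test_function_derivative[OF \<psi>]] by auto
  have "(L2_norm ?Q (\<lambda>z. w \<bullet> \<psi> z))\<^sup>2 \<le> (L2_norm ?Q \<psi>)\<^sup>2"
    by (intro power_mono bd L L2_norm_nonneg)
  moreover have "(L2_norm ?Q (pd (0, 1) (\<lambda>z. w \<bullet> \<psi> z)))\<^sup>2 \<le> (\<Sum>d\<in>Basis. (L2_norm ?Q (pd d \<psi>))\<^sup>2)"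
  proof -
    have "pd (0, 1) (\<lambda>z. w \<bullet> \<psi> z) = (\<lambda>z. w \<bullet> pd (0, 1) \<psi> z)"
      by (rule ext) (rule test_function_component(2)[OF \<psi>])
    then have "(L2_norm ?Q (pd (0, 1) (\<lambda>z. w \<bullet> \<psi> z)))\<^sup>2 \<le> (L2_norm ?Q (pd (0, 1) \<psi>))\<^sup>2"
      using bd[OF L(2)] by (auto intro!: power_mono L2_norm_nonneg)
    also have "\<dots> \<le> (\<Sum>d\<in>Basis. (L2_norm ?Q (pd d \<psi>))\<^sup>2)"
    proof (rule member_le_sum[of "(0, 1)" Basis "\<lambda>d. (L2_norm ?Q (pd d \<psi>))\<^sup>2"])
      show "(0, 1) \<in> (Basis :: (real \<times> real) set)" by (simp add: Basis_prod_def)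
    qed simp_all
    finally show ?thesis .
  qed
  ultimately show ?thesis unfolding H1_norm_def by (intro real_sqrt_le_mono add_mono)
qed

text \<open>The three contractions of the error are estimated separately with the components of the test function in
  the dual basis, whose \<open>H\<^sup>1\<close> norms do not exceed that of the test function.\<close>

theorem maxwell_error_estimate:
  fixes T a b \<kappa>1 \<kappa>2 c :: real and k :: nat
  assumes T: "0 < T" and \<kappa>: "a < \<kappa>1" "\<kappa>2 < b" "\<kappa>1 \<le> \<kappa>2" and c: "0 < c" and K: "K \<subseteq> {\<kappa>1<..<\<kappa>2}"
  shows "\<exists>C\<ge>0. \<forall>t M x N h \<beta> g Wh W \<psi>.
    maxwell_scheme t M x N h k (c * h) \<beta> g Wh \<longrightarrow> t M = T \<longrightarrow> x 0 = a \<longrightarrow> x N = b \<longrightarrow>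
    maxwell_solution T {a<..<b} K \<beta> g W \<longrightarrow> (\<forall>s\<in>{0..T}. \<forall>y. y \<notin> K \<longrightarrow> \<beta> (s, y) = 0) \<longrightarrow> (\<forall>y. y \<notin> K \<longrightarrow> g y = 0) \<longrightarrow>
    \<psi> \<in> test_functions (box (0, a) (T, b)) \<longrightarrow>
    L2_ip (box (0, a) (T, b)) (\<lambda>z. W z - Wh z) \<psi>
      \<le> C * H1_norm (box (0, a) (T, b)) \<psi>
        * (L2_norm (box (0, a) (T, b)) (\<lambda>z. h *\<^sub>R residual1 {a<..<b} t \<beta> Wh z)
          + L2_norm (box (0, a) (T, b)) (\<lambda>z. h *\<^sub>R residual2 h t g Wh z))"
proof -
  let ?Q = "box (0, a) (T, b)"
  obtain C where C0: "0 \<le> C" and C: "\<forall>t M x N h \<sigma> U V0 \<beta> r p q \<omega> V.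
    scalar_scheme t M x N h k \<sigma> (c * h) U V0 \<beta> r p q \<longrightarrow> t M = T \<longrightarrow> x 0 = a \<longrightarrow> x N = b \<longrightarrow>
    (AE z in lebesgue_on ?Q. snd z \<notin> {\<kappa>1<..<\<kappa>2} \<longrightarrow> \<beta> z = 0
        \<and> p z * spacetime_mesh.assemble t x (\<lambda>m j. pd (0, 1) (U m j)) z + q z * spacetime_mesh.assemble t x (\<lambda>m j. pd (1, 0) (U m j)) z \<le> 0) \<longrightarrow>
    (\<forall>y. y \<notin> {\<kappa>1<..<\<kappa>2} \<longrightarrow> V0 y = 0) \<longrightarrow>
    \<omega> \<in> test_functions ?Q \<longrightarrow> V \<in> L2 ?Q \<longrightarrow>
    (LINT z|lebesgue_on ?Q. dual \<sigma> T \<omega> z * \<beta> z)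
      = - (LINT z|lebesgue_on ?Q. (pd (1, 0) (dual \<sigma> T \<omega>) z + \<sigma> * pd (0, 1) (dual \<sigma> T \<omega>) z) * V z)
        - (LINT y|lebesgue_on {a<..<b}. V0 y * dual \<sigma> T \<omega> (0, y)) \<longrightarrow>
    \<bar>LINT z|lebesgue_on ?Q. (V z - spacetime_mesh.assemble t x U z) * \<omega> z\<bar>
      \<le> C * sqrt ((L2_norm ?Q \<omega>)\<^sup>2 + (L2_norm ?Q (pd (0, 1) \<omega>))\<^sup>2)
        * (h * (L2_norm ?Q r + L2_norm ?Q p + L2_norm ?Q q) + L2_norm ?Q (spacetime_mesh.slabwise t (spacetime_mesh.jump t x V0 U)))"
    using scalar_error_estimate[OF T \<kappa> c, of k] by blast
  show ?thesis
  (* 18 = 3 * 6: three components, and the residual norms of each one add up to at most a factor 6. *)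
  proof (rule exI[of _ "18 * C"], intro conjI allI impI)
    show "0 \<le> 18 * C" using C0 by simp
    fix t M x N h \<beta> g Wh W and \<psi> :: "real \<times> real \<Rightarrow> real^3"
    assume sch: "maxwell_scheme t M x N h k (c * h) \<beta> g Wh" and tM: "t M = T" and x0: "x 0 = a" and xN: "x N = b"
      and W: "maxwell_solution T {a<..<b} K \<beta> g W" and \<beta>0: "\<forall>s\<in>{0..T}. \<forall>y. y \<notin> K \<longrightarrow> \<beta> (s, y) = 0"
      and g0: "\<forall>y. y \<notin> K \<longrightarrow> g y = 0" and \<psi>: "\<psi> \<in> test_functions ?Q"
    interpret maxwell_scheme t M x N h k "c * h" \<beta> g Wh by fact
    have Qeq: "Q = ?Q" by (simp add: tM x0 xN)
    have WL: "W \<in> L2 ?Q" and tr: "initial_trace {a<..<b} W g" and W0z: "\<forall>s\<in>{0..T}. \<forall>y. y \<notin> K \<longrightarrow> W (s, y) = 0"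
      using W unfolding maxwell_solution_def Let_def H1_def box_Pair by simp_all
    have gL: "g \<in> L2 {a<..<b}" using tr by (simp add: initial_trace_def)
    let ?R = "L2_norm ?Q R1" and ?J = "L2_norm ?Q (\<lambda>z. h *\<^sub>R R2 z)"
    have n0: "0 \<le> ?R" "0 \<le> ?J" by (simp_all add: L2_norm_nonneg)
    have HQ: "0 \<le> H1_norm ?Q \<psi>" unfolding H1_norm_def by (simp add: sum_nonneg)
    have est: "\<bar>LINT z|lebesgue_on ?Q. (v \<bullet> (W z - Wh z)) * (w \<bullet> \<psi> z)\<bar> \<le> C * H1_norm ?Q \<psi> * (6 * (h * ?R + ?J))"
      if ch: "characteristic v \<sigma>" and w: "norm w \<le> 1" for v \<sigma> w
    proof -
      let ?\<omega> = "\<lambda>z. w \<bullet> \<psi> z"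
      let ?\<phi> = "dual \<sigma> T ?\<omega>"
      note nv = characteristic_norms[OF ch]
      have \<omega>: "?\<omega> \<in> test_functions ?Q" by (rule test_function_component(1)[OF \<psi>])
      obtain T0 where T0: "T0 < T" "\<And>s y. T0 \<le> s \<Longrightarrow> ?\<omega> (s, y) = 0" by (rule test_function_final_time[OF \<omega> T]) blast
      have exact: "(LINT z|lebesgue_on ?Q. ?\<phi> z * (hat v \<bullet> \<beta> z))
          = - (LINT z|lebesgue_on ?Q. (pd (1, 0) ?\<phi> z + \<sigma> * pd (0, 1) ?\<phi> z) * (v \<bullet> W z))
            - (LINT y|lebesgue_on {a<..<b}. (v \<bullet> g y) * ?\<phi> (0, y))"
      proof (rule exact_solution_tested[OF T \<kappa>(1,3,2)])
        show "(\<lambda>z. v \<bullet> W z) \<in> L2 ?Q" by (rule L2_inner_const[OF WL])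
        show "(\<lambda>z. hat v \<bullet> \<beta> z) \<in> L2 ?Q" by (rule L2_inner_const[OF maxwell_source_L2[OF W]])
        show "(\<lambda>y. v \<bullet> g y) \<in> L2 {a<..<b}" by (rule L2_inner_const[OF gL])
        fix s y assume s: "0 < s" "s < T" "y \<notin> {\<kappa>1..\<kappa>2}"
        then have y: "y \<notin> K" using K by auto
        show "v \<bullet> W (s, y) = 0" using W0z y s by simp
        show "hat v \<bullet> \<beta> (s, y) = 0" using \<beta>0 y s by simp
      next
        fix \<Phi> :: "real \<times> real \<Rightarrow> real" assume "\<Phi> \<in> test_functions ?Q"
        then show "(LINT z|lebesgue_on ?Q. \<Phi> z * (hat v \<bullet> \<beta> z)) = - (LINT z|lebesgue_on ?Q. (pd (1, 0) \<Phi> z + \<sigma> * pd (0, 1) \<Phi> z) * (v \<bullet> W z))"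
          by (rule characteristic_weak_equation[OF W ch])
      next
        show "((\<lambda>\<epsilon>. (LINT z|lebesgue_on (box (0, a) (\<epsilon>, b)). (v \<bullet> W z - v \<bullet> g (snd z))\<^sup>2) / \<epsilon>) \<longlongrightarrow> 0) (at_right 0)"
          by (rule characteristic_initial_trace[OF tr WL T nv(1)])
        show "Ck n ?\<phi>" for n by (rule Ck_dual[OF test_function_Ck[OF \<omega>]])
        show "T0 < T" by fact
        show "?\<phi> (s, y) = 0" if "T0 \<le> s" for s y by (rule dual_zero) (use T0(2) that in auto)
      qed
      have data: "AE z in lebesgue_on ?Q. snd z \<notin> {\<kappa>1<..<\<kappa>2} \<longrightarrow> hat v \<bullet> \<beta> z = 0
        \<and> ((M2 *v v) \<bullet> R1 z) * assemble (\<lambda>m j. pd (0, 1) (component v m j)) z + ((M1 *v v) \<bullet> R1 z) * assemble (\<lambda>m j. pd (1, 0) (component v m j)) z \<le> 0"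
      proof -
        have "AE z in lebesgue_on ?Q. z \<in> ?Q" by (intro AE_I2) simp
        with dissipative_off_source[OF ch] show ?thesis unfolding Qeq
        proof eventually_elim
          case (elim z)
          show ?case
          proof
            assume "snd z \<notin> {\<kappa>1<..<\<kappa>2}"
            then have "snd z \<notin> K" using K by blast
            then have "\<beta> (fst z, snd z) = 0" using \<beta>0 elim(2) by (cases z) (auto simp: box_Pair)
            then have "\<beta> z = 0" by simp
            then show "hat v \<bullet> \<beta> z = 0 \<and> ((M2 *v v) \<bullet> R1 z) * assemble (\<lambda>m j. pd (0, 1) (component v m j)) z
              + ((M1 *v v) \<bullet> R1 z) * assemble (\<lambda>m j. pd (1, 0) (component v m j)) z \<le> 0" using elim(1) by simp
          qed
        qed
      qed
      have V0: "\<forall>y. y \<notin> {\<kappa>1<..<\<kappa>2} \<longrightarrow> v \<bullet> g y = 0" using g0 K by (metis inner_zero_right subsetD)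
      let ?n = "h * (L2_norm ?Q (\<lambda>z. hat v \<bullet> R1 z) + L2_norm ?Q (\<lambda>z. (M2 *v v) \<bullet> R1 z) + L2_norm ?Q (\<lambda>z. (M1 *v v) \<bullet> R1 z))
          + L2_norm ?Q (slabwise (jump (\<lambda>y. v \<bullet> g y) (component v)))"
      have err: "(LINT z|lebesgue_on ?Q. (v \<bullet> (W z - Wh z)) * (w \<bullet> \<psi> z)) = (LINT z|lebesgue_on ?Q. (v \<bullet> W z - assemble (component v) z) * ?\<omega> z)"
        using discrete_assemble[OF component_discrete, of _ v] unfolding Qeq by (intro Bochner_Integration.integral_cong) (auto simp: inner_diff_right)
      have "\<bar>LINT z|lebesgue_on ?Q. (v \<bullet> W z - assemble (component v) z) * ?\<omega> z\<bar> \<le> C * sqrt ((L2_norm ?Q ?\<omega>)\<^sup>2 + (L2_norm ?Q (pd (0, 1) ?\<omega>))\<^sup>2) * ?n"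
        by (rule C[rule_format, OF scalar_scheme_of[OF ch] tM x0 xN data]) (use V0 \<omega> L2_inner_const[OF WL] exact in auto)
      also have "\<dots> \<le> C * H1_norm ?Q \<psi> * (6 * (h * ?R + ?J))"
      proof (intro mult_mono mult_left_mono C0 test_function_norms[OF \<psi> w] mult_nonneg_nonneg HQ)
        have "L2_norm ?Q (\<lambda>z. hat v \<bullet> R1 z) \<le> 2 * ?R" "L2_norm ?Q (\<lambda>z. (M2 *v v) \<bullet> R1 z) \<le> 2 * ?R" "L2_norm ?Q (\<lambda>z. (M1 *v v) \<bullet> R1 z) \<le> 2 * ?R"
          using inner_norm_bound[OF residual1_L2 nv(2)] inner_norm_bound[OF residual1_L2 nv(4)] inner_norm_bound[OF residual1_L2 nv(3)] unfolding Qeq by auto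
        then have "L2_norm ?Q (\<lambda>z. hat v \<bullet> R1 z) + L2_norm ?Q (\<lambda>z. (M2 *v v) \<bullet> R1 z) + L2_norm ?Q (\<lambda>z. (M1 *v v) \<bullet> R1 z) \<le> 6 * ?R" by simp
        then have "h * (L2_norm ?Q (\<lambda>z. hat v \<bullet> R1 z) + L2_norm ?Q (\<lambda>z. (M2 *v v) \<bullet> R1 z) + L2_norm ?Q (\<lambda>z. (M1 *v v) \<bullet> R1 z)) \<le> h * (6 * ?R)"
          using h_pos by (intro mult_left_mono) auto
        moreover have "L2_norm ?Q (slabwise (jump (\<lambda>y. v \<bullet> g y) (component v))) \<le> 2 * ?J"
          using jump_norm_bound[OF nv(1)] unfolding Qeq .
        ultimately show "?n \<le> 6 * (h * ?R + ?J)" using n0 by (simp add: algebra_simps)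
        show "0 \<le> ?n" using h_pos by (intro add_nonneg_nonneg mult_nonneg_nonneg L2_norm_nonneg) auto
      qed simp_all
      finally show ?thesis unfolding err .
    qed
    let ?v1 = "vector [1, 0, 0] :: real^3" and ?v2 = "vector [0, 1, 1] :: real^3" and ?v3 = "vector [0, 1, -1] :: real^3"
    let ?w2 = "vector [0, 1/2, 1/2] :: real^3" and ?w3 = "vector [0, 1/2, -1/2] :: real^3"
    let ?e = "\<lambda>z. W z - Wh z"
    have eL: "?e \<in> L2 ?Q" using Wh_L2 WL unfolding Qeq by (rule L2_diff[rotated])
    have i: "integrable (lebesgue_on ?Q) (\<lambda>z. (v \<bullet> ?e z) * (w \<bullet> \<psi> z))" for v w
      by (intro L2_mult_integrable L2_inner_const eL test_function_L2[OF \<psi>]) auto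
    have "L2_ip ?Q ?e \<psi> = (LINT z|lebesgue_on ?Q. (?v1 \<bullet> ?e z) * (?v1 \<bullet> \<psi> z) + (?v2 \<bullet> ?e z) * (?w2 \<bullet> \<psi> z) + (?v3 \<bullet> ?e z) * (?w3 \<bullet> \<psi> z))"
      unfolding L2_ip_def by (subst characteristic_sum) simp
    also have "\<dots> = (LINT z|lebesgue_on ?Q. (?v1 \<bullet> ?e z) * (?v1 \<bullet> \<psi> z)) + (LINT z|lebesgue_on ?Q. (?v2 \<bullet> ?e z) * (?w2 \<bullet> \<psi> z))
        + (LINT z|lebesgue_on ?Q. (?v3 \<bullet> ?e z) * (?w3 \<bullet> \<psi> z))"
      using i by simp
    also have "\<dots> \<le> 3 * (C * H1_norm ?Q \<psi> * (6 * (h * ?R + ?J)))"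
    proof -
      have "sqrt (1 / 2) \<le> (1::real)" using real_sqrt_le_mono[of "1 / 2" 1] by simp
      then have n: "norm ?v1 \<le> 1" "norm ?w2 \<le> 1" "norm ?w3 \<le> 1" by (simp_all add: norm_eq_sqrt_inner inner_3)
      have "characteristic ?v1 1" "characteristic ?v2 1" "characteristic ?v3 (-1)" by (auto simp: characteristic_def)
      from est[OF this(1) n(1)] est[OF this(2) n(2)] est[OF this(3) n(3)] show ?thesis by linarith
    qed
    also have "\<dots> = 18 * C * H1_norm ?Q \<psi> * (h * ?R + ?J)" by simp
    also have "h * ?R = L2_norm ?Q (\<lambda>z. h *\<^sub>R R1 z)" using h_pos by (simp add: L2_norm_scaleR)
    finally show "L2_ip ?Q ?e \<psi> \<le> 18 * C * H1_norm ?Q \<psi> * (L2_norm ?Q (\<lambda>z. h *\<^sub>R residual1 {a<..<b} t \<beta> Wh z) + L2_norm ?Q (\<lambda>z. h *\<^sub>R residual2 h t g Wh z))"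
      by (simp add: x0 xN)
  qed
qed

lemma mesh_maxwell_scheme:
  fixes a b T :: real
  assumes mesh: "mesh T {a<..<b} h M t N x" and T: "0 < T" and ab: "a < b" and k: "1 \<le> k" and c: "0 \<le> c"
    and sol: "maxwell_solution T {a<..<b} K \<beta> g W"
    and sd: "sd_solution k (c * h) {a<..<b} M t N x \<beta> g Wh"
  shows "maxwell_scheme t M x N h k (c * h) \<beta> g Wh" "t M = T" "x 0 = a" "x N = b"
proof -
  have h: "0 < h" "t 0 = 0" and tM: "t M = T" and st: "\<And>m. m \<in> {1..M} \<Longrightarrow> t m - t (m - 1) = h"
    and sp: "{x 0<..<x N} = {a<..<b}" and xs: "\<And>j. j \<in> {1..N} \<Longrightarrow> x (j - 1) < x j \<and> x j - x (j - 1) \<le> h"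
    using mesh by (auto simp: mesh_def)
  have ends: "x 0 = a" "x N = b" using sp ab by (simp_all add: greaterThanLessThan_eq_iff)
  have "M \<noteq> 0"
  proof
    assume "M = 0"
    then show False using h(2) tM T by simp
  qed
  moreover have "N \<noteq> 0"
  proof
    assume "N = 0"
    then show False using ends ab by simp
  qed
  ultimately have "1 \<le> M" "1 \<le> N" by simp_all
  show "t M = T" "x 0 = a" "x N = b" by fact+
  have st': "x' < y'" if "y' - x' = h" for x' y' using that h(1) by simp
  show "maxwell_scheme t M x N h k (c * h) \<beta> g Wh"
  proof (unfold_locales)
    show "1 \<le> M" "1 \<le> N" by fact+
    show "t (m - 1) < t m" if "m \<in> {1..M}" for m by (rule st'[OF st[OF that]])
    show "x (j - 1) < x j" "x j - x (j - 1) \<le> h" if "j \<in> {1..N}" for j using xs[OF that] by auto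
    show "t 0 = 0" "0 < h" "1 \<le> k" "0 \<le> c * h" using h k c by auto
    show "t m = t (m - 1) + h" if "m \<in> {1..M}" for m using st[OF that] by simp
    show "\<beta> \<in> L2 (box (0, x 0) (t M, x N))" unfolding ends tM by (rule maxwell_source_L2[OF sol])
    show "g \<in> L2 {x 0<..<x N}" using sol unfolding ends maxwell_solution_def Let_def initial_trace_def by blast
    show "sd_solution k (c * h) {x 0<..<x N} M t N x \<beta> g Wh" unfolding ends by (rule sd)
  qed
qed

lemma interval_of_open_connected:
  fixes G :: "real set"
  assumes "open G" "connected G" "bounded G" "G \<noteq> {}"
  obtains a b where "a < b" "G = {a<..<b}"
proof -
  have bd: "bdd_below G" "bdd_above G" using assms(3) by (auto intro: bounded_imp_bdd_below bounded_imp_bdd_above)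
  have in_between: "Inf G < y \<and> y < Sup G" if "y \<in> G" for y
  proof -
    obtain e where e: "0 < e" "ball y e \<subseteq> G" using assms(1) \<open>y \<in> G\<close> by (meson open_contains_ball)
    then have "y - e / 2 \<in> G" "y + e / 2 \<in> G" by (auto intro!: subsetD[OF e(2)] simp: dist_real_def)
    then show ?thesis using cInf_lower[OF _ bd(1)] cSup_upper[OF _ bd(2)] e(1) by fastforce
  qed
  have "y \<in> G" if y: "Inf G < y" "y < Sup G" for y
  proof -
    obtain p q where "p \<in> G" "p < y" "q \<in> G" "y < q"
      using cInf_lessD[OF assms(4) y(1)] less_cSupD[OF assms(4) y(2)] by auto
    then show ?thesis using connectedD_interval[OF assms(2), of p q y] by simp
  qed
  then have "G = {Inf G<..<Sup G}" using in_between by auto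
  moreover have "Inf G < Sup G" using in_between assms(4) by force
  ultimately show ?thesis by (rule that[rotated])
qed

text \<open>A test function of zero norm contributes the quotient 0, so only the bound on the pairing matters.\<close>

lemma Hneg1_norm_le:
  fixes u :: "'a::euclidean_space \<Rightarrow> 'b::euclidean_space"
  assumes C: "0 \<le> C" and le: "\<And>\<psi>. \<psi> \<in> test_functions G \<Longrightarrow> L2_ip G u \<psi> \<le> C * H1_norm G \<psi>"
  shows "Hneg1_norm G u \<le> ereal C"
  unfolding Hneg1_norm_def
proof (rule SUP_least)
  fix \<psi> :: "'a \<Rightarrow> 'b" assume "\<psi> \<in> test_functions G - {\<lambda>_. 0}"
  then have "L2_ip G u \<psi> \<le> C * H1_norm G \<psi>" using le by simp
  moreover have "0 \<le> H1_norm G \<psi>" by (simp add: H1_norm_def sum_nonneg)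
  ultimately have "L2_ip G u \<psi> / H1_norm G \<psi> \<le> C"
    using C by (cases "H1_norm G \<psi> = 0") (auto simp: divide_le_eq)
  then show "ereal (L2_ip G u \<psi> / H1_norm G \<psi>) \<le> ereal C" by simp
qed

theorem theorem3p2:
  fixes T c :: real and k :: nat and \<Omega>x K :: "real set" and \<Omega>v :: "(real^2) set"
  assumes "0 < T"
    and "open \<Omega>x" "connected \<Omega>x" "bounded \<Omega>x" "\<Omega>x \<noteq> {}"
    and "open \<Omega>v" "connected \<Omega>v" "bounded \<Omega>v" "\<Omega>v \<noteq> {}"
    and "compact K" "K \<subseteq> \<Omega>x"
    and "1 \<le> k" and "0 < c"
  shows "\<exists>C::real. \<forall>h M t N x f0 \<rho> E20 B0
      (fh :: nat \<Rightarrow> real \<times> real \<times> (real^2) \<Rightarrow> real)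
      (Wh :: nat \<Rightarrow> real \<times> real \<Rightarrow> real^3) (W :: nat \<Rightarrow> real \<times> real \<Rightarrow> real^3) i.
    mesh T \<Omega>x h M t N x \<longrightarrow>
    maxwell_data K \<Omega>v f0 \<rho> E20 B0 \<longrightarrow>
    1 \<le> i \<longrightarrow>
    fh (i - 1) \<in> L2 ({0<..<T} \<times> \<Omega>x \<times> \<Omega>v) \<longrightarrow>
    (\<forall>s y v. v \<notin> \<Omega>v \<longrightarrow> fh (i - 1) (s, y, v) = 0) \<longrightarrow>
    (\<forall>s\<in>{0..T}. \<forall>y. y \<notin> K \<longrightarrow> source (fh (i - 1)) \<rho> (s, y) = 0) \<longrightarrow>
    sd_solution k (c * h) \<Omega>x M t N x (source (fh (i - 1)) \<rho>) (W0 f0 \<rho> E20 B0) (Wh i) \<longrightarrow>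
    maxwell_solution T \<Omega>x K (source (fh (i - 1)) \<rho>) (W0 f0 \<rho> E20 B0) (W i) \<longrightarrow>
    Hneg1_norm ({0<..<T} \<times> \<Omega>x) (\<lambda>p. W i p - Wh i p)
      \<le> ereal (C *
          (L2_norm ({0<..<T} \<times> \<Omega>x)
             (\<lambda>p. h *\<^sub>R residual1 \<Omega>x t (source (fh (i - 1)) \<rho>) (Wh i) p)
         + L2_norm ({0<..<T} \<times> \<Omega>x)
             (\<lambda>p. h *\<^sub>R residual2 h t (W0 f0 \<rho> E20 B0) (Wh i) p)))"
proof -
  obtain a b where ab: "a < b" and \<Omega>: "\<Omega>x = {a<..<b}"
    using interval_of_open_connected[OF assms(2-5)] .
  obtain \<kappa>1 \<kappa>2 where \<kappa>: "a < \<kappa>1" "\<kappa>2 < b" "\<kappa>1 \<le> \<kappa>2" and K: "K \<subseteq> {\<kappa>1<..<\<kappa>2}"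
  proof -
  (* The midpoint makes the set nonempty, so that extreme points exist. *)
    let ?K = "insert ((a + b) / 2) K"
    have cK: "compact ?K" "?K \<noteq> {}" using assms(10) by auto
    have sub: "?K \<subseteq> {a<..<b}" using assms(11) \<Omega> ab by auto
    obtain l where l: "l \<in> ?K" "\<forall>y\<in>?K. l \<le> y" using compact_attains_inf[OF cK] by blast
    obtain r where r: "r \<in> ?K" "\<forall>y\<in>?K. y \<le> r" using compact_attains_sup[OF cK] by blast
    have lr: "a < l" "r < b" "l \<le> r" using sub l r by auto
    show ?thesis
    proof (rule that[of "(a + l) / 2" "(b + r) / 2"])
      show "K \<subseteq> {(a + l) / 2<..<(b + r) / 2}"
      proof
        fix y assume "y \<in> K"
        then have "l \<le> y" "y \<le> r" using l r by auto
        then show "y \<in> {(a + l) / 2<..<(b + r) / 2}" using lr by simp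
      qed
    qed (use lr in auto)
  qed
  from maxwell_error_estimate[OF assms(1) \<kappa> assms(13) K, of k] obtain C where C0: "0 \<le> C"
    and C: "\<forall>t M x N h \<beta> g Wh W \<psi>.
    maxwell_scheme t M x N h k (c * h) \<beta> g Wh \<longrightarrow> t M = T \<longrightarrow> x 0 = a \<longrightarrow> x N = b \<longrightarrow>
    maxwell_solution T {a<..<b} K \<beta> g W \<longrightarrow> (\<forall>s\<in>{0..T}. \<forall>y. y \<notin> K \<longrightarrow> \<beta> (s, y) = 0) \<longrightarrow> (\<forall>y. y \<notin> K \<longrightarrow> g y = 0) \<longrightarrow>
    \<psi> \<in> test_functions (box (0, a) (T, b)) \<longrightarrow>
    L2_ip (box (0, a) (T, b)) (\<lambda>z. W z - Wh z) \<psi>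
      \<le> C * H1_norm (box (0, a) (T, b)) \<psi>
        * (L2_norm (box (0, a) (T, b)) (\<lambda>z. h *\<^sub>R residual1 {a<..<b} t \<beta> Wh z)
          + L2_norm (box (0, a) (T, b)) (\<lambda>z. h *\<^sub>R residual2 h t g Wh z))" by blast
  show ?thesis
    unfolding \<Omega> box_Pair[symmetric]
  proof (rule exI[of _ C], intro allI impI Hneg1_norm_le mult_nonneg_nonneg add_nonneg_nonneg L2_norm_nonneg C0)
    fix h M t N x f0 \<rho> E20 B0
      and fh :: "nat \<Rightarrow> real \<times> real \<times> (real^2) \<Rightarrow> real" and Wh W :: "nat \<Rightarrow> real \<times> real \<Rightarrow> real^3"
      and i :: nat and \<psi> :: "real \<times> real \<Rightarrow> real^3"
    let ?\<beta> = "source (fh (i - 1)) \<rho>" and ?g = "W0 f0 \<rho> E20 B0"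
    assume mesh: "mesh T {a<..<b} h M t N x" and data: "maxwell_data K \<Omega>v f0 \<rho> E20 B0"
      and \<beta>: "\<forall>s\<in>{0..T}. \<forall>y. y \<notin> K \<longrightarrow> ?\<beta> (s, y) = 0"
      and sd: "sd_solution k (c * h) {a<..<b} M t N x ?\<beta> ?g (Wh i)"
      and sol: "maxwell_solution T {a<..<b} K ?\<beta> ?g (W i)" and \<psi>: "\<psi> \<in> test_functions (box (0, a) (T, b))"
    note scheme = mesh_maxwell_scheme[OF mesh assms(1) ab assms(12) less_imp_le[OF assms(13)] sol sd]
    have g0: "\<forall>y. y \<notin> K \<longrightarrow> ?g y = 0" using data by (simp add: maxwell_data_def)
    have "L2_ip (box (0, a) (T, b)) (\<lambda>z. W i z - Wh i z) \<psi>
      \<le> C * H1_norm (box (0, a) (T, b)) \<psi>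
        * (L2_norm (box (0, a) (T, b)) (\<lambda>z. h *\<^sub>R residual1 {a<..<b} t ?\<beta> (Wh i) z)
          + L2_norm (box (0, a) (T, b)) (\<lambda>z. h *\<^sub>R residual2 h t ?g (Wh i) z))"
      by (rule C[rule_format, OF scheme sol _ _ \<psi>]) (use \<beta> g0 in auto)
    then show "L2_ip (box (0, a) (T, b)) (\<lambda>p. W i p - Wh i p) \<psi>
      \<le> C * (L2_norm (box (0, a) (T, b)) (\<lambda>p. h *\<^sub>R residual1 {a<..<b} t ?\<beta> (Wh i) p)
          + L2_norm (box (0, a) (T, b)) (\<lambda>p. h *\<^sub>R residual2 h t ?g (Wh i) p)) * H1_norm (box (0, a) (T, b)) \<psi>"
      by (simp only: mult_ac)
  qed
qed

end
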